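(* Let $d\le 0$ be an integer, let $\mathcal{A}:=S\text{-}\mathrm{grmod}_{\geq d}$ and let $\mathcal{C}:=S\text{-}\mathrm{grmod}^0_{\geq d}$ be its full subcategory of quasi-zero modules. The $d$-truncated $\mathfrak{m}$-transform $D_{\mathfrak{m},\geq d}:\mathcal{A}\to\mathcal{A}$ together with the natural transformation $\eta:\mathrm{Id}_{\mathcal{A}}\to D_{\mathfrak{m},\geq d}$ is a Gabriel monad of $\mathcal{A}$ with respect to $\mathcal{C}$.
   Context: $B$ is a Noetherian commutative ring with $1$, $n\ge 0$, and $S=B[x_0,\ldots,x_n]$ is the polynomial ring graded by $\deg x_j=1$; $\mathfrak{m}=S_{>0}=\langle x_0,\ldots,x_n\rangle$ and $\mathfrak{m}^0=S$. $S\text{-}\mathrm{grmod}$ is the category of finitely presented graded $S$-modules (with degree-preserving morphisms), and $S\text{-}\mathrm{grmod}_{\geq d}$ is its full subcategory of modules $M$ with $M=M_{\geq d}$. A graded module $M$ is quasi-zero if $M_{\geq\ell}=0$ for $\ell$ large enough. $\mathrm{Hom}_\bullet(M,N)$ is the internal graded Hom (the $S$-module of all $S$-homomorphisms with its natural grading) and $\mathrm{Hom}_{\geq d}(M,N)=\mathrm{Hom}_\bullet(M,N)_{\geq d}$. The $d$-truncated $\mathfrak{m}$-transform is $D_{\mathfrak{m},\geq d}(M):=\varinjlim_\ell \mathrm{Hom}_{\geq d}(\mathfrak{m}^\ell,M)$, with transition maps induced by the inclusions $\mathfrak{m}^{\ell+1}\hookrightarrow\mathfrak{m}^\ell$. The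 natural transformation is $\eta_M:=\varinjlim_\ell \eta^\ell_M$, where $\eta^\ell_M: M\cong \mathrm{Hom}_{\geq d}(S,M)\to\mathrm{Hom}_{\geq d}(\mathfrak{m}^\ell,M)$ is induced by $\mathfrak{m}^\ell\hookrightarrow S$. A non-empty full subcategory $\mathcal{C}$ of an abelian category $\mathcal{A}$ is thick if it is closed under subobjects, factor objects and extensions; $\mathscr{Q}:\mathcal{A}\to\mathcal{A}/\mathcal{C}$ denotes the canonical functor to the Serre quotient. $\mathcal{C}$ is localizing if $\mathscr{Q}$ has a right adjoint $\mathscr{S}$ (section functor). An endofunctor $\mathscr{W}$ of $\mathcal{A}$ with a natural transformation $\eta:\mathrm{Id}_{\mathcal{A}}\to\mathscr{W}$ is a Gabriel monad of $\mathcal{A}$ with respect to $\mathcal{C}$ if $\mathcal{C}$ is localizing and there is a natural isomorphism $\mathscr{W}\cong\mathscr{S}\circ\mathscr{Q}$ carrying $\eta$ to the unit of the adjunction $\mathscr{Q}\dashv\mathscr{S}$. *)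

theory Defs
  imports
    "HOL-Algebra.Module"
    "HOL-Algebra.Ideal_Product"
    "HOL-Algebra.Ring_Divisibility"
    "HOL-Algebra.Indexed_Polynomials"
begin

section \<open>Categories, functors, adjunctions\<close>

record ('o, 'a) cat =
  Ob :: "'o set"
  Ar :: "'a set"
  Dom :: "'a \<Rightarrow> 'o"
  Cod :: "'a \<Rightarrow> 'o"
  Idt :: "'o \<Rightarrow> 'a"
  Cmp :: "'a \<Rightarrow> 'a \<Rightarrow> 'a"  (infixl \<open>\<bullet>\<index>\<close> 70)

definition Hom :: "('o, 'a) cat \<Rightarrow> 'o \<Rightarrow> 'o \<Rightarrow> 'a set" where
  "Hom C A B = {f \<in> Ar C. Dom C f = A \<and> Cod C f = B}"

locale category =
  fixes C :: "('o, 'a) cat" (structure)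
  assumes Dom_Ob: "f \<in> Ar C \<Longrightarrow> Dom C f \<in> Ob C"
    and Cod_Ob: "f \<in> Ar C \<Longrightarrow> Cod C f \<in> Ob C"
    and Idt_Hom: "A \<in> Ob C \<Longrightarrow> Idt C A \<in> Hom C A A"
    and Cmp_Hom: "f \<in> Hom C A B \<Longrightarrow> g \<in> Hom C B Z \<Longrightarrow> g \<bullet> f \<in> Hom C A Z"
    and Cmp_Idt_right: "f \<in> Hom C A B \<Longrightarrow> f \<bullet> Idt C A = f"
    and Cmp_Idt_left: "f \<in> Hom C A B \<Longrightarrow> Idt C B \<bullet> f = f"
    and Cmp_assoc: "f \<in> Hom C A B \<Longrightarrow> g \<in> Hom C B Z \<Longrightarrow> h \<in> Hom C Z V \<Longrightarrow>
          h \<bullet> (g \<bullet> f) = (h \<bullet> g) \<bullet> f"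

definition full_subcat :: "('o, 'a) cat \<Rightarrow> 'o set \<Rightarrow> ('o, 'a) cat" where
  "full_subcat C P = C\<lparr>Ob := Ob C \<inter> P, Ar := {f \<in> Ar C. Dom C f \<in> P \<and> Cod C f \<in> P}\<rparr>"

definition is_iso :: "('o, 'a) cat \<Rightarrow> 'a \<Rightarrow> bool" where
  "is_iso C f \<longleftrightarrow> f \<in> Ar C \<and>
     (\<exists>g \<in> Hom C (Cod C f) (Dom C f).
        g \<bullet>\<^bsub>C\<^esub> f = Idt C (Dom C f) \<and> f \<bullet>\<^bsub>C\<^esub> g = Idt C (Cod C f))"

record ('o, 'a, 'p, 'b) fnctr =
  Fo :: "'o \<Rightarrow> 'p"
  Fa :: "'a \<Rightarrow> 'b"

locale is_functor = C: category C + D: category D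
  for C :: "('o, 'a) cat" and D :: "('p, 'b) cat" +
  fixes F :: "('o, 'a, 'p, 'b) fnctr"
  assumes Fo_Ob: "A \<in> Ob C \<Longrightarrow> Fo F A \<in> Ob D"
    and Fa_Hom: "f \<in> Hom C A B \<Longrightarrow> Fa F f \<in> Hom D (Fo F A) (Fo F B)"
    and Fa_Idt: "A \<in> Ob C \<Longrightarrow> Fa F (Idt C A) = Idt D (Fo F A)"
    and Fa_Cmp: "f \<in> Hom C A B \<Longrightarrow> g \<in> Hom C B Z \<Longrightarrow>
          Fa F (g \<bullet>\<^bsub>C\<^esub> f) = Fa F g \<bullet>\<^bsub>D\<^esub> Fa F f"

definition id_fnctr :: "('o, 'a, 'o, 'a) fnctr" where
  "id_fnctr = \<lparr>Fo = id, Fa = id\<rparr>"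

definition comp_fnctr ::
    "('p, 'b, 'q, 'c) fnctr \<Rightarrow> ('o, 'a, 'p, 'b) fnctr \<Rightarrow> ('o, 'a, 'q, 'c) fnctr" where
  "comp_fnctr G F = \<lparr>Fo = Fo G \<circ> Fo F, Fa = Fa G \<circ> Fa F\<rparr>"

locale nat_trans = F: is_functor C D F + G: is_functor C D G
  for C :: "('o, 'a) cat" and D :: "('p, 'b) cat"
    and F G :: "('o, 'a, 'p, 'b) fnctr" +
  fixes \<tau> :: "'o \<Rightarrow> 'b"
  assumes component: "A \<in> Ob C \<Longrightarrow> \<tau> A \<in> Hom D (Fo F A) (Fo G A)"
    and naturality: "f \<in> Hom C A B \<Longrightarrow> \<tau> B \<bullet>\<^bsub>D\<^esub> Fa F f = Fa G f \<bullet>\<^bsub>D\<^esub> \<tau> A"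

locale nat_iso = nat_trans +
  assumes component_iso: "A \<in> Ob C \<Longrightarrow> is_iso D (\<tau> A)"

locale adjunction =
  unit: nat_trans C C id_fnctr "comp_fnctr G F" \<eta> +
  counit: nat_trans D D "comp_fnctr F G" id_fnctr \<epsilon> +
  F: is_functor C D F + G: is_functor D C G
  for C :: "('o, 'a) cat" and D :: "('p, 'b) cat"
    and F :: "('o, 'a, 'p, 'b) fnctr" and G :: "('p, 'b, 'o, 'a) fnctr"
    and \<eta> :: "'o \<Rightarrow> 'a" and \<epsilon> :: "'p \<Rightarrow> 'b" +
  assumes triangle_F: "A \<in> Ob C \<Longrightarrow> \<epsilon> (Fo F A) \<bullet>\<^bsub>D\<^esub> Fa F (\<eta> A) = Idt D (Fo F A)"
    and triangle_G: "B \<in> Ob D \<Longrightarrow> Fa G (\<epsilon> B) \<bullet>\<^bsub>C\<^esub> \<eta> (Fo G B) = Idt C (Fo G B)"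


section \<open>Abelian categories\<close>

definition is_mono :: "('o, 'a) cat \<Rightarrow> 'a \<Rightarrow> bool" where
  "is_mono C m \<longleftrightarrow> m \<in> Ar C \<and>
     (\<forall>A. \<forall>f \<in> Hom C A (Dom C m). \<forall>g \<in> Hom C A (Dom C m). m \<bullet>\<^bsub>C\<^esub> f = m \<bullet>\<^bsub>C\<^esub> g \<longrightarrow> f = g)"

definition is_epi :: "('o, 'a) cat \<Rightarrow> 'a \<Rightarrow> bool" where
  "is_epi C e \<longleftrightarrow> e \<in> Ar C \<and>
     (\<forall>A. \<forall>f \<in> Hom C (Cod C e) A. \<forall>g \<in> Hom C (Cod C e) A. f \<bullet>\<^bsub>C\<^esub> e = g \<bullet>\<^bsub>C\<^esub> e \<longrightarrow> f = g)"

definition is_zero_obj :: "('o, 'a) cat \<Rightarrow> 'o \<Rightarrow> bool" where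
  "is_zero_obj C Z \<longleftrightarrow> Z \<in> Ob C \<and>
     (\<forall>A \<in> Ob C. (\<exists>!f. f \<in> Hom C A Z) \<and> (\<exists>!f. f \<in> Hom C Z A))"

definition is_zero_arr :: "('o, 'a) cat \<Rightarrow> 'a \<Rightarrow> bool" where
  "is_zero_arr C f \<longleftrightarrow> f \<in> Ar C \<and>
     (\<exists>Z. is_zero_obj C Z \<and>
       (\<exists>g \<in> Hom C (Dom C f) Z. \<exists>h \<in> Hom C Z (Cod C f). f = h \<bullet>\<^bsub>C\<^esub> g))"

definition is_kernel :: "('o, 'a) cat \<Rightarrow> 'a \<Rightarrow> 'a \<Rightarrow> bool" where
  "is_kernel C f k \<longleftrightarrow> f \<in> Ar C \<and> k \<in> Ar C \<and> Cod C k = Dom C f \<and> is_zero_arr C (f \<bullet>\<^bsub>C\<^esub> k) \<and>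
     (\<forall>A. \<forall>h \<in> Hom C A (Dom C f). is_zero_arr C (f \<bullet>\<^bsub>C\<^esub> h) \<longrightarrow>
       (\<exists>!u. u \<in> Hom C A (Dom C k) \<and> k \<bullet>\<^bsub>C\<^esub> u = h))"

definition is_cokernel :: "('o, 'a) cat \<Rightarrow> 'a \<Rightarrow> 'a \<Rightarrow> bool" where
  "is_cokernel C f q \<longleftrightarrow> f \<in> Ar C \<and> q \<in> Ar C \<and> Dom C q = Cod C f \<and> is_zero_arr C (q \<bullet>\<^bsub>C\<^esub> f) \<and>
     (\<forall>A. \<forall>h \<in> Hom C (Cod C f) A. is_zero_arr C (h \<bullet>\<^bsub>C\<^esub> f) \<longrightarrow>
       (\<exists>!u. u \<in> Hom C (Cod C q) A \<and> u \<bullet>\<^bsub>C\<^esub> q = h))"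

definition is_product :: "('o, 'a) cat \<Rightarrow> 'o \<Rightarrow> 'o \<Rightarrow> 'o \<Rightarrow> 'a \<Rightarrow> 'a \<Rightarrow> bool" where
  "is_product C A B P p q \<longleftrightarrow> p \<in> Hom C P A \<and> q \<in> Hom C P B \<and>
     (\<forall>V. \<forall>f \<in> Hom C V A. \<forall>g \<in> Hom C V B.
       \<exists>!u. u \<in> Hom C V P \<and> p \<bullet>\<^bsub>C\<^esub> u = f \<and> q \<bullet>\<^bsub>C\<^esub> u = g)"

definition is_coproduct :: "('o, 'a) cat \<Rightarrow> 'o \<Rightarrow> 'o \<Rightarrow> 'o \<Rightarrow> 'a \<Rightarrow> 'a \<Rightarrow> bool" where
  "is_coproduct C A B P i j \<longleftrightarrow> i \<in> Hom C A P \<and> j \<in> Hom C B P \<and>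
     (\<forall>V. \<forall>f \<in> Hom C A V. \<forall>g \<in> Hom C B V.
       \<exists>!u. u \<in> Hom C P V \<and> u \<bullet>\<^bsub>C\<^esub> i = f \<and> u \<bullet>\<^bsub>C\<^esub> j = g)"

text \<open>Freyd's definition; the additive structure on the Hom-sets is determined by it.\<close>

locale abelian_category = category C for C :: "('o, 'a) cat" (structure) +
  assumes ex_zero: "\<exists>Z. is_zero_obj C Z"
    and ex_product: "A \<in> Ob C \<Longrightarrow> B \<in> Ob C \<Longrightarrow> \<exists>P p q. is_product C A B P p q"
    and ex_coproduct: "A \<in> Ob C \<Longrightarrow> B \<in> Ob C \<Longrightarrow> \<exists>P i j. is_coproduct C A B P i j"
    and ex_kernel: "f \<in> Ar C \<Longrightarrow> \<exists>k. is_kernel C f k"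
    and ex_cokernel: "f \<in> Ar C \<Longrightarrow> \<exists>q. is_cokernel C f q"
    and mono_normal: "is_mono C m \<Longrightarrow> \<exists>f. is_kernel C f m"
    and epi_normal: "is_epi C e \<Longrightarrow> \<exists>f. is_cokernel C f e"


section \<open>Thick subcategories and Serre quotients\<close>

text \<open>A full subcategory is given by its set \<open>T\<close> of objects.\<close>

definition thick :: "('o, 'a) cat \<Rightarrow> 'o set \<Rightarrow> bool" where
  "thick C T \<longleftrightarrow> T \<noteq> {} \<and> T \<subseteq> Ob C \<and>
     (\<forall>m. is_mono C m \<longrightarrow> Cod C m \<in> T \<longrightarrow> Dom C m \<in> T) \<and>
     (\<forall>e. is_epi C e \<longrightarrow> Dom C e \<in> T \<longrightarrow> Cod C e \<in> T) \<and>
     (\<forall>k p. is_kernel C p k \<longrightarrow> is_cokernel C k p \<longrightarrow> Dom C k \<in> T \<longrightarrow> Cod C p \<in> T \<longrightarrow> Cod C k \<in> T)"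

text \<open>\<open>Hom(M, N)\<close> in the quotient is the filtered colimit of the sets \<open>Hom(M', N/N')\<close> over the
  subobjects \<open>M'\<close> of \<open>M\<close> with \<open>M/M'\<close> in \<open>T\<close> and the subobjects \<open>N'\<close> of \<open>N\<close> in \<open>T\<close>.
  An element of one of these sets is a triple \<open>(i, f, p)\<close> consisting of the inclusion
  \<open>i : M' \<rightarrow> M\<close>, the projection \<open>p : N \<rightarrow> N/N'\<close> and \<open>f : M' \<rightarrow> N/N'\<close>.\<close>

definition cosmall_mono :: "('o, 'a) cat \<Rightarrow> 'o set \<Rightarrow> 'a \<Rightarrow> bool" where
  "cosmall_mono C T i \<longleftrightarrow> is_mono C i \<and> (\<exists>q. is_cokernel C i q \<and> Cod C q \<in> T)"

definition small_epi :: "('o, 'a) cat \<Rightarrow> 'o set \<Rightarrow> 'a \<Rightarrow> bool" where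
  "small_epi C T p \<longleftrightarrow> is_epi C p \<and> (\<exists>k. is_kernel C p k \<and> Dom C k \<in> T)"

definition serre_reps :: "('o, 'a) cat \<Rightarrow> 'o set \<Rightarrow> 'o \<Rightarrow> 'o \<Rightarrow> ('a \<times> 'a \<times> 'a) set" where
  "serre_reps C T M N = {(i, f, p). cosmall_mono C T i \<and> Cod C i = M \<and>
     small_epi C T p \<and> Dom C p = N \<and> f \<in> Hom C (Dom C i) (Cod C p)}"

text \<open>\<open>serre_refines C \<rho> \<rho>'\<close>: \<open>\<rho>'\<close> is the image of \<open>\<rho>\<close> under a transition map of the system.\<close>

fun serre_refines :: "('o, 'a) cat \<Rightarrow> 'a \<times> 'a \<times> 'a \<Rightarrow> 'a \<times> 'a \<times> 'a \<Rightarrow> bool" where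
  "serre_refines C (i, f, p) (i', f', p') \<longleftrightarrow>
     (\<exists>u \<in> Hom C (Dom C i') (Dom C i). \<exists>v \<in> Hom C (Cod C p) (Cod C p').
        i' = i \<bullet>\<^bsub>C\<^esub> u \<and> p' = v \<bullet>\<^bsub>C\<^esub> p \<and> f' = v \<bullet>\<^bsub>C\<^esub> (f \<bullet>\<^bsub>C\<^esub> u))"

definition serre_class ::
    "('o, 'a) cat \<Rightarrow> 'o set \<Rightarrow> 'o \<Rightarrow> 'o \<Rightarrow> 'a \<times> 'a \<times> 'a \<Rightarrow> ('a \<times> 'a \<times> 'a) set" where
  "serre_class C T M N \<rho> = {\<rho>' \<in> serre_reps C T M N.
     \<exists>\<sigma> \<in> serre_reps C T M N. serre_refines C \<rho> \<sigma> \<and> serre_refines C \<rho>' \<sigma>}"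

text \<open>Composition. Given \<open>f : M' \<rightarrow> N/N\<^sub>1\<close> and \<open>g : N' \<rightarrow> P/P\<^sub>1\<close>, factor \<open>N' \<rightarrow> N \<rightarrow> N/N\<^sub>1\<close> as
  \<open>e : N' \<rightarrow> I\<close> epi followed by \<open>m : I \<rightarrow> N/N\<^sub>1\<close> mono. After restricting \<open>f\<close> along some
  \<open>k : M'' \<rightarrow> M'\<close> it factors as \<open>m u\<close>, and after a further projection
  \<open>r : P/P\<^sub>1 \<rightarrow> P/P\<^sub>2\<close> the morphism \<open>g\<close> factors as \<open>v e\<close>; the composite is the class of
  \<open>v u : M'' \<rightarrow> P/P\<^sub>2\<close>. (The largest choice of \<open>M''\<close> is the preimage of \<open>(N' + N\<^sub>1)/N\<^sub>1\<close>, the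
  smallest choice of \<open>P\<^sub>2\<close> is \<open>P\<^sub>1 + g(N' \<inter> N\<^sub>1)\<close>.)\<close>

definition serre_comp_rep ::
    "('o, 'a) cat \<Rightarrow> 'o set \<Rightarrow> 'a \<times> 'a \<times> 'a \<Rightarrow> 'a \<times> 'a \<times> 'a \<Rightarrow> 'a \<times> 'a \<times> 'a \<Rightarrow> bool" where
  "serre_comp_rep C T \<gamma> \<rho> \<sigma> \<longleftrightarrow>
     (case \<gamma> of (j, g, q) \<Rightarrow> case \<rho> of (i, f, p) \<Rightarrow>
       (\<exists>e m k u r v.
          is_epi C e \<and> is_mono C m \<and> Dom C e = Dom C j \<and> Cod C e = Dom C m \<and> Cod C m = Cod C p \<and>
          m \<bullet>\<^bsub>C\<^esub> e = p \<bullet>\<^bsub>C\<^esub> j \<and>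
          k \<in> Ar C \<and> Cod C k = Dom C i \<and> cosmall_mono C T (i \<bullet>\<^bsub>C\<^esub> k) \<and>
          u \<in> Hom C (Dom C k) (Dom C m) \<and> f \<bullet>\<^bsub>C\<^esub> k = m \<bullet>\<^bsub>C\<^esub> u \<and>
          r \<in> Ar C \<and> Dom C r = Cod C q \<and> small_epi C T (r \<bullet>\<^bsub>C\<^esub> q) \<and>
          v \<in> Hom C (Cod C e) (Cod C r) \<and> r \<bullet>\<^bsub>C\<^esub> g = v \<bullet>\<^bsub>C\<^esub> e \<and>
          \<sigma> = (i \<bullet>\<^bsub>C\<^esub> k, v \<bullet>\<^bsub>C\<^esub> u, r \<bullet>\<^bsub>C\<^esub> q)))"

text \<open>The union below ranges over all choices of representatives and factorizations; they all
  yield the same class.\<close>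

definition serre_comp ::
    "('o, 'a) cat \<Rightarrow> 'o set \<Rightarrow> 'o \<times> ('a \<times> 'a \<times> 'a) set \<times> 'o \<Rightarrow> 'o \<times> ('a \<times> 'a \<times> 'a) set \<times> 'o
      \<Rightarrow> 'o \<times> ('a \<times> 'a \<times> 'a) set \<times> 'o" where
  "serre_comp C T = (\<lambda>(N', \<Gamma>, P) (M, \<Phi>, N).
     (M, \<Union>{serre_class C T M P \<sigma> | \<sigma> \<gamma> \<rho>. \<gamma> \<in> \<Gamma> \<and> \<rho> \<in> \<Phi> \<and> serre_comp_rep C T \<gamma> \<rho> \<sigma>}, P))"

definition serre_quotient ::
    "('o, 'a) cat \<Rightarrow> 'o set \<Rightarrow> ('o, 'o \<times> ('a \<times> 'a \<times> 'a) set \<times> 'o) cat" where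
  "serre_quotient C T = \<lparr>
     Ob = Ob C,
     Ar = {(M, serre_class C T M N \<rho>, N) | M N \<rho>. M \<in> Ob C \<and> N \<in> Ob C \<and> \<rho> \<in> serre_reps C T M N},
     Dom = (\<lambda>(M, \<Phi>, N). M),
     Cod = (\<lambda>(M, \<Phi>, N). N),
     Idt = (\<lambda>M. (M, serre_class C T M M (Idt C M, Idt C M, Idt C M), M)),
     Cmp = serre_comp C T\<rparr>"

definition serre_functor ::
    "('o, 'a) cat \<Rightarrow> 'o set \<Rightarrow> ('o, 'a, 'o, 'o \<times> ('a \<times> 'a \<times> 'a) set \<times> 'o) fnctr" where
  "serre_functor C T = \<lparr>
     Fo = (\<lambda>M. M),
     Fa = (\<lambda>f. (Dom C f,
                serre_class C T (Dom C f) (Cod C f) (Idt C (Dom C f), f, Idt C (Cod C f)),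
                Cod C f))\<rparr>"

definition localizing :: "('o, 'a) cat \<Rightarrow> 'o set \<Rightarrow> bool" where
  "localizing C T \<longleftrightarrow> thick C T \<and>
     (\<exists>S \<eta> \<epsilon>. adjunction C (serre_quotient C T) (serre_functor C T) S \<eta> \<epsilon>)"

definition gabriel_monad ::
    "('o, 'a) cat \<Rightarrow> 'o set \<Rightarrow> ('o, 'a, 'o, 'a) fnctr \<Rightarrow> ('o \<Rightarrow> 'a) \<Rightarrow> bool" where
  "gabriel_monad C T W \<eta> \<longleftrightarrow>
     abelian_category C \<and> is_functor C C W \<and> nat_trans C C id_fnctr W \<eta> \<and> localizing C T \<and>
     (\<exists>S \<delta> \<epsilon> \<alpha>. adjunction C (serre_quotient C T) (serre_functor C T) S \<delta> \<epsilon> \<and>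
        nat_iso C C W (comp_fnctr S (serre_functor C T)) \<alpha> \<and>
        (\<forall>A \<in> Ob C. \<alpha> A \<bullet>\<^bsub>C\<^esub> \<eta> A = \<delta> A))"


section \<open>Graded modules\<close>

text \<open>The library's module record also carries the (irrelevant) ring fields \<open>mult\<close> and \<open>one\<close>.\<close>

record ('a, 'b) graded_module = "('a, 'b) module" +
  hcomp :: "int \<Rightarrow> 'b set"

text \<open>A graded ring is represented as a graded module over itself, with \<open>smult = mult\<close>.\<close>

locale graded_module = module R M
  for R :: "('a, 'a) graded_module" (structure) and M :: "('a, 'b) graded_module" (structure) +
  assumes hcomp_subgroup: "subgroup (hcomp M i) (add_monoid M)"
    and decomposition: "x \<in> carrier M \<Longrightarrow>
      \<exists>!f. (\<forall>i. f i \<in> hcomp M i) \<and> finite {i. f i \<noteq> \<zero>\<^bsub>M\<^esub>} \<and>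
           x = (\<Oplus>\<^bsub>M\<^esub>i\<in>{i. f i \<noteq> \<zero>\<^bsub>M\<^esub>}. f i)"
    and smult_hcomp: "r \<in> hcomp R i \<Longrightarrow> x \<in> hcomp M j \<Longrightarrow> r \<odot>\<^bsub>M\<^esub> x \<in> hcomp M (i + j)"

text \<open>Maps between carriers are extensional, so that equal maps are equal functions.\<close>

definition lin_hom ::
    "('a, 'r) ring_scheme \<Rightarrow> ('a, 'b, 'm) module_scheme \<Rightarrow> ('a, 'c, 'n) module_scheme \<Rightarrow> ('b \<Rightarrow> 'c) set"
  where "lin_hom R M N = {f \<in> carrier M \<rightarrow>\<^sub>E carrier N.
     (\<forall>x \<in> carrier M. \<forall>y \<in> carrier M. f (x \<oplus>\<^bsub>M\<^esub> y) = f x \<oplus>\<^bsub>N\<^esub> f y) \<and>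
     (\<forall>r \<in> carrier R. \<forall>x \<in> carrier M. f (r \<odot>\<^bsub>M\<^esub> x) = r \<odot>\<^bsub>N\<^esub> f x)}"

definition graded_hom ::
    "('a, 'r) ring_scheme \<Rightarrow> ('a, 'b) graded_module \<Rightarrow> ('a, 'c) graded_module \<Rightarrow> ('b \<Rightarrow> 'c) set"
  where "graded_hom R M N = {f \<in> lin_hom R M N. \<forall>i. f ` hcomp M i \<subseteq> hcomp N i}"

definition free_module :: "('a, 'r) ring_scheme \<Rightarrow> nat \<Rightarrow> ('a, nat \<Rightarrow> 'a) module" where
  "free_module R r = \<lparr>
     carrier = {..<r} \<rightarrow>\<^sub>E carrier R,
     monoid.mult = undefined, one = undefined,
     zero = (\<lambda>i\<in>{..<r}. \<zero>\<^bsub>R\<^esub>),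
     add = (\<lambda>a b. \<lambda>i\<in>{..<r}. a i \<oplus>\<^bsub>R\<^esub> b i),
     smult = (\<lambda>c a. \<lambda>i\<in>{..<r}. c \<otimes>\<^bsub>R\<^esub> a i)\<rparr>"

text \<open>There is an exact sequence \<open>R\<^sup>s \<rightarrow> R\<^sup>r \<rightarrow> M \<rightarrow> 0\<close>.\<close>

definition finitely_presented :: "('a, 'r) ring_scheme \<Rightarrow> ('a, 'b, 'm) module_scheme \<Rightarrow> bool" where
  "finitely_presented R M \<longleftrightarrow>
     (\<exists>s r. \<exists>h \<in> lin_hom R (free_module R s) (free_module R r). \<exists>g \<in> lin_hom R (free_module R r) M.
        g ` carrier (free_module R r) = carrier M \<and>
        h ` carrier (free_module R s) = {a \<in> carrier (free_module R r). g a = \<zero>\<^bsub>M\<^esub>})"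

text \<open>The submodule \<open>M\<^sub>\<ge>\<^sub>d\<close>, the sum of the components of degree at least \<open>d\<close>.\<close>

definition trunc :: "int \<Rightarrow> ('a, 'b) graded_module \<Rightarrow> ('a, 'b) graded_module" where
  "trunc d M = M\<lparr>
     carrier := {\<Oplus>\<^bsub>M\<^esub>i\<in>F. f i | F f. finite F \<and> F \<subseteq> {d..} \<and> (\<forall>i\<in>F. f i \<in> hcomp M i)},
     hcomp := (\<lambda>i. if d \<le> i then hcomp M i else {\<zero>\<^bsub>M\<^esub>})\<rparr>"

definition quasi_zero :: "('a, 'b) graded_module \<Rightarrow> bool" where
  "quasi_zero M \<longleftrightarrow> (\<exists>l. carrier (trunc l M) = {\<zero>\<^bsub>M\<^esub>})"

text \<open>The graded module of all linear maps, with components the maps of degree \<open>i\<close>.\<close>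

definition internal_hom ::
    "('a, 'r) ring_scheme \<Rightarrow> ('a, 'b) graded_module \<Rightarrow> ('a, 'c) graded_module \<Rightarrow> ('a, 'b \<Rightarrow> 'c) graded_module"
  where "internal_hom R M N = \<lparr>
     carrier = lin_hom R M N,
     monoid.mult = undefined, one = undefined,
     zero = (\<lambda>x\<in>carrier M. \<zero>\<^bsub>N\<^esub>),
     add = (\<lambda>f g. \<lambda>x\<in>carrier M. f x \<oplus>\<^bsub>N\<^esub> g x),
     smult = (\<lambda>r f. \<lambda>x\<in>carrier M. r \<odot>\<^bsub>N\<^esub> f x),
     hcomp = (\<lambda>i. {f \<in> lin_hom R M N. \<forall>j. f ` hcomp M j \<subseteq> hcomp N (i + j)})\<rparr>"


subsection \<open>Direct limits of sequences\<close>

primrec trans_iter :: "(nat \<Rightarrow> 'b \<Rightarrow> 'b) \<Rightarrow> nat \<Rightarrow> nat \<Rightarrow> 'b \<Rightarrow> 'b" where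
  "trans_iter t k 0 x = x"
| "trans_iter t k (Suc j) x = t (k + j) (trans_iter t k j x)"

definition lim_class ::
    "(nat \<Rightarrow> ('a, 'b) graded_module) \<Rightarrow> (nat \<Rightarrow> 'b \<Rightarrow> 'b) \<Rightarrow> nat \<Rightarrow> 'b \<Rightarrow> (nat \<times> 'b) set" where
  "lim_class H t k x = {(l, y). y \<in> carrier (H l) \<and>
     (\<exists>j. k \<le> j \<and> l \<le> j \<and> trans_iter t k (j - k) x = trans_iter t l (j - l) y)}"

text \<open>The unions range over classes that all coincide.\<close>

definition direct_limit ::
    "(nat \<Rightarrow> ('a, 'b) graded_module) \<Rightarrow> (nat \<Rightarrow> 'b \<Rightarrow> 'b) \<Rightarrow> ('a, (nat \<times> 'b) set) graded_module" where
  "direct_limit H t = \<lparr>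
     carrier = {lim_class H t k x | k x. x \<in> carrier (H k)},
     monoid.mult = undefined, one = undefined,
     zero = lim_class H t 0 \<zero>\<^bsub>H 0\<^esub>,
     add = (\<lambda>U V. \<Union>{lim_class H t k (x \<oplus>\<^bsub>H k\<^esub> y) | k x y. (k, x) \<in> U \<and> (k, y) \<in> V}),
     smult = (\<lambda>r U. \<Union>{lim_class H t k (r \<odot>\<^bsub>H k\<^esub> x) | k x. (k, x) \<in> U}),
     hcomp = (\<lambda>i. {lim_class H t k x | k x. x \<in> hcomp (H k) i})\<rparr>"

text \<open>The map induced by a family of maps \<open>\<phi> k\<close> into \<open>H k\<close> compatible with the transition maps.\<close>

definition lim_map ::
    "(nat \<Rightarrow> ('a, 'c) graded_module) \<Rightarrow> (nat \<Rightarrow> 'c \<Rightarrow> 'c) \<Rightarrow> (nat \<Rightarrow> 'b \<Rightarrow> 'c)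
      \<Rightarrow> (nat \<times> 'b) set \<Rightarrow> (nat \<times> 'c) set" where
  "lim_map H t \<phi> U = \<Union>{lim_class H t k (\<phi> k x) | k x. (k, x) \<in> U}"


subsection \<open>Categories of graded modules\<close>

text \<open>All modules of the category have their elements in a fixed type \<open>'u\<close>, the universe.
  Constructions that leave \<open>'u\<close> are brought back by transport of structure along an injection
  of the carrier into \<open>'u\<close> (which exists for finitely generated modules if \<open>'u\<close> is at least
  as large as the base ring).\<close>

definition to_univ :: "('a, 'b) graded_module \<Rightarrow> 'b \<Rightarrow> 'u" where
  "to_univ M = (SOME \<phi>. inj_on \<phi> (carrier M))"

definition from_univ :: "('a, 'b) graded_module \<Rightarrow> 'u \<Rightarrow> 'b" where
  "from_univ M = inv_into (carrier M) (to_univ M)"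

definition univ_copy :: "('a, 'b) graded_module \<Rightarrow> ('a, 'u) graded_module" where
  "univ_copy M = \<lparr>
     carrier = to_univ M ` carrier M,
     monoid.mult = undefined, one = undefined,
     zero = to_univ M \<zero>\<^bsub>M\<^esub>,
     add = (\<lambda>x y. to_univ M (from_univ M x \<oplus>\<^bsub>M\<^esub> from_univ M y)),
     smult = (\<lambda>r x. to_univ M (r \<odot>\<^bsub>M\<^esub> from_univ M x)),
     hcomp = (\<lambda>i. to_univ M ` hcomp M i)\<rparr>"

type_synonym ('a, 'u) gmod_arrow =
  "('a, 'u) graded_module \<times> ('u \<Rightarrow> 'u) \<times> ('a, 'u) graded_module"

definition grmod :: "('a, 'a) graded_module \<Rightarrow> (('a, 'u) graded_module, ('a, 'u) gmod_arrow) cat" where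
  "grmod R = (let obs = {M. graded_module R M \<and> finitely_presented R M} in \<lparr>
     Ob = obs,
     Ar = {(M, f, N). M \<in> obs \<and> N \<in> obs \<and> f \<in> graded_hom R M N},
     Dom = (\<lambda>(M, f, N). M),
     Cod = (\<lambda>(M, f, N). N),
     Idt = (\<lambda>M. (M, \<lambda>x\<in>carrier M. x, M)),
     Cmp = (\<lambda>(N', g, P) (M, f, N). (M, compose (carrier M) g f, P))\<rparr>)"

definition grmod_ge ::
    "('a, 'a) graded_module \<Rightarrow> int \<Rightarrow> (('a, 'u) graded_module, ('a, 'u) gmod_arrow) cat" where
  "grmod_ge R d = full_subcat (grmod R) {M. M = trunc d M}"

definition grmod0_ge :: "('a, 'a) graded_module \<Rightarrow> int \<Rightarrow> ('a, 'u) graded_module set" where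
  "grmod0_ge R d = {M \<in> Ob (grmod_ge R d). quasi_zero M}"


section \<open>The polynomial ring and the truncated transform\<close>

text \<open>The ring \<open>B[x\<^sub>0,\<dots>,x\<^sub>n]\<close> with its standard grading; a polynomial maps monomials (multisets of
  variables) to coefficients.\<close>

definition graded_poly_ring ::
    "('b, 'm) ring_scheme \<Rightarrow> nat \<Rightarrow> (nat multiset \<Rightarrow> 'b, nat multiset \<Rightarrow> 'b) graded_module" where
  "graded_poly_ring B n =
     (let car = ring.indexed_pset B {0..n} (carrier B);
          mul = (\<lambda>P Q m. \<Oplus>\<^bsub>B\<^esub>a\<in>{a. a \<subseteq># m}. P a \<otimes>\<^bsub>B\<^esub> Q (m - a)) in
      \<lparr>carrier = car,
       monoid.mult = mul,
       one = ring.indexed_const B \<one>\<^bsub>B\<^esub>,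
       zero = ring.indexed_const B \<zero>\<^bsub>B\<^esub>,
       add = ring.indexed_padd B,
       smult = mul,
       hcomp = (\<lambda>i. {P \<in> car. \<forall>m. P m \<noteq> \<zero>\<^bsub>B\<^esub> \<longrightarrow> int (size m) = i})\<rparr>)"

definition irrelevant_ideal :: "('b, 'm) ring_scheme \<Rightarrow> nat \<Rightarrow> (nat multiset \<Rightarrow> 'b) set" where
  "irrelevant_ideal B n =
     genideal (graded_poly_ring B n) ((\<lambda>j. ring.indexed_var B j) ` {0..n})"

primrec irrelevant_power :: "('b, 'm) ring_scheme \<Rightarrow> nat \<Rightarrow> nat \<Rightarrow> (nat multiset \<Rightarrow> 'b) set" where
  "irrelevant_power B n 0 = carrier (graded_poly_ring B n)"
| "irrelevant_power B n (Suc l) =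
     ideal_prod (graded_poly_ring B n) (irrelevant_ideal B n) (irrelevant_power B n l)"

definition power_module ::
    "('b, 'm) ring_scheme \<Rightarrow> nat \<Rightarrow> nat \<Rightarrow> (nat multiset \<Rightarrow> 'b, nat multiset \<Rightarrow> 'b) graded_module" where
  "power_module B n l = (graded_poly_ring B n)\<lparr>
     carrier := irrelevant_power B n l,
     hcomp := (\<lambda>i. hcomp (graded_poly_ring B n) i \<inter> irrelevant_power B n l)\<rparr>"

text \<open>The sequence \<open>Hom\<^sub>\<ge>\<^sub>d(\<mm>\<^sup>l, M)\<close> with the transition maps given by restriction.\<close>

definition transform_seq ::
    "('b, 'm) ring_scheme \<Rightarrow> nat \<Rightarrow> int \<Rightarrow> (nat multiset \<Rightarrow> 'b, 'u) graded_module
      \<Rightarrow> nat \<Rightarrow> (nat multiset \<Rightarrow> 'b, (nat multiset \<Rightarrow> 'b) \<Rightarrow> 'u) graded_module" where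
  "transform_seq B n d M l =
     trunc d (internal_hom (graded_poly_ring B n) (power_module B n l) M)"

definition transform_trans ::
    "('b, 'm) ring_scheme \<Rightarrow> nat
      \<Rightarrow> nat \<Rightarrow> ((nat multiset \<Rightarrow> 'b) \<Rightarrow> 'u) \<Rightarrow> (nat multiset \<Rightarrow> 'b) \<Rightarrow> 'u" where
  "transform_trans B n l f = restrict f (irrelevant_power B n (Suc l))"

definition transform_lim ::
    "('b, 'm) ring_scheme \<Rightarrow> nat \<Rightarrow> int \<Rightarrow> (nat multiset \<Rightarrow> 'b, 'u) graded_module
      \<Rightarrow> (nat multiset \<Rightarrow> 'b, (nat \<times> ((nat multiset \<Rightarrow> 'b) \<Rightarrow> 'u)) set) graded_module" where
  "transform_lim B n d M = direct_limit (transform_seq B n d M) (transform_trans B n)"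

definition transform_ob ::
    "('b, 'm) ring_scheme \<Rightarrow> nat \<Rightarrow> int \<Rightarrow> (nat multiset \<Rightarrow> 'b, 'u) graded_module
      \<Rightarrow> (nat multiset \<Rightarrow> 'b, 'u) graded_module" where
  "transform_ob B n d M = univ_copy (transform_lim B n d M)"

definition transform_ar ::
    "('b, 'm) ring_scheme \<Rightarrow> nat \<Rightarrow> int \<Rightarrow> (nat multiset \<Rightarrow> 'b, 'u) gmod_arrow
      \<Rightarrow> (nat multiset \<Rightarrow> 'b, 'u) gmod_arrow" where
  "transform_ar B n d = (\<lambda>(M, \<phi>, N).
     (transform_ob B n d M,
      \<lambda>y\<in>carrier (transform_ob B n d M).
        to_univ (transform_lim B n d N)
          (lim_map (transform_seq B n d N) (transform_trans B n)
            (\<lambda>l f. \<lambda>s\<in>irrelevant_power B n l. \<phi> (f s))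
            (from_univ (transform_lim B n d M) y)),
      transform_ob B n d N))"

definition transform ::
    "('b, 'm) ring_scheme \<Rightarrow> nat \<Rightarrow> int
      \<Rightarrow> ((nat multiset \<Rightarrow> 'b, 'u) graded_module, (nat multiset \<Rightarrow> 'b, 'u) gmod_arrow,
          (nat multiset \<Rightarrow> 'b, 'u) graded_module, (nat multiset \<Rightarrow> 'b, 'u) gmod_arrow) fnctr" where
  "transform B n d = \<lparr>Fo = transform_ob B n d, Fa = transform_ar B n d\<rparr>"

text \<open>An element \<open>x\<close> of \<open>M\<close> is identified with the linear map \<open>s \<mapsto> s x\<close> on the ring, which is then
  restricted to \<open>\<mm>\<^sup>l\<close>; the resulting classes for different \<open>l\<close> coincide.\<close>

definition transform_unit_level ::
    "('b, 'm) ring_scheme \<Rightarrow> nat \<Rightarrow> (nat multiset \<Rightarrow> 'b, 'u) graded_module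
      \<Rightarrow> nat \<Rightarrow> 'u \<Rightarrow> (nat multiset \<Rightarrow> 'b) \<Rightarrow> 'u" where
  "transform_unit_level B n M l x = (\<lambda>s\<in>irrelevant_power B n l. s \<odot>\<^bsub>M\<^esub> x)"

definition transform_unit ::
    "('b, 'm) ring_scheme \<Rightarrow> nat \<Rightarrow> int \<Rightarrow> (nat multiset \<Rightarrow> 'b, 'u) graded_module
      \<Rightarrow> (nat multiset \<Rightarrow> 'b, 'u) gmod_arrow" where
  "transform_unit B n d M =
     (M,
      \<lambda>x\<in>carrier M. to_univ (transform_lim B n d M)
        (\<Union>l. lim_class (transform_seq B n d M) (transform_trans B n) l
               (transform_unit_level B n M l x)),
      transform_ob B n d M)"

end

theory Submission
  imports Defs
begin

text \<open>
  Call a morphism negligible if it is a mono with small cokernel or an epi with small kernel, where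
  small means lying in the thick subcategory.  If each \<open>\<eta> : U \<rightarrow> W U\<close> is a negligible epi followed by
  a negligible mono, and morphisms \<open>A \<rightarrow> W U\<close> extend uniquely along negligible \<open>A \<rightarrow> B\<close>, then morphisms
  \<open>A \<rightarrow> U\<close> in the Serre quotient correspond to morphisms \<open>A \<rightarrow> W U\<close>, so \<open>W\<close> itself gives the section
  functor.

  For the transform, \<open>s [f] = \<eta> (f s)\<close> for \<open>s \<in> \<mm>\<^sup>k\<close> and \<open>f : \<mm>\<^sup>k \<rightarrow> M\<close>.  Hence the cokernel of \<open>\<eta>\<close> is
  torsion and maps \<open>\<mm>\<^sup>k \<rightarrow> M\<close> are realized by elements of the limit, which yields the extension
  property.  Finite generation of the limit \<open>E\<close> uses the truncation: for each variable \<open>v\<close> a power of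
  \<open>v\<close>, uniform since degrees are bounded below, maps \<open>E\<close> into \<open>\<eta> M\<close> up to \<open>v\<close>-torsion, and an element
  that is torsion for every variable vanishes.  So ascending chains of submodules of \<open>E\<close> become
  stationary because those of \<open>M\<close> do.
\<close>

\<comment> \<open>Composition in the Serre quotient ranges over all representatives and
  factorizations, so computing with triples is avoided: a class is encoded by the one morphism into
  \<open>W N\<close> that it induces. Composition becomes Kleisli composition for \<open>W\<close>,
  and category laws, functors and adjunction follow from uniqueness of extensions. Modules enter
  this part only through the axioms of \<open>closed_reflection\<close>, and polynomials enter the
  module part only through those of \<open>standard_graded\<close>, where \<open>I l\<close> stands
  for the l-th power of the irrelevant ideal.

  A second obstacle is the universe: objects are finitely generated with elements in the fixed type
  \<open>'u\<close>, while the limit consists of classes of functions. It can be copied into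
  \<open>'u\<close> only after finite generation is known, as this bounds its cardinality. What
  matters about the unit is therefore stated as a predicate \<open>envelope\<close> that does not
  mention the limit and passes to the copy.

  Chain conditions refer to a set of operators instead of a ring, which lets Hilbert's basis theorem
  adjoin one variable at a time inside one fixed module, without iterated polynomial rings.\<close>
syntax
  "_index_id" :: "id_position \<Rightarrow> index" (\<open>\<^sub>_\<close>)
  "_index_schematic" :: "var_position \<Rightarrow> index" (\<open>\<^sub>_\<close>)
translations
  "_index_id x" \<rightharpoonup> "_index x"
  "_index_schematic x" \<rightharpoonup> "_index x"

section \<open>Gabriel monads from closed reflections\<close>

lemma HomI: "f \<in> Ar C \<Longrightarrow> Dom C f = A \<Longrightarrow> Cod C f = B \<Longrightarrow> f \<in> Hom C A B"
 by (simp add: Hom_def)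

lemma HomD:
 assumes "f \<in> Hom C A B"
 shows "f \<in> Ar C" "Dom C f = A" "Cod C f = B"
 using assms by (auto simp: Hom_def)

lemma (in category) Hom_Ob:
 assumes "f \<in> Hom C A B"
 shows "A \<in> Ob C" "B \<in> Ob C"
 using assms Dom_Ob Cod_Ob by (auto simp: Hom_def)

text \<open>The input for the construction of the section functor. \<open>W\<close> is given on
  objects and arrows with \<open>\<eta>\<close> natural; that it preserves identities and
  composition is derived from unique extension along \<open>\<eta>\<close>.
  \<open>cosmall_pullback\<close> asks for a commutative square with one cosmall side, and
  \<open>epi_mono_lift\<close> is the diagonal filler of an epi-mono square. In the application all
  of these are checked on elements.\<close>

locale closed_reflection = category C for C :: "('o, 'a) cat" (structure) +
 fixes T :: "'o set" and W :: "('o, 'a, 'o, 'a) fnctr" and \<eta> :: "'o \<Rightarrow> 'a"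
 assumes W_Ob: "A \<in> Ob C \<Longrightarrow> Fo W A \<in> Ob C"
  and W_Hom: "f \<in> Hom C A B \<Longrightarrow> Fa W f \<in> Hom C (Fo W A) (Fo W B)"
  and eta_Hom: "A \<in> Ob C \<Longrightarrow> \<eta> A \<in> Hom C A (Fo W A)"
  and eta_nat: "f \<in> Hom C A B \<Longrightarrow> \<eta> B \<bullet> f = Fa W f \<bullet> \<eta> A"
  and ext_unique: "cosmall_mono C T i \<or> small_epi C T i \<Longrightarrow> i \<in> Hom C A B \<Longrightarrow> U \<in> Ob C \<Longrightarrow>
     f \<in> Hom C A (Fo W U) \<Longrightarrow> \<exists>!g. g \<in> Hom C B (Fo W U) \<and> g \<bullet> i = f"
  and eta_factor: "U \<in> Ob C \<Longrightarrow> \<exists>Y. \<exists>q \<in> Hom C U Y. \<exists>m \<in> Hom C Y (Fo W U).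
     small_epi C T q \<and> cosmall_mono C T m \<and> m \<bullet> q = \<eta> U"
  and cosmall_comp: "cosmall_mono C T i \<Longrightarrow> cosmall_mono C T j \<Longrightarrow> i \<in> Hom C A B \<Longrightarrow> j \<in> Hom C B Z \<Longrightarrow>
     cosmall_mono C T (j \<bullet> i)"
  and cosmall_pullback: "cosmall_mono C T m \<Longrightarrow> m \<in> Hom C I Y \<Longrightarrow> g \<in> Hom C M Y \<Longrightarrow>
     \<exists>M'. \<exists>i \<in> Hom C M' M. \<exists>f \<in> Hom C M' I. cosmall_mono C T i \<and> g \<bullet> i = m \<bullet> f"
  and cosmall_image: "is_epi C e \<Longrightarrow> e \<in> Hom C N Y \<Longrightarrow> cosmall_mono C T j \<Longrightarrow> j \<in> Hom C N' N \<Longrightarrow>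
     \<exists>I. \<exists>e0 \<in> Hom C N' I. \<exists>m0 \<in> Hom C I Y. is_epi C e0 \<and> cosmall_mono C T m0 \<and> m0 \<bullet> e0 = e \<bullet> j"
  and epi_mono_lift: "is_epi C e \<Longrightarrow> e \<in> Hom C A Y \<Longrightarrow> is_mono C m \<Longrightarrow> m \<in> Hom C Z V \<Longrightarrow>
     g \<in> Hom C A Z \<Longrightarrow> w \<in> Hom C Y V \<Longrightarrow> m \<bullet> g = w \<bullet> e \<Longrightarrow> \<exists>v \<in> Hom C Y Z. v \<bullet> e = g"
  and cosmall_Idt: "A \<in> Ob C \<Longrightarrow> cosmall_mono C T (Idt C A)"
  and small_Idt: "A \<in> Ob C \<Longrightarrow> small_epi C T (Idt C A)"
begin

lemma cosmall_is_mono: "cosmall_mono C T i \<Longrightarrow> is_mono C i"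
 by (simp add: cosmall_mono_def)

lemma small_is_epi: "small_epi C T p \<Longrightarrow> is_epi C p"
 by (simp add: small_epi_def)

lemma is_monoD: "is_mono C m \<Longrightarrow> m \<in> Hom C A B \<Longrightarrow> f \<in> Hom C Z A \<Longrightarrow> g \<in> Hom C Z A \<Longrightarrow>
  m \<bullet> f = m \<bullet> g \<Longrightarrow> f = g"
 unfolding is_mono_def by (metis HomD(2))

lemma is_epiD: "is_epi C e \<Longrightarrow> e \<in> Hom C A B \<Longrightarrow> f \<in> Hom C B Z \<Longrightarrow> g \<in> Hom C B Z \<Longrightarrow>
  f \<bullet> e = g \<bullet> e \<Longrightarrow> f = g"
 unfolding is_epi_def by (metis HomD(3))

lemma ext_eq:
 assumes "cosmall_mono C T i \<or> small_epi C T i" "i \<in> Hom C A B" "U \<in> Ob C"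
  "g \<in> Hom C B (Fo W U)" "g' \<in> Hom C B (Fo W U)" "g \<bullet> i = g' \<bullet> i"
 shows "g = g'"
 using ext_unique[OF assms(1-3), of "g \<bullet> i"] assms Cmp_Hom by (metis (no_types, lifting))

section \<open>Representatives of quotient morphisms and the morphisms realizing them\<close>

lemma serre_repsD:
 assumes "(i, f, p) \<in> serre_reps C T M N"
 shows "cosmall_mono C T i" "i \<in> Hom C (Dom C i) M" "small_epi C T p" "p \<in> Hom C N (Cod C p)"
  "f \<in> Hom C (Dom C i) (Cod C p)" "M \<in> Ob C" "N \<in> Ob C"
proof -
 show *: "cosmall_mono C T i" "i \<in> Hom C (Dom C i) M" "small_epi C T p" "p \<in> Hom C N (Cod C p)"
  "f \<in> Hom C (Dom C i) (Cod C p)"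
  using assms by (auto simp: serre_reps_def cosmall_mono_def is_mono_def small_epi_def is_epi_def Hom_def)
 show "M \<in> Ob C" "N \<in> Ob C" using *(2,4) Hom_Ob by auto
qed

lemma serre_repsI:
 assumes "cosmall_mono C T i" "i \<in> Hom C A M" "small_epi C T p" "p \<in> Hom C N Z" "f \<in> Hom C A Z"
 shows "(i, f, p) \<in> serre_reps C T M N"
 using assms HomD unfolding serre_reps_def by fastforce

text \<open>The fraction \<open>(i, f, p)\<close> becomes a morphism
  \<open>g : M \<rightarrow> W N\<close>: extend \<open>\<eta> N\<close> along the small epi
  \<open>p\<close> to \<open>h\<close>, then extend \<open>h f\<close> along the cosmall mono
  \<open>i\<close>. As \<open>i\<close> and \<open>p\<close> become invertible in the quotient,
  \<open>g\<close> is there the composite of \<open>\<eta> N\<close> with the fraction.\<close>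

definition realizes :: "'o \<Rightarrow> 'o \<Rightarrow> 'a \<times> 'a \<times> 'a \<Rightarrow> 'a \<Rightarrow> bool" where
 "realizes M N \<rho> g \<longleftrightarrow> \<rho> \<in> serre_reps C T M N \<and> g \<in> Hom C M (Fo W N) \<and>
  (case \<rho> of (i, f, p) \<Rightarrow>
    \<exists>h \<in> Hom C (Cod C p) (Fo W N). h \<bullet> p = \<eta> N \<and> g \<bullet> i = h \<bullet> f)"

lemma realizes_ex:
 assumes "\<rho> \<in> serre_reps C T M N"
 shows "\<exists>g. realizes M N \<rho> g"
proof -
 obtain i f p where \<rho>: "\<rho> = (i, f, p)" by (cases \<rho>)
 note r = serre_repsD[OF assms[unfolded \<rho>]]
 obtain h where h: "h \<in> Hom C (Cod C p) (Fo W N)" "h \<bullet> p = \<eta> N"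
  using ext_unique[OF _ r(4,7) eta_Hom] r by blast
 obtain g where "g \<in> Hom C M (Fo W N)" "g \<bullet> i = h \<bullet> f"
  using ext_unique[OF _ r(2) r(7), of "h \<bullet> f"] r h Cmp_Hom by blast
 with h assms show ?thesis unfolding realizes_def \<rho> by blast
qed

lemma realizes_unique:
 assumes "realizes M N \<rho> g" "realizes M N \<rho> g'"
 shows "g = g'"
proof -
 obtain i f p where \<rho>: "\<rho> = (i, f, p)" by (cases \<rho>)
 note a = assms[unfolded realizes_def \<rho> prod.case]
 note r = serre_repsD[OF a(1)[THEN conjunct1]]
 obtain h where h: "h \<in> Hom C (Cod C p) (Fo W N)" "h \<bullet> p = \<eta> N" "g \<bullet> i = h \<bullet> f" using a by blast
 obtain h' where h': "h' \<in> Hom C (Cod C p) (Fo W N)" "h' \<bullet> p = \<eta> N" "g' \<bullet> i = h' \<bullet> f" using a by blast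
 have "h = h'" using ext_eq[OF _ r(4) r(7) h(1) h'(1)] h h' r by simp
 thus ?thesis using ext_eq[OF _ r(2) r(7), of g g'] a r h h' by simp
qed

text \<open>A transition map changes neither extension: if \<open>h'\<close> extends
  \<open>\<eta> N\<close> along \<open>p' = v p\<close>, then \<open>h' v\<close> extends it along
  \<open>p\<close> and so equals \<open>h\<close>.\<close>

lemma realizes_refines:
 assumes "serre_refines C \<rho> \<sigma>" "\<sigma> \<in> serre_reps C T M N" "realizes M N \<rho> g"
 shows "realizes M N \<sigma> g"
proof -
 obtain i f p where \<rho>: "\<rho> = (i, f, p)" by (cases \<rho>)
 obtain i' f' p' where \<sigma>: "\<sigma> = (i', f', p')" by (cases \<sigma>)
 note a = assms(3)[unfolded realizes_def \<rho> prod.case]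
 note r = serre_repsD[OF a[THEN conjunct1]]
 note r' = serre_repsD[OF assms(2)[unfolded \<sigma>]]
 obtain u v where uv: "u \<in> Hom C (Dom C i') (Dom C i)" "v \<in> Hom C (Cod C p) (Cod C p')"
  "i' = i \<bullet> u" "p' = v \<bullet> p" "f' = v \<bullet> (f \<bullet> u)" using assms(1) unfolding \<rho> \<sigma> by auto
 obtain h where h: "h \<in> Hom C (Cod C p) (Fo W N)" "h \<bullet> p = \<eta> N" "g \<bullet> i = h \<bullet> f" using a by blast
 obtain h' where h': "h' \<in> Hom C (Cod C p') (Fo W N)" "h' \<bullet> p' = \<eta> N"
  using ext_unique[OF _ r'(4,7) eta_Hom] r' by blast
 have hv: "h' \<bullet> v \<in> Hom C (Cod C p) (Fo W N)" using h' uv Cmp_Hom by blast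
 have "h' \<bullet> v = h"
  using ext_eq[OF _ r(4) r(7) hv h(1)] r(3) h' h uv Cmp_assoc[OF r(4) uv(2) h'(1)] by simp
 moreover have "g \<bullet> i' = (g \<bullet> i) \<bullet> u" using Cmp_assoc[OF uv(1) r(2)] a uv by auto
 moreover have fu: "f \<bullet> u \<in> Hom C (Dom C i') (Cod C p)" using uv r Cmp_Hom by blast
 moreover have "h' \<bullet> (v \<bullet> (f \<bullet> u)) = (h' \<bullet> v) \<bullet> (f \<bullet> u)" using Cmp_assoc[OF fu uv(2) h'(1)] .
 moreover have "h \<bullet> (f \<bullet> u) = (h \<bullet> f) \<bullet> u" using Cmp_assoc[OF uv(1) r(5) h(1)] .
 ultimately have "g \<bullet> i' = h' \<bullet> f'" using h uv by simp
 thus ?thesis using assms(2) h' a unfolding realizes_def \<sigma> by auto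
qed

text \<open>Every class has a representative with second projection the coimage of \<open>\<eta>\<close>; since the
 remaining part of \<open>\<eta>\<close> is mono, two such representatives on a common domain are equal as soon
 as they are realized by the same morphism.\<close>

lemma realizes_common:
 assumes "realizes M N \<rho> g" "realizes M N \<rho>' g"
 shows "\<exists>\<sigma> \<in> serre_reps C T M N. serre_refines C \<rho> \<sigma> \<and> serre_refines C \<rho>' \<sigma>"
proof -
 obtain i f p where \<rho>: "\<rho> = (i, f, p)" by (cases \<rho>)
 obtain i' f' p' where \<rho>': "\<rho>' = (i', f', p')" by (cases \<rho>')
 note a = assms(1)[unfolded realizes_def \<rho> prod.case]
 note a' = assms(2)[unfolded realizes_def \<rho>' prod.case]
 note r = serre_repsD[OF a[THEN conjunct1]]
 note r' = serre_repsD[OF a'[THEN conjunct1]]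
 obtain h where h: "h \<in> Hom C (Cod C p) (Fo W N)" "h \<bullet> p = \<eta> N" "g \<bullet> i = h \<bullet> f" using a by blast
 obtain h' where h': "h' \<in> Hom C (Cod C p') (Fo W N)" "h' \<bullet> p' = \<eta> N" "g \<bullet> i' = h' \<bullet> f'"
  using a' by blast
 obtain Y q m where qm: "q \<in> Hom C N Y" "m \<in> Hom C Y (Fo W N)" "small_epi C T q" "cosmall_mono C T m"
  "m \<bullet> q = \<eta> N" using eta_factor[OF r(7)] by blast
 \<comment> \<open>Every small epi \<open>p0\<close> along which \<open>\<eta> N\<close> extends
   factors the coimage \<open>q\<close>: \<open>v\<close> is the diagonal of the square formed by
   \<open>p0\<close> and the mono \<open>m\<close>.\<close>
 have lift: "\<exists>v. v \<in> Hom C (Cod C p0) Y \<and> v \<bullet> p0 = q \<and> m \<bullet> v = h0"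
  if "small_epi C T p0" "p0 \<in> Hom C N (Cod C p0)" "h0 \<in> Hom C (Cod C p0) (Fo W N)" "h0 \<bullet> p0 = \<eta> N" for p0 h0
 proof -
  have "\<exists>v \<in> Hom C (Cod C p0) Y. v \<bullet> p0 = q"
   using epi_mono_lift[OF small_is_epi[OF that(1)] that(2) cosmall_is_mono[OF qm(4)] qm(2,1) that(3)]
    that qm by auto
  then obtain v where v: "v \<in> Hom C (Cod C p0) Y" "v \<bullet> p0 = q" by blast
  have "m \<bullet> v \<in> Hom C (Cod C p0) (Fo W N)" using v qm Cmp_Hom by blast
  moreover have "(m \<bullet> v) \<bullet> p0 = h0 \<bullet> p0" using Cmp_assoc[OF that(2) v(1) qm(2)] v qm that by simp
  ultimately have "m \<bullet> v = h0" using is_epiD[OF small_is_epi[OF that(1)] that(2)] that by blast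
  with v show ?thesis by blast
 qed
 obtain v where v: "v \<in> Hom C (Cod C p) Y" "v \<bullet> p = q" "m \<bullet> v = h" using lift[OF r(3,4) h(1,2)] by blast
 obtain v' where v': "v' \<in> Hom C (Cod C p') Y" "v' \<bullet> p' = q" "m \<bullet> v' = h'"
  using lift[OF r'(3,4) h'(1,2)] by blast
 \<comment> \<open>A common domain: pulling \<open>i'\<close> back along \<open>i\<close> gives a
   cosmall \<open>u\<close>, and \<open>i u\<close> is cosmall as a composite.\<close>
 obtain M0 u u' where u: "u \<in> Hom C M0 (Dom C i)" "u' \<in> Hom C M0 (Dom C i')" "cosmall_mono C T u"
  "i \<bullet> u = i' \<bullet> u'" using cosmall_pullback[OF r'(1,2) r(2)] by blast
 have iu: "cosmall_mono C T (i \<bullet> u)" "i \<bullet> u \<in> Hom C M0 M"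
  using cosmall_comp[OF u(3) r(1) u(1) r(2)] Cmp_Hom[OF u(1) r(2)] .
 have fu: "f \<bullet> u \<in> Hom C M0 (Cod C p)" "f' \<bullet> u' \<in> Hom C M0 (Cod C p')"
  using u r r' Cmp_Hom by blast+
 have vfu: "v \<bullet> (f \<bullet> u) \<in> Hom C M0 Y" "v' \<bullet> (f' \<bullet> u') \<in> Hom C M0 Y" using fu v v' Cmp_Hom by blast+
 have g: "g \<in> Hom C M (Fo W N)" using a by blast
 have "m \<bullet> (v \<bullet> (f \<bullet> u)) = g \<bullet> (i \<bullet> u)"
  using Cmp_assoc[OF fu(1) v(1) qm(2)] Cmp_assoc[OF u(1) r(5) h(1)] Cmp_assoc[OF u(1) r(2) g] v h by simp
 moreover have "m \<bullet> (v' \<bullet> (f' \<bullet> u')) = g \<bullet> (i' \<bullet> u')"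
  using Cmp_assoc[OF fu(2) v'(1) qm(2)] Cmp_assoc[OF u(2) r'(5) h'(1)] Cmp_assoc[OF u(2) r'(2) g] v' h' by simp
 ultimately have eq: "v \<bullet> (f \<bullet> u) = v' \<bullet> (f' \<bullet> u')"
  using is_monoD[OF cosmall_is_mono[OF qm(4)] qm(2) vfu] u(4) by simp
 let ?\<sigma> = "(i \<bullet> u, v \<bullet> (f \<bullet> u), q)"
 have "?\<sigma> \<in> serre_reps C T M N" using serre_repsI[OF iu qm(3,1) vfu(1)] .
 moreover have "serre_refines C \<rho> ?\<sigma>"
  unfolding \<rho> serre_refines.simps HomD(2)[OF iu(2)] HomD(3)[OF qm(1)] using u(1) v(1,2) by blast
 moreover have "serre_refines C \<rho>' ?\<sigma>"
  unfolding \<rho>' serre_refines.simps HomD(2)[OF iu(2)] HomD(3)[OF qm(1)] eq using u(2,4) v'(1,2) by blast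
 ultimately show ?thesis by blast
qed

text \<open>Refinement preserves the realizing morphism, and triples with the same one have a common
  refinement; so the classes are the fibres of the map from triples to morphisms
  \<open>M \<rightarrow> W N\<close>.\<close>

lemma serre_class_realizes:
 assumes "realizes M N \<rho> g"
 shows "serre_class C T M N \<rho> = {\<sigma>. realizes M N \<sigma> g}"
proof -
 have \<rho>: "\<rho> \<in> serre_reps C T M N" using assms by (simp add: realizes_def)
 have "realizes M N \<sigma> g" if "\<sigma> \<in> serre_class C T M N \<rho>" for \<sigma>
 proof -
  obtain \<tau> where \<tau>: "\<sigma> \<in> serre_reps C T M N" "\<tau> \<in> serre_reps C T M N" "serre_refines C \<rho> \<tau>" "serre_refines C \<sigma> \<tau>"
   using \<open>\<sigma> \<in> serre_class C T M N \<rho>\<close> unfolding serre_class_def by blast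
  obtain g' where "realizes M N \<sigma> g'" using realizes_ex[OF \<tau>(1)] by blast
  moreover have "g' = g"
   using realizes_unique realizes_refines[OF \<tau>(3,2) assms] realizes_refines[OF \<tau>(4,2) calculation] by blast
  ultimately show ?thesis by simp
 qed
 moreover have "\<sigma> \<in> serre_class C T M N \<rho>" if "realizes M N \<sigma> g" for \<sigma>
  using realizes_common[OF assms that] that unfolding serre_class_def realizes_def by blast
 ultimately show ?thesis by blast
qed

text \<open>The arrow of the quotient with label \<open>g\<close>. Labels range bijectively over the
  morphisms \<open>M \<rightarrow> W N\<close>, by \<open>Q_Hom\<close> and
  \<open>qarr_inj\<close>.\<close>

definition qarr :: "'o \<Rightarrow> 'a \<Rightarrow> 'o \<Rightarrow> 'o \<times> ('a \<times> 'a \<times> 'a) set \<times> 'o" where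
 "qarr M g N = (M, {\<sigma>. realizes M N \<sigma> g}, N)"

text \<open>Pull the mono part of \<open>\<eta> N\<close> back along \<open>g\<close>: on the
  resulting cosmall subobject, \<open>g\<close> takes values in the image of \<open>\<eta> N\<close>
  and is thus a morphism to the coimage.\<close>

lemma realizes_surj:
 assumes "N \<in> Ob C" "g \<in> Hom C M (Fo W N)"
 shows "\<exists>\<rho>. realizes M N \<rho> g"
proof -
 obtain Y q m where qm: "q \<in> Hom C N Y" "m \<in> Hom C Y (Fo W N)" "small_epi C T q" "cosmall_mono C T m"
  "m \<bullet> q = \<eta> N" using eta_factor[OF assms(1)] by blast
 obtain M' i f where i: "i \<in> Hom C M' M" "f \<in> Hom C M' Y" "cosmall_mono C T i" "g \<bullet> i = m \<bullet> f"
  using cosmall_pullback[OF qm(4,2) assms(2)] by blast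
 have "realizes M N (i, f, q) g"
  unfolding realizes_def using serre_repsI[OF i(3,1) qm(3,1) i(2)] assms i qm HomD(3)[OF qm(1)] by auto
 thus ?thesis ..
qed

text \<open>The fibre over \<open>g\<close> is nonempty by \<open>realizes_surj\<close>, and a
  triple in it is realized by both labels.\<close>

lemma qarr_inj:
 assumes "qarr M g N = qarr M' g' N'" "N \<in> Ob C" "g \<in> Hom C M (Fo W N)"
 shows "M = M'" "N = N'" "g = g'"
proof -
 show "M = M'" "N = N'" using assms by (auto simp: qarr_def)
 moreover obtain \<rho> where "realizes M N \<rho> g" using realizes_surj[OF assms(2,3)] by blast
 ultimately show "g = g'" using realizes_unique[of M N \<rho> g g'] assms(1)
  by (auto simp: qarr_def)
qed

section \<open>Hom-sets of the quotient in terms of morphisms into \<open>W\<close>\<close>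

abbreviation "Q \<equiv> serre_quotient C T"

lemma Q_Ob [simp]: "Ob Q = Ob C"
 by (simp add: serre_quotient_def)

lemma Q_Ar: "Ar Q = {qarr M g N | M g N. N \<in> Ob C \<and> g \<in> Hom C M (Fo W N)}"
proof -
 have "(M, serre_class C T M N \<rho>, N) \<in> {qarr M g N | M g N. N \<in> Ob C \<and> g \<in> Hom C M (Fo W N)}"
  if "N \<in> Ob C" "\<rho> \<in> serre_reps C T M N" for M N \<rho>
 proof -
  obtain g where g: "realizes M N \<rho> g" using realizes_ex[OF \<open>\<rho> \<in> serre_reps C T M N\<close>] by blast
  hence "(M, serre_class C T M N \<rho>, N) = qarr M g N" by (simp add: qarr_def serre_class_realizes)
  thus ?thesis using \<open>N \<in> Ob C\<close> g unfolding realizes_def by blast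
 qed
 moreover have "qarr M g N \<in> {(M, serre_class C T M N \<rho>, N) | M N \<rho>. M \<in> Ob C \<and> N \<in> Ob C \<and> \<rho> \<in> serre_reps C T M N}"
  if "N \<in> Ob C" "g \<in> Hom C M (Fo W N)" for M g N
 proof -
  obtain \<rho> where "realizes M N \<rho> g"
   using realizes_surj[OF \<open>N \<in> Ob C\<close> \<open>g \<in> Hom C M (Fo W N)\<close>] by blast
  hence "qarr M g N = (M, serre_class C T M N \<rho>, N)" "\<rho> \<in> serre_reps C T M N"
   by (simp_all add: qarr_def serre_class_realizes) (simp add: realizes_def)
  thus ?thesis using that Hom_Ob by blast
 qed
 ultimately show ?thesis unfolding serre_quotient_def by auto
qed

lemma Q_Dom [simp]: "Dom Q (qarr M g N) = M" and Q_Cod [simp]: "Cod Q (qarr M g N) = N"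
 by (simp_all add: serre_quotient_def qarr_def)

lemma Q_Hom: "Hom Q M N = {qarr M g N | g. N \<in> Ob C \<and> g \<in> Hom C M (Fo W N)}"
 unfolding Hom_def[of Q] Q_Ar by auto

lemma Q_HomE:
 assumes "f \<in> Hom Q M N"
 obtains g where "f = qarr M g N" "M \<in> Ob C" "N \<in> Ob C" "g \<in> Hom C M (Fo W N)"
 using assms Hom_Ob unfolding Q_Hom by blast

lemma realizes_Idt:
 assumes "f \<in> Hom C M N"
 shows "realizes M N (Idt C M, f, Idt C N) (\<eta> N \<bullet> f)"
proof -
 have o: "M \<in> Ob C" "N \<in> Ob C" using Hom_Ob[OF assms] .
 have "\<eta> N \<bullet> f \<in> Hom C M (Fo W N)" using Cmp_Hom[OF assms eta_Hom] o by blast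
 thus ?thesis unfolding realizes_def
  using serre_repsI[OF cosmall_Idt Idt_Hom small_Idt Idt_Hom assms] o HomD(3)[OF Idt_Hom] eta_Hom
   Cmp_Idt_right by auto
qed

lemma Q_Idt: "M \<in> Ob C \<Longrightarrow> Idt Q M = qarr M (\<eta> M) M"
 using serre_class_realizes[OF realizes_Idt[OF Idt_Hom]] Cmp_Idt_right[OF eta_Hom]
 by (simp add: serre_quotient_def qarr_def)

lemma serre_functor_Fo [simp]: "Fo (serre_functor C T) M = M"
 by (simp add: serre_functor_def)

lemma serre_functor_Fa: "f \<in> Hom C M N \<Longrightarrow> Fa (serre_functor C T) f = qarr M (\<eta> N \<bullet> f) N"
 using serre_class_realizes[OF realizes_Idt] HomD[of f C M N]
 by (simp add: serre_functor_def qarr_def)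

section \<open>Kleisli extension and composition\<close>

lemma eta_ext_unique:
 assumes "N \<in> Ob C" "P \<in> Ob C" "g \<in> Hom C N (Fo W P)"
 shows "\<exists>!e. e \<in> Hom C (Fo W N) (Fo W P) \<and> e \<bullet> \<eta> N = g"
proof -
 obtain Y q m where qm: "q \<in> Hom C N Y" "m \<in> Hom C Y (Fo W N)" "small_epi C T q" "cosmall_mono C T m"
  "m \<bullet> q = \<eta> N" using eta_factor[OF assms(1)] by blast
 \<comment> \<open>Extension in two stages: \<open>ext_unique\<close> applies to the epi part of
   \<open>\<eta> N\<close> and then to its mono part, though not to \<open>\<eta> N\<close>
   itself.\<close>
 obtain a where a: "a \<in> Hom C Y (Fo W P)" "a \<bullet> q = g" using ext_unique[OF _ qm(1) assms(2,3)] qm by blast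
 obtain e where e: "e \<in> Hom C (Fo W N) (Fo W P)" "e \<bullet> m = a" using ext_unique[OF _ qm(2) assms(2) a(1)] qm by blast
 show ?thesis
 proof (rule ex1I[of _ e])
  show "e \<in> Hom C (Fo W N) (Fo W P) \<and> e \<bullet> \<eta> N = g"
   using e a qm Cmp_assoc[OF qm(1,2) e(1)] by simp
  fix e' assume e': "e' \<in> Hom C (Fo W N) (Fo W P) \<and> e' \<bullet> \<eta> N = g"
  hence "e' \<bullet> m = a"
   using ext_eq[OF _ qm(1) assms(2) Cmp_Hom[OF qm(2), of e'] a(1)] a qm Cmp_assoc[OF qm(1,2), of e'] by auto
  thus "e' = e" using ext_eq[OF _ qm(2) assms(2), of e' e] e e' qm by simp
 qed
qed

text \<open>The Kleisli extension operator of the monad that \<open>W\<close> is going to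
  be.\<close>

definition kext :: "'o \<Rightarrow> 'a \<Rightarrow> 'o \<Rightarrow> 'a" where
 "kext N g P = (THE e. e \<in> Hom C (Fo W N) (Fo W P) \<and> e \<bullet> \<eta> N = g)"

lemma kext:
 assumes "N \<in> Ob C" "P \<in> Ob C" "g \<in> Hom C N (Fo W P)"
 shows "kext N g P \<in> Hom C (Fo W N) (Fo W P)" "kext N g P \<bullet> \<eta> N = g"
 using theI'[OF eta_ext_unique[OF assms]] unfolding kext_def by auto

lemma kext_eq:
 assumes "N \<in> Ob C" "P \<in> Ob C" "e \<in> Hom C (Fo W N) (Fo W P)"
 shows "kext N (e \<bullet> \<eta> N) P = e"
 unfolding kext_def using eta_ext_unique[OF assms(1,2), of "e \<bullet> \<eta> N"] assms Cmp_Hom[OF eta_Hom]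
 by (intro the1_equality) auto

text \<open>Composition of fractions is Kleisli composition of labels. Whatever representatives and
  factorization are chosen, the composite has the same realizing morphism, which is why the union in
  \<open>serre_comp\<close> is a single class.\<close>

lemma comp_rep_realizes:
 assumes "realizes M N \<rho> g" "realizes N P \<gamma> g'" "serre_comp_rep C T \<gamma> \<rho> \<sigma>"
 shows "realizes M P \<sigma> (kext N g' P \<bullet> g)"
proof -
 obtain i f p where \<rho>: "\<rho> = (i, f, p)" by (cases \<rho>)
 obtain j g0 q where \<gamma>: "\<gamma> = (j, g0, q)" by (cases \<gamma>)
 note a = assms(1)[unfolded realizes_def \<rho> prod.case]
 note b = assms(2)[unfolded realizes_def \<gamma> prod.case]
 note ra = serre_repsD[OF a[THEN conjunct1]]
 note rb = serre_repsD[OF b[THEN conjunct1]]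
 obtain h where h: "h \<in> Hom C (Cod C p) (Fo W N)" "h \<bullet> p = \<eta> N" "g \<bullet> i = h \<bullet> f" using a by blast
 obtain h' where h': "h' \<in> Hom C (Cod C q) (Fo W P)" "h' \<bullet> q = \<eta> P" "g' \<bullet> j = h' \<bullet> g0" using b by blast
 obtain e m k u r v where s: "is_epi C e" "is_mono C m" "Dom C e = Dom C j" "Cod C e = Dom C m" "Cod C m = Cod C p"
   "m \<bullet> e = p \<bullet> j" "k \<in> Ar C" "Cod C k = Dom C i" "cosmall_mono C T (i \<bullet> k)"
   "u \<in> Hom C (Dom C k) (Dom C m)" "f \<bullet> k = m \<bullet> u"
   "r \<in> Ar C" "Dom C r = Cod C q" "small_epi C T (r \<bullet> q)" "v \<in> Hom C (Cod C e) (Cod C r)" "r \<bullet> g0 = v \<bullet> e"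
   "\<sigma> = (i \<bullet> k, v \<bullet> u, r \<bullet> q)"
  using assms(3) unfolding serre_comp_rep_def \<rho> \<gamma> prod.case by blast
 define A I Z where "A = Dom C k" and "I = Dom C m" and "Z = Cod C r"
 have e: "e \<in> Hom C (Dom C j) I" using s unfolding I_def by (auto intro: HomI simp: is_epi_def)
 have m: "m \<in> Hom C I (Cod C p)" using s unfolding I_def by (auto intro: HomI simp: is_mono_def)
 have k: "k \<in> Hom C A (Dom C i)" and r: "r \<in> Hom C (Cod C q) Z" using s unfolding A_def Z_def by (auto intro: HomI)
 have u: "u \<in> Hom C A I" and v: "v \<in> Hom C I Z" using s unfolding A_def I_def Z_def by auto
 have g: "g \<in> Hom C M (Fo W N)" and g': "g' \<in> Hom C N (Fo W P)" using a b by auto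
 let ?G = "kext N g' P"
 note G = kext[OF rb(6,7) g']
 have rq: "r \<bullet> q \<in> Hom C P Z" using Cmp_Hom[OF rb(4) r] .
 \<comment> \<open>\<open>h1\<close> extends \<open>\<eta> P\<close> along the enlarged projection
   \<open>r q\<close>; precomposed with \<open>r\<close> it gives back the extension
   \<open>h'\<close> belonging to \<open>q\<close>.\<close>
 obtain h1 where h1: "h1 \<in> Hom C Z (Fo W P)" "h1 \<bullet> (r \<bullet> q) = \<eta> P"
  using ext_unique[OF _ rq rb(7) eta_Hom[OF rb(7)]] s by blast
 have h1r: "h1 \<bullet> r = h'"
  using ext_eq[OF _ rb(4) rb(7) Cmp_Hom[OF r h1(1)] h'(1)] rb(3) h1 h' Cmp_assoc[OF rb(4) r h1(1)] by simp
 have Gh: "?G \<bullet> h \<in> Hom C (Cod C p) (Fo W P)" using Cmp_Hom[OF h(1) G(1)] .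
 have Ghm: "?G \<bullet> h \<bullet> m \<in> Hom C I (Fo W P)" using Cmp_Hom[OF m Gh] .
 \<comment> \<open>Both sides of \<open>key\<close> are compared on the domain of \<open>j\<close>,
   where each equals \<open>g' j\<close>; the epi \<open>e\<close> can then be cancelled.\<close>
 have "(?G \<bullet> h \<bullet> m) \<bullet> e = (?G \<bullet> h) \<bullet> (p \<bullet> j)" using Cmp_assoc[OF e m Gh] s by simp
 also have "\<dots> = (?G \<bullet> \<eta> N) \<bullet> j"
  using Cmp_assoc[OF rb(2) ra(4) Gh] Cmp_assoc[OF ra(4) h(1) G(1)] h by simp
 also have "\<dots> = (h1 \<bullet> r) \<bullet> g0" using G h' h1r by simp
 also have "\<dots> = (h1 \<bullet> v) \<bullet> e" using Cmp_assoc[OF rb(5) r h1(1)] Cmp_assoc[OF e v h1(1)] s by simp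
 finally have key: "?G \<bullet> h \<bullet> m = h1 \<bullet> v" using is_epiD[OF s(1) e Ghm Cmp_Hom[OF v h1(1)]] by blast
 have Gg: "?G \<bullet> g \<in> Hom C M (Fo W P)" using Cmp_Hom[OF g G(1)] .
 have "(?G \<bullet> g) \<bullet> (i \<bullet> k) = ?G \<bullet> ((g \<bullet> i) \<bullet> k)"
  using Cmp_assoc[OF Cmp_Hom[OF k ra(2)] g G(1)] Cmp_assoc[OF k ra(2) g] by simp
 also have "\<dots> = ?G \<bullet> (h \<bullet> (m \<bullet> u))" using h s Cmp_assoc[OF k ra(5) h(1)] by simp
 also have "\<dots> = (?G \<bullet> h \<bullet> m) \<bullet> u"
  using Cmp_assoc[OF Cmp_Hom[OF u m] h(1) G(1)] Cmp_assoc[OF u m Gh] by simp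
 also have "\<dots> = h1 \<bullet> (v \<bullet> u)" using key Cmp_assoc[OF u v h1(1)] by simp
 finally have fin: "(?G \<bullet> g) \<bullet> (i \<bullet> k) = h1 \<bullet> (v \<bullet> u)" .
 have "\<sigma> \<in> serre_reps C T M P"
  unfolding s(17) using serre_repsI[OF s(9) Cmp_Hom[OF k ra(2)] s(14) rq Cmp_Hom[OF u v]] .
 thus ?thesis unfolding realizes_def s(17) using Gg fin h1 HomD(3)[OF rq] by auto
qed

text \<open>The union defining a composite is not empty. The image of \<open>N'\<close> in the
  coimage \<open>Y\<close> is again cosmall; pulling \<open>g\<close> back along it from the start
  makes the restriction \<open>k\<close> and the projection \<open>r\<close> of
  \<open>serre_comp_rep\<close> identities.\<close>

lemma comp_rep_ex:
 assumes "N \<in> Ob C" "P \<in> Ob C" "g \<in> Hom C M (Fo W N)" "g' \<in> Hom C N (Fo W P)"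
 shows "\<exists>\<rho> \<gamma> \<sigma>. realizes M N \<rho> g \<and> realizes N P \<gamma> g' \<and> serre_comp_rep C T \<gamma> \<rho> \<sigma>"
proof -
 note G = kext[OF assms(1,2,4)]
 let ?G = "kext N g' P"
 obtain Y p m where pm: "p \<in> Hom C N Y" "m \<in> Hom C Y (Fo W N)" "small_epi C T p" "cosmall_mono C T m"
  "m \<bullet> p = \<eta> N" using eta_factor[OF assms(1)] by blast
 obtain Z q mP where q: "q \<in> Hom C P Z" "mP \<in> Hom C Z (Fo W P)" "small_epi C T q" "cosmall_mono C T mP"
  "mP \<bullet> q = \<eta> P" using eta_factor[OF assms(2)] by blast
 obtain N' j g0 where j: "j \<in> Hom C N' N" "g0 \<in> Hom C N' Z" "cosmall_mono C T j" "g' \<bullet> j = mP \<bullet> g0"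
  using cosmall_pullback[OF q(4,2) assms(4)] by blast
 obtain I e m0 where I: "e \<in> Hom C N' I" "m0 \<in> Hom C I Y" "is_epi C e" "cosmall_mono C T m0" "m0 \<bullet> e = p \<bullet> j"
  using cosmall_image[OF small_is_epi[OF pm(3)] pm(1) j(3,1)] by blast
 have mm: "cosmall_mono C T (m \<bullet> m0)" "m \<bullet> m0 \<in> Hom C I (Fo W N)"
  using cosmall_comp[OF I(4) pm(4) I(2) pm(2)] Cmp_Hom[OF I(2) pm(2)] .
 obtain M' i u where i: "i \<in> Hom C M' M" "u \<in> Hom C M' I" "cosmall_mono C T i" "g \<bullet> i = (m \<bullet> m0) \<bullet> u"
  using cosmall_pullback[OF mm assms(3)] by blast
 have f: "m0 \<bullet> u \<in> Hom C M' Y" using Cmp_Hom[OF i(2) I(2)] .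
 have "realizes M N (i, m0 \<bullet> u, p) g"
  unfolding realizes_def using serre_repsI[OF i(3,1) pm(3,1) f] assms pm HomD(3)[OF pm(1)] i
   Cmp_assoc[OF i(2) I(2) pm(2)] by auto
 moreover have "realizes N P (j, g0, q) g'"
  unfolding realizes_def using serre_repsI[OF j(3,1) q(3,1) j(2)] assms j q HomD(3)[OF q(1)] by auto
 \<comment> \<open>A square with the epi \<open>e\<close> on one side and the mono \<open>mP\<close>
   on the other, whose diagonal is the required \<open>v\<close>.\<close>
 moreover have "mP \<bullet> g0 = (?G \<bullet> (m \<bullet> m0)) \<bullet> e"
 proof -
  have "mP \<bullet> g0 = ?G \<bullet> (\<eta> N \<bullet> j)" using j G Cmp_assoc[OF j(1) eta_Hom[OF assms(1)] G(1)] by simp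
  also have "\<eta> N \<bullet> j = m \<bullet> (m0 \<bullet> e)" using pm I Cmp_assoc[OF j(1) pm(1,2)] by simp
  also have "\<dots> = (m \<bullet> m0) \<bullet> e" using Cmp_assoc[OF I(1,2) pm(2)] .
  finally show ?thesis using Cmp_assoc[OF I(1) mm(2) G(1)] by simp
 qed
 then obtain v where v: "v \<in> Hom C I Z" "v \<bullet> e = g0"
  using epi_mono_lift[OF I(3,1) cosmall_is_mono[OF q(4)] q(2) j(2) Cmp_Hom[OF mm(2) G(1)]] by blast
 have "serre_comp_rep C T (j, g0, q) (i, m0 \<bullet> u, p) (i, v \<bullet> u, q)"
  unfolding serre_comp_rep_def prod.case
 proof (intro exI conjI)
  note o = Hom_Ob[OF i(1)] Hom_Ob[OF q(1)]
  show "is_epi C e" "is_mono C m0" "m0 \<bullet> e = p \<bullet> j" using I cosmall_is_mono by auto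
  show "Dom C e = Dom C j" "Cod C e = Dom C m0" "Cod C m0 = Cod C p" using I j pm HomD by metis+
  show "Idt C M' \<in> Ar C" "Cod C (Idt C M') = Dom C i" "u \<in> Hom C (Dom C (Idt C M')) (Dom C m0)"
   using HomD[OF Idt_Hom] o i I HomD by metis+
  show "Idt C Z \<in> Ar C" "Dom C (Idt C Z) = Cod C q" "v \<in> Hom C (Cod C e) (Cod C (Idt C Z))"
   using HomD[OF Idt_Hom] o q v I HomD by metis+
  show "cosmall_mono C T (i \<bullet> Idt C M')" "(m0 \<bullet> u) \<bullet> Idt C M' = m0 \<bullet> u"
   "(i, v \<bullet> u, q) = (i \<bullet> Idt C M', v \<bullet> u, Idt C Z \<bullet> q)" "small_epi C T (Idt C Z \<bullet> q)"
   "Idt C Z \<bullet> g0 = v \<bullet> e"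
   using Cmp_Idt_right[OF i(1)] Cmp_Idt_right[OF f] Cmp_Idt_left[OF q(1)] Cmp_Idt_left[OF j(2)] i q v by auto
 qed
 ultimately show ?thesis by blast
qed

text \<open>All members of the union coincide by \<open>comp_rep_realizes\<close> and there is at
  least one by \<open>comp_rep_ex\<close>.\<close>

lemma Q_Cmp:
 assumes "N \<in> Ob C" "P \<in> Ob C" "g \<in> Hom C M (Fo W N)" "g' \<in> Hom C N (Fo W P)"
 shows "qarr N g' P \<bullet>\<^sub>Q qarr M g N = qarr M (kext N g' P \<bullet> g) P"
proof -
 let ?S = "{serre_class C T M P \<sigma> | \<sigma> \<gamma> \<rho>. \<gamma> \<in> {\<sigma>. realizes N P \<sigma> g'} \<and> \<rho> \<in> {\<sigma>. realizes M N \<sigma> g} \<and> serre_comp_rep C T \<gamma> \<rho> \<sigma>}"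
 let ?R = "{\<sigma>. realizes M P \<sigma> (kext N g' P \<bullet> g)}"
 have "U = ?R" if "U \<in> ?S" for U
 proof -
  obtain \<sigma> \<gamma> \<rho> where "U = serre_class C T M P \<sigma>" "realizes N P \<gamma> g'" "realizes M N \<rho> g"
   "serre_comp_rep C T \<gamma> \<rho> \<sigma>" using \<open>U \<in> ?S\<close> by blast
  thus ?thesis using serre_class_realizes[OF comp_rep_realizes] by simp
 qed
 moreover have "?S \<noteq> {}" using comp_rep_ex[OF assms] by blast
 ultimately have "?S = {?R}" by blast
 hence "\<Union>?S = ?R" by simp
 thus ?thesis unfolding qarr_def by (simp add: serre_quotient_def serre_comp_def)
qed

lemma kext_eta: "N \<in> Ob C \<Longrightarrow> kext N (\<eta> N) N = Idt C (Fo W N)"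
 using kext_eq[of N N "Idt C (Fo W N)"] Idt_Hom[OF W_Ob] Cmp_Idt_left[OF eta_Hom] by simp

text \<open>Both sides agree after composition with \<open>\<eta> M\<close>, and extensions along it
  are unique; this is the associativity law of the Kleisli category.\<close>

lemma kext_comp:
 assumes "M \<in> Ob C" "N \<in> Ob C" "P \<in> Ob C" "g \<in> Hom C M (Fo W N)" "g' \<in> Hom C N (Fo W P)"
 shows "kext M (kext N g' P \<bullet> g) P = kext N g' P \<bullet> kext M g N"
proof -
 note G' = kext[OF assms(2,3,5)] and G = kext[OF assms(1,2,4)]
 show ?thesis
  using kext_eq[OF assms(1,3) Cmp_Hom[OF G(1) G'(1)]] Cmp_assoc[OF eta_Hom[OF assms(1)] G(1) G'(1)] G by simp
qed

section \<open>The quotient category, its section functor and the adjunction\<close>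

lemma category_Q: "category Q"
proof
 show "Dom Q f \<in> Ob Q" "Cod Q f \<in> Ob Q" if "f \<in> Ar Q" for f
  using that Hom_Ob unfolding Q_Ar by auto
 show "Idt Q A \<in> Hom Q A A" if "A \<in> Ob Q" for A
  using that Q_Idt eta_Hom unfolding Q_Hom by auto
next
 fix f g A B Z assume fg: "f \<in> Hom Q A B" "g \<in> Hom Q B Z"
 thus "g \<bullet>\<^sub>Q f \<in> Hom Q A Z"
  by (elim Q_HomE) (use Q_Cmp kext Cmp_Hom in \<open>auto simp: Q_Hom\<close>)
next
 fix f A B assume f: "f \<in> Hom Q A B"
 show "f \<bullet>\<^sub>Q Idt Q A = f" "Idt Q B \<bullet>\<^sub>Q f = f"
  using f by (elim Q_HomE; simp add: Q_Idt Q_Cmp eta_Hom kext kext_eta Cmp_Idt_left)+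
next
 fix f g h A B Z V assume "f \<in> Hom Q A B" "g \<in> Hom Q B Z" "h \<in> Hom Q Z V"
 then obtain f' g' h' where o: "A \<in> Ob C" "B \<in> Ob C" "Z \<in> Ob C" "V \<in> Ob C"
  and f: "f = qarr A f' B" "f' \<in> Hom C A (Fo W B)" and g: "g = qarr B g' Z" "g' \<in> Hom C B (Fo W Z)"
  and h: "h = qarr Z h' V" "h' \<in> Hom C Z (Fo W V)" by (metis Q_HomE)
 note F = kext(1)[OF o(2,3) g(2)] kext(1)[OF o(3,4) h(2)]
 show "h \<bullet>\<^sub>Q (g \<bullet>\<^sub>Q f) = (h \<bullet>\<^sub>Q g) \<bullet>\<^sub>Q f"
  unfolding f g h using o f g h F
  by (simp add: Q_Cmp Cmp_Hom[OF f(2) F(1)] Cmp_Hom[OF g(2) F(2)] kext_comp Cmp_assoc[OF f(2) F])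
qed

text \<open>Naturality of \<open>\<eta>\<close> forces the value of \<open>W\<close> on arrows, so
  functoriality of \<open>W\<close> is inherited from \<open>kext_comp\<close>.\<close>

lemma W_eq_kext:
 assumes "f \<in> Hom C M N"
 shows "kext M (\<eta> N \<bullet> f) N = Fa W f"
 using kext_eq[OF Hom_Ob[OF assms] W_Hom[OF assms]] eta_nat[OF assms] by simp

lemma functor_W: "is_functor C C W"
proof
 show "Fo W A \<in> Ob C" if "A \<in> Ob C" for A using W_Ob that .
 show "Fa W f \<in> Hom C (Fo W A) (Fo W B)" if "f \<in> Hom C A B" for f A B using W_Hom that .
 show "Fa W (Idt C A) = Idt C (Fo W A)" if "A \<in> Ob C" for A
  using W_eq_kext[OF Idt_Hom[OF that]] Cmp_Idt_right[OF eta_Hom[OF that]] kext_eta[OF that] by simp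
 fix f g A B Z assume fg: "f \<in> Hom C A B" "g \<in> Hom C B Z"
 have o: "A \<in> Ob C" "B \<in> Ob C" "Z \<in> Ob C" using Hom_Ob fg by blast+
 have "Fa W g \<bullet> Fa W f = kext A (kext B (\<eta> Z \<bullet> g) Z \<bullet> (\<eta> B \<bullet> f)) Z"
  using kext_comp[OF o Cmp_Hom[OF fg(1) eta_Hom[OF o(2)]] Cmp_Hom[OF fg(2) eta_Hom[OF o(3)]]] W_eq_kext fg by simp
 also have "kext B (\<eta> Z \<bullet> g) Z \<bullet> (\<eta> B \<bullet> f) = (\<eta> Z \<bullet> g) \<bullet> f"
  using Cmp_assoc[OF fg(1) eta_Hom[OF o(2)] kext(1)[OF o(2,3) Cmp_Hom[OF fg(2) eta_Hom[OF o(3)]]]]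
   kext(2)[OF o(2,3) Cmp_Hom[OF fg(2) eta_Hom[OF o(3)]]] by simp
 also have "kext A ((\<eta> Z \<bullet> g) \<bullet> f) Z = Fa W (g \<bullet> f)"
  using W_eq_kext[OF Cmp_Hom[OF fg]] Cmp_assoc[OF fg eta_Hom[OF o(3)]] by simp
 finally show "Fa W (g \<bullet> f) = Fa W g \<bullet> Fa W f" by simp
qed

text \<open>An arrow of the quotient carries a set of triples instead of its label, so the label has
  to be recovered by a description; \<open>qarr_inj\<close> makes it unique.\<close>

definition section_functor :: "('o, 'o \<times> ('a \<times> 'a \<times> 'a) set \<times> 'o, 'o, 'a) fnctr" where
 "section_functor = \<lparr>Fo = Fo W,
  Fa = (\<lambda>\<phi>. THE e. \<exists>M g N. N \<in> Ob C \<and> g \<in> Hom C M (Fo W N) \<and> \<phi> = qarr M g N \<and> e = kext M g N)\<rparr>"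

lemma section_Fa:
 assumes "N \<in> Ob C" "g \<in> Hom C M (Fo W N)"
 shows "Fa section_functor (qarr M g N) = kext M g N"
 unfolding section_functor_def fnctr.simps
proof (rule the_equality)
 fix e assume "\<exists>M' g' N'. N' \<in> Ob C \<and> g' \<in> Hom C M' (Fo W N') \<and> qarr M g N = qarr M' g' N' \<and> e = kext M' g' N'"
 thus "e = kext M g N" using qarr_inj[OF _ assms] by blast
qed (use assms in blast)

lemma section_Fo [simp]: "Fo section_functor = Fo W"
 by (simp add: section_functor_def)

lemma functor_section: "is_functor Q C section_functor"
proof (intro is_functor.intro is_functor_axioms.intro category_Q category_axioms)
 show "Fo section_functor A \<in> Ob C" if "A \<in> Ob Q" for A using W_Ob that by simp
 show "Fa section_functor (Idt Q A) = Idt C (Fo section_functor A)" if "A \<in> Ob Q" for A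
  using that by (simp add: Q_Idt section_Fa eta_Hom kext_eta)
 show "Fa section_functor f \<in> Hom C (Fo section_functor A) (Fo section_functor B)"
  if "f \<in> Hom Q A B" for f A B
  using that by (elim Q_HomE) (simp add: section_Fa kext)
 show "Fa section_functor (g \<bullet>\<^sub>Q f) = Fa section_functor g \<bullet> Fa section_functor f"
  if "f \<in> Hom Q A B" "g \<in> Hom Q B Z" for f g A B Z
  using that by (elim Q_HomE) (simp add: section_Fa kext_comp Q_Cmp Cmp_Hom[OF _ kext(1)])
qed

lemma functor_serre: "is_functor C Q (serre_functor C T)"
proof (intro is_functor.intro is_functor_axioms.intro category_Q category_axioms)
 show "Fo (serre_functor C T) A \<in> Ob Q" if "A \<in> Ob C" for A using that by simp
 show "Fa (serre_functor C T) (Idt C A) = Idt Q (Fo (serre_functor C T) A)" if "A \<in> Ob C" for A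
  using that by (simp add: serre_functor_Fa[OF Idt_Hom] Q_Idt Cmp_Idt_right[OF eta_Hom])
 show "Fa (serre_functor C T) f \<in> Hom Q (Fo (serre_functor C T) A) (Fo (serre_functor C T) B)"
  if "f \<in> Hom C A B" for f A B
  using that Cmp_Hom[OF that eta_Hom] Hom_Ob[OF that] by (auto simp: serre_functor_Fa Q_Hom)
 fix f g A B Z assume fg: "f \<in> Hom C A B" "g \<in> Hom C B Z"
 have o: "A \<in> Ob C" "B \<in> Ob C" "Z \<in> Ob C" using Hom_Ob fg by blast+
 note e = Cmp_Hom[OF fg(1) eta_Hom[OF o(2)]] Cmp_Hom[OF fg(2) eta_Hom[OF o(3)]]
 show "Fa (serre_functor C T) (g \<bullet> f) = Fa (serre_functor C T) g \<bullet>\<^sub>Q Fa (serre_functor C T) f"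
  using fg e o Cmp_assoc[OF fg(1) eta_Hom[OF o(2)] kext(1)[OF o(2,3) e(2)]] kext(2)[OF o(2,3) e(2)]
   Cmp_assoc[OF fg eta_Hom[OF o(3)]]
  by (simp add: serre_functor_Fa[OF fg(1)] serre_functor_Fa[OF fg(2)] serre_functor_Fa[OF Cmp_Hom[OF fg]] Q_Cmp)
qed

lemma functor_id: "is_functor C C id_fnctr"
 by standard (simp_all add: id_fnctr_def)

lemma functor_id_Q: "is_functor Q Q id_fnctr"
proof -
 interpret Q: category Q by (rule category_Q)
 show ?thesis by standard (simp_all add: id_fnctr_def)
qed

lemma functor_comp:
 assumes "is_functor A B F" "is_functor B D G"
 shows "is_functor A D (comp_fnctr G F)"
proof -
 interpret F: is_functor A B F by fact
 interpret G: is_functor B D G by fact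
 show ?thesis
  by standard (auto simp: comp_fnctr_def F.Fo_Ob G.Fo_Ob G.Fa_Hom F.Fa_Hom F.Fa_Idt G.Fa_Idt
    F.Fa_Cmp G.Fa_Cmp[OF F.Fa_Hom F.Fa_Hom])
qed

lemma section_serre_Fa: "f \<in> Hom C A B \<Longrightarrow> Fa section_functor (Fa (serre_functor C T) f) = Fa W f"
 using Hom_Ob[of f A B] Cmp_Hom[OF _ eta_Hom] by (simp add: serre_functor_Fa section_Fa W_eq_kext)

lemma unit_nat: "nat_trans C C id_fnctr (comp_fnctr section_functor (serre_functor C T)) \<eta>"
 by (intro nat_trans.intro nat_trans_axioms.intro functor_id functor_comp[OF functor_serre functor_section])
  (auto simp: id_fnctr_def comp_fnctr_def eta_Hom eta_nat section_serre_Fa)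

text \<open>As in every Kleisli adjunction, the counit at \<open>N\<close> is the arrow labelled by
  the identity of \<open>W N\<close>.\<close>

definition qcounit :: "'o \<Rightarrow> 'o \<times> ('a \<times> 'a \<times> 'a) set \<times> 'o" where
 "qcounit N = qarr (Fo W N) (Idt C (Fo W N)) N"

lemma counit_nat: "nat_trans Q Q (comp_fnctr (serre_functor C T) section_functor) id_fnctr qcounit"
proof (intro nat_trans.intro nat_trans_axioms.intro functor_id_Q functor_comp[OF functor_section functor_serre])
 show "qcounit A \<in> Hom Q (Fo (comp_fnctr (serre_functor C T) section_functor) A) (Fo id_fnctr A)"
  if "A \<in> Ob Q" for A
  using that Idt_Hom[OF W_Ob] by (auto simp: qcounit_def comp_fnctr_def id_fnctr_def Q_Hom)
 fix f A B assume "f \<in> Hom Q A B"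
 then obtain g where g: "f = qarr A g B" "A \<in> Ob C" "B \<in> Ob C" "g \<in> Hom C A (Fo W B)" by (rule Q_HomE)
 note G = kext[OF g(2-4)] and o = W_Ob[OF g(2)] W_Ob[OF g(3)]
 have "qcounit B \<bullet>\<^sub>Q Fa (serre_functor C T) (kext A g B)
   = qarr (Fo W A) (kext (Fo W B) (Idt C (Fo W B)) B \<bullet> (\<eta> (Fo W B) \<bullet> kext A g B)) B"
  unfolding qcounit_def serre_functor_Fa[OF G(1)]
  using Q_Cmp[OF o(2) g(3) Cmp_Hom[OF G(1) eta_Hom[OF o(2)]] Idt_Hom[OF o(2)]] .
 also have "kext (Fo W B) (Idt C (Fo W B)) B \<bullet> (\<eta> (Fo W B) \<bullet> kext A g B) = kext A g B"
  using Cmp_assoc[OF G(1) eta_Hom[OF o(2)] kext(1)[OF o(2) g(3) Idt_Hom[OF o(2)]]]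
   kext(2)[OF o(2) g(3) Idt_Hom[OF o(2)]] Cmp_Idt_left[OF G(1)] by simp
 also have "qarr (Fo W A) (kext A g B) B = f \<bullet>\<^sub>Q qcounit A"
  unfolding qcounit_def g(1) using Q_Cmp[OF g(2,3) Idt_Hom[OF o(1)] g(4)] Cmp_Idt_right[OF G(1)] by simp
 finally show "qcounit B \<bullet>\<^sub>Q Fa (comp_fnctr (serre_functor C T) section_functor) f
   = Fa id_fnctr f \<bullet>\<^sub>Q qcounit A"
  by (simp add: comp_fnctr_def id_fnctr_def section_Fa g)
qed

lemma adjunction_Q: "adjunction C Q (serre_functor C T) section_functor \<eta> qcounit"
proof (intro adjunction.intro adjunction_axioms.intro unit_nat counit_nat functor_serre functor_section)
 fix A assume A: "A \<in> Ob C"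
 note o = W_Ob[OF A]
 show "qcounit (Fo (serre_functor C T) A) \<bullet>\<^sub>Q Fa (serre_functor C T) (\<eta> A) = Idt Q (Fo (serre_functor C T) A)"
  using Q_Cmp[OF o A Cmp_Hom[OF eta_Hom[OF A] eta_Hom[OF o]] Idt_Hom[OF o]] A
   Cmp_assoc[OF eta_Hom[OF A] eta_Hom[OF o] kext(1)[OF o A Idt_Hom[OF o]]] kext(2)[OF o A Idt_Hom[OF o]]
   Cmp_Idt_left[OF eta_Hom[OF A]]
  by (simp add: qcounit_def serre_functor_Fa[OF eta_Hom] Q_Idt)
next
 fix B assume B: "B \<in> Ob Q"
 hence o: "B \<in> Ob C" "Fo W B \<in> Ob C" using W_Ob by auto
 show "Fa section_functor (qcounit B) \<bullet> \<eta> (Fo section_functor B) = Idt C (Fo section_functor B)"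
  using kext(2)[OF o(2,1) Idt_Hom[OF o(2)]] o by (simp add: qcounit_def section_Fa Idt_Hom)
qed

theorem gabriel_monadI:
 assumes "abelian_category C" "thick C T"
 shows "gabriel_monad C T W \<eta>"
proof -
 have nat: "nat_trans C C id_fnctr W \<eta>"
  by (intro nat_trans.intro nat_trans_axioms.intro functor_id functor_W)
   (auto simp: id_fnctr_def eta_Hom eta_nat)
 \<comment> \<open>The section functor after the quotient functor agrees with \<open>W\<close> on
   objects and on arrows, so identities serve as comparison isomorphism and the unit is
   \<open>\<eta>\<close> on the nose.\<close>
 have "nat_iso C C W (comp_fnctr section_functor (serre_functor C T)) (\<lambda>A. Idt C (Fo W A))"
 proof (intro nat_iso.intro nat_iso_axioms.intro nat_trans.intro nat_trans_axioms.intro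
   functor_W functor_comp[OF functor_serre functor_section])
  fix A assume A: "A \<in> Ob C"
  note i = Idt_Hom[OF W_Ob[OF A]]
  show "Idt C (Fo W A) \<in> Hom C (Fo W A) (Fo (comp_fnctr section_functor (serre_functor C T)) A)"
   using i by (simp add: comp_fnctr_def)
  show "is_iso C (Idt C (Fo W A))"
   unfolding is_iso_def using HomD[OF i] i Cmp_Idt_left[OF i] by auto
 next
  fix f A B assume f: "f \<in> Hom C A B"
  show "Idt C (Fo W B) \<bullet> Fa W f = Fa (comp_fnctr section_functor (serre_functor C T)) f \<bullet> Idt C (Fo W A)"
   using W_Hom[OF f] section_serre_Fa[OF f] by (simp add: comp_fnctr_def Cmp_Idt_left Cmp_Idt_right)
 qed
 moreover have "\<forall>A \<in> Ob C. Idt C (Fo W A) \<bullet> \<eta> A = \<eta> A" using Cmp_Idt_left[OF eta_Hom] by simp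
 ultimately show ?thesis
  unfolding gabriel_monad_def localizing_def using assms nat functor_W adjunction_Q by blast
qed

end

section \<open>Noetherian modules\<close>

text \<open>The operators are a mere set \<open>K\<close> without closure conditions, so that it can
  grow by one variable at a time in the basis theorem. Negatives are required separately because
  \<open>K\<close> may lack minus one.\<close>

definition opsub :: "'a set \<Rightarrow> ('a, 'b, 'm) module_scheme \<Rightarrow> 'b set \<Rightarrow> bool" where
 "opsub K M H \<longleftrightarrow> H \<subseteq> carrier M \<and> \<zero>\<^sub>M \<in> H \<and> (\<forall>x\<in>H. \<forall>y\<in>H. x \<oplus>\<^sub>M y \<in> H) \<and>
  (\<forall>x\<in>H. \<ominus>\<^sub>M x \<in> H) \<and> (\<forall>r\<in>K. \<forall>x\<in>H. r \<odot>\<^sub>M x \<in> H)"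

text \<open>Relative to a subset \<open>N\<close> of the module, so that the condition can be
  propagated while \<open>N\<close> is enlarged by a generator or a variable.\<close>

definition acc :: "'a set \<Rightarrow> ('a, 'b, 'm) module_scheme \<Rightarrow> 'b set \<Rightarrow> bool" where
 "acc K M N \<longleftrightarrow> (\<forall>U :: nat \<Rightarrow> 'b set. (\<forall>i. opsub K M (U i) \<and> U i \<subseteq> N \<and> U i \<subseteq> U (Suc i)) \<longrightarrow>
  (\<exists>k. \<forall>i\<ge>k. U i = U k))"

text \<open>Generation is phrased by minimality, which avoids linear combinations over a set of
  operators that is no ring.\<close>

definition fin_gen :: "'a set \<Rightarrow> ('a, 'b, 'm) module_scheme \<Rightarrow> 'b set \<Rightarrow> bool" where
 "fin_gen K M H \<longleftrightarrow> (\<exists>A. finite A \<and> A \<subseteq> H \<and> (\<forall>H'. opsub K M H' \<longrightarrow> A \<subseteq> H' \<longrightarrow> H \<subseteq> H'))"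

lemma opsubD:
 assumes "opsub K M H"
 shows "H \<subseteq> carrier M" "\<zero>\<^sub>M \<in> H" "x \<in> H \<Longrightarrow> y \<in> H \<Longrightarrow> x \<oplus>\<^sub>M y \<in> H" "x \<in> H \<Longrightarrow> \<ominus>\<^sub>M x \<in> H"
  "r \<in> K \<Longrightarrow> x \<in> H \<Longrightarrow> r \<odot>\<^sub>M x \<in> H" "x \<in> H \<Longrightarrow> y \<in> H \<Longrightarrow> x \<ominus>\<^sub>M y \<in> H" "x \<in> H \<Longrightarrow> x \<in> carrier M"
 using assms by (auto simp: opsub_def a_minus_def)

lemma opsub_mono: "opsub K M H \<Longrightarrow> K' \<subseteq> K \<Longrightarrow> opsub K' M H"
 unfolding opsub_def by blast

text \<open>More operators admit fewer submodules, hence fewer chains.\<close>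

lemma acc_mono_ops: "acc K' M N \<Longrightarrow> K' \<subseteq> K \<Longrightarrow> acc K M N"
 unfolding acc_def using opsub_mono by meson

lemma acc_subset: "acc K M N \<Longrightarrow> N' \<subseteq> N \<Longrightarrow> acc K M N'"
 unfolding acc_def by (meson order_trans)

lemma accD:
 assumes "acc K M N" "\<And>i. opsub K M (U i)" "\<And>i. U i \<subseteq> N" "\<And>i. U i \<subseteq> U (Suc i)"
 shows "\<exists>k. \<forall>i\<ge>k. U i = U k"
 using assms unfolding acc_def by blast

lemma (in abelian_group) add_minus_cancel:
 assumes "x \<in> carrier G" "w \<in> carrier G"
 shows "w \<oplus> (x \<ominus> w) = x"
 using assms by (simp add: a_minus_def a_comm[of x] r_neg2)

lemma (in abelian_group) add_diff_cancel:
 assumes "a \<in> carrier G" "u \<in> carrier G" "v \<in> carrier G"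
 shows "(a \<oplus> u) \<ominus> (a \<oplus> v) = u \<ominus> v"
proof -
 have "(a \<oplus> u) \<oplus> (\<ominus> a \<oplus> \<ominus> v) = (a \<oplus> \<ominus> a) \<oplus> (u \<oplus> \<ominus> v)" using assms by (simp add: a_ac)
 thus ?thesis using assms by (simp add: a_minus_def minus_add r_neg)
qed

lemma (in module) submodule_iff_opsub: "submodule H R M \<longleftrightarrow> opsub (carrier R) M H"
proof
 assume "submodule H R M"
 note s = submoduleE[OF this]
 obtain x where "x \<in> H" using s(2) by blast
 hence "x \<oplus>\<^sub>M (\<ominus>\<^sub>M x) \<in> H" "x \<in> carrier M" using s(1,3,5) by blast+
 hence z: "\<zero>\<^sub>M \<in> H" by (simp add: M.r_neg)
 show "opsub (carrier R) M H"
  unfolding opsub_def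
 proof (intro conjI ballI)
  show "H \<subseteq> carrier M" by (rule s(1))
  show "\<zero>\<^sub>M \<in> H" by (rule z)
  show "x \<oplus>\<^sub>M y \<in> H" if "x \<in> H" "y \<in> H" for x y using that by (rule s(5))
  show "\<ominus>\<^sub>M x \<in> H" if "x \<in> H" for x using that by (rule s(3))
  show "r \<odot>\<^sub>M x \<in> H" if "r \<in> carrier R" "x \<in> H" for r x using that by (rule s(4))
 qed
next
 assume "opsub (carrier R) M H"
 note o = opsubD[OF this]
 show "submodule H R M" by (rule submoduleI) (simp_all add: o)
qed

lemma (in module) opsub_submoduleI:
 assumes "H \<subseteq> carrier M" "\<zero>\<^sub>M \<in> H" "\<And>x y. x \<in> H \<Longrightarrow> y \<in> H \<Longrightarrow> x \<oplus>\<^sub>M y \<in> H"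
  "\<And>r x. r \<in> carrier R \<Longrightarrow> x \<in> H \<Longrightarrow> r \<odot>\<^sub>M x \<in> H"
 shows "opsub (carrier R) M H"
proof -
 have "\<ominus>\<^sub>M x \<in> H" if "x \<in> H" for x
  using assms(4)[of "\<ominus> \<one>" x] smult_l_minus[of \<one> x] assms(1) that by auto
 thus ?thesis using assms by (auto simp: opsub_def)
qed

lemma (in module) opsub_carrier: "K \<subseteq> carrier R \<Longrightarrow> opsub K M (carrier M)"
 by (auto simp: opsub_def)

lemma (in module) opsub_zero: "K \<subseteq> carrier R \<Longrightarrow> opsub K M {\<zero>\<^sub>M}"
 by (auto simp: opsub_def)

lemma (in module) acc_zero: "acc K M {\<zero>\<^sub>M}"
 unfolding acc_def
proof (intro allI impI)
 fix U :: "nat \<Rightarrow> _" assume U: "\<forall>i. opsub K M (U i) \<and> U i \<subseteq> {\<zero>\<^sub>M} \<and> U i \<subseteq> U (Suc i)"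
 have "U i = {\<zero>\<^sub>M}" for i using U opsubD(2)[of K M "U i"] by blast
 thus "\<exists>k. \<forall>i\<ge>k. U i = U k" by simp
qed

lemma opsub_Inter:
 assumes "\<And>H. H \<in> \<A> \<Longrightarrow> opsub K M H" "\<A> \<noteq> {}"
 shows "opsub K M (\<Inter>\<A>)"
 unfolding opsub_def
proof (intro conjI ballI InterI)
 show "\<Inter>\<A> \<subseteq> carrier M" using assms opsubD(1)[of K M] by blast
 fix H assume H: "H \<in> \<A>"
 note o = opsubD[OF assms(1)[OF H]]
 show "\<zero>\<^sub>M \<in> H" by (rule o(2))
 fix x assume x: "x \<in> \<Inter>\<A>"
 hence xH: "x \<in> H" using H by blast
 show "\<ominus>\<^sub>M x \<in> H" by (rule o(4)[OF xH])
 show "r \<odot>\<^sub>M x \<in> H" if "r \<in> K" for r by (rule o(5)[OF that xH])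
 show "x \<oplus>\<^sub>M y \<in> H" if "y \<in> \<Inter>\<A>" for y using that H by (intro o(3)[OF xH]) blast
qed

lemma opsub_Int: "opsub K M H \<Longrightarrow> opsub K M H' \<Longrightarrow> opsub K M (H \<inter> H')"
 unfolding opsub_def by auto

text \<open>If no finite subset generated \<open>H\<close>, repeatedly adjoining an element outside
  the span reached so far would give a chain that never becomes stationary.\<close>

lemma acc_fin_gen:
 assumes "acc K M N" "opsub K M H" "H \<subseteq> N"
 shows "fin_gen K M H"
proof (rule ccontr)
 assume no: "\<not> fin_gen K M H"
 define gen where "gen A = \<Inter>{H'. opsub K M H' \<and> A \<subseteq> H'}" for A
 have gen: "opsub K M (gen A)" "A \<subseteq> gen A" "gen A \<subseteq> H" if "A \<subseteq> H" for A
  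
 proof -
  show "opsub K M (gen A)" unfolding gen_def by (rule opsub_Inter) (use assms(2) that in blast)+
  show "A \<subseteq> gen A" "gen A \<subseteq> H" unfolding gen_def using assms(2) that by blast+
 qed
 have "\<exists>h. h \<in> H \<and> h \<notin> gen A" if "finite A" "A \<subseteq> H" for A
 proof (rule ccontr)
  assume "\<not> ?thesis"
  hence "H \<subseteq> gen A" by blast
  hence "fin_gen K M H" unfolding fin_gen_def gen_def
   using that by (intro exI[of _ A] conjI allI impI) (assumption, assumption, erule order_trans, rule Inter_lower, simp)
  thus False using no by blast
 qed
 then obtain pick where pick: "pick A \<in> H" "pick A \<notin> gen A" if "finite A" "A \<subseteq> H" for A by metis
 define A where "A = rec_nat {} (\<lambda>_ A. insert (pick A) A)"
 have A: "finite (A i) \<and> A i \<subseteq> H" for i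
  by (induction i) (auto simp: A_def pick)
 have step: "A (Suc i) = insert (pick (A i)) (A i)" for i by (simp add: A_def)
 have mono: "gen (A i) \<subseteq> gen (A (Suc i))" for i unfolding gen_def step by blast
 have gA: "opsub K M (gen (A i))" "gen (A i) \<subseteq> H" for i using gen(1,3) A by auto
 have "\<exists>k. \<forall>i\<ge>k. gen (A i) = gen (A k)"
 proof (rule accD[where U = "\<lambda>i. gen (A i)"])
  show "acc K M N" by (rule assms(1))
  show "opsub K M (gen (A i))" for i by (rule gA(1))
  show "gen (A i) \<subseteq> N" for i using gA(2) assms(3) by (rule order_trans)
  show "gen (A i) \<subseteq> gen (A (Suc i))" for i by (rule mono)
 qed
 then obtain k where "\<forall>i\<ge>k. gen (A i) = gen (A k)" ..
 hence "gen (A (Suc k)) = gen (A k)" by (rule allE[of _ "Suc k"]) (erule impE, rule le_SucI, rule order_refl)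
 moreover have "pick (A k) \<in> gen (A (Suc k))" using gen(2)[of "A (Suc k)"] A[of "Suc k"] step[of k] by auto
 ultimately show False using pick(2)[of "A k"] A[of k] by simp
qed

lemma chain_le: "(\<And>i. U i \<subseteq> U (Suc i)) \<Longrightarrow> i \<le> j \<Longrightarrow> U i \<subseteq> U (j :: nat)"
 by (rule lift_Suc_mono_le)

lemma (in noetherian_ring) ideal_seq_stable:
 fixes J :: "nat \<Rightarrow> 'a set"
 assumes "\<And>i. ideal (J i) R" "\<And>i. J i \<subseteq> J (Suc i)"
 shows "\<exists>k. \<forall>i\<ge>k. J i = J k"
proof -
 have "J i \<subseteq> J j \<or> J j \<subseteq> J i" for i j using chain_le[of J] assms(2) by (metis nat_le_linear)
 hence "subset.chain {I. ideal I R} (range J)" using assms(1) unfolding pred_on.chain_def by blast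
 then obtain k where "\<Union>(range J) = J k" using ideal_chain_is_trivial by blast
 hence "J i = J k" if "i \<ge> k" for i using chain_le[of J, OF assms(2) that] by blast
 thus ?thesis by blast
qed

text \<open>The usual extension argument: within a chain, a member is determined by its trace on
  \<open>N\<close> and by the ideal \<open>J i\<close> of coefficients at \<open>e\<close> that
  occur in it. The sum of \<open>R e\<close> and \<open>N\<close> need not be direct, so
  \<open>J i\<close> collects the coefficients of all expressions of all elements.\<close>

lemma (in module) acc_adjoin_generator:
 assumes "noetherian_ring R" "opsub (carrier R) M N" "acc (carrier R) M N" "e \<in> carrier M"
 defines "N' \<equiv> {r \<odot>\<^sub>M e \<oplus>\<^sub>M u | r u. r \<in> carrier R \<and> u \<in> N}"
 shows "opsub (carrier R) M N'" "acc (carrier R) M N'" "N \<subseteq> N'" "e \<in> N'"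
proof -
 note N = opsubD[OF assms(2)]
 have Nc: "u \<in> carrier M" if "u \<in> N" for u using N(1) that by blast
 show "opsub (carrier R) M N'"
 proof (rule opsub_submoduleI)
  show "N' \<subseteq> carrier M" using N assms(4) unfolding N'_def by auto
  show "\<zero>\<^sub>M \<in> N'" unfolding N'_def using N(2) assms(4) by (auto intro!: exI[of _ \<zero>] exI[of _ "\<zero>\<^sub>M"])
 next
  fix x y assume "x \<in> N'" "y \<in> N'"
  then obtain r u s v where *: "x = r \<odot>\<^sub>M e \<oplus>\<^sub>M u" "y = s \<odot>\<^sub>M e \<oplus>\<^sub>M v" "r \<in> carrier R" "s \<in> carrier R" "u \<in> N" "v \<in> N"
   unfolding N'_def by blast
  hence "x \<oplus>\<^sub>M y = (r \<oplus> s) \<odot>\<^sub>M e \<oplus>\<^sub>M (u \<oplus>\<^sub>M v)"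
   using assms(4) Nc by (simp add: smult_l_distr M.a_ac)
  thus "x \<oplus>\<^sub>M y \<in> N'" using * N(3) unfolding N'_def by blast
 next
  fix r x assume "r \<in> carrier R" "x \<in> N'"
  then obtain s u where *: "x = s \<odot>\<^sub>M e \<oplus>\<^sub>M u" "s \<in> carrier R" "u \<in> N" unfolding N'_def by blast
  hence "r \<odot>\<^sub>M x = (r \<otimes> s) \<odot>\<^sub>M e \<oplus>\<^sub>M r \<odot>\<^sub>M u"
   using assms(4) Nc \<open>r \<in> carrier R\<close> by (simp add: smult_r_distr smult_assoc1)
  thus "r \<odot>\<^sub>M x \<in> N'" using * N(5) \<open>r \<in> carrier R\<close> unfolding N'_def by blast
 qed
 show "N \<subseteq> N'"
 proof
  fix u assume "u \<in> N"
  thus "u \<in> N'" unfolding N'_def using Nc assms(4) by (auto intro!: exI[of _ \<zero>] exI[of _ u])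
 qed
 show "e \<in> N'" unfolding N'_def using N(2) assms(4) by (auto intro!: exI[of _ \<one>] exI[of _ "\<zero>\<^sub>M"])
 show "acc (carrier R) M N'"
  unfolding acc_def
 proof (intro allI impI)
  fix U :: "nat \<Rightarrow> _" assume U: "\<forall>i. opsub (carrier R) M (U i) \<and> U i \<subseteq> N' \<and> U i \<subseteq> U (Suc i)"
  define J where "J i = {r \<in> carrier R. \<exists>u\<in>N. r \<odot>\<^sub>M e \<oplus>\<^sub>M u \<in> U i}" for i
  have "ideal (J i) R" for i
  proof -
   note Ui = opsubD[OF U[rule_format, THEN conjunct1, of i]]
   have mul: "s \<otimes> r \<in> J i" if rs: "r \<in> J i" "s \<in> carrier R" for r s
   proof -
    obtain u where u: "r \<in> carrier R" "u \<in> N" "r \<odot>\<^sub>M e \<oplus>\<^sub>M u \<in> U i" using rs unfolding J_def by blast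
    have "s \<odot>\<^sub>M (r \<odot>\<^sub>M e \<oplus>\<^sub>M u) = (s \<otimes> r) \<odot>\<^sub>M e \<oplus>\<^sub>M s \<odot>\<^sub>M u"
     using u rs(2) assms(4) Nc by (simp add: smult_r_distr smult_assoc1)
    thus ?thesis unfolding J_def using Ui(5)[OF rs(2) u(3)] u rs N(5) by auto
   qed
   have "r \<oplus> s \<in> J i" if "r \<in> J i" "s \<in> J i" for r s
   proof -
    obtain u v where *: "r \<in> carrier R" "u \<in> N" "r \<odot>\<^sub>M e \<oplus>\<^sub>M u \<in> U i"
     "s \<in> carrier R" "v \<in> N" "s \<odot>\<^sub>M e \<oplus>\<^sub>M v \<in> U i" using \<open>r \<in> J i\<close> \<open>s \<in> J i\<close> unfolding J_def by blast
    hence "(r \<odot>\<^sub>M e \<oplus>\<^sub>M u) \<oplus>\<^sub>M (s \<odot>\<^sub>M e \<oplus>\<^sub>M v) = (r \<oplus> s) \<odot>\<^sub>M e \<oplus>\<^sub>M (u \<oplus>\<^sub>M v)"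
     using assms(4) Nc by (simp add: smult_l_distr M.a_ac)
    thus ?thesis unfolding J_def using Ui(3)[OF *(3,6)] * N(3) by auto
   qed
   moreover have "\<ominus> r \<in> J i" if "r \<in> J i" for r
   proof -
    have "r \<in> carrier R" using that unfolding J_def by blast
    thus ?thesis using mul[OF that, of "\<ominus> \<one>"] by (simp add: R.l_minus)
   qed
   moreover have "\<zero> \<in> J i" unfolding J_def using N(2) Ui(2) assms(4)
    by (auto intro!: bexI[of _ "\<zero>\<^sub>M"])
   moreover have "J i \<subseteq> carrier R" unfolding J_def by blast
   ultimately have "subgroup (J i) (add_monoid R)"
    by (intro R.add.subgroupI) (auto simp: a_inv_def[symmetric])
   thus ?thesis using mul by (intro idealI R.ring_axioms) (auto simp: R.m_comm J_def)
  qed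
  moreover have "J i \<subseteq> J (Suc i)" for i using U unfolding J_def by blast
  ultimately obtain k1 where k1: "\<forall>i\<ge>k1. J i = J k1"
   using noetherian_ring.ideal_seq_stable[OF assms(1), of J] by blast
  obtain k2 where k2: "\<forall>i\<ge>k2. U i \<inter> N = U k2 \<inter> N"
   using accD[OF assms(3), of "\<lambda>i. U i \<inter> N"] U opsub_Int[OF _ assms(2)] by blast
  define k where "k = max k1 k2"
  \<comment> \<open>An element \<open>x\<close> of the later member shares a coefficient at
    \<open>e\<close> with some \<open>?w\<close> of \<open>U k\<close>; the difference lies in
    \<open>N\<close>, where the chain has stabilized.\<close>
  have "U i \<subseteq> U k" if "i \<ge> k" for i
  proof
   fix x assume x: "x \<in> U i"
   note Ui = opsubD[OF U[rule_format, THEN conjunct1, of i]]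
   note Uk = opsubD[OF U[rule_format, THEN conjunct1, of k]]
   have sub: "U k \<subseteq> U i" using chain_le[of U] U that by blast
   obtain r u where ru: "x = r \<odot>\<^sub>M e \<oplus>\<^sub>M u" "r \<in> carrier R" "u \<in> N" using x U unfolding N'_def by blast
   hence "r \<in> J i" unfolding J_def using x by blast
   moreover have "J i = J k" using k1 that unfolding k_def by (metis max.bounded_iff order_trans max.cobounded1)
   ultimately obtain v where v: "v \<in> N" "r \<odot>\<^sub>M e \<oplus>\<^sub>M v \<in> U k" unfolding J_def by blast
   let ?w = "r \<odot>\<^sub>M e \<oplus>\<^sub>M v"
   have "x \<ominus>\<^sub>M ?w = u \<ominus>\<^sub>M v"
    using ru v assms(4) Nc by (simp add: M.add_diff_cancel)
   hence "x \<ominus>\<^sub>M ?w \<in> U i \<inter> N" using Ui(6)[OF x subsetD[OF sub v(2)]] N(6)[OF ru(3) v(1)] by simp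
   moreover have "U i \<inter> N = U k \<inter> N" using k2 that unfolding k_def by (metis max.bounded_iff order_trans max.cobounded2)
   ultimately have "?w \<oplus>\<^sub>M (x \<ominus>\<^sub>M ?w) \<in> U k" using Uk(3) v by blast
   moreover have "?w \<oplus>\<^sub>M (x \<ominus>\<^sub>M ?w) = x"
    using ru v assms(4) Nc by (simp add: M.add_minus_cancel)
   ultimately show "x \<in> U k" by simp
  qed
  moreover have "U k \<subseteq> U i" if "i \<ge> k" for i using chain_le[of U] U that by blast
  ultimately show "\<exists>k. \<forall>i\<ge>k. U i = U k" by blast
 qed
qed

lemma (in module) fin_gen_imp_acc:
 assumes "noetherian_ring R" "fin_gen (carrier R) M (carrier M)"
 shows "acc (carrier R) M (carrier M)"
proof -
 obtain A where A: "finite A" "A \<subseteq> carrier M" "\<forall>H'. opsub (carrier R) M H' \<longrightarrow> A \<subseteq> H' \<longrightarrow> carrier M \<subseteq> H'"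
  using assms(2) unfolding fin_gen_def by blast
 have "\<exists>N. opsub (carrier R) M N \<and> acc (carrier R) M N \<and> A' \<subseteq> N" if "finite A'" "A' \<subseteq> carrier M" for A'
  using that
 proof (induction A')
  case empty
  thus ?case using opsub_zero acc_zero by blast
 next
  case (insert e A')
  then obtain N where N: "opsub (carrier R) M N" "acc (carrier R) M N" "A' \<subseteq> N" by blast
  have e: "e \<in> carrier M" using insert by blast
  note G = acc_adjoin_generator[OF assms(1) N(1,2) e]
  have "insert e A' \<subseteq> {r \<odot>\<^sub>M e \<oplus>\<^sub>M u | r u. r \<in> carrier R \<and> u \<in> N}"
   using G(4) order_trans[OF N(3) G(3)] by (rule insert_subset[THEN iffD2, OF conjI])
  with G(1,2) show ?case by (intro exI conjI)
 qed
 then obtain N where "opsub (carrier R) M N" "acc (carrier R) M N" "A \<subseteq> N" using A(1,2) by blast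
 moreover have "carrier M \<subseteq> N" using A(3) calculation by blast
 ultimately show ?thesis by (rule_tac acc_subset)
qed

lemma (in module) fin_gen_submodule:
 assumes "noetherian_ring R" "fin_gen (carrier R) M (carrier M)" "opsub (carrier R) M H"
 shows "fin_gen (carrier R) M H"
 using acc_fin_gen[OF fin_gen_imp_acc[OF assms(1,2)] assms(3)] opsubD[OF assms(3)] by blast

text \<open>The leading coefficient argument of Hilbert's basis theorem: \<open>L i j\<close> collects the leading
 coefficients of the elements of \<open>U i\<close> of degree at most \<open>j\<close> in \<open>x\<close>. It does not matter that
 expressions in powers of \<open>x\<close> need not be unique.\<close>

lemma (in module) acc_adjoin_variable:
 assumes "K \<subseteq> carrier R" "opsub K M N" "acc K M N" "x \<in> carrier R"
 shows "\<exists>N'. N \<subseteq> N' \<and> opsub (insert x K) M N' \<and> acc (insert x K) M N'"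
proof -
 note N = opsubD[OF assms(2)]
 have Nc: "u \<in> carrier M" if "u \<in> N" for u using N(1) that by blast
 \<comment> \<open>\<open>F j\<close> consists of the expressions in \<open>x\<close> of degree less
   than \<open>j\<close> with coefficients in \<open>N\<close>. With this offset \<open>F 0\<close>
   is zero and \<open>x [^] j\<close> carries the leading coefficient of an element of
   \<open>F (Suc j)\<close>.\<close>
 define F where "F = rec_nat {\<zero>\<^sub>M} (\<lambda>j G. {(x [^] j) \<odot>\<^sub>M a \<oplus>\<^sub>M u | a u. a \<in> N \<and> u \<in> G})"
 have F0: "F 0 = {\<zero>\<^sub>M}" by (simp add: F_def)
 have FS: "F (Suc j) = {(x [^] j) \<odot>\<^sub>M a \<oplus>\<^sub>M u | a u. a \<in> N \<and> u \<in> F j}" for j by (simp add: F_def)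
 have Kc: "r \<in> carrier R" if "r \<in> K" for r using assms(1) that by blast
 have add: "((x [^] j) \<odot>\<^sub>M a \<oplus>\<^sub>M u) \<oplus>\<^sub>M ((x [^] j) \<odot>\<^sub>M b \<oplus>\<^sub>M v) = (x [^] j) \<odot>\<^sub>M (a \<oplus>\<^sub>M b) \<oplus>\<^sub>M (u \<oplus>\<^sub>M v)"
  if "a \<in> N" "b \<in> N" "u \<in> carrier M" "v \<in> carrier M" for j :: nat and a b u v
  using that assms(4) Nc by (simp add: smult_r_distr M.a_ac)
 have neg: "\<ominus>\<^sub>M ((x [^] j) \<odot>\<^sub>M a \<oplus>\<^sub>M u) = (x [^] j) \<odot>\<^sub>M (\<ominus>\<^sub>M a) \<oplus>\<^sub>M (\<ominus>\<^sub>M u)"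
  if "a \<in> N" "u \<in> carrier M" for j :: nat and a u
  using that assms(4) Nc by (simp add: smult_r_minus M.minus_add)
 have mul: "r \<odot>\<^sub>M ((x [^] j) \<odot>\<^sub>M a \<oplus>\<^sub>M u) = (x [^] j) \<odot>\<^sub>M (r \<odot>\<^sub>M a) \<oplus>\<^sub>M (r \<odot>\<^sub>M u)"
  if "r \<in> carrier R" "a \<in> N" "u \<in> carrier M" for r a u and j :: nat
  using that assms(4) Nc by (simp add: smult_r_distr smult_assoc1[symmetric] R.m_comm)
 have mulx: "x \<odot>\<^sub>M ((x [^] j) \<odot>\<^sub>M a \<oplus>\<^sub>M u) = (x [^] Suc j) \<odot>\<^sub>M a \<oplus>\<^sub>M (x \<odot>\<^sub>M u)"
  if "a \<in> N" "u \<in> carrier M" for a u and j :: nat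
  using that assms(4) Nc by (simp add: smult_r_distr smult_assoc1[symmetric] R.m_comm)
 have F: "opsub K M (F j)" for j
 proof (induction j)
  case 0
  show ?case unfolding F0 using opsub_zero assms(1) by blast
 next
  case (Suc j)
  note Fj = opsubD[OF Suc]
  have Fc: "u \<in> carrier M" if "u \<in> F j" for u using Fj(1) that by blast
  show ?case unfolding opsub_def
  proof (intro conjI ballI)
   show "F (Suc j) \<subseteq> carrier M" unfolding FS using Nc Fc assms(4) by auto
   show "\<zero>\<^sub>M \<in> F (Suc j)" unfolding FS using N(2) Fj(2) assms(4)
    by (auto intro!: exI[of _ "\<zero>\<^sub>M"])
  next
   fix y z assume "y \<in> F (Suc j)" "z \<in> F (Suc j)"
   then obtain a u b v where "y = (x [^] j) \<odot>\<^sub>M a \<oplus>\<^sub>M u" "z = (x [^] j) \<odot>\<^sub>M b \<oplus>\<^sub>M v"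
    "a \<in> N" "b \<in> N" "u \<in> F j" "v \<in> F j" unfolding FS by blast
   with add[of a b u v j] N(3)[of a b] Fj(3)[of u v] Fc show "y \<oplus>\<^sub>M z \<in> F (Suc j)"
    unfolding FS by blast
  next
   fix y assume "y \<in> F (Suc j)"
   then obtain a u where *: "y = (x [^] j) \<odot>\<^sub>M a \<oplus>\<^sub>M u" "a \<in> N" "u \<in> F j" unfolding FS by blast
   with neg[of a u j] N(4)[of a] Fj(4)[of u] Fc show "\<ominus>\<^sub>M y \<in> F (Suc j)"
    unfolding FS by blast
   fix r assume "r \<in> K"
   with mul[of r a u j] * N(5)[of r a] Fj(5)[of r u] Fc Kc show "r \<odot>\<^sub>M y \<in> F (Suc j)"
    unfolding FS by blast
  qed
 qed
 have Fc: "u \<in> carrier M" if "u \<in> F j" for u j using opsubD(1)[OF F] that by blast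
 have Fmono: "F j \<subseteq> F (Suc j)" for j
 proof
  fix u assume "u \<in> F j"
  moreover have "u = (x [^] j) \<odot>\<^sub>M \<zero>\<^sub>M \<oplus>\<^sub>M u" using calculation Fc assms(4) by simp
  ultimately show "u \<in> F (Suc j)" unfolding FS using N(2) by blast
 qed
 have Fx: "x \<odot>\<^sub>M u \<in> F (Suc j)" if "u \<in> F j" for u j
  using that
 proof (induction j arbitrary: u)
  case 0
  thus ?case using opsubD(2)[OF F] assms(4) unfolding F0 by simp
 next
  case (Suc j)
  obtain a v where *: "u = (x [^] j) \<odot>\<^sub>M a \<oplus>\<^sub>M v" "a \<in> N" "v \<in> F j" using Suc(2) unfolding FS by blast
  thus ?case using mulx[of a v j] Suc(1)[OF *(3)] Fc unfolding FS[of "Suc j"] by blast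
 qed
 define N' where "N' = (\<Union>j. F j)"
 have common: "\<exists>j. u \<in> F j \<and> v \<in> F j" if "u \<in> N'" "v \<in> N'" for u v
 proof -
  obtain i j where "u \<in> F i" "v \<in> F j"
   using \<open>u \<in> N'\<close> \<open>v \<in> N'\<close> unfolding N'_def by blast
  thus ?thesis using chain_le[of F, OF Fmono, of i "max i j"] chain_le[of F, OF Fmono, of j "max i j"] by auto
 qed
 have "opsub (insert x K) M N'" unfolding opsub_def
 proof (intro conjI ballI)
  show "N' \<subseteq> carrier M" unfolding N'_def using Fc by blast
  show "\<zero>\<^sub>M \<in> N'" unfolding N'_def using F0 by blast
  show "u \<oplus>\<^sub>M v \<in> N'" if "u \<in> N'" "v \<in> N'" for u v
   using common[OF that] opsubD(3)[OF F] unfolding N'_def by blast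
  show "\<ominus>\<^sub>M u \<in> N'" if "u \<in> N'" for u
   using that opsubD(4)[OF F] unfolding N'_def by blast
  show "r \<odot>\<^sub>M u \<in> N'" if "r \<in> insert x K" "u \<in> N'" for r u
   using that opsubD(5)[OF F] Fx unfolding N'_def by blast
 qed
 moreover have "N \<subseteq> N'"
 proof
  fix a assume "a \<in> N"
  hence "a \<in> F (Suc 0)" unfolding FS F0 using Nc by (auto intro!: exI[of _ a])
  thus "a \<in> N'" unfolding N'_def by blast
 qed
 moreover have "acc (insert x K) M N'"
  unfolding acc_def
 proof (intro allI impI)
  fix U :: "nat \<Rightarrow> _" assume U: "\<forall>i. opsub (insert x K) M (U i) \<and> U i \<subseteq> N' \<and> U i \<subseteq> U (Suc i)"
  have Ui: "opsub (insert x K) M (U i)" for i using U by blast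
  have Umono: "U i \<subseteq> U j" if "i \<le> j" for i j using chain_le[of U] U that by blast
  define L where "L i j = {a \<in> N. \<exists>u\<in>F j. (x [^] j) \<odot>\<^sub>M a \<oplus>\<^sub>M u \<in> U i}" for i j
  have L: "opsub K M (L i j)" for i j unfolding opsub_def
  proof (intro conjI ballI)
   show "L i j \<subseteq> carrier M" unfolding L_def using Nc by blast
   show "\<zero>\<^sub>M \<in> L i j" unfolding L_def using N(2) opsubD(2)[OF F] opsubD(2)[OF Ui] assms(4)
    by (auto intro!: bexI[of _ "\<zero>\<^sub>M"])
  next
   fix a b assume "a \<in> L i j" "b \<in> L i j"
   then obtain u v where *: "a \<in> N" "b \<in> N" "u \<in> F j" "v \<in> F j" "(x [^] j) \<odot>\<^sub>M a \<oplus>\<^sub>M u \<in> U i"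
    "(x [^] j) \<odot>\<^sub>M b \<oplus>\<^sub>M v \<in> U i" unfolding L_def by blast
   thus "a \<oplus>\<^sub>M b \<in> L i j" unfolding L_def
    using add[of a b u v j] opsubD(3)[OF Ui *(5,6)] N(3) opsubD(3)[OF F *(3,4)] Fc by auto
  next
   fix a assume "a \<in> L i j"
   then obtain u where *: "a \<in> N" "u \<in> F j" "(x [^] j) \<odot>\<^sub>M a \<oplus>\<^sub>M u \<in> U i" unfolding L_def by blast
   thus "\<ominus>\<^sub>M a \<in> L i j" unfolding L_def
    using neg[of a u j] opsubD(4)[OF Ui *(3)] N(4) opsubD(4)[OF F *(2)] Fc by auto
   fix r assume r: "r \<in> K"
   have "r \<odot>\<^sub>M ((x [^] j) \<odot>\<^sub>M a \<oplus>\<^sub>M u) \<in> U i" using opsubD(5)[OF Ui _ *(3)] r by blast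
   thus "r \<odot>\<^sub>M a \<in> L i j" unfolding L_def
    using mul[of r a u j] N(5)[OF r] opsubD(5)[OF F r *(2)] Fc * Kc[OF r] by auto
  qed
  have LN: "L i j \<subseteq> N" for i j unfolding L_def by blast
  have Lj: "L i j \<subseteq> L i (Suc j)" for i j
  proof
   fix a assume "a \<in> L i j"
   then obtain u where *: "a \<in> N" "u \<in> F j" "(x [^] j) \<odot>\<^sub>M a \<oplus>\<^sub>M u \<in> U i" unfolding L_def by blast
   have "x \<odot>\<^sub>M ((x [^] j) \<odot>\<^sub>M a \<oplus>\<^sub>M u) \<in> U i" using opsubD(5)[OF Ui _ *(3)] by blast
   thus "a \<in> L i (Suc j)" unfolding L_def using mulx[of a u j] Fx * Fc by auto
  qed
  have Li: "L i j \<subseteq> L (Suc i) j" for i j unfolding L_def using U by blast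
  have Lmono: "L i j \<subseteq> L i' j'" if "i \<le> i'" "j \<le> j'" for i j i' j'
   using chain_le[of "\<lambda>i. L i j", OF Li that(1)] chain_le[of "L i'", OF Lj that(2)] by blast
  \<comment> \<open>The diagonal takes care of all degrees from \<open>k\<close> on; the finitely
    many smaller degrees are made stationary one by one through \<open>k'\<close>.\<close>
  obtain k where k: "\<forall>i\<ge>k. L i i = L k k"
   using accD[OF assms(3), of "\<lambda>i. L i i"] L LN Lmono[of i "Suc i" i "Suc i" for i] by auto
  have "\<forall>j. \<exists>k'. \<forall>i\<ge>k'. L i j = L k' j" using accD[OF assms(3), of "\<lambda>i. L i j" for j] L LN Li by simp
  then obtain k' where k': "\<And>j i. i \<ge> k' j \<Longrightarrow> L i j = L (k' j) j" by metis
  define m where "m = Max (insert k (k' ` {..<k}))"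
  have mk: "k \<le> m" "\<And>j. j < k \<Longrightarrow> k' j \<le> m" unfolding m_def by auto
  have stable: "L i j = L m j" if "i \<ge> m" for i j
  proof (cases "j < k")
   case True
   have le: "k' j \<le> m" "k' j \<le> i" using mk(2)[OF True] that by auto
   show ?thesis using k'[OF le(1)] k'[OF le(2)] by metis
  next
   case False
   \<comment> \<open>Monotonicity in both indices puts \<open>L i j\<close> below a diagonal term
     beyond \<open>k\<close>, and that term is already \<open>L k k\<close>.\<close>
   have "L i j \<subseteq> L (max i j) (max i j)" by (rule Lmono) auto
   also have "\<dots> = L k k" using that mk(1) by (intro k[rule_format]) auto
   also have "\<dots> \<subseteq> L m j" using mk(1) False by (intro Lmono) auto
   finally show ?thesis using Lmono[of m i j j] that by blast
  qed
  \<comment> \<open>Induction on the degree bound: subtracting an element of \<open>U m\<close> with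
    the same leading coefficient lowers the degree.\<close>
  have "U i \<inter> F j \<subseteq> U m" if i: "i \<ge> m" for i j
  proof (induction j)
   case 0
   show ?case unfolding F0 using opsubD(2)[OF Ui] by blast
  next
   case (Suc j)
   show ?case
   proof
    fix y assume y: "y \<in> U i \<inter> F (Suc j)"
    then obtain a u where au: "y = (x [^] j) \<odot>\<^sub>M a \<oplus>\<^sub>M u" "a \<in> N" "u \<in> F j" unfolding FS by blast
    hence "a \<in> L i j" unfolding L_def using y by blast
    then obtain v where v: "v \<in> F j" "(x [^] j) \<odot>\<^sub>M a \<oplus>\<^sub>M v \<in> U m" using stable[OF i] unfolding L_def by blast
    let ?w = "(x [^] j) \<odot>\<^sub>M a \<oplus>\<^sub>M v"
    have c: "a \<in> carrier M" "u \<in> carrier M" "v \<in> carrier M" using au v Nc Fc by auto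
    have "y \<ominus>\<^sub>M ?w = u \<ominus>\<^sub>M v"
     using au(1) c assms(4) by (simp add: M.add_diff_cancel)
    moreover have "y \<ominus>\<^sub>M ?w \<in> U i" using opsubD(6)[OF Ui] y v(2) Umono[OF i] by blast
    moreover have "u \<ominus>\<^sub>M v \<in> F j" using opsubD(6)[OF F] au v by blast
    ultimately have "y \<ominus>\<^sub>M ?w \<in> U m" using Suc by auto
    hence "?w \<oplus>\<^sub>M (y \<ominus>\<^sub>M ?w) \<in> U m" using opsubD(3)[OF Ui v(2)] by blast
    moreover have "?w \<oplus>\<^sub>M (y \<ominus>\<^sub>M ?w) = y"
     using au(1) c assms(4) by (simp add: M.add_minus_cancel)
    ultimately show "y \<in> U m" by simp
   qed
  qed
  hence "U i \<subseteq> U m" if "i \<ge> m" for i using U that unfolding N'_def by blast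
  thus "\<exists>k. \<forall>i\<ge>k. U i = U k" using Umono by blast
 qed
 ultimately show ?thesis by blast
qed

section \<open>Graded modules\<close>

text \<open>Formulated for maps that are additive on carriers, because it is applied to evaluations,
  projections and inclusions as well as to homomorphisms.\<close>

lemma hom_finsum:
 assumes "abelian_group M" "abelian_group N" "\<And>x. x \<in> carrier M \<Longrightarrow> \<phi> x \<in> carrier N"
  "\<And>x y. x \<in> carrier M \<Longrightarrow> y \<in> carrier M \<Longrightarrow> \<phi> (x \<oplus>\<^sub>M y) = \<phi> x \<oplus>\<^sub>N \<phi> y"
  "\<And>i. i \<in> A \<Longrightarrow> f i \<in> carrier M"
 shows "\<phi> (\<Oplus>\<^sub>M i\<in>A. f i) = (\<Oplus>\<^sub>N i\<in>A. \<phi> (f i))"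
proof -
 interpret M: abelian_group M by fact
 interpret N: abelian_group N by fact
 have "\<phi> \<zero>\<^sub>M \<oplus>\<^sub>N \<phi> \<zero>\<^sub>M = \<phi> \<zero>\<^sub>M" using assms(4)[of "\<zero>\<^sub>M" "\<zero>\<^sub>M"] by simp
 hence zero: "\<phi> \<zero>\<^sub>M = \<zero>\<^sub>N" using assms(3)[of "\<zero>\<^sub>M"] N.add.r_cancel_one' by force
 show ?thesis using assms(5)
 proof (induction A rule: infinite_finite_induct)
  case (insert a A)
  have "\<phi> (\<Oplus>\<^sub>M i\<in>insert a A. f i) = \<phi> (f a) \<oplus>\<^sub>N \<phi> (\<Oplus>\<^sub>M i\<in>A. f i)"
   using insert assms(4) by (simp add: M.finsum_insert Pi_def)
  also have "\<dots> = (\<Oplus>\<^sub>N i\<in>insert a A. \<phi> (f i))"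
   using insert assms(3) by (simp add: N.finsum_insert Pi_def)
  finally show ?case .
 qed (simp_all add: zero)
qed

lemma hom_zero:
 assumes "abelian_group M" "abelian_group N" "\<And>x. x \<in> carrier M \<Longrightarrow> \<phi> x \<in> carrier N"
  "\<And>x y. x \<in> carrier M \<Longrightarrow> y \<in> carrier M \<Longrightarrow> \<phi> (x \<oplus>\<^sub>M y) = \<phi> x \<oplus>\<^sub>N \<phi> y"
 shows "\<phi> \<zero>\<^sub>M = \<zero>\<^sub>N"
proof -
 interpret M: abelian_group M by fact
 interpret N: abelian_group N by fact
 show ?thesis using hom_finsum[OF assms, of "{}" "\<lambda>_. \<zero>\<^sub>M"] by simp
qed

section \<open>Sums of homogeneous elements\<close>

definition hspan :: "('a, 'b) graded_module \<Rightarrow> int set \<Rightarrow> 'b set" where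
 "hspan M D = {\<Oplus>\<^sub>M i\<in>F. f i | F f. finite F \<and> F \<subseteq> D \<and> (\<forall>i\<in>F. f i \<in> hcomp M i)}"

lemma carrier_trunc: "carrier (trunc d M) = hspan M {d..}"
 by (simp add: trunc_def hspan_def)

text \<open>No decomposition is assumed: these facts serve to establish gradedness of newly
  constructed modules.\<close>

locale pregraded = abelian_group M for M :: "('a, 'b) graded_module" (structure) +
 assumes hcomp_sub: "subgroup (hcomp M i) (add_monoid M)"
begin

lemma hcompD:
 shows "x \<in> hcomp M i \<Longrightarrow> x \<in> carrier M" "\<zero> \<in> hcomp M i"
  "x \<in> hcomp M i \<Longrightarrow> y \<in> hcomp M i \<Longrightarrow> x \<oplus> y \<in> hcomp M i" "x \<in> hcomp M i \<Longrightarrow> \<ominus> x \<in> hcomp M i"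
  "x \<in> hcomp M i \<Longrightarrow> y \<in> hcomp M i \<Longrightarrow> x \<ominus> y \<in> hcomp M i"
 using subgroup.mem_carrier[OF hcomp_sub] subgroup.one_closed[OF hcomp_sub] subgroup.m_closed[OF hcomp_sub]
  subgroup.m_inv_closed[OF hcomp_sub] by (auto simp: a_inv_def a_minus_def)

lemma hspan_carrier: "hspan M D \<subseteq> carrier M"
 unfolding hspan_def using hcompD(1) by (auto intro!: finsum_closed)

lemma hcomp_hspan: "i \<in> D \<Longrightarrow> x \<in> hcomp M i \<Longrightarrow> x \<in> hspan M D"
 unfolding hspan_def using hcompD(1)
 by (auto intro!: exI[of _ "{i}"] exI[of _ "\<lambda>_. x"] simp: finsum_insert)

lemma zero_hspan: "\<zero> \<in> hspan M D"
 unfolding hspan_def by (auto intro!: exI[of _ "{}"])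

lemma finsum_extend:
 assumes "finite G" "F \<subseteq> G" "\<And>i. i \<in> F \<Longrightarrow> f i \<in> carrier M"
 shows "(\<Oplus>i\<in>G. if i \<in> F then f i else \<zero>) = (\<Oplus>i\<in>F. f i)"
 using assms by (intro add.finprod_mono_neutral_cong_right) auto

lemma hspan_add:
 assumes "x \<in> hspan M D" "y \<in> hspan M D"
 shows "x \<oplus> y \<in> hspan M D"
proof -
 obtain F f where F: "x = (\<Oplus>i\<in>F. f i)" "finite F" "F \<subseteq> D" "\<And>i. i \<in> F \<Longrightarrow> f i \<in> hcomp M i"
  using assms(1) unfolding hspan_def by blast
 obtain G g where G: "y = (\<Oplus>i\<in>G. g i)" "finite G" "G \<subseteq> D" "\<And>i. i \<in> G \<Longrightarrow> g i \<in> hcomp M i"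
  using assms(2) unfolding hspan_def by blast
 define h where "h i = (if i \<in> F then f i else \<zero>) \<oplus> (if i \<in> G then g i else \<zero>)" for i
 have "x = (\<Oplus>i\<in>F \<union> G. if i \<in> F then f i else \<zero>)" "y = (\<Oplus>i\<in>F \<union> G. if i \<in> G then g i else \<zero>)"
  unfolding F(1) G(1) using F G hcompD(1) by (intro finsum_extend[symmetric]; blast)+
 hence "x \<oplus> y = (\<Oplus>i\<in>F \<union> G. h i)"
  unfolding h_def using F(4) G(4) hcompD(1) by (subst finsum_addf) (auto simp: Pi_def)
 moreover have "h i \<in> hcomp M i" for i unfolding h_def using F(4) G(4) hcompD by auto
 ultimately show ?thesis unfolding hspan_def using F G by blast
qed

lemma hspan_induct [consumes 1, case_names zero comp add]:
 assumes "x \<in> hspan M D" "P \<zero>" "\<And>i y. i \<in> D \<Longrightarrow> y \<in> hcomp M i \<Longrightarrow> P y"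
  "\<And>y z. y \<in> hspan M D \<Longrightarrow> z \<in> hspan M D \<Longrightarrow> P y \<Longrightarrow> P z \<Longrightarrow> P (y \<oplus> z)"
 shows "P x"
proof -
 obtain F f where F: "x = (\<Oplus>i\<in>F. f i)" "finite F" "F \<subseteq> D" "\<And>i. i \<in> F \<Longrightarrow> f i \<in> hcomp M i"
  using assms(1) unfolding hspan_def by blast
 from F(2-4) have "P (\<Oplus>i\<in>F. f i)"
 proof (induction F)
  case empty
  thus ?case using assms(2) by simp
 next
  case (insert a F)
  have "(\<Oplus>i\<in>insert a F. f i) = f a \<oplus> (\<Oplus>i\<in>F. f i)"
   using insert hcompD(1) by (intro finsum_insert) auto
  moreover have "(\<Oplus>i\<in>F. f i) \<in> hspan M D" unfolding hspan_def using insert by blast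
  ultimately show ?case using assms(3)[of a "f a"] assms(4)[of "f a"] insert hcomp_hspan[of a D "f a"] by auto
 qed
 thus ?thesis using F by simp
qed

lemma hspan_neg: "x \<in> hspan M D \<Longrightarrow> \<ominus> x \<in> hspan M D"
proof (induction rule: hspan_induct)
 case (add y z)
 thus ?case using hspan_add hspan_carrier[of D] by (simp add: minus_add subset_iff)
next
 case zero
 have "\<ominus> \<zero> = \<zero>" by (rule minus_equality) simp_all
 show ?case unfolding \<open>\<ominus> \<zero> = \<zero>\<close> by (rule zero_hspan)
next
 case (comp i y)
 thus ?case using hcomp_hspan hcompD(4) by blast
qed

end

text \<open>Unique existence of finitely supported families is split into spanning and the
  triviality of vanishing sums; the difference of two decompositions is a vanishing sum over the
  union of their supports.\<close>

lemma graded_moduleI: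
 assumes "module R M" "\<And>i. subgroup (hcomp M i) (add_monoid M)"
  and gen: "carrier M \<subseteq> hspan M UNIV"
  and uniq: "\<And>F f. finite F \<Longrightarrow> (\<And>i. i \<in> F \<Longrightarrow> f i \<in> hcomp M i) \<Longrightarrow> (\<Oplus>\<^sub>M i\<in>F. f i) = \<zero>\<^sub>M \<Longrightarrow>
     (\<forall>i\<in>F. f i = \<zero>\<^sub>M)"
  and "\<And>i j r x. r \<in> hcomp R i \<Longrightarrow> x \<in> hcomp M j \<Longrightarrow> r \<odot>\<^sub>M x \<in> hcomp M (i + j)"
 shows "graded_module R M"
proof -
 interpret M: module R M by fact
 interpret pregraded M
  using M.abelian_group_axioms assms(2) by (intro pregraded.intro pregraded_axioms.intro)
 have "\<exists>!f. (\<forall>i. f i \<in> hcomp M i) \<and> finite {i. f i \<noteq> \<zero>\<^sub>M} \<and> x = (\<Oplus>\<^sub>M i\<in>{i. f i \<noteq> \<zero>\<^sub>M}. f i)"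
  if x: "x \<in> carrier M" for x
 proof -
  have "x \<in> hspan M UNIV" using gen x by (rule subsetD)
  then obtain F f where F: "x = (\<Oplus>\<^sub>M i\<in>F. f i)" "finite F" "\<And>i. i \<in> F \<Longrightarrow> f i \<in> hcomp M i"
   unfolding hspan_def by blast
  define f' where "f' i = (if i \<in> F then f i else \<zero>\<^sub>M)" for i
  have f': "f' i \<in> hcomp M i" for i unfolding f'_def using F hcompD(2) by simp
  have sup: "{i. f' i \<noteq> \<zero>\<^sub>M} \<subseteq> F" unfolding f'_def by auto
  have "x = (\<Oplus>\<^sub>M i\<in>F. f' i)" unfolding f'_def F(1)
   using F hcompD(1) by (intro finsum_extend[symmetric]) auto
  also have "\<dots> = (\<Oplus>\<^sub>M i\<in>{i. f' i \<noteq> \<zero>\<^sub>M}. f' i)"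
   using F(2) sup f' hcompD(1) by (intro M.add.finprod_mono_neutral_cong_right) auto
  finally have ex: "(\<forall>i. f' i \<in> hcomp M i) \<and> finite {i. f' i \<noteq> \<zero>\<^sub>M} \<and> x = (\<Oplus>\<^sub>M i\<in>{i. f' i \<noteq> \<zero>\<^sub>M}. f' i)"
   using f' finite_subset[OF sup F(2)] by blast
  have "g = h" if g: "(\<forall>i. g i \<in> hcomp M i) \<and> finite {i. g i \<noteq> \<zero>\<^sub>M} \<and> x = (\<Oplus>\<^sub>M i\<in>{i. g i \<noteq> \<zero>\<^sub>M}. g i)"
   and h: "(\<forall>i. h i \<in> hcomp M i) \<and> finite {i. h i \<noteq> \<zero>\<^sub>M} \<and> x = (\<Oplus>\<^sub>M i\<in>{i. h i \<noteq> \<zero>\<^sub>M}. h i)" for g h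
  proof -
   define G where "G = {i. g i \<noteq> \<zero>\<^sub>M} \<union> {i. h i \<noteq> \<zero>\<^sub>M}"
   have fin: "finite G" unfolding G_def using g h by blast
   have c: "g i \<in> carrier M" "h i \<in> carrier M" for i using g h hcompD(1) by blast+
   have gx: "x = (\<Oplus>\<^sub>M i\<in>G. g i)" using g fin c
    by (subst conjunct2[OF conjunct2[OF g]]) (intro M.add.finprod_mono_neutral_cong_left; auto simp: G_def)
   have hx: "x = (\<Oplus>\<^sub>M i\<in>G. h i)" using h fin c
    by (subst conjunct2[OF conjunct2[OF h]]) (intro M.add.finprod_mono_neutral_cong_left; auto simp: G_def)
   have "(\<Oplus>\<^sub>M i\<in>G. g i \<ominus>\<^sub>M h i) \<oplus>\<^sub>M (\<Oplus>\<^sub>M i\<in>G. h i) = (\<Oplus>\<^sub>M i\<in>G. (g i \<ominus>\<^sub>M h i) \<oplus>\<^sub>M h i)"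
    using c by (subst M.finsum_addf) (auto simp: Pi_def)
   also have "\<dots> = (\<Oplus>\<^sub>M i\<in>G. g i)"
    using c by (intro M.finsum_cong') (auto simp: M.a_comm[of _ "h _"] M.add_minus_cancel)
   finally have "(\<Oplus>\<^sub>M i\<in>G. g i \<ominus>\<^sub>M h i) = \<zero>\<^sub>M"
    using gx hx x c M.finsum_closed[of "\<lambda>i. g i \<ominus>\<^sub>M h i" G] by (simp add: Pi_def)
   hence z: "\<forall>i\<in>G. g i \<ominus>\<^sub>M h i = \<zero>\<^sub>M" using uniq[OF fin, of "\<lambda>i. g i \<ominus>\<^sub>M h i"] g h hcompD(5) by blast
   show "g = h"
   proof
    fix i show "g i = h i"
    proof (cases "i \<in> G")
     case True
     thus ?thesis using z M.add_minus_cancel[of "g i" "h i"] c by simp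
    next
     case False
     thus ?thesis unfolding G_def by simp
    qed
   qed
  qed
  with ex show ?thesis by blast
 qed
 thus ?thesis
  by (intro graded_module.intro assms graded_module_axioms.intro)
qed

section \<open>Homogeneous projections\<close>

definition pr :: "('a, 'b) graded_module \<Rightarrow> int \<Rightarrow> 'b \<Rightarrow> 'b" where
 "pr M i x = (THE f. (\<forall>i. f i \<in> hcomp M i) \<and> finite {i. f i \<noteq> \<zero>\<^sub>M} \<and>
  x = (\<Oplus>\<^sub>M i\<in>{i. f i \<noteq> \<zero>\<^sub>M}. f i)) i"

sublocale graded_module \<subseteq> G: pregraded M
 using abelian_group_axioms hcomp_subgroup by (intro pregraded.intro pregraded_axioms.intro)

context graded_module begin

lemma pr:
 assumes "x \<in> carrier M"
 shows "pr M i x \<in> hcomp M i" "finite {i. pr M i x \<noteq> \<zero>\<^sub>M}" "x = (\<Oplus>\<^sub>M i\<in>{i. pr M i x \<noteq> \<zero>\<^sub>M}. pr M i x)"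
 using theI'[OF decomposition[OF assms]] unfolding pr_def by blast+

lemma pr_carrier [simp, intro]: "x \<in> carrier M \<Longrightarrow> pr M i x \<in> carrier M"
 using pr(1) G.hcompD(1) by blast

lemma pr_unique:
 assumes "finite F" "\<And>i. i \<in> F \<Longrightarrow> f i \<in> hcomp M i" "x = (\<Oplus>\<^sub>M i\<in>F. f i)"
 shows "pr M i x = (if i \<in> F then f i else \<zero>\<^sub>M)"
proof -
 have x: "x \<in> carrier M" using assms G.hcompD(1) by (auto intro!: M.finsum_closed)
 define f' where "f' i = (if i \<in> F then f i else \<zero>\<^sub>M)" for i
 have f': "f' i \<in> hcomp M i" for i unfolding f'_def using assms G.hcompD(2) by simp
 have sup: "{i. f' i \<noteq> \<zero>\<^sub>M} \<subseteq> F" unfolding f'_def by auto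
 have "x = (\<Oplus>\<^sub>M i\<in>F. f' i)" unfolding f'_def assms(3)
  using assms G.hcompD(1) by (intro G.finsum_extend[symmetric]) auto
 also have "\<dots> = (\<Oplus>\<^sub>M i\<in>{i. f' i \<noteq> \<zero>\<^sub>M}. f' i)"
  using assms(1) sup f' G.hcompD(1) by (intro M.add.finprod_mono_neutral_cong_right) auto
 finally have "pr M i x = f' i"
  unfolding pr_def using f' finite_subset[OF sup assms(1)]
  by (subst the1_equality[OF decomposition[OF x], of f']) simp_all
 thus ?thesis unfolding f'_def .
qed

lemma pr_homog: "x \<in> hcomp M j \<Longrightarrow> pr M i x = (if i = j then x else \<zero>\<^sub>M)"
 using pr_unique[of "{j}" "\<lambda>_. x" x i] G.hcompD(1) by (simp add: M.finsum_insert)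

lemma pr_zero [simp]: "pr M i \<zero>\<^sub>M = \<zero>\<^sub>M"
 using pr_homog[OF G.hcompD(2)] by simp

lemma pr_add:
 assumes "x \<in> carrier M" "y \<in> carrier M"
 shows "pr M i (x \<oplus>\<^sub>M y) = pr M i x \<oplus>\<^sub>M pr M i y"
proof -
 define F where "F = {i. pr M i x \<noteq> \<zero>\<^sub>M} \<union> {i. pr M i y \<noteq> \<zero>\<^sub>M}"
 have fin: "finite F" unfolding F_def using pr(2) assms by blast
 have "x = (\<Oplus>\<^sub>M i\<in>F. pr M i x)" using fin assms
  by (subst pr(3)[OF assms(1)]) (intro M.add.finprod_mono_neutral_cong_left; auto simp: F_def)
 moreover have "y = (\<Oplus>\<^sub>M i\<in>F. pr M i y)" using fin assms
  by (subst pr(3)[OF assms(2)]) (intro M.add.finprod_mono_neutral_cong_left; auto simp: F_def)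
 ultimately have "x \<oplus>\<^sub>M y = (\<Oplus>\<^sub>M i\<in>F. pr M i x \<oplus>\<^sub>M pr M i y)"
  using assms by (subst M.finsum_addf) (auto simp: Pi_def)
 from pr_unique[OF fin _ this, of i] show ?thesis
  using pr(1) assms G.hcompD(3) by (auto simp: F_def)
qed

lemma carrier_hspan: "carrier M = hspan M UNIV"
proof
 show "carrier M \<subseteq> hspan M UNIV"
  unfolding hspan_def using pr by blast
qed (rule G.hspan_carrier)

lemma graded_induct [consumes 1, case_names zero comp add]:
 assumes "x \<in> carrier M" "P \<zero>\<^sub>M" "\<And>i y. y \<in> hcomp M i \<Longrightarrow> P y"
  "\<And>y z. y \<in> carrier M \<Longrightarrow> z \<in> carrier M \<Longrightarrow> P y \<Longrightarrow> P z \<Longrightarrow> P (y \<oplus>\<^sub>M z)"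
 shows "P x"
 using assms G.hspan_induct[of x UNIV P] by (auto simp: carrier_hspan[symmetric])

lemma pr_smult:
 assumes "r \<in> hcomp R i" "r \<in> carrier R" "x \<in> carrier M"
 shows "pr M k (r \<odot>\<^sub>M x) = r \<odot>\<^sub>M pr M (k - i) x"
 using assms(3)
proof (induction rule: graded_induct)
 case zero
 thus ?case using assms by simp
next
 case (comp j y)
 thus ?case using assms smult_hcomp[OF assms(1) comp] by (simp add: pr_homog)
next
 case (add y z)
 thus ?case using assms by (simp add: pr_add smult_r_distr)
qed

lemma pr_eq_zero: "x \<in> carrier M \<Longrightarrow> (\<And>i. pr M i x = \<zero>\<^sub>M) \<Longrightarrow> x = \<zero>\<^sub>M"
 using pr(3)[of x] by simp

end

lemma pr_hom:
 assumes "graded_module R M" "graded_module R N" "\<And>x. x \<in> carrier M \<Longrightarrow> \<phi> x \<in> carrier N"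
  "\<And>x y. x \<in> carrier M \<Longrightarrow> y \<in> carrier M \<Longrightarrow> \<phi> (x \<oplus>\<^sub>M y) = \<phi> x \<oplus>\<^sub>N \<phi> y"
  "\<And>i x. x \<in> hcomp M i \<Longrightarrow> \<phi> x \<in> hcomp N i" "x \<in> carrier M"
 shows "pr N i (\<phi> x) = \<phi> (pr M i x)"
proof -
 interpret M: graded_module R M by fact
 interpret N: graded_module R N by fact
 have z: "\<phi> \<zero>\<^sub>M = \<zero>\<^sub>N" using hom_zero[OF M.M.abelian_group_axioms N.M.abelian_group_axioms] assms by blast
 show ?thesis using assms(6)
 proof (induction rule: M.graded_induct)
  case zero
  thus ?case using z by simp
 next
  case (comp k y)
  thus ?case using z by (simp add: M.pr_homog[OF comp] N.pr_homog[OF assms(5)[OF comp]])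
 next
  case (add y w)
  thus ?case using assms by (simp add: M.pr_add N.pr_add)
 qed
qed

section \<open>The polynomial ring\<close>

text \<open>Makes the convolution at each monomial a finite sum.\<close>

lemma finite_submultisets: "finite {a. a \<subseteq># m}"
proof (induction m)
 case (add i m)
 have "{a. a \<subseteq># add_mset i m} \<subseteq> {a. a \<subseteq># m} \<union> add_mset i ` {a. a \<subseteq># m}"
 proof
  fix a assume "a \<in> {a. a \<subseteq># add_mset i m}"
  hence a: "a \<subseteq># add_mset i m" by simp
  show "a \<in> {a. a \<subseteq># m} \<union> add_mset i ` {a. a \<subseteq># m}"
  proof (cases "i \<in># a")
   case True
   hence "a = add_mset i (a - {#i#})" by simp
   moreover have "a - {#i#} \<subseteq># m" using a by (metis add_mset_remove_trivial subset_eq_diff_conv union_mset_add_mset_right add_0_right)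
   ultimately show ?thesis by blast
  next
   case False
   have "a \<subseteq># m"
   proof (rule mset_subset_eqI)
    fix j show "count a j \<le> count m j"
     using False mset_subset_eq_count[OF a, of j] by (cases "i = j") (auto simp: not_in_iff)
   qed
   thus ?thesis by blast
  qed
 qed
 thus ?case using add finite_subset by blast
qed simp

definition mon :: "('b, 'm) ring_scheme \<Rightarrow> 'b \<Rightarrow> 'c multiset \<Rightarrow> 'c multiset \<Rightarrow> 'b" where
 "mon B c a = (\<lambda>m. if m = a then c else \<zero>\<^sub>B)"

lemma graded_poly_ring_simps:
 fixes B (structure)
 shows "carrier (graded_poly_ring B n) = ring.indexed_pset B {0..n} (carrier B)"
  "P \<otimes>\<^bsub>graded_poly_ring B n\<^esub> Q = (\<lambda>m. \<Oplus>\<^sub>B a\<in>{a. a \<subseteq># m}. P a \<otimes>\<^sub>B Q (m - a))"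
  "\<one>\<^bsub>graded_poly_ring B n\<^esub> = ring.indexed_const B \<one>\<^sub>B"
  "\<zero>\<^bsub>graded_poly_ring B n\<^esub> = ring.indexed_const B \<zero>\<^sub>B"
  "P \<oplus>\<^bsub>graded_poly_ring B n\<^esub> Q = ring.indexed_padd B P Q"
  "P \<odot>\<^bsub>graded_poly_ring B n\<^esub> Q = P \<otimes>\<^bsub>graded_poly_ring B n\<^esub> Q"
  "hcomp (graded_poly_ring B n) i = {P \<in> carrier (graded_poly_ring B n). \<forall>m. P m \<noteq> \<zero>\<^sub>B \<longrightarrow> int (size m) = i}"
 by (simp_all add: graded_poly_ring_def Let_def)

section \<open>Convolution of coefficient functions\<close>

context cring begin

text \<open>The product of \<open>graded_poly_ring\<close> on arbitrary coefficient functions;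
  commutativity and distributivity hold before any finiteness of support is imposed.\<close>

definition pmul :: "('c multiset \<Rightarrow> 'a) \<Rightarrow> ('c multiset \<Rightarrow> 'a) \<Rightarrow> 'c multiset \<Rightarrow> 'a" where
 "pmul P Q = (\<lambda>m. \<Oplus>a\<in>{a. a \<subseteq># m}. P a \<otimes> Q (m - a))"

lemma coeffD: "carrier_coeff P \<Longrightarrow> P m \<in> carrier R"
 by (simp add: carrier_coeff_def)

lemma pmul_closed_coeff: "carrier_coeff P \<Longrightarrow> carrier_coeff Q \<Longrightarrow> carrier_coeff (pmul P Q)"
 unfolding carrier_coeff_def pmul_def by (auto intro!: finsum_closed)

lemma pmul_const: "k \<in> carrier R \<Longrightarrow> carrier_coeff Q \<Longrightarrow> pmul (indexed_const k) Q = (\<lambda>m. k \<otimes> Q m)"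
proof
 fix m assume a: "k \<in> carrier R" "carrier_coeff Q"
 have "pmul (indexed_const k) Q m = (\<Oplus>a\<in>{m - m}. k \<otimes> Q m)"
  unfolding pmul_def using a
  by (intro add.finprod_mono_neutral_cong_right finite_submultisets) (auto simp: indexed_const_def coeffD)
 thus "pmul (indexed_const k) Q m = k \<otimes> Q m" using a by (simp add: finsum_insert coeffD)
qed

text \<open>Reindexing by the complement \<open>m - a\<close>, an involution of the submultisets of
  \<open>m\<close>.\<close>

lemma pmul_comm:
 fixes P Q :: "'c multiset \<Rightarrow> 'a"
 assumes "carrier_coeff P" "carrier_coeff Q"
 shows "pmul P Q = pmul Q P"
proof
 fix m :: "'c multiset"
 have inj: "inj_on (\<lambda>a. m - a) {a. a \<subseteq># m}"
  by (rule inj_on_inverseI[of _ "\<lambda>a. m - a"]) (simp add: subset_mset.diff_diff_right)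
 have im: "(\<lambda>a. m - a) ` {a. a \<subseteq># m} = {a. a \<subseteq># m}"
 proof (intro equalityI subsetI)
  fix a assume "a \<in> {a. a \<subseteq># m}"
  hence "a = m - (m - a)" "m - a \<subseteq># m" by (auto simp: subset_mset.diff_diff_right)
  thus "a \<in> (\<lambda>a. m - a) ` {a. a \<subseteq># m}" by blast
 qed auto
 have "pmul P Q m = (\<Oplus>a\<in>(\<lambda>a. m - a) ` {a. a \<subseteq># m}. P a \<otimes> Q (m - a))" unfolding im by (simp add: pmul_def)
 also have "\<dots> = (\<Oplus>a\<in>{a. a \<subseteq># m}. P (m - a) \<otimes> Q (m - (m - a)))"
  using assms inj by (intro finsum_reindex) (auto simp: coeffD)
 also have "\<dots> = pmul Q P m" unfolding pmul_def
  using assms by (intro finsum_cong') (auto simp: coeffD m_comm subset_mset.diff_diff_right)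
 finally show "pmul P Q m = pmul Q P m" .
qed

text \<open>Together with \<open>pmul_const\<close> and \<open>pmul_add_left\<close> this allows
  closure and associativity to be proved by induction on the left factor. Only submultisets
  containing \<open>i\<close> contribute, and they correspond to the submultisets of
  \<open>m - {#i#}\<close>.\<close>

lemma pmul_pmult_left:
 assumes "carrier_coeff P" "carrier_coeff Q"
 shows "pmul (indexed_pmult P i) Q = indexed_pmult (pmul P Q) i"
proof
 fix m
 show "pmul (indexed_pmult P i) Q m = indexed_pmult (pmul P Q) i m"
 proof (cases "i \<in># m")
  case False
  hence "i \<notin># a" if "a \<subseteq># m" for a using that by (meson mset_subset_eqD)
  hence "pmul (indexed_pmult P i) Q m = (\<Oplus>a\<in>{a. a \<subseteq># m}. \<zero>)"
   unfolding pmul_def using assms by (intro finsum_cong') (auto simp: indexed_pmult_def coeffD)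
  thus ?thesis using False by (simp add: indexed_pmult_def)
 next
  case True
  let ?m = "m - {#i#}"
  have im: "add_mset i ` {b. b \<subseteq># ?m} = {a. a \<subseteq># m \<and> i \<in># a}"
  proof (intro equalityI subsetI)
   fix a assume "a \<in> add_mset i ` {b. b \<subseteq># ?m}"
   then obtain b where b: "a = add_mset i b" "b \<subseteq># ?m" by blast
   hence "a \<subseteq># add_mset i ?m" by simp
   thus "a \<in> {a. a \<subseteq># m \<and> i \<in># a}" using True b by simp
  next
   fix a assume "a \<in> {a. a \<subseteq># m \<and> i \<in># a}"
   hence "a = add_mset i (a - {#i#})" "a \<subseteq># add_mset i ?m" using True by auto
   hence "a = add_mset i (a - {#i#})" "a - {#i#} \<subseteq># ?m" by (metis mset_subset_eq_add_mset_cancel)+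
   thus "a \<in> add_mset i ` {b. b \<subseteq># ?m}" by blast
  qed
  have "pmul (indexed_pmult P i) Q m = (\<Oplus>a\<in>add_mset i ` {b. b \<subseteq># ?m}. indexed_pmult P i a \<otimes> Q (m - a))"
   unfolding pmul_def im using assms indexed_pmult_in_carrier[OF assms(1), of i]
   by (intro add.finprod_mono_neutral_cong_right finite_submultisets) (auto simp: indexed_pmult_def coeffD)
  also have "\<dots> = (\<Oplus>b\<in>{b. b \<subseteq># ?m}. indexed_pmult P i (add_mset i b) \<otimes> Q (m - add_mset i b))"
   using assms indexed_pmult_in_carrier[OF assms(1), of i] by (intro finsum_reindex) (auto simp: coeffD inj_on_def)
  also have "\<dots> = pmul P Q ?m" unfolding pmul_def
   using assms by (intro finsum_cong') (auto simp: indexed_pmult_def coeffD)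
  finally show ?thesis using True by (simp add: indexed_pmult_def)
 qed
qed

lemma pmul_add_left:
 assumes "carrier_coeff P" "carrier_coeff P'" "carrier_coeff Q"
 shows "pmul (indexed_padd P P') Q = indexed_padd (pmul P Q) (pmul P' Q)"
proof
 fix m
 have "pmul (indexed_padd P P') Q m = (\<Oplus>a\<in>{a. a \<subseteq># m}. P a \<otimes> Q (m - a) \<oplus> P' a \<otimes> Q (m - a))"
  unfolding pmul_def using assms by (intro finsum_cong') (auto simp: indexed_padd_def coeffD l_distr)
 also have "\<dots> = pmul P Q m \<oplus> pmul P' Q m" unfolding pmul_def using assms by (intro finsum_addf) (auto simp: coeffD)
 finally show "pmul (indexed_padd P P') Q m = indexed_padd (pmul P Q) (pmul P' Q) m" by (simp add: indexed_padd_def)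
qed

lemma pmul_nonzero:
 assumes "pmul P Q m \<noteq> \<zero>" "carrier_coeff P" "carrier_coeff Q"
 obtains a b where "m = a + b" "P a \<noteq> \<zero>" "Q b \<noteq> \<zero>"
proof -
 have "\<exists>a. a \<subseteq># m \<and> P a \<otimes> Q (m - a) \<noteq> \<zero>"
 proof (rule ccontr)
  assume "\<not> ?thesis"
  hence "pmul P Q m = \<zero>" unfolding pmul_def by (intro add.finprod_one_eqI) auto
  thus False using assms(1) by contradiction
 qed
 then obtain a where "a \<subseteq># m" "P a \<otimes> Q (m - a) \<noteq> \<zero>" by auto
 hence "m = a + (m - a)" "P a \<noteq> \<zero>" "Q (m - a) \<noteq> \<zero>" using assms(2,3) by (auto simp: coeffD)
 thus ?thesis using that by blast
qed

text \<open>The description of \<open>indexed_pset\<close> by finite support. It provides induction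
  over monomials, while the inductive description provides induction over constants, sums and
  multiplication by a variable; both are used.\<close>

definition polys :: "'c set \<Rightarrow> ('c multiset \<Rightarrow> 'a) set" where
 "polys A = {P. carrier_coeff P \<and> finite {m. P m \<noteq> \<zero>} \<and> (\<forall>m. P m \<noteq> \<zero> \<longrightarrow> set_mset m \<subseteq> A)}"

lemma polys_coeff: "P \<in> polys A \<Longrightarrow> carrier_coeff P"
 by (simp add: polys_def)

lemma mon_indexed_pset: "c \<in> carrier R \<Longrightarrow> set_mset a \<subseteq> A \<Longrightarrow> mon R c a \<in> indexed_pset A (carrier R)"
proof (induction a)
 case empty
 have "mon R c {#} = indexed_const c" by (auto simp: mon_def indexed_const_def)
 thus ?case using empty indexed_pset.indexed_const by metis
next
 case (add i a)
 have "mon R c (add_mset i a) = indexed_pmult (mon R c a) i"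
  by (auto simp: mon_def indexed_pmult_def fun_eq_iff)
 thus ?case using add indexed_pset.indexed_pmult[of "mon R c a" A _ i] by simp
qed

lemma polys_induct [consumes 1, case_names zero mon add]:
 assumes "P \<in> polys A" "Q (\<lambda>_. \<zero>)"
  "\<And>a. P a \<noteq> \<zero> \<Longrightarrow> set_mset a \<subseteq> A \<Longrightarrow> Q (mon R (P a) a)"
  "\<And>P P'. P \<in> polys A \<Longrightarrow> P' \<in> polys A \<Longrightarrow> Q P \<Longrightarrow> Q P' \<Longrightarrow> Q (indexed_padd P P')"
 shows "Q P"
proof -
 have P: "carrier_coeff P" "finite {m. P m \<noteq> \<zero>}" "\<And>m. P m \<noteq> \<zero> \<Longrightarrow> set_mset m \<subseteq> A"
  using assms(1) by (auto simp: polys_def)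
 have "(\<lambda>m. if m \<in> F then P m else \<zero>) \<in> polys A \<and> Q (\<lambda>m. if m \<in> F then P m else \<zero>)"
  if "finite F" "F \<subseteq> {m. P m \<noteq> \<zero>}" for F
  using that
 proof (induction F)
  case empty
  thus ?case using assms(2) by (simp add: polys_def carrier_coeff_def)
 next
  case (insert a F)
  have "mon R (P a) a \<in> polys A"
   using P insert unfolding polys_def by (auto simp: mon_def carrier_coeff_def intro: finite_subset[of _ "{a}"])
  moreover have "indexed_padd (mon R (P a) a) (\<lambda>m. if m \<in> F then P m else \<zero>) = (\<lambda>m. if m \<in> insert a F then P m else \<zero>)"
   using P(1) insert by (auto simp: indexed_padd_def mon_def fun_eq_iff coeffD)
  moreover have "(\<lambda>m. if m \<in> insert a F then P m else \<zero>) \<in> polys A"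
   unfolding polys_def using P insert by (auto simp: carrier_coeff_def intro: finite_subset[OF _ P(2)])
  moreover have "(\<lambda>m. if m \<in> F then P m else \<zero>) \<in> polys A" "Q (\<lambda>m. if m \<in> F then P m else \<zero>)"
   "Q (mon R (P a) a)" using insert P(3) assms(3) by auto
  ultimately show ?case using assms(4)[of "mon R (P a) a" "\<lambda>m. if m \<in> F then P m else \<zero>"] by simp
 qed
 note Q = conjunct2[OF this[OF P(2) order_refl]]
 have "(\<lambda>m. if m \<in> {m. P m \<noteq> \<zero>} then P m else \<zero>) = P" by auto
 with Q show ?thesis by (simp only:)
qed

lemma indexed_pset_eq: "indexed_pset A (carrier R) = polys A"
proof
 have "P \<in> polys A" if "P \<in> indexed_pset A (carrier R)" for P
  using that
 proof (induction P)
  case (indexed_const k)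
  thus ?case unfolding polys_def indexed_const_def carrier_coeff_def by (auto intro: finite_subset[of _ "{{#}}"])
 next
  case (indexed_padd P Q)
  have "finite ({m. P m \<noteq> \<zero>} \<union> {m. Q m \<noteq> \<zero>})" using indexed_padd by (simp add: polys_def)
  moreover have nz: "P m \<noteq> \<zero> \<or> Q m \<noteq> \<zero>" if "indexed_padd P Q m \<noteq> \<zero>" for m
   using that by (auto simp: indexed_padd_def)
  hence "{m. indexed_padd P Q m \<noteq> \<zero>} \<subseteq> {m. P m \<noteq> \<zero>} \<union> {m. Q m \<noteq> \<zero>}" by blast
  ultimately have "finite {m. indexed_padd P Q m \<noteq> \<zero>}" by (rule rev_finite_subset)
  moreover have "set_mset m \<subseteq> A" if "indexed_padd P Q m \<noteq> \<zero>" for m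
   using nz[OF that] indexed_padd unfolding polys_def by blast
  ultimately show ?case using indexed_padd indexed_padd_in_carrier[of P Q] unfolding polys_def by blast
 next
  case (indexed_pmult P i)
  have "finite (add_mset i ` {m. P m \<noteq> \<zero>})" using indexed_pmult by (simp add: polys_def)
  moreover have "{m. indexed_pmult P i m \<noteq> \<zero>} \<subseteq> add_mset i ` {m. P m \<noteq> \<zero>}"
  proof
   fix m assume "m \<in> {m. indexed_pmult P i m \<noteq> \<zero>}"
   hence "m = add_mset i (m - {#i#})" "P (m - {#i#}) \<noteq> \<zero>" by (auto simp: indexed_pmult_def split: if_splits)
   thus "m \<in> add_mset i ` {m. P m \<noteq> \<zero>}" by blast
  qed
  ultimately have "finite {m. indexed_pmult P i m \<noteq> \<zero>}" by (rule rev_finite_subset)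
  moreover have "set_mset m \<subseteq> A" if "indexed_pmult P i m \<noteq> \<zero>" for m
  proof -
   have m: "m = add_mset i (m - {#i#})" "P (m - {#i#}) \<noteq> \<zero>" using that by (auto simp: indexed_pmult_def split: if_splits)
   hence "set_mset (m - {#i#}) \<subseteq> A" using indexed_pmult unfolding polys_def by blast
   thus ?thesis using indexed_pmult(2) by (subst m(1)) simp
  qed
  ultimately show ?case using indexed_pmult indexed_pmult_in_carrier[of P i] unfolding polys_def by blast
 qed
 thus "indexed_pset A (carrier R) \<subseteq> polys A" by blast
 have "P \<in> indexed_pset A (carrier R)" if "P \<in> polys A" for P
  using that
 proof (induction rule: polys_induct)
  case zero
  thus ?case using indexed_pset.indexed_const[of \<zero> "carrier R" A] by (simp add: indexed_zero_def)
 next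
  case (mon a)
  thus ?case using mon_indexed_pset coeffD[OF polys_coeff[OF that]] by blast
 next
  case (add P Q)
  thus ?case using indexed_pset.indexed_padd by blast
 qed
 thus "polys A \<subseteq> indexed_pset A (carrier R)" by blast
qed

lemma const_polys: "k \<in> carrier R \<Longrightarrow> indexed_const k \<in> polys A"
 unfolding indexed_pset_eq[symmetric] by (rule indexed_pset.indexed_const)

lemma padd_polys: "P \<in> polys A \<Longrightarrow> Q \<in> polys A \<Longrightarrow> indexed_padd P Q \<in> polys A"
 unfolding indexed_pset_eq[symmetric] by (rule indexed_pset.indexed_padd)

lemma pmult_polys: "P \<in> polys A \<Longrightarrow> i \<in> A \<Longrightarrow> indexed_pmult P i \<in> polys A"
 unfolding indexed_pset_eq[symmetric] by (rule indexed_pset.indexed_pmult)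

lemma polys_const_induct [consumes 1, case_names const padd pmult]:
 assumes "P \<in> polys A" "\<And>k. k \<in> carrier R \<Longrightarrow> Q (indexed_const k)"
  "\<And>P P'. P \<in> polys A \<Longrightarrow> Q P \<Longrightarrow> P' \<in> polys A \<Longrightarrow> Q P' \<Longrightarrow> Q (indexed_padd P P')"
  "\<And>P i. P \<in> polys A \<Longrightarrow> Q P \<Longrightarrow> i \<in> A \<Longrightarrow> Q (indexed_pmult P i)"
 shows "Q P"
 using assms unfolding indexed_pset_eq[symmetric] by (rule indexed_pset.induct)

lemma pmul_polys:
 assumes "P \<in> polys A" "Q \<in> polys A"
 shows "pmul P Q \<in> polys A"
 using assms(1)
proof (induction rule: polys_const_induct)
 case (const k)
 have nz: "Q m \<noteq> \<zero>" if "k \<otimes> Q m \<noteq> \<zero>" for m using that const by auto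
 have "finite {m. Q m \<noteq> \<zero>}" using assms(2) by (simp add: polys_def)
 moreover have "{m. k \<otimes> Q m \<noteq> \<zero>} \<subseteq> {m. Q m \<noteq> \<zero>}" using nz by blast
 ultimately have "finite {m. k \<otimes> Q m \<noteq> \<zero>}" by (rule rev_finite_subset)
 moreover have "set_mset m \<subseteq> A" if "k \<otimes> Q m \<noteq> \<zero>" for m using nz[OF that] assms(2) unfolding polys_def by blast
 moreover have "carrier_coeff (\<lambda>m. k \<otimes> Q m)" using const coeffD[OF polys_coeff[OF assms(2)]] by (simp add: carrier_coeff_def)
 ultimately have "(\<lambda>m. k \<otimes> Q m) \<in> polys A" unfolding polys_def by blast
 thus ?case using const polys_coeff[OF assms(2)] by (simp add: pmul_const)
next
 case (padd P P')
 thus ?case using assms polys_coeff[OF assms(2)] polys_coeff[OF padd(1)] polys_coeff[OF padd(2)] padd_polys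
  by (simp add: pmul_add_left)
next
 case (pmult P i)
 thus ?case using polys_coeff[OF assms(2)] polys_coeff[OF pmult(1)] pmult_polys
  by (simp add: pmul_pmult_left)
qed

lemma pmul_assoc:
 assumes "P \<in> polys A" "carrier_coeff Q" "carrier_coeff Q'"
 shows "pmul (pmul P Q) Q' = pmul P (pmul Q Q')"
 using assms(1)
proof (induction rule: polys_const_induct)
 case (const k)
 have "pmul (\<lambda>m. k \<otimes> Q m) Q' m = k \<otimes> pmul Q Q' m" for m
  unfolding pmul_def using const assms(2,3)
  by (subst finsum_rdistr) (auto simp: coeffD m_assoc finite_submultisets intro!: finsum_cong')
 thus ?case using const assms pmul_closed_coeff[OF assms(2,3)] by (simp add: pmul_const[OF _ assms(2)] pmul_const[OF _ pmul_closed_coeff])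
next
 case (padd P P')
 thus ?case using assms polys_coeff[OF padd(1)] polys_coeff[OF padd(2)]
  by (simp add: pmul_add_left pmul_closed_coeff)
next
 case (pmult P i)
 thus ?case using assms polys_coeff[OF pmult(1)]
  by (simp add: pmul_pmult_left pmul_closed_coeff)
qed

section \<open>The graded ring of polynomials\<close>

abbreviation "PR n \<equiv> graded_poly_ring R n"

lemma PR_simps:
 "carrier (PR n) = polys {0..n}" "P \<otimes>\<^bsub>PR n\<^esub> Q = pmul P Q" "\<one>\<^bsub>PR n\<^esub> = indexed_const \<one>"
 "\<zero>\<^bsub>PR n\<^esub> = (\<lambda>_. \<zero>)" "P \<oplus>\<^bsub>PR n\<^esub> Q = indexed_padd P Q" "P \<odot>\<^bsub>PR n\<^esub> Q = pmul P Q"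
 "hcomp (PR n) i = {P \<in> polys {0..n}. \<forall>m. P m \<noteq> \<zero> \<longrightarrow> int (size m) = i}"
 by (simp_all add: graded_poly_ring_simps indexed_pset_eq pmul_def indexed_zero_def)

lemma cring_PR: "cring (PR n)"
proof (rule cringI)
 show "abelian_group (PR n)"
 proof (rule abelian_groupI)
  fix P assume P: "P \<in> carrier (PR n)"
  hence c: "carrier_coeff P" by (simp add: PR_simps polys_coeff)
  have nz: "P m \<noteq> \<zero>" if "\<ominus> P m \<noteq> \<zero>" for m using that by auto
  have "finite {m. P m \<noteq> \<zero>}" using P by (simp add: polys_def PR_simps)
  moreover have "{m. \<ominus> P m \<noteq> \<zero>} \<subseteq> {m. P m \<noteq> \<zero>}" using nz by blast
  ultimately have "finite {m. \<ominus> P m \<noteq> \<zero>}" by (rule rev_finite_subset)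
  moreover have "set_mset m \<subseteq> {0..n}" if "\<ominus> P m \<noteq> \<zero>" for m
   using nz[OF that] P unfolding polys_def PR_simps by blast
  moreover have "carrier_coeff (\<lambda>m. \<ominus> P m)" using coeffD[OF c] by (simp add: carrier_coeff_def)
  ultimately have "(\<lambda>m. \<ominus> P m) \<in> polys {0..n}" unfolding polys_def by blast
  moreover have "indexed_padd (\<lambda>m. \<ominus> P m) P = (\<lambda>_. \<zero>)" using c by (simp add: indexed_padd_def coeffD l_neg)
  ultimately show "\<exists>Q\<in>carrier (PR n). Q \<oplus>\<^bsub>PR n\<^esub> P = \<zero>\<^bsub>PR n\<^esub>" by (auto simp: PR_simps)
 qed (auto simp: PR_simps padd_polys[unfolded indexed_padd_def] const_polys[of \<zero>, unfolded indexed_zero_def] indexed_padd_def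
   coeffD polys_coeff a_ac)
 show "Group.comm_monoid (PR n)"
  by (rule comm_monoidI)
   (simp_all add: PR_simps pmul_polys const_polys pmul_assoc polys_coeff pmul_const coeffD,
    metis pmul_comm polys_coeff)
 show "(P \<oplus>\<^bsub>PR n\<^esub> P') \<otimes>\<^bsub>PR n\<^esub> Q = (P \<otimes>\<^bsub>PR n\<^esub> Q) \<oplus>\<^bsub>PR n\<^esub> (P' \<otimes>\<^bsub>PR n\<^esub> Q)"
  if "P \<in> carrier (PR n)" "P' \<in> carrier (PR n)" "Q \<in> carrier (PR n)" for P P' Q
  using that by (simp add: PR_simps pmul_add_left polys_coeff)
qed

lemma cring_self_module:
 fixes S :: "('x, 'x) graded_module"
 assumes "cring S" "\<And>r s. r \<odot>\<^sub>S s = r \<otimes>\<^sub>S s"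
 shows "module S S"
proof -
 interpret S: cring S by fact
 show ?thesis
  by (rule moduleI) (simp_all add: assms S.abelian_group_axioms S.l_distr S.r_distr S.m_assoc)
qed

lemma module_PR: "module (PR n) (PR n)"
 by (rule cring_self_module[OF cring_PR]) (simp add: PR_simps)

lemma finsum_PR:
 assumes "finite F" "\<And>i. i \<in> F \<Longrightarrow> f i \<in> polys {0..n}"
 shows "(\<Oplus>\<^bsub>PR n\<^esub>i\<in>F. f i) m = (\<Oplus>i\<in>F. f i m)"
proof -
 interpret S: cring "PR n" by (rule cring_PR)
 show ?thesis using assms
 proof (induction F)
  case empty
  thus ?case by (simp add: PR_simps)
 next
  case (insert a F)
  have "f i m \<in> carrier R" if "i \<in> insert a F" for i using coeffD[OF polys_coeff] insert(4)[OF that] by blast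
  thus ?case using insert
   by (subst S.finsum_insert) (auto simp: PR_simps indexed_padd_def finsum_insert coeffD[OF polys_coeff] Pi_def)
 qed
qed

lemma graded_PR: "graded_module (PR n) (PR n)"
proof (rule graded_moduleI[OF module_PR])
 interpret S: cring "PR n" by (rule cring_PR)
 show sub: "subgroup (hcomp (PR n) i) (add_monoid (PR n))" for i
 proof (rule S.add.subgroupI)
  have "(\<lambda>_. \<zero>) \<in> hcomp (PR n) i" using S.zero_closed by (simp add: PR_simps)
  thus "hcomp (PR n) i \<noteq> {}" by blast
  fix P assume P: "P \<in> hcomp (PR n) i"
  hence Pc: "P \<in> carrier (PR n)" by (simp add: PR_simps)
  \<comment> \<open>The negative is only known as an additive inverse; evaluating the inverse law at
    \<open>m\<close> shows that it keeps zero coefficients zero.\<close>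
  have "indexed_padd (\<ominus>\<^bsub>PR n\<^esub> P) P = (\<lambda>_. \<zero>)" using S.l_neg[OF Pc] by (simp add: PR_simps)
  hence "(\<ominus>\<^bsub>PR n\<^esub> P) m \<oplus> P m = \<zero>" for m by (simp add: indexed_padd_def fun_eq_iff)
  hence "P m = \<zero> \<Longrightarrow> (\<ominus>\<^bsub>PR n\<^esub> P) m = \<zero>" for m
   using S.a_inv_closed[OF Pc] by (metis PR_simps(1) coeffD polys_coeff r_zero)
  thus "\<ominus>\<^bsub>PR n\<^esub> P \<in> hcomp (PR n) i" using P S.a_inv_closed[OF Pc] unfolding PR_simps by blast
  fix Q assume Q: "Q \<in> hcomp (PR n) i"
  have "int (size m) = i" if "indexed_padd P Q m \<noteq> \<zero>" for m
  proof -
   have "P m \<noteq> \<zero> \<or> Q m \<noteq> \<zero>" using that by (auto simp: indexed_padd_def)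
   thus ?thesis using P Q by (auto simp: PR_simps)
  qed
  thus "P \<oplus>\<^bsub>PR n\<^esub> Q \<in> hcomp (PR n) i" using P Q padd_polys by (auto simp: PR_simps)
 qed (auto simp: PR_simps)
 interpret pregraded "PR n" by (intro pregraded.intro pregraded_axioms.intro sub S.abelian_group_axioms)
 show "carrier (PR n) \<subseteq> hspan (PR n) UNIV"
 proof
  fix P assume "P \<in> carrier (PR n)"
  hence P: "P \<in> polys {0..n}" by (simp add: PR_simps)
  thus "P \<in> hspan (PR n) UNIV"
  proof (induction rule: polys_induct)
   case zero
   thus ?case using zero_hspan[of UNIV] by (simp add: PR_simps)
  next
   case (mon a)
   have "mon R (P a) a \<in> polys {0..n}"
    using mon_indexed_pset[of "P a" a "{0..n}"] mon coeffD[OF polys_coeff[OF P]] by (simp add: indexed_pset_eq)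
   hence "mon R (P a) a \<in> hcomp (PR n) (int (size a))" by (simp add: PR_simps mon_def)
   thus ?case using hcomp_hspan by blast
  next
   case (add P Q)
   thus ?case using hspan_add[of P UNIV Q] by (simp add: PR_simps)
  qed
 qed
 fix F :: "int set" and f assume F: "finite F" "\<And>i. i \<in> F \<Longrightarrow> f i \<in> hcomp (PR n) i"
  "(\<Oplus>\<^bsub>PR n\<^esub>i\<in>F. f i) = \<zero>\<^bsub>PR n\<^esub>"
 show "\<forall>i\<in>F. f i = \<zero>\<^bsub>PR n\<^esub>"
 proof
  fix i assume i: "i \<in> F"
  have f: "f j \<in> polys {0..n}" "f j m \<noteq> \<zero> \<Longrightarrow> int (size m) = j" if "j \<in> F" for j m using F(2)[OF that] by (auto simp: PR_simps)
  \<comment> \<open>Distinct components have disjoint supports, so at a monomial in the support of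
    \<open>f i\<close> all other summands vanish.\<close>
  have "f i m = \<zero>" for m
  proof (rule ccontr)
   assume nz: "f i m \<noteq> \<zero>"
   have fc: "f j m \<in> carrier R" if "j \<in> F" for j using f(1)[OF that] polys_coeff coeffD by blast
   have "(\<Oplus>j\<in>F. f j m) = (\<Oplus>j\<in>{i}. f j m)"
    using F(1) i f nz fc by (intro add.finprod_mono_neutral_cong_right) (auto simp: Pi_def, metis)
   also have "(\<Oplus>j\<in>{i}. f j m) = f i m" using fc[OF i] by (simp add: finsum_insert)
   also have "(\<Oplus>j\<in>F. f j m) = (\<Oplus>\<^bsub>PR n\<^esub>i\<in>F. f i) m" by (rule finsum_PR[OF F(1), symmetric]) (rule f(1))
   finally show False using nz F(3) by (simp add: PR_simps)
  qed
  thus "f i = \<zero>\<^bsub>PR n\<^esub>" by (auto simp: PR_simps)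
 qed
next
 fix i j P Q assume "P \<in> hcomp (PR n) i" "Q \<in> hcomp (PR n) j"
 thus "P \<odot>\<^bsub>PR n\<^esub> Q \<in> hcomp (PR n) (i + j)"
  by (auto simp: PR_simps pmul_polys elim!: pmul_nonzero[OF _ polys_coeff polys_coeff]) 
qed

end

text \<open>The facts about \<open>B[x_0,...,x_n]\<close> from which everything about modules is
  derived. \<open>I_prod\<close> expresses that \<open>I (a + b)\<close> is generated by products,
  \<open>I_var\<close> that an ideal containing a power of each variable contains some
  \<open>I l\<close>. \<open>hcomp_neg\<close> keeps truncations closed under scalars, and
  \<open>S_infinite\<close> bounds the cardinality of finitely generated modules.\<close>

locale standard_graded =
 fixes S :: "('a, 'a) graded_module" and n :: nat and var :: "nat \<Rightarrow> 'a" and I :: "nat \<Rightarrow> 'a set"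
 assumes graded_S: "graded_module S S"
  and noeth_S: "noetherian_ring S"
  and smult_S: "r \<odot>\<^sub>S s = r \<otimes>\<^sub>S s"
  and hcomp_neg: "i < 0 \<Longrightarrow> hcomp S i = {\<zero>\<^sub>S}"
  and S_infinite: "\<one>\<^sub>S \<noteq> \<zero>\<^sub>S \<Longrightarrow> infinite (carrier S)"
  and I_sub: "opsub (carrier S) S (I l)"
  and I_hspan: "I l \<subseteq> hspan S {int l..}"
  and hcomp_I: "int l \<le> i \<Longrightarrow> hcomp S i \<subseteq> I l"
  and var_hcomp: "j \<le> n \<Longrightarrow> var j \<in> hcomp S 1"
  and I_prod: "opsub (carrier S) S H \<Longrightarrow> (\<And>s t. s \<in> I a \<Longrightarrow> t \<in> I b \<Longrightarrow> s \<otimes>\<^sub>S t \<in> H) \<Longrightarrow> I (a + b) \<subseteq> H"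
  and I_var: "opsub (carrier S) S H \<Longrightarrow> (\<And>j. j \<le> n \<Longrightarrow> \<exists>r :: nat. var j [^]\<^sub>S r \<in> H) \<Longrightarrow> \<exists>l. I l \<subseteq> H"

section \<open>Hilbert's basis theorem\<close>

context cring begin

text \<open>The polynomial ring is a module over itself with the constants as initial operators.
  Starting from the constants, the variables are adjoined one after another by
  \<open>acc_adjoin_variable\<close>, both to the subset and to the operators; finally the operators
  are enlarged to the whole ring.\<close>

lemma noetherian_PR:
 assumes "noetherian_ring R"
 shows "noetherian_ring (PR n)"
proof -
 interpret S: module "PR n" "PR n" by (rule module_PR)
 define cs :: "(nat multiset \<Rightarrow> 'a) set" where "cs = indexed_const ` carrier R"
 define xs where "xs k = (indexed_var :: nat \<Rightarrow> _) ` {..<k}" for k :: nat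
 have cc: "cs \<subseteq> polys {0..n}" unfolding cs_def using const_polys by blast
 have xc: "indexed_var i \<in> polys {0..n}" if "i \<le> n" for i
  unfolding indexed_var_def by (rule pmult_polys[OF const_polys[OF one_closed]]) (simp add: that)
 have neg: "\<ominus>\<^bsub>PR n\<^esub> (indexed_const k) = indexed_const (\<ominus> k)" if "k \<in> carrier R" for k
  using that const_polys[of k] const_polys[of "\<ominus> k"]
  by (intro S.R.minus_equality) (auto simp: PR_simps indexed_padd_const l_neg indexed_zero_def)
 have mult: "indexed_const k \<odot>\<^bsub>PR n\<^esub> indexed_const k' = indexed_const (k \<otimes> k')"
  if "k \<in> carrier R" "k' \<in> carrier R" for k k'
  unfolding PR_simps using that
  by (subst pmul_const[OF that(1) polys_coeff[OF const_polys[OF that(2)]]]) (auto simp: indexed_const_def)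
 have "opsub cs (PR n) cs"
  unfolding opsub_def using cc neg mult
  by (auto simp: cs_def PR_simps(1,4,5) indexed_padd_const indexed_zero_def[symmetric])
 \<comment> \<open>Submodules consisting of constants, with constants as operators, are ideals of
   the base ring.\<close>
 moreover have "acc cs (PR n) cs"
  unfolding acc_def
 proof (intro allI impI)
  fix U :: "nat \<Rightarrow> (nat multiset \<Rightarrow> 'a) set"
  assume U: "\<forall>i. opsub cs (PR n) (U i) \<and> U i \<subseteq> cs \<and> U i \<subseteq> U (Suc i)"
  define J where "J i = {k \<in> carrier R. indexed_const k \<in> U i}" for i
  have "ideal (J i) R" for i
  proof (intro idealI ring_axioms)
   note o = opsubD[OF U[rule_format, THEN conjunct1, of i]]
   show "subgroup (J i) (add_monoid R)"
   proof (rule add.subgroupI)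
    have "\<zero> \<in> J i" unfolding J_def using o(2) by (simp add: PR_simps indexed_zero_def)
    thus "J i \<noteq> {}" by blast
    show "\<ominus> a \<in> J i" if "a \<in> J i" for a unfolding J_def using that o(4) neg by (force simp: J_def)
    show "a \<oplus> b \<in> J i" if "a \<in> J i" "b \<in> J i" for a b
     using that o(3)[of "indexed_const a" "indexed_const b"]
     by (auto simp: J_def PR_simps indexed_padd_const)
   qed (auto simp: J_def)
   show *: "x \<otimes> a \<in> J i" if "a \<in> J i" "x \<in> carrier R" for a x
    using that o(5)[of "indexed_const x" "indexed_const a"] mult by (auto simp: J_def cs_def)
   show "a \<otimes> x \<in> J i" if "a \<in> J i" "x \<in> carrier R" for a x
    using *[OF that] that by (simp add: J_def m_comm)
  qed
  moreover have "J i \<subseteq> J (Suc i)" for i using U unfolding J_def by blast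
  ultimately have "\<exists>k. \<forall>i\<ge>k. J i = J k" by (rule noetherian_ring.ideal_seq_stable[OF assms])
  then obtain k where k: "\<forall>i\<ge>k. J i = J k" ..
  have UJ: "U i = indexed_const ` J i" for i using U unfolding J_def cs_def by blast
  have "U i = U k" if "i \<ge> k" for i
   unfolding UJ[of i] UJ[of k] using k[rule_format, OF that] by (rule arg_cong)
  thus "\<exists>k. \<forall>i\<ge>k. U i = U k" by (intro exI allI impI)
 qed
 ultimately have "\<exists>N. cs \<subseteq> N \<and> opsub (cs \<union> xs k) (PR n) N \<and> acc (cs \<union> xs k) (PR n) N"
  if "k \<le> Suc n" for k
  using that
 proof (induction k)
  case 0
  thus ?case by (auto simp: xs_def)
 next
  case (Suc k)
  then obtain N where N: "cs \<subseteq> N" "opsub (cs \<union> xs k) (PR n) N" "acc (cs \<union> xs k) (PR n) N" by auto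
  have K: "cs \<union> xs k \<subseteq> carrier (PR n)" using cc xc Suc.prems by (auto simp: xs_def PR_simps)
  have x: "indexed_var k \<in> carrier (PR n)" using xc Suc.prems by (simp add: PR_simps)
  have "insert (indexed_var k) (cs \<union> xs k) = cs \<union> xs (Suc k)" by (auto simp: xs_def lessThan_Suc)
  with S.acc_adjoin_variable[OF K N(2,3) x] N(1) show ?case by (metis order_trans)
 qed
 then obtain N where N: "cs \<subseteq> N" "opsub (cs \<union> xs (Suc n)) (PR n) N" "acc (cs \<union> xs (Suc n)) (PR n) N"
  by blast
 have "P \<in> N" if "P \<in> polys {0..n}" for P
  using that
 proof (induction rule: polys_const_induct)
  case (const k)
  thus ?case using N(1) by (auto simp: cs_def)
 next
  case (padd P P')
  thus ?case using opsubD(3)[OF N(2)] by (simp add: PR_simps)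
 next
  case (pmult P i)
  have "indexed_pmult P i = indexed_var i \<odot>\<^bsub>PR n\<^esub> P"
   unfolding PR_simps indexed_var_def
   by (simp add: pmul_pmult_left[OF polys_coeff[OF const_polys[OF one_closed]] polys_coeff[OF pmult(1)]]
     pmul_const[OF one_closed polys_coeff[OF pmult(1)]] coeffD[OF polys_coeff[OF pmult(1)]])
  moreover have "indexed_var i \<in> xs (Suc n)" using pmult by (auto simp: xs_def)
  ultimately show ?case using opsubD(5)[OF N(2) _ pmult.IH] by simp
 qed
 hence sub: "carrier (PR n) \<subseteq> N" by (auto simp: PR_simps)
 have ops: "cs \<union> xs (Suc n) \<subseteq> carrier (PR n)" using cc xc by (auto simp: PR_simps xs_def)
 have "acc (carrier (PR n)) (PR n) (carrier (PR n))"
  by (rule acc_mono_ops[OF acc_subset[OF N(3) sub] ops])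
 hence fg: "fin_gen (carrier (PR n)) (PR n) H" if "opsub (carrier (PR n)) (PR n) H" for H
  using acc_fin_gen that opsubD(1)[OF that] by blast
 show ?thesis
 proof (rule S.R.noetherian_ringI)
  fix J assume J: "ideal J (PR n)"
  have op: "opsub (carrier (PR n)) (PR n) H" if "ideal H (PR n)" for H
  proof -
   interpret H: ideal H "PR n" by fact
   show ?thesis using H.I_l_closed H.a_subset unfolding opsub_def by (auto simp: PR_simps(2,6))
  qed
  obtain A where A: "finite A" "A \<subseteq> J" "\<And>H. opsub (carrier (PR n)) (PR n) H \<Longrightarrow> A \<subseteq> H \<Longrightarrow> J \<subseteq> H"
   using fg[OF op[OF J]] unfolding fin_gen_def by blast
  have Ac: "A \<subseteq> carrier (PR n)" using A(2) opsubD(1)[OF op[OF J]] by blast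
  have "J = genideal (PR n) A"
   using A(3)[OF op[OF S.R.genideal_ideal[OF Ac]] S.R.genideal_self[OF Ac]] S.R.genideal_minimal[OF J A(2)] by blast
  thus "\<exists>A\<subseteq>carrier (PR n). finite A \<and> J = genideal (PR n) A" using A(1) Ac by blast
 qed
qed

section \<open>Monomials and the powers of the irrelevant ideal\<close>

lemma mon_polys: "c \<in> carrier R \<Longrightarrow> set_mset a \<subseteq> A \<Longrightarrow> mon R c a \<in> polys A"
 using mon_indexed_pset unfolding indexed_pset_eq[symmetric] .

lemma mon_add_mset: "mon R c (add_mset i a) = indexed_pmult (mon R c a) i"
 by (auto simp: mon_def indexed_pmult_def fun_eq_iff)

lemma mon_empty: "mon R c {#} = indexed_const c"
 by (auto simp: mon_def indexed_const_def)

lemma pmul_mon: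
 assumes "c \<in> carrier R" "d \<in> carrier R"
 shows "pmul (mon R c a) (mon R d b) = mon R (c \<otimes> d) (a + b)"
proof (induction a)
 case empty
 have "pmul (indexed_const c) (mon R d b) = mon R (c \<otimes> d) b"
  using assms by (subst pmul_const[OF assms(1) polys_coeff[OF mon_polys[OF assms(2) subset_UNIV]]])
   (auto simp: mon_def)
 thus ?case by (simp add: mon_empty)
next
 case (add i a)
 thus ?case
  using assms by (simp add: mon_add_mset pmul_pmult_left polys_coeff[OF mon_polys[OF _ subset_UNIV]])
qed

lemma var_mon: "indexed_var i = mon R \<one> {#i#}"
proof -
 have "mon R \<one> {#} = indexed_const \<one>" by (auto simp: mon_def indexed_const_def)
 thus ?thesis unfolding indexed_var_def mon_add_mset by (rule arg_cong[OF sym])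
qed

lemma var_pow: "i \<le> n \<Longrightarrow> indexed_var i [^]\<^bsub>PR n\<^esub> (r::nat) = mon R \<one> (replicate_mset r i)"
proof (induction r)
 case 0
 interpret S: cring "PR n" by (rule cring_PR)
 show ?case by (auto simp: PR_simps mon_def indexed_const_def)
next
 case (Suc r)
 interpret S: cring "PR n" by (rule cring_PR)
 show ?case using Suc by (simp add: PR_simps var_mon pmul_mon)
qed

text \<open>The polynomials of order at least \<open>l\<close>: a monomial description of the l-th
  power of the irrelevant ideal.\<close>

definition ord_ge :: "nat \<Rightarrow> nat \<Rightarrow> (nat multiset \<Rightarrow> 'a) set" where
 "ord_ge n l = {P \<in> polys {0..n}. \<forall>m. P m \<noteq> \<zero> \<longrightarrow> l \<le> size m}"

lemma ord_ge_ideal: "ideal (ord_ge n l) (PR n)"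
proof -
 interpret S: cring "PR n" by (rule cring_PR)
 have mul: "P \<otimes>\<^bsub>PR n\<^esub> Q \<in> ord_ge n l" if "Q \<in> ord_ge n l" "P \<in> carrier (PR n)" for P Q
 proof -
  have c: "P \<in> polys {0..n}" "Q \<in> polys {0..n}" using that by (auto simp: ord_ge_def PR_simps)
  have "l \<le> size m" if nz: "pmul P Q m \<noteq> \<zero>" for m
  proof -
   obtain a b where "m = a + b" "Q b \<noteq> \<zero>" using pmul_nonzero[OF nz polys_coeff[OF c(1)] polys_coeff[OF c(2)]] by blast
   thus ?thesis using \<open>Q \<in> ord_ge n l\<close> by (auto simp: ord_ge_def)
  qed
  thus ?thesis using pmul_polys[OF c] by (simp add: ord_ge_def PR_simps)
 qed
 have add: "P \<oplus>\<^bsub>PR n\<^esub> Q \<in> ord_ge n l" if "P \<in> ord_ge n l" "Q \<in> ord_ge n l" for P Q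
 proof -
  have "l \<le> size m" if "indexed_padd P Q m \<noteq> \<zero>" for m
  proof -
   have "P m \<noteq> \<zero> \<or> Q m \<noteq> \<zero>" using that by (auto simp: indexed_padd_def)
   thus ?thesis using \<open>P \<in> ord_ge n l\<close> \<open>Q \<in> ord_ge n l\<close> by (auto simp: ord_ge_def)
  qed
  thus ?thesis using that padd_polys by (auto simp: ord_ge_def PR_simps)
 qed
 have sub: "ord_ge n l \<subseteq> carrier (PR n)" by (auto simp: ord_ge_def PR_simps)
 have neg: "\<ominus>\<^bsub>PR n\<^esub> P \<in> ord_ge n l" if "P \<in> ord_ge n l" for P
  using mul[OF that, of "\<ominus>\<^bsub>PR n\<^esub> \<one>\<^bsub>PR n\<^esub>"] sub that by (auto simp: S.l_minus)
 show ?thesis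
 proof (intro idealI S.ring_axioms S.add.subgroupI)
  have "\<zero>\<^bsub>PR n\<^esub> \<in> ord_ge n l" using S.zero_closed[of ] by (simp add: ord_ge_def PR_simps)
  thus "ord_ge n l \<noteq> {}" by blast
  show "P \<otimes>\<^bsub>PR n\<^esub> Q \<in> ord_ge n l" if "P \<in> ord_ge n l" "Q \<in> carrier (PR n)" for P Q
   using mul[OF that] sub that by (simp add: S.m_comm subset_iff)
 qed (use sub mul add neg in \<open>auto simp: a_inv_def[symmetric]\<close>)
qed

text \<open>Applied to ideals and, with \<open>K\<close> empty, to the additive span of the
  homogeneous components of degree at least \<open>l\<close>.\<close>

lemma ord_ge_span:
 assumes "opsub K (PR n) H" "\<And>c a. c \<in> carrier R \<Longrightarrow> set_mset a \<subseteq> {0..n} \<Longrightarrow> l \<le> size a \<Longrightarrow> mon R c a \<in> H"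
 shows "ord_ge n l \<subseteq> H"
proof
 fix P assume "P \<in> ord_ge n l"
 hence P: "P \<in> polys {0..n}" "\<And>m. P m \<noteq> \<zero> \<Longrightarrow> l \<le> size m" by (auto simp: ord_ge_def)
 from P(1) show "P \<in> H"
 proof (induction rule: polys_induct)
  case zero
  thus ?case using opsubD(2)[OF assms(1)] by (simp add: PR_simps)
 next
  case (mon a)
  thus ?case using assms(2) P coeffD[OF polys_coeff[OF P(1)]] by blast
 next
  case (add P Q)
  thus ?case using opsubD(3)[OF assms(1)] by (simp add: PR_simps)
 qed
qed

lemma ideal_opsub: "ideal H (PR n) \<Longrightarrow> opsub (carrier (PR n)) (PR n) H"
proof -
 assume "ideal H (PR n)"
 then interpret H: ideal H "PR n" .
 show ?thesis using H.I_l_closed H.a_subset unfolding opsub_def by (auto simp: PR_simps(2,6))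
qed

lemma irrelevant_ideal_ideal: "ideal (irrelevant_ideal R n) (PR n)"
 and var_irrelevant: "i \<le> n \<Longrightarrow> indexed_var i \<in> irrelevant_ideal R n"
 and irrelevant_ideal_subset: "irrelevant_ideal R n \<subseteq> ord_ge n 1"
proof -
 interpret S: cring "PR n" by (rule cring_PR)
 have c: "indexed_var ` {0..n} \<subseteq> carrier (PR n)"
  using mon_polys[OF one_closed, of "{#i#}" "{0..n}" for i] by (auto simp: PR_simps var_mon)
 show "ideal (irrelevant_ideal R n) (PR n)" unfolding irrelevant_ideal_def by (rule S.genideal_ideal[OF c])
 show "indexed_var i \<in> irrelevant_ideal R n" if "i \<le> n"
  unfolding irrelevant_ideal_def using S.genideal_self[OF c] that by auto
 show "irrelevant_ideal R n \<subseteq> ord_ge n 1" unfolding irrelevant_ideal_def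
  using mon_polys[OF one_closed, of "{#i#}" "{0..n}" for i]
  by (intro S.genideal_minimal ord_ge_ideal) (auto simp: ord_ge_def var_mon, simp add: mon_def split: if_splits)
qed

text \<open>The order of a product is at least the sum of the orders; conversely, a monomial of
  degree above \<open>l\<close> splits off one variable.\<close>

lemma irrelevant_power_eq: "irrelevant_power R n l = ord_ge n l"
proof (induction l)
 case 0
 show ?case by (simp add: ord_ge_def PR_simps)
next
 case (Suc l)
 interpret S: cring "PR n" by (rule cring_PR)
 let ?M = "irrelevant_ideal R n"
 have id: "ideal (ideal_prod (PR n) ?M (ord_ge n l)) (PR n)"
  by (intro S.ideal_prod_is_ideal irrelevant_ideal_ideal ord_ge_ideal)
 have "ideal_prod (PR n) ?M (ord_ge n l) \<subseteq> ord_ge n (Suc l)"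
 proof
  fix P assume "P \<in> ideal_prod (PR n) ?M (ord_ge n l)"
  thus "P \<in> ord_ge n (Suc l)"
  proof (induction rule: ideal_prod.induct)
   case (prod P Q)
   hence "P \<in> ord_ge n 1" using irrelevant_ideal_subset by blast
   hence P: "P \<in> polys {0..n}" "\<And>m. P m \<noteq> \<zero> \<Longrightarrow> 1 \<le> size m" by (auto simp: ord_ge_def)
   have Q: "Q \<in> polys {0..n}" "\<And>m. Q m \<noteq> \<zero> \<Longrightarrow> l \<le> size m" using prod by (auto simp: ord_ge_def)
   have "Suc l \<le> size m" if nz: "pmul P Q m \<noteq> \<zero>" for m
   proof -
    obtain a b where "m = a + b" "P a \<noteq> \<zero>" "Q b \<noteq> \<zero>"
     using pmul_nonzero[OF nz polys_coeff[OF P(1)] polys_coeff[OF Q(1)]] by blast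
    thus ?thesis using P(2) Q(2) by fastforce
   qed
   thus ?case using pmul_polys[OF P(1) Q(1)] by (simp add: ord_ge_def PR_simps)
  next
   case (sum P Q)
   thus ?case using opsubD(3)[OF ideal_opsub[OF ord_ge_ideal]] by blast
  qed
 qed
 moreover have "ord_ge n (Suc l) \<subseteq> ideal_prod (PR n) ?M (ord_ge n l)"
 proof (rule ord_ge_span[OF ideal_opsub[OF id]])
  fix c and a :: "nat multiset" assume a: "c \<in> carrier R" "set_mset a \<subseteq> {0..n}" "Suc l \<le> size a"
  then obtain i b where b: "a = add_mset i b" by (metis Suc_le_D size_eq_Suc_imp_eq_union)
  have "mon R c b \<in> ord_ge n l" unfolding ord_ge_def using a b mon_polys[of c b "{0..n}"] by (auto simp: mon_def)
  moreover have "indexed_var i \<in> ?M" using var_irrelevant a b by simp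
  moreover have "mon R c a = indexed_var i \<otimes>\<^bsub>PR n\<^esub> mon R c b" using a b by (simp add: PR_simps var_mon pmul_mon)
  ultimately show "mon R c a \<in> ideal_prod (PR n) ?M (ord_ge n l)" using ideal_prod.prod by metis
 qed
 ultimately show ?case using Suc by simp
qed

lemma standard_graded_PR:
 assumes "noetherian_ring R"
 shows "standard_graded (PR n) n indexed_var (irrelevant_power R n)"
proof (rule standard_graded.intro)
 interpret S: cring "PR n" by (rule cring_PR)
 interpret G: graded_module "PR n" "PR n" by (rule graded_PR)
 show "graded_module (PR n) (PR n)" by (rule graded_PR)
 show "noetherian_ring (PR n)" by (rule noetherian_PR[OF assms])
 show "P \<odot>\<^bsub>PR n\<^esub> Q = P \<otimes>\<^bsub>PR n\<^esub> Q" for P Q by (simp add: PR_simps)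
 show "hcomp (PR n) i = {\<zero>\<^bsub>PR n\<^esub>}" if "i < 0" for i
 proof -
  have "P m = \<zero>" if "P \<in> hcomp (PR n) i" for P m
  proof (rule ccontr)
   assume "P m \<noteq> \<zero>"
   hence "int (size m) = i" using that by (simp add: PR_simps)
   thus False using \<open>i < 0\<close> by simp
  qed
  hence "P = \<zero>\<^bsub>PR n\<^esub>" if "P \<in> hcomp (PR n) i" for P using that unfolding PR_simps(4) by (intro ext)
  thus ?thesis using G.G.hcompD(2)[of i] by blast
 qed
 show "infinite (carrier (PR n))" if "\<one>\<^bsub>PR n\<^esub> \<noteq> \<zero>\<^bsub>PR n\<^esub>"
 proof -
  have "\<one> \<noteq> \<zero>" using that by (auto simp: PR_simps indexed_const_def)
  \<comment> \<open>The powers of one variable are pairwise distinct, as their exponent multisets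
    have different sizes.\<close>
  hence "inj (\<lambda>r. mon R \<one> (replicate_mset r (0::nat)))"
   by (intro injI) (metis mon_def size_replicate_mset)
  moreover have "range (\<lambda>r. mon R \<one> (replicate_mset r 0)) \<subseteq> carrier (PR n)"
   by (auto simp: PR_simps intro!: mon_polys split: if_splits)
  ultimately show ?thesis using finite_subset range_inj_infinite by blast
 qed
 show "opsub (carrier (PR n)) (PR n) (irrelevant_power R n l)" for l
  unfolding irrelevant_power_eq by (rule ideal_opsub[OF ord_ge_ideal])
 have mon_hcomp: "mon R c a \<in> hcomp (PR n) (int (size a))" if "c \<in> carrier R" "set_mset a \<subseteq> {0..n}" for c a
  using mon_polys[OF that] by (simp add: PR_simps mon_def)
 show "irrelevant_power R n l \<subseteq> hspan (PR n) {int l..}" for l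
  unfolding irrelevant_power_eq
 proof (rule ord_ge_span[where K = "{}"])
  show "opsub {} (PR n) (hspan (PR n) {int l..})"
   using G.G.hspan_carrier G.G.zero_hspan G.G.hspan_add G.G.hspan_neg unfolding opsub_def by blast
  show "mon R c a \<in> hspan (PR n) {int l..}" if "c \<in> carrier R" "set_mset a \<subseteq> {0..n}" "l \<le> size a" for c a
   using G.G.hcomp_hspan[OF _ mon_hcomp] that by simp
 qed
 show "hcomp (PR n) i \<subseteq> irrelevant_power R n l" if "int l \<le> i" for l i
  unfolding irrelevant_power_eq using that by (auto simp: PR_simps ord_ge_def)
 show "indexed_var j \<in> hcomp (PR n) 1" if "j \<le> n" for j
  using mon_hcomp[OF one_closed, of "{#j#}"] that by (simp add: var_mon)
 show "irrelevant_power R n (a + b) \<subseteq> H" if H: "opsub (carrier (PR n)) (PR n) H"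
  and prod: "\<And>s t. s \<in> irrelevant_power R n a \<Longrightarrow> t \<in> irrelevant_power R n b \<Longrightarrow> s \<otimes>\<^bsub>PR n\<^esub> t \<in> H" for H a b
  unfolding irrelevant_power_eq
 proof (rule ord_ge_span[OF H])
  fix c and m :: "nat multiset" assume m: "c \<in> carrier R" "set_mset m \<subseteq> {0..n}" "a + b \<le> size m"
  \<comment> \<open>Listing the variables of \<open>m\<close> splits it into a factor of degree
    exactly \<open>a\<close> and a remainder of degree at least \<open>b\<close>.\<close>
  obtain ys where "mset ys = m" using ex_mset by blast
  hence "m = mset (take a ys) + mset (drop a ys)" "size (mset (take a ys)) = a"
   using m(3) by (auto simp: mset_append[symmetric] simp del: mset_append)
  then obtain u v where uv: "m = u + v" "size u = a" by blast
  have "mon R \<one> u \<in> ord_ge n a" "mon R c v \<in> ord_ge n b"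
   using m uv mon_polys[of \<one> u "{0..n}"] mon_polys[of c v "{0..n}"] by (auto simp: ord_ge_def mon_def)
  hence "mon R \<one> u \<otimes>\<^bsub>PR n\<^esub> mon R c v \<in> H" using prod unfolding irrelevant_power_eq by blast
  thus "mon R c m \<in> H" using m uv by (simp add: PR_simps pmul_mon)
 qed
 show "\<exists>l. irrelevant_power R n l \<subseteq> H" if H: "opsub (carrier (PR n)) (PR n) H"
  and var: "\<And>j. j \<le> n \<Longrightarrow> \<exists>r :: nat. indexed_var j [^]\<^bsub>PR n\<^esub> r \<in> H" for H
 proof -
  obtain r :: "nat \<Rightarrow> nat" where r: "\<And>j. j \<le> n \<Longrightarrow> indexed_var j [^]\<^bsub>PR n\<^esub> r j \<in> H" using var by metis
  \<comment> \<open>By pigeonhole, a monomial whose degree exceeds the sum of the exponents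
    \<open>r j\<close> contains some variable \<open>j\<close> at least \<open>r j\<close>
    times.\<close>
  define l where "l = (\<Sum>j\<le>n. r j) + 1"
  have "ord_ge n l \<subseteq> H"
  proof (rule ord_ge_span[OF H])
   fix c and m :: "nat multiset" assume m: "c \<in> carrier R" "set_mset m \<subseteq> {0..n}" "l \<le> size m"
   have "\<exists>j\<le>n. r j \<le> count m j"
   proof (rule ccontr)
    assume "\<not> ?thesis"
    hence "count m j \<le> r j" if "j \<le> n" for j using that by (meson nat_le_linear)
    hence "sum (count m) {0..n} \<le> (\<Sum>j\<le>n. r j)" unfolding atLeast0AtMost by (intro sum_mono) simp
    moreover have "size m = sum (count m) {0..n}"
     unfolding size_multiset_overloaded_eq using m(2) by (intro sum.mono_neutral_left) (auto simp: not_in_iff)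
    ultimately show False using m(3) unfolding l_def by simp
   qed
   then obtain j where j: "j \<le> n" "replicate_mset (r j) j \<subseteq># m" using count_le_replicate_mset_subset_eq by metis
   then obtain v where v: "m = v + replicate_mset (r j) j" by (metis mset_subset_eq_exists_conv add.commute)
   have "mon R c v \<odot>\<^bsub>PR n\<^esub> (indexed_var j [^]\<^bsub>PR n\<^esub> r j) \<in> H"
    using m v mon_polys[of c v "{0..n}"] by (intro opsubD(5)[OF H _ r[OF j(1)]]) (simp add: PR_simps)
   thus "mon R c m \<in> H" using m v j by (simp add: var_pow) (simp add: PR_simps pmul_mon)
  qed
  thus ?thesis unfolding irrelevant_power_eq by blast
 qed
qed

end

section \<open>Graded modules over a standard graded ring\<close>

lemma (in abelian_group) a_inv_zero [simp]: "\<ominus> \<zero> = \<zero>"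
 by (rule minus_equality) simp_all

lemma (in abelian_group) minus_zero_right [simp]: "x \<in> carrier G \<Longrightarrow> x \<ominus> \<zero> = x"
 by (simp add: a_minus_def)

lemma (in abelian_group) minus_self [simp]: "x \<in> carrier G \<Longrightarrow> x \<ominus> x = \<zero>"
 by (simp add: a_minus_def r_neg)

lemma (in abelian_group) minus_eq_zero_iff: "x \<in> carrier G \<Longrightarrow> y \<in> carrier G \<Longrightarrow> x \<ominus> y = \<zero> \<longleftrightarrow> x = y"
 using add_minus_cancel[of x y] by auto

definition sub_gm :: "('a, 'b) graded_module \<Rightarrow> 'b set \<Rightarrow> ('a, 'b) graded_module" where
 "sub_gm M H = M\<lparr>carrier := H, hcomp := (\<lambda>i. hcomp M i \<inter> H)\<rparr>"

text \<open>Transport of structure along a map that may identify elements: it yields quotients when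
  the fibres are cosets, and isomorphic copies such as \<open>univ_copy\<close> when
  \<open>\<theta>\<close> is injective.\<close>

definition image_gm :: "('b \<Rightarrow> 'c) \<Rightarrow> ('a, 'b) graded_module \<Rightarrow> ('a, 'c) graded_module" where
 "image_gm \<theta> M = \<lparr>
  carrier = \<theta> ` carrier M,
  monoid.mult = undefined, one = undefined,
  zero = \<theta> \<zero>\<^sub>M,
  add = (\<lambda>x y. \<theta> (inv_into (carrier M) \<theta> x \<oplus>\<^sub>M inv_into (carrier M) \<theta> y)),
  smult = (\<lambda>r x. \<theta> (r \<odot>\<^sub>M inv_into (carrier M) \<theta> x)),
  hcomp = (\<lambda>i. \<theta> ` hcomp M i)\<rparr>"

definition prod_gm :: "('a, 'b) graded_module \<Rightarrow> ('a, 'c) graded_module \<Rightarrow> ('a, 'b \<times> 'c) graded_module" where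
 "prod_gm M N = \<lparr>
  carrier = carrier M \<times> carrier N,
  monoid.mult = undefined, one = undefined,
  zero = (\<zero>\<^sub>M, \<zero>\<^sub>N),
  add = (\<lambda>x y. (fst x \<oplus>\<^sub>M fst y, snd x \<oplus>\<^sub>N snd y)),
  smult = (\<lambda>r x. (r \<odot>\<^sub>M fst x, r \<odot>\<^sub>N snd x)),
  hcomp = (\<lambda>i. hcomp M i \<times> hcomp N i)\<rparr>"

definition trivial_gm :: "'b \<Rightarrow> ('a, 'b) graded_module" where
 "trivial_gm z = \<lparr>carrier = {z}, monoid.mult = undefined, one = undefined, zero = z,
  add = (\<lambda>_ _. z), smult = (\<lambda>_ _. z), hcomp = (\<lambda>_. {z})\<rparr>"

lemma univ_copy_eq: "univ_copy M = image_gm (to_univ M) M"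
 by (simp add: univ_copy_def image_gm_def from_univ_def)

sublocale standard_graded \<subseteq> S: graded_module S S
 by (rule graded_S)

section \<open>Homogeneous submodules and graded homomorphisms\<close>

context standard_graded begin

abbreviation "ghom \<equiv> graded_hom S"

abbreviation "sub \<equiv> opsub (carrier S)"

definition hsub :: "('a, 'b) graded_module \<Rightarrow> 'b set \<Rightarrow> bool" where
 "hsub M H \<longleftrightarrow> sub M H \<and> (\<forall>x\<in>H. \<forall>i. pr M i x \<in> H)"

text \<open>Membership in the category in elementary terms, see \<open>Ob_iff\<close>: finite
  generation stands for finite presentation, and vanishing below \<open>d\<close> for
  \<open>M = trunc d M\<close>.\<close>

definition gobj :: "int \<Rightarrow> ('a, 'b) graded_module \<Rightarrow> bool" where
 "gobj d M \<longleftrightarrow> graded_module S M \<and> fin_gen (carrier S) M (carrier M) \<and> (\<forall>i<d. hcomp M i = {\<zero>\<^sub>M})"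

lemma gobjD:
 assumes "gobj d M"
 shows "graded_module S M" "fin_gen (carrier S) M (carrier M)" "i < d \<Longrightarrow> hcomp M i = {\<zero>\<^sub>M}"
 using assms by (auto simp: gobj_def)

lemma hsubD:
 assumes "hsub M H"
 shows "sub M H" "x \<in> H \<Longrightarrow> pr M i x \<in> H"
 using assms by (auto simp: hsub_def)

lemma gobj_sub_fin_gen:
 assumes "gobj d M" "sub M H"
 shows "fin_gen (carrier S) M H"
proof -
 interpret M: graded_module S M using gobjD[OF assms(1)] by blast
 show ?thesis using M.fin_gen_submodule[OF noeth_S gobjD(2)[OF assms(1)] assms(2)] .
qed

lemma ghomI:
 assumes "\<phi> \<in> extensional (carrier M)" "\<And>x. x \<in> carrier M \<Longrightarrow> \<phi> x \<in> carrier N"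
  "\<And>x y. x \<in> carrier M \<Longrightarrow> y \<in> carrier M \<Longrightarrow> \<phi> (x \<oplus>\<^sub>M y) = \<phi> x \<oplus>\<^sub>N \<phi> y"
  "\<And>r x. r \<in> carrier S \<Longrightarrow> x \<in> carrier M \<Longrightarrow> \<phi> (r \<odot>\<^sub>M x) = r \<odot>\<^sub>N \<phi> x"
  "\<And>i x. x \<in> hcomp M i \<Longrightarrow> \<phi> x \<in> hcomp N i"
 shows "\<phi> \<in> ghom M N"
 using assms unfolding graded_hom_def lin_hom_def by (auto simp: PiE_def)

lemma ghom_restrictI:
 assumes "graded_module S M" "\<And>x. x \<in> carrier M \<Longrightarrow> \<phi> x \<in> carrier N"
  "\<And>x y. x \<in> carrier M \<Longrightarrow> y \<in> carrier M \<Longrightarrow> \<phi> (x \<oplus>\<^sub>M y) = \<phi> x \<oplus>\<^sub>N \<phi> y"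
  "\<And>r x. r \<in> carrier S \<Longrightarrow> x \<in> carrier M \<Longrightarrow> \<phi> (r \<odot>\<^sub>M x) = r \<odot>\<^sub>N \<phi> x"
  "\<And>i x. x \<in> hcomp M i \<Longrightarrow> \<phi> x \<in> hcomp N i"
 shows "restrict \<phi> (carrier M) \<in> ghom M N"
proof -
 interpret M: graded_module S M by fact
 show ?thesis using assms by (intro ghomI) (auto dest: M.G.hcompD(1))
qed

lemma ghomD:
 assumes "\<phi> \<in> ghom M N"
 shows "x \<in> carrier M \<Longrightarrow> \<phi> x \<in> carrier N"
  "x \<in> carrier M \<Longrightarrow> y \<in> carrier M \<Longrightarrow> \<phi> (x \<oplus>\<^sub>M y) = \<phi> x \<oplus>\<^sub>N \<phi> y"
  "r \<in> carrier S \<Longrightarrow> x \<in> carrier M \<Longrightarrow> \<phi> (r \<odot>\<^sub>M x) = r \<odot>\<^sub>N \<phi> x"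
  "x \<in> hcomp M i \<Longrightarrow> \<phi> x \<in> hcomp N i"
  "\<phi> \<in> extensional (carrier M)"
 using assms unfolding graded_hom_def lin_hom_def by (auto simp: PiE_def image_subset_iff)

lemma ghom_zero:
 assumes "graded_module S M" "graded_module S N" "\<phi> \<in> ghom M N"
 shows "\<phi> \<zero>\<^sub>M = \<zero>\<^sub>N" "x \<in> carrier M \<Longrightarrow> \<phi> (\<ominus>\<^sub>M x) = \<ominus>\<^sub>N \<phi> x"
  "x \<in> carrier M \<Longrightarrow> y \<in> carrier M \<Longrightarrow> \<phi> (x \<ominus>\<^sub>M y) = \<phi> x \<ominus>\<^sub>N \<phi> y"
  "x \<in> carrier M \<Longrightarrow> pr N i (\<phi> x) = \<phi> (pr M i x)"
proof -
 interpret M: graded_module S M by fact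
 interpret N: graded_module S N by fact
 note h = ghomD[OF assms(3)]
 show z: "\<phi> \<zero>\<^sub>M = \<zero>\<^sub>N" using h(3)[of "\<zero>\<^sub>S" "\<zero>\<^sub>M"] h(1)[of "\<zero>\<^sub>M"] by simp
 show n: "\<phi> (\<ominus>\<^sub>M x) = \<ominus>\<^sub>N \<phi> x" if "x \<in> carrier M" for x
 proof (rule N.M.minus_equality[symmetric])
  show "\<phi> (\<ominus>\<^sub>M x) \<oplus>\<^sub>N \<phi> x = \<zero>\<^sub>N"
   using h(2)[of "\<ominus>\<^sub>M x" x] that z by (simp add: M.M.l_neg)
 qed (use that h in auto)
 show "\<phi> (x \<ominus>\<^sub>M y) = \<phi> x \<ominus>\<^sub>N \<phi> y" if "x \<in> carrier M" "y \<in> carrier M" for x y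
  using that h(2)[of x "\<ominus>\<^sub>M y"] n by (simp add: a_minus_def)
 show "pr N i (\<phi> x) = \<phi> (pr M i x)" if "x \<in> carrier M" for x
  by (rule pr_hom[OF assms(1,2)]) (use h that in auto)
qed

lemma ghom_inj_iff:
 assumes "graded_module S M" "graded_module S N" "\<phi> \<in> ghom M N"
 shows "inj_on \<phi> (carrier M) \<longleftrightarrow> (\<forall>x\<in>carrier M. \<phi> x = \<zero>\<^sub>N \<longrightarrow> x = \<zero>\<^sub>M)"
proof -
 interpret M: graded_module S M by fact
 interpret N: graded_module S N by fact
 note h = ghomD[OF assms(3)] and z = ghom_zero[OF assms]
 show ?thesis
 proof
  assume "inj_on \<phi> (carrier M)"
  thus "\<forall>x\<in>carrier M. \<phi> x = \<zero>\<^sub>N \<longrightarrow> x = \<zero>\<^sub>M" using z(1) by (metis M.M.zero_closed inj_onD)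
 next
  assume *: "\<forall>x\<in>carrier M. \<phi> x = \<zero>\<^sub>N \<longrightarrow> x = \<zero>\<^sub>M"
  show "inj_on \<phi> (carrier M)"
  proof (rule inj_onI)
   fix x y assume xy: "x \<in> carrier M" "y \<in> carrier M" "\<phi> x = \<phi> y"
   hence "\<phi> (x \<ominus>\<^sub>M y) = \<zero>\<^sub>N" using z(3) h(1) by (simp add: a_minus_def N.M.r_neg)
   hence "x \<ominus>\<^sub>M y = \<zero>\<^sub>M" using * xy by simp
   thus "x = y" using xy M.M.add_minus_cancel[of x y] by simp
  qed
 qed
qed

text \<open>The projection of \<open>x\<close> to degree \<open>i\<close> has the same image as
  \<open>x\<close>.\<close>

lemma ghom_homog_inj:
 assumes "graded_module S M" "graded_module S N" "\<phi> \<in> ghom M N" "inj_on \<phi> (carrier M)"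
  "x \<in> carrier M" "\<phi> x \<in> hcomp N i"
 shows "x \<in> hcomp M i"
proof -
 interpret M: graded_module S M by fact
 interpret N: graded_module S N by fact
 have "\<phi> (pr M i x) = \<phi> x"
  using ghom_zero(4)[OF assms(1-3,5), of i] N.pr_homog[OF assms(6), of i] by simp
 hence "pr M i x = x" using assms(4,5) by (simp add: inj_on_eq_iff)
 thus ?thesis using M.pr(1)[OF assms(5), of i] by simp
qed

lemma hsub_kernel:
 assumes "graded_module S M" "graded_module S N" "\<phi> \<in> ghom M N"
 shows "hsub M {x \<in> carrier M. \<phi> x = \<zero>\<^sub>N}"
proof -
 interpret M: graded_module S M by fact
 interpret N: graded_module S N by fact
 note h = ghomD[OF assms(3)] and z = ghom_zero[OF assms]
 have "sub M {x \<in> carrier M. \<phi> x = \<zero>\<^sub>N}"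
  by (rule M.opsub_submoduleI) (auto simp: z h)
 thus ?thesis unfolding hsub_def using z(4) N.pr_zero by (auto simp: z(4)[symmetric])
qed

lemma hsub_image:
 assumes "graded_module S M" "graded_module S N" "\<phi> \<in> ghom M N" "hsub M H"
 shows "hsub N (\<phi> ` H)"
proof -
 interpret M: graded_module S M by fact
 interpret N: graded_module S N by fact
 note h = ghomD[OF assms(3)] and z = ghom_zero[OF assms(1-3)]
 note H = hsubD[OF assms(4)] and o = opsubD[OF hsubD(1)[OF assms(4)]]
 have "sub N (\<phi> ` H)"
 proof (rule N.opsub_submoduleI)
  show "\<phi> ` H \<subseteq> carrier N" using h(1) o(1) by blast
  show "\<zero>\<^sub>N \<in> \<phi> ` H" using z(1) o(2) by (metis imageI)
  show "x \<oplus>\<^sub>N y \<in> \<phi> ` H" if "x \<in> \<phi> ` H" "y \<in> \<phi> ` H" for x y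
  proof -
   obtain a b where "x = \<phi> a" "y = \<phi> b" "a \<in> H" "b \<in> H"
    using \<open>x \<in> \<phi> ` H\<close> \<open>y \<in> \<phi> ` H\<close> by blast
   thus ?thesis using h(2)[of a b] o(3,7) by (metis imageI)
  qed
  show "r \<odot>\<^sub>N x \<in> \<phi> ` H" if "r \<in> carrier S" "x \<in> \<phi> ` H" for r x
  proof -
   obtain a where "x = \<phi> a" "a \<in> H" using \<open>x \<in> \<phi> ` H\<close> by blast
   thus ?thesis using h(3)[OF that(1), of a] o(5,7) that(1) by (metis imageI)
  qed
 qed
 moreover have "pr N i (\<phi> a) \<in> \<phi> ` H" if "a \<in> H" for a i
  using z(4)[of a i] H(2)[OF that] o(7)[OF that] by simp
 ultimately show ?thesis unfolding hsub_def by blast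
qed

lemma hsub_carrier: "graded_module S M \<Longrightarrow> hsub M (carrier M)"
proof -
 assume "graded_module S M"
 then interpret M: graded_module S M .
 show ?thesis unfolding hsub_def using M.opsub_carrier by auto
qed

lemma sub_gm_simps [simp]:
 "carrier (sub_gm M H) = H" "\<zero>\<^bsub>sub_gm M H\<^esub> = \<zero>\<^sub>M" "x \<oplus>\<^bsub>sub_gm M H\<^esub> y = x \<oplus>\<^sub>M y"
 "r \<odot>\<^bsub>sub_gm M H\<^esub> x = r \<odot>\<^sub>M x" "hcomp (sub_gm M H) i = hcomp M i \<inter> H"
 by (simp_all add: sub_gm_def)

text \<open>Homogeneity of \<open>H\<close> keeps the decomposition of its elements inside
  \<open>H\<close>.\<close>

lemma graded_sub_gm:
 assumes "graded_module S M" "hsub M H"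
 shows "graded_module S (sub_gm M H)"
proof -
 interpret M: graded_module S M by fact
 note H = hsubD[OF assms(2)] and o = opsubD[OF hsubD(1)[OF assms(2)]]
 have "module S (M\<lparr>carrier := H\<rparr>)"
  using submodule.submodule_is_module[of H S M] M.submodule_iff_opsub H(1) M.module_axioms by blast
 hence mod: "module S (sub_gm M H)"
  by (auto simp: module_def module_axioms_def abelian_group_def abelian_monoid_def abelian_group_axioms_def sub_gm_def)
 interpret N: module S "sub_gm M H" by fact
 have neg: "\<ominus>\<^bsub>sub_gm M H\<^esub> x = \<ominus>\<^sub>M x" if "x \<in> H" for x
  using that o(4,7) by (intro N.M.minus_equality) (auto simp: M.M.l_neg)
 have fin: "(\<Oplus>\<^bsub>sub_gm M H\<^esub>i\<in>F. f i) = (\<Oplus>\<^sub>M i\<in>F. f i)" if "\<And>i. i \<in> F \<Longrightarrow> f i \<in> H" for F :: "int set" and f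
  using hom_finsum[OF N.M.abelian_group_axioms M.M.abelian_group_axioms, of "\<lambda>x. x" F f] o(7) that by simp
 show ?thesis
 proof (rule graded_moduleI[OF mod])
  show "subgroup (hcomp (sub_gm M H) i) (add_monoid (sub_gm M H))" for i
  proof (rule N.M.add.subgroupI)
   show "hcomp (sub_gm M H) i \<noteq> {}" using M.G.hcompD(2) o(2) by auto
   show "\<ominus>\<^bsub>sub_gm M H\<^esub> x \<in> hcomp (sub_gm M H) i" if "x \<in> hcomp (sub_gm M H) i" for x
    using that neg M.G.hcompD(4) o(4) by auto
   show "x \<oplus>\<^bsub>sub_gm M H\<^esub> y \<in> hcomp (sub_gm M H) i"
    if "x \<in> hcomp (sub_gm M H) i" "y \<in> hcomp (sub_gm M H) i" for x y
    using that M.G.hcompD(3) o(3) by auto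
  qed auto
  show "carrier (sub_gm M H) \<subseteq> hspan (sub_gm M H) UNIV"
  proof
   fix x assume "x \<in> carrier (sub_gm M H)"
   hence x: "x \<in> H" "x \<in> carrier M" using o(7) by auto
   have "x = (\<Oplus>\<^bsub>sub_gm M H\<^esub>i\<in>{i. pr M i x \<noteq> \<zero>\<^sub>M}. pr M i x)"
    using M.pr(3)[OF x(2)] fin[of _ "\<lambda>i. pr M i x"] H(2)[OF x(1)] by simp
   thus "x \<in> hspan (sub_gm M H) UNIV"
    unfolding hspan_def using M.pr(1,2)[OF x(2)] H(2)[OF x(1)] by auto
  qed
  show "\<forall>i\<in>F. f i = \<zero>\<^bsub>sub_gm M H\<^esub>" if F: "finite F" "\<And>i. i \<in> F \<Longrightarrow> f i \<in> hcomp (sub_gm M H) i"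
   "(\<Oplus>\<^bsub>sub_gm M H\<^esub>i\<in>F. f i) = \<zero>\<^bsub>sub_gm M H\<^esub>" for F :: "int set" and f
  proof
   fix i assume i: "i \<in> F"
   have "(\<Oplus>\<^sub>M i\<in>F. f i) = \<zero>\<^sub>M" using F(3) fin[of F f] F(2) by simp
   from M.pr_unique[OF F(1) _ this[symmetric], of i] show "f i = \<zero>\<^bsub>sub_gm M H\<^esub>" using F(2) i by simp
  qed
 qed (use M.smult_hcomp o(5) S.G.hcompD(1) in auto)
qed

lemma incl_hom:
 assumes "graded_module S M" "hsub M H"
 shows "(\<lambda>x\<in>H. x) \<in> ghom (sub_gm M H) M"
 using opsubD[OF hsubD(1)[OF assms(2)]] by (intro ghomI) auto

lemma pr_sub_gm:
 assumes "graded_module S M" "hsub M H" "x \<in> H"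
 shows "pr (sub_gm M H) i x = pr M i x"
proof -
 interpret N: graded_module S "sub_gm M H" by (rule graded_sub_gm[OF assms(1,2)])
 have "pr (sub_gm M H) i x \<in> H" using N.pr_carrier[of x i] assms(3) by simp
 thus ?thesis using ghom_zero(4)[OF graded_sub_gm[OF assms(1,2)] assms(1) incl_hom[OF assms(1,2)], of x i] assms(3)
  by simp
qed

lemma gobj_sub_gm:
 assumes "gobj d M" "hsub M H"
 shows "gobj d (sub_gm M H)"
proof -
 note M = gobjD[OF assms(1)]
 interpret M: graded_module S M by (rule M(1))
 interpret N: graded_module S "sub_gm M H" by (rule graded_sub_gm[OF M(1) assms(2)])
 note o = opsubD[OF hsubD(1)[OF assms(2)]]
 obtain A where A: "finite A" "A \<subseteq> H" "\<And>H'. sub M H' \<Longrightarrow> A \<subseteq> H' \<Longrightarrow> H \<subseteq> H'"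
  using gobj_sub_fin_gen[OF assms(1) hsubD(1)[OF assms(2)]] unfolding fin_gen_def by blast
 have sub: "sub M H'" if "sub (sub_gm M H) H'" for H'
 proof -
  note p = opsubD[OF that, simplified]
  show ?thesis
   by (rule M.opsub_submoduleI) (rule order_trans[OF p(1) o(1)], rule p(2), erule p(3), assumption, erule p(5), assumption)
 qed
 have "fin_gen (carrier S) (sub_gm M H) H"
  unfolding fin_gen_def
 proof (intro exI conjI allI impI)
  show "finite A" "A \<subseteq> H" by (fact A(1), fact A(2))
  show "H \<subseteq> H'" if "sub (sub_gm M H) H'" "A \<subseteq> H'" for H' by (rule A(3)[OF sub[OF that(1)] that(2)])
 qed
 thus ?thesis unfolding gobj_def using N.graded_module_axioms M(3) o(2) by auto
qed

section \<open>Quotients and transported copies\<close>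

lemma image_gm_simps [simp]:
 "carrier (image_gm \<theta> M) = \<theta> ` carrier M" "\<zero>\<^bsub>image_gm \<theta> M\<^esub> = \<theta> \<zero>\<^sub>M"
 "hcomp (image_gm \<theta> M) i = \<theta> ` hcomp M i"
 by (simp_all add: image_gm_def)

text \<open>The operations pass through chosen preimages, and since the fibres of
  \<open>\<theta>\<close> are cosets of \<open>K\<close> the choice does not matter. Homogeneity of
  \<open>K\<close> yields directness: if a sum of homogeneous elements lies in \<open>K\<close>, so
  does each summand.\<close>

lemma image_gm:
 assumes "graded_module S M" "hsub M K"
  "\<And>x y. x \<in> carrier M \<Longrightarrow> y \<in> carrier M \<Longrightarrow> \<theta> x = \<theta> y \<longleftrightarrow> x \<ominus>\<^sub>M y \<in> K"
 shows image_gm_add: "x \<in> carrier M \<Longrightarrow> y \<in> carrier M \<Longrightarrow> \<theta> x \<oplus>\<^bsub>image_gm \<theta> M\<^esub> \<theta> y = \<theta> (x \<oplus>\<^sub>M y)"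
  and image_gm_smult: "r \<in> carrier S \<Longrightarrow> x \<in> carrier M \<Longrightarrow> r \<odot>\<^bsub>image_gm \<theta> M\<^esub> \<theta> x = \<theta> (r \<odot>\<^sub>M x)"
  and graded_image_gm: "graded_module S (image_gm \<theta> M)"
  and image_gm_hom: "restrict \<theta> (carrier M) \<in> ghom M (image_gm \<theta> M)"
proof -
 interpret M: graded_module S M by fact
 note K = hsubD[OF assms(2)] and o = opsubD[OF hsubD(1)[OF assms(2)]]
 let ?Q = "image_gm \<theta> M" and ?inv = "inv_into (carrier M) \<theta>"
 have inv: "?inv (\<theta> x) \<in> carrier M" "\<theta> (?inv (\<theta> x)) = \<theta> x" if "x \<in> carrier M" for x
  using that by (auto intro: inv_into_into f_inv_into_f)
 have cong: "\<theta> (x' \<oplus>\<^sub>M y') = \<theta> (x \<oplus>\<^sub>M y)"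
  if "x \<in> carrier M" "y \<in> carrier M" "x' \<in> carrier M" "y' \<in> carrier M" "\<theta> x' = \<theta> x" "\<theta> y' = \<theta> y" for x y x' y'
 proof -
  have "(x' \<oplus>\<^sub>M y') \<ominus>\<^sub>M (x \<oplus>\<^sub>M y) = (x' \<ominus>\<^sub>M x) \<oplus>\<^sub>M (y' \<ominus>\<^sub>M y)"
   using that by (simp add: a_minus_def M.M.minus_add M.M.a_ac)
  also have "\<dots> \<in> K" using that assms(3) o(3) by simp
  finally show ?thesis using that assms(3) by simp
 qed
 have cong': "\<theta> (r \<odot>\<^sub>M x') = \<theta> (r \<odot>\<^sub>M x)"
  if "r \<in> carrier S" "x \<in> carrier M" "x' \<in> carrier M" "\<theta> x' = \<theta> x" for r x x'
 proof -
  have "r \<odot>\<^sub>M x' \<ominus>\<^sub>M r \<odot>\<^sub>M x = r \<odot>\<^sub>M (x' \<ominus>\<^sub>M x)"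
   using that by (simp add: a_minus_def M.smult_r_distr M.smult_r_minus)
  also have "\<dots> \<in> K" using that assms(3) o(5) by simp
  finally show ?thesis using that assms(3) by simp
 qed
 show add: "\<theta> x \<oplus>\<^sub>?Q \<theta> y = \<theta> (x \<oplus>\<^sub>M y)" if "x \<in> carrier M" "y \<in> carrier M" for x y
 proof -
  have "\<theta> x \<oplus>\<^sub>?Q \<theta> y = \<theta> (?inv (\<theta> x) \<oplus>\<^sub>M ?inv (\<theta> y))" by (simp add: image_gm_def)
  also have "\<dots> = \<theta> (x \<oplus>\<^sub>M y)" by (intro cong that inv)
  finally show ?thesis .
 qed
 show smult: "r \<odot>\<^sub>?Q \<theta> x = \<theta> (r \<odot>\<^sub>M x)" if "r \<in> carrier S" "x \<in> carrier M" for r x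
 proof -
  have "r \<odot>\<^sub>?Q \<theta> x = \<theta> (r \<odot>\<^sub>M ?inv (\<theta> x))" by (simp add: image_gm_def)
  also have "\<dots> = \<theta> (r \<odot>\<^sub>M x)" by (intro cong' that inv)
  finally show ?thesis .
 qed
 have ab: "abelian_group ?Q"
 proof (rule abelian_groupI)
  fix x assume "x \<in> carrier ?Q"
  then obtain a where a: "x = \<theta> a" "a \<in> carrier M" by auto
  hence "\<theta> (\<ominus>\<^sub>M a) \<oplus>\<^sub>?Q x = \<zero>\<^sub>?Q" by (simp add: add M.M.l_neg)
  thus "\<exists>y\<in>carrier ?Q. y \<oplus>\<^sub>?Q x = \<zero>\<^sub>?Q" using a by auto
 qed (auto simp: add M.M.a_ac)
 have mod: "module S ?Q"
  by (rule moduleI[OF S.R.cring_axioms ab])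
   (auto simp: smult add M.smult_l_distr M.smult_r_distr M.smult_assoc1)
 interpret Q: module S ?Q by fact
 have fin: "(\<Oplus>\<^sub>?Q i\<in>F. \<theta> (f i)) = \<theta> (\<Oplus>\<^sub>M i\<in>F. f i)" if "\<And>i. i \<in> F \<Longrightarrow> f i \<in> carrier M" for F :: "int set" and f
  using hom_finsum[OF M.M.abelian_group_axioms Q.M.abelian_group_axioms, of \<theta> F f] add that by simp
 have neg: "\<ominus>\<^sub>?Q \<theta> x = \<theta> (\<ominus>\<^sub>M x)" if "x \<in> carrier M" for x
  using that by (intro Q.M.minus_equality) (auto simp: add M.M.l_neg)
 show gr: "graded_module S ?Q"
 proof (rule graded_moduleI[OF mod])
  show "subgroup (hcomp ?Q i) (add_monoid ?Q)" for i
  proof (rule Q.M.add.subgroupI)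
   show "hcomp ?Q i \<subseteq> carrier ?Q" using M.G.hcompD(1) by auto
   show "hcomp ?Q i \<noteq> {}" using M.G.hcompD(2) by auto
   show "\<ominus>\<^sub>?Q x \<in> hcomp ?Q i" if "x \<in> hcomp ?Q i" for x
    using that neg M.G.hcompD(1,4) by auto
   show "x \<oplus>\<^sub>?Q y \<in> hcomp ?Q i" if "x \<in> hcomp ?Q i" "y \<in> hcomp ?Q i" for x y
    using that add M.G.hcompD(1,3) by auto
  qed
  show "carrier ?Q \<subseteq> hspan ?Q UNIV"
  proof
   fix x assume "x \<in> carrier ?Q"
   then obtain a where a: "x = \<theta> a" "a \<in> carrier M" by auto
   have "x = (\<Oplus>\<^sub>?Q i\<in>{i. pr M i a \<noteq> \<zero>\<^sub>M}. \<theta> (pr M i a))"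
    using M.pr(3)[OF a(2)] fin[of _ "\<lambda>i. pr M i a"] a by simp
   thus "x \<in> hspan ?Q UNIV"
    unfolding hspan_def using M.pr(1,2)[OF a(2)] by auto
  qed
  show "\<forall>i\<in>F. f i = \<zero>\<^sub>?Q" if F: "finite F" "\<And>i. i \<in> F \<Longrightarrow> f i \<in> hcomp ?Q i"
   "(\<Oplus>\<^sub>?Q i\<in>F. f i) = \<zero>\<^sub>?Q" for F :: "int set" and f
  proof
   fix i assume i: "i \<in> F"
   have "\<forall>i\<in>F. \<exists>a. a \<in> hcomp M i \<and> f i = \<theta> a" using F(2) by auto
   then obtain g where g: "\<And>i. i \<in> F \<Longrightarrow> g i \<in> hcomp M i" "\<And>i. i \<in> F \<Longrightarrow> f i = \<theta> (g i)" by metis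
   have gc: "g i \<in> carrier M" if "i \<in> F" for i using g(1)[OF that] M.G.hcompD(1) by blast
   have "(\<Oplus>\<^sub>?Q i\<in>F. f i) = (\<Oplus>\<^sub>?Q i\<in>F. \<theta> (g i))" using g(2) gc by (intro Q.M.finsum_cong') auto
   hence "\<theta> (\<Oplus>\<^sub>M i\<in>F. g i) = \<theta> \<zero>\<^sub>M" using F(3) fin[of F g] gc by simp
   hence "(\<Oplus>\<^sub>M i\<in>F. g i) \<in> K" using assms(3)[of "\<Oplus>\<^sub>M i\<in>F. g i" "\<zero>\<^sub>M"] gc M.M.finsum_closed[of g F]
    by (simp add: Pi_def a_minus_def)
   from K(2)[OF this, of i] have "g i \<in> K"
    using M.pr_unique[OF F(1) g(1) refl, of i] i by simp
   hence "\<theta> (g i) = \<theta> \<zero>\<^sub>M" using assms(3)[of "g i" "\<zero>\<^sub>M"] gc[OF i] by (simp add: a_minus_def)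
   thus "f i = \<zero>\<^sub>?Q" using g(2)[OF i] by simp
  qed
  show "r \<odot>\<^sub>?Q x \<in> hcomp ?Q (i + j)" if "r \<in> hcomp S i" "x \<in> hcomp ?Q j" for i j r x
   using that smult M.smult_hcomp S.G.hcompD(1) M.G.hcompD(1) by auto
 qed
 show "restrict \<theta> (carrier M) \<in> ghom M ?Q"
  by (rule ghom_restrictI[OF assms(1)]) (auto simp: add smult)
qed

lemma fin_gen_hom_image:
 assumes "graded_module S M" "graded_module S N" "\<phi> \<in> ghom M N" "fin_gen (carrier S) M (carrier M)"
 shows "fin_gen (carrier S) N (\<phi> ` carrier M)"
proof -
 interpret M: graded_module S M by fact
 interpret N: graded_module S N by fact
 note h = ghomD[OF assms(3)] and z = ghom_zero[OF assms(1-3)]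
 obtain A where A: "finite A" "A \<subseteq> carrier M" "\<And>H'. sub M H' \<Longrightarrow> A \<subseteq> H' \<Longrightarrow> carrier M \<subseteq> H'"
  using assms(4) unfolding fin_gen_def by blast
 show ?thesis unfolding fin_gen_def
 proof (intro exI conjI allI impI)
  show "finite (\<phi> ` A)" "\<phi> ` A \<subseteq> \<phi> ` carrier M" using A by auto
  fix H' assume H': "sub N H'" "\<phi> ` A \<subseteq> H'"
  note o = opsubD[OF H'(1)]
  have "sub M {x \<in> carrier M. \<phi> x \<in> H'}"
   by (rule M.opsub_submoduleI) (auto simp: h(2,3) z(1) intro: o)
  from A(3)[OF this] show "\<phi> ` carrier M \<subseteq> H'" using A(2) H'(2) by blast
 qed
qed

lemma gobj_image_gm:
 assumes "gobj d M" "hsub M K"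
  "\<And>x y. x \<in> carrier M \<Longrightarrow> y \<in> carrier M \<Longrightarrow> \<theta> x = \<theta> y \<longleftrightarrow> x \<ominus>\<^sub>M y \<in> K"
 shows "gobj d (image_gm \<theta> M)"
proof -
 note M = gobjD[OF assms(1)]
 note g = graded_image_gm[OF M(1) assms(2,3)] image_gm_hom[OF M(1) assms(2,3)]
 have "restrict \<theta> (carrier M) ` carrier M = \<theta> ` carrier M" by auto
 thus ?thesis
  unfolding gobj_def using g(1) fin_gen_hom_image[OF M(1) g(1) g(2) M(2)] M(3) by auto
qed

text \<open>Picks one representative per coset inside \<open>M\<close> itself, so that the quotient
  has its elements in the type of \<open>M\<close> and stays in the same category.\<close>

definition quot_map :: "('a, 'b) graded_module \<Rightarrow> 'b set \<Rightarrow> 'b \<Rightarrow> 'b" where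
 "quot_map M K x = (SOME y. y \<in> carrier M \<and> x \<ominus>\<^sub>M y \<in> K)"

lemma quot_map_eq:
 assumes "graded_module S M" "hsub M K" "x \<in> carrier M" "y \<in> carrier M"
 shows "quot_map M K x = quot_map M K y \<longleftrightarrow> x \<ominus>\<^sub>M y \<in> K"
proof -
 interpret M: graded_module S M by fact
 note o = opsubD[OF hsubD(1)[OF assms(2)]]
 have ex: "quot_map M K z \<in> carrier M \<and> z \<ominus>\<^sub>M quot_map M K z \<in> K" if "z \<in> carrier M" for z
  unfolding quot_map_def by (rule someI[of _ z]) (use that o(2) in \<open>simp add: a_minus_def M.M.r_neg\<close>)
 have tr: "a \<ominus>\<^sub>M c \<in> K" if "a \<ominus>\<^sub>M b \<in> K" "b \<ominus>\<^sub>M c \<in> K" "a \<in> carrier M" "b \<in> carrier M" "c \<in> carrier M" for a b c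
 proof -
  have "(a \<ominus>\<^sub>M b) \<oplus>\<^sub>M (b \<ominus>\<^sub>M c) = a \<oplus>\<^sub>M ((\<ominus>\<^sub>M b \<oplus>\<^sub>M b) \<oplus>\<^sub>M \<ominus>\<^sub>M c)"
   using that unfolding a_minus_def by (simp only: M.M.a_assoc M.M.a_inv_closed M.M.a_closed)
  also have "\<dots> = a \<ominus>\<^sub>M c" using that by (simp add: a_minus_def M.M.l_neg)
  finally show ?thesis using o(3)[OF that(1,2)] by simp
 qed
 have sy: "b \<ominus>\<^sub>M a \<in> K" if "a \<ominus>\<^sub>M b \<in> K" "a \<in> carrier M" "b \<in> carrier M" for a b
  using o(4)[OF that(1)] that by (simp add: a_minus_def M.M.minus_add M.M.a_comm)
 show ?thesis
 proof
  assume "quot_map M K x = quot_map M K y"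
  thus "x \<ominus>\<^sub>M y \<in> K"
   using tr[of x "quot_map M K x" y] sy[of y "quot_map M K y"] ex[OF assms(3)] ex[OF assms(4)] assms(3,4) by simp
 next
  assume *: "x \<ominus>\<^sub>M y \<in> K"
  have "(w \<in> carrier M \<and> x \<ominus>\<^sub>M w \<in> K) = (w \<in> carrier M \<and> y \<ominus>\<^sub>M w \<in> K)" for w
   using tr[of x y w] tr[of y x w] sy[OF *] * assms(3,4) by blast
  thus "quot_map M K x = quot_map M K y" unfolding quot_map_def by simp
 qed
qed

definition quot :: "('a, 'b) graded_module \<Rightarrow> 'b set \<Rightarrow> ('a, 'b) graded_module" where
 "quot M K = image_gm (quot_map M K) M"

definition proj :: "('a, 'b) graded_module \<Rightarrow> 'b set \<Rightarrow> 'b \<Rightarrow> 'b" where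
 "proj M K = restrict (quot_map M K) (carrier M)"

lemma quot:
 assumes "gobj d M" "hsub M K"
 shows "gobj d (quot M K)" "proj M K \<in> ghom M (quot M K)" "proj M K ` carrier M = carrier (quot M K)"
  "x \<in> carrier M \<Longrightarrow> proj M K x = \<zero>\<^bsub>quot M K\<^esub> \<longleftrightarrow> x \<in> K"
proof -
 note M = gobjD[OF assms(1)]
 interpret M: graded_module S M by (rule M(1))
 note e = quot_map_eq[OF M(1) assms(2)]
 show "gobj d (quot M K)" unfolding quot_def by (rule gobj_image_gm[OF assms e])
 show "proj M K \<in> ghom M (quot M K)" unfolding quot_def proj_def by (rule image_gm_hom[OF M(1) assms(2) e])
 show "proj M K ` carrier M = carrier (quot M K)" by (simp add: quot_def proj_def)
 show "proj M K x = \<zero>\<^bsub>quot M K\<^esub> \<longleftrightarrow> x \<in> K" if "x \<in> carrier M" for x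
  using e[OF that, of "\<zero>\<^sub>M"] that by (simp add: quot_def proj_def a_minus_def)
qed

section \<open>Products and zero modules\<close>

lemma prod_gm_simps [simp]:
 "carrier (prod_gm M N) = carrier M \<times> carrier N" "\<zero>\<^bsub>prod_gm M N\<^esub> = (\<zero>\<^sub>M, \<zero>\<^sub>N)"
 "x \<oplus>\<^bsub>prod_gm M N\<^esub> y = (fst x \<oplus>\<^sub>M fst y, snd x \<oplus>\<^sub>N snd y)"
 "r \<odot>\<^bsub>prod_gm M N\<^esub> x = (r \<odot>\<^sub>M fst x, r \<odot>\<^sub>N snd x)"
 "hcomp (prod_gm M N) i = hcomp M i \<times> hcomp N i"
 by (simp_all add: prod_gm_def)

lemma gobj_prod_gm:
 assumes "gobj d M" "gobj d N"
 shows "gobj d (prod_gm M N)"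
proof -
 note M = gobjD[OF assms(1)] and N = gobjD[OF assms(2)]
 interpret M: graded_module S M by (rule M(1))
 interpret N: graded_module S N by (rule N(1))
 let ?P = "prod_gm M N"
 have ab: "abelian_group ?P"
 proof (rule abelian_groupI)
  fix x assume "x \<in> carrier ?P"
  thus "\<exists>y\<in>carrier ?P. y \<oplus>\<^sub>?P x = \<zero>\<^sub>?P"
   by (intro bexI[of _ "(\<ominus>\<^sub>M fst x, \<ominus>\<^sub>N snd x)"]) (auto simp: M.M.l_neg N.M.l_neg)
 qed (auto simp: M.M.a_ac N.M.a_ac)
 have mod: "module S ?P"
  by (rule moduleI[OF S.R.cring_axioms ab])
   (auto simp: M.smult_l_distr M.smult_r_distr M.smult_assoc1 N.smult_l_distr N.smult_r_distr N.smult_assoc1)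
 interpret P: module S ?P by fact
 have neg: "\<ominus>\<^sub>?P x = (\<ominus>\<^sub>M fst x, \<ominus>\<^sub>N snd x)" if "x \<in> carrier ?P" for x
  using that by (intro P.M.minus_equality) (auto simp: M.M.l_neg N.M.l_neg)
 have fin: "fst (\<Oplus>\<^sub>?P i\<in>F. f i) = (\<Oplus>\<^sub>M i\<in>F. fst (f i))" "snd (\<Oplus>\<^sub>?P i\<in>F. f i) = (\<Oplus>\<^sub>N i\<in>F. snd (f i))"
  if "\<And>i. i \<in> F \<Longrightarrow> f i \<in> carrier ?P" for F :: "int set" and f
  using hom_finsum[OF P.M.abelian_group_axioms M.M.abelian_group_axioms, of fst F f]
   hom_finsum[OF P.M.abelian_group_axioms N.M.abelian_group_axioms, of snd F f] that by auto
 have sg: "subgroup (hcomp ?P i) (add_monoid ?P)" for i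
 proof (rule P.M.add.subgroupI)
  show "hcomp ?P i \<subseteq> carrier ?P" using M.G.hcompD(1) N.G.hcompD(1) by auto
  show "hcomp ?P i \<noteq> {}" using M.G.hcompD(2) N.G.hcompD(2) by auto
  show "\<ominus>\<^sub>?P x \<in> hcomp ?P i" if "x \<in> hcomp ?P i" for x
   using that neg[of x] M.G.hcompD(1,4) N.G.hcompD(1,4) by auto
  show "x \<oplus>\<^sub>?P y \<in> hcomp ?P i" if "x \<in> hcomp ?P i" "y \<in> hcomp ?P i" for x y
   using that M.G.hcompD(3) N.G.hcompD(3) by auto
 qed
 interpret PG: pregraded ?P by (intro pregraded.intro pregraded_axioms.intro sg P.M.abelian_group_axioms)
 have split: "x = (fst x, \<zero>\<^sub>N) \<oplus>\<^sub>?P (\<zero>\<^sub>M, snd x)" if "x \<in> carrier ?P" for x using that by auto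
 have gr: "graded_module S ?P"
 proof (rule graded_moduleI[OF mod sg])
  have 1: "(x, \<zero>\<^sub>N) \<in> hspan ?P UNIV" if "x \<in> carrier M" for x
   using that
  proof (induction rule: M.graded_induct)
   case zero
   thus ?case using PG.zero_hspan by simp
  next
   case (comp i y)
   thus ?case using PG.hcomp_hspan[of i UNIV "(y, \<zero>\<^sub>N)"] N.G.hcompD(2) by simp
  next
   case (add y z)
   thus ?case using PG.hspan_add[of "(y, \<zero>\<^sub>N)" UNIV "(z, \<zero>\<^sub>N)"] by simp
  qed
  have 2: "(\<zero>\<^sub>M, x) \<in> hspan ?P UNIV" if "x \<in> carrier N" for x
   using that
  proof (induction rule: N.graded_induct)
   case zero
   thus ?case using PG.zero_hspan by simp
  next
   case (comp i y)
   thus ?case using PG.hcomp_hspan[of i UNIV "(\<zero>\<^sub>M, y)"] M.G.hcompD(2) by simp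
  next
   case (add y z)
   thus ?case using PG.hspan_add[of "(\<zero>\<^sub>M, y)" UNIV "(\<zero>\<^sub>M, z)"] by simp
  qed
  show "carrier ?P \<subseteq> hspan ?P UNIV"
   using 1 2 PG.hspan_add[OF 1 2] by auto
  show "\<forall>i\<in>F. f i = \<zero>\<^sub>?P" if F: "finite F" "\<And>i. i \<in> F \<Longrightarrow> f i \<in> hcomp ?P i"
   "(\<Oplus>\<^sub>?P i\<in>F. f i) = \<zero>\<^sub>?P" for F :: "int set" and f
  proof
   fix i assume i: "i \<in> F"
   have c: "f i \<in> carrier ?P" if "i \<in> F" for i using F(2)[OF that] PG.hcompD(1) by blast
   have h: "fst (f i) \<in> hcomp M i" "snd (f i) \<in> hcomp N i" if "i \<in> F" for i using F(2)[OF that] by auto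
   have z1: "\<zero>\<^sub>M = (\<Oplus>\<^sub>M i\<in>F. fst (f i))" using fin(1)[of F f, OF c] F(3) by simp
   have "fst (f i) = \<zero>\<^sub>M" using M.pr_unique[OF F(1) h(1) z1, of i] i by simp
   have z2: "\<zero>\<^sub>N = (\<Oplus>\<^sub>N i\<in>F. snd (f i))" using fin(2)[of F f, OF c] F(3) by simp
   have "snd (f i) = \<zero>\<^sub>N" using N.pr_unique[OF F(1) h(2) z2, of i] i by simp
   with \<open>fst (f i) = \<zero>\<^sub>M\<close> show "f i = \<zero>\<^sub>?P" by (simp add: prod_eq_iff)
  qed
 qed (use M.smult_hcomp N.smult_hcomp in auto)
 let ?i = "\<lambda>x\<in>carrier M. (x, \<zero>\<^sub>N)" and ?j = "\<lambda>y\<in>carrier N. (\<zero>\<^sub>M, y)"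
 have i: "?i \<in> ghom M ?P" by (rule ghom_restrictI[OF M(1)]) (use N.G.hcompD(2) in auto)
 have j: "?j \<in> ghom N ?P" by (rule ghom_restrictI[OF N(1)]) (use M.G.hcompD(2) in auto)
 obtain A where A: "finite A" "A \<subseteq> ?i ` carrier M" "\<And>H. sub ?P H \<Longrightarrow> A \<subseteq> H \<Longrightarrow> ?i ` carrier M \<subseteq> H"
  using fin_gen_hom_image[OF M(1) gr i M(2)] unfolding fin_gen_def by blast
 obtain B where B: "finite B" "B \<subseteq> ?j ` carrier N" "\<And>H. sub ?P H \<Longrightarrow> B \<subseteq> H \<Longrightarrow> ?j ` carrier N \<subseteq> H"
  using fin_gen_hom_image[OF N(1) gr j N(2)] unfolding fin_gen_def by blast
 have "fin_gen (carrier S) ?P (carrier ?P)"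
  unfolding fin_gen_def
 proof (intro exI[of _ "A \<union> B"] conjI allI impI)
  show "finite (A \<union> B)" "A \<union> B \<subseteq> carrier ?P" using A(1,2) B(1,2) by auto
  fix H assume H: "sub ?P H" "A \<union> B \<subseteq> H"
  have AB: "?i ` carrier M \<subseteq> H" "?j ` carrier N \<subseteq> H" using A(3)[OF H(1)] B(3)[OF H(1)] H(2) by simp_all
  show "carrier ?P \<subseteq> H"
  proof
   fix x assume x: "x \<in> carrier ?P"
   hence "fst x \<in> carrier M" "snd x \<in> carrier N" by auto
   note ij = subsetD[OF AB(1) imageI[OF this(1)]] subsetD[OF AB(2) imageI[OF this(2)]]
   show "x \<in> H" using opsubD(3)[OF H(1) ij] split[OF x] x by auto
  qed
 qed
 thus ?thesis unfolding gobj_def using gr M(3) N(3) by simp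
qed

lemma gobj_trivial: "gobj d (trivial_gm z)"
proof -
 let ?Z = "trivial_gm z :: ('a, 'b) graded_module"
 have s: "carrier ?Z = {z}" "\<zero>\<^sub>?Z = z" "x \<oplus>\<^sub>?Z y = z" "r \<odot>\<^sub>?Z x = z" "hcomp ?Z i = {z}" for x y r i
  by (simp_all add: trivial_gm_def)
 have ab: "abelian_group ?Z" by (rule abelian_groupI) (auto simp: s)
 have mod: "module S ?Z" by (rule moduleI[OF S.R.cring_axioms ab]) (auto simp: s)
 interpret Z: module S ?Z by fact
 have "\<ominus>\<^sub>?Z z = z" using Z.M.a_inv_closed[of z] by (simp add: s)
 hence sg: "subgroup (hcomp ?Z i) (add_monoid ?Z)" for i by (intro Z.M.add.subgroupI) (auto simp: s)
 interpret G: pregraded ?Z by (intro pregraded.intro pregraded_axioms.intro sg Z.M.abelian_group_axioms)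
 have "graded_module S ?Z"
  by (rule graded_moduleI[OF mod sg]) (use G.zero_hspan[of UNIV] in \<open>auto simp: s\<close>)
 moreover have "fin_gen (carrier S) ?Z (carrier ?Z)"
  unfolding fin_gen_def by (intro exI[of _ "{z}"]) (simp add: s)
 ultimately show ?thesis by (simp add: gobj_def s)
qed

section \<open>Truncated and quasi-zero modules in terms of components\<close>

lemma trunc_eq_iff:
 assumes "graded_module S M"
 shows "M = trunc d M \<longleftrightarrow> (\<forall>i<d. hcomp M i = {\<zero>\<^sub>M})"
proof -
 interpret M: graded_module S M by fact
 show ?thesis
 proof
  assume M: "M = trunc d M"
  have "hcomp (trunc d M) i = {\<zero>\<^sub>M}" if "i < d" for i using that by (simp add: trunc_def)
  thus "\<forall>i<d. hcomp M i = {\<zero>\<^sub>M}" by (subst M) blast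
 next
  assume *: "\<forall>i<d. hcomp M i = {\<zero>\<^sub>M}"
  have "x \<in> hspan M {d..}" if "x \<in> carrier M" for x
   using that
  proof (induction rule: M.graded_induct)
   case (comp i y)
   thus ?case using * M.G.zero_hspan[of "{d..}"] M.G.hcomp_hspan[of i "{d..}" y] by (cases "i < d") auto
  qed (use M.G.zero_hspan M.G.hspan_add in auto)
  hence "carrier (trunc d M) = carrier M" unfolding carrier_trunc using M.G.hspan_carrier by blast
  moreover have "hcomp (trunc d M) = hcomp M" using * by (auto simp: trunc_def fun_eq_iff)
  ultimately show "M = trunc d M" by (simp add: trunc_def)
 qed
qed

lemma quasi_zero_iff:
 assumes "graded_module S M"
 shows "quasi_zero M \<longleftrightarrow> (\<exists>l. \<forall>i\<ge>l. hcomp M i = {\<zero>\<^sub>M})"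
proof -
 interpret M: graded_module S M by fact
 have "hspan M {l..} = {\<zero>\<^sub>M} \<longleftrightarrow> (\<forall>i\<ge>l. hcomp M i = {\<zero>\<^sub>M})" for l
 proof
  assume "hspan M {l..} = {\<zero>\<^sub>M}"
  thus "\<forall>i\<ge>l. hcomp M i = {\<zero>\<^sub>M}" using M.G.hcomp_hspan[of _ "{l..}"] M.G.hcompD(2) by blast
 next
  assume *: "\<forall>i\<ge>l. hcomp M i = {\<zero>\<^sub>M}"
  have "x = \<zero>\<^sub>M" if "x \<in> hspan M {l..}" for x
   using that by (induction rule: M.G.hspan_induct) (use * in auto)
  thus "hspan M {l..} = {\<zero>\<^sub>M}" using M.G.zero_hspan by blast
 qed
 thus ?thesis unfolding quasi_zero_def carrier_trunc by simp
qed

section \<open>Free modules, finite presentation and cardinality\<close>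

abbreviation "Fr \<equiv> free_module S"

lemma free_simps [simp]:
 "carrier (Fr r) = {..<r} \<rightarrow>\<^sub>E carrier S" "\<zero>\<^bsub>Fr r\<^esub> = (\<lambda>i\<in>{..<r}. \<zero>\<^sub>S)"
 "a \<oplus>\<^bsub>Fr r\<^esub> b = (\<lambda>i\<in>{..<r}. a i \<oplus>\<^sub>S b i)"
 "c \<odot>\<^bsub>Fr r\<^esub> a = (\<lambda>i\<in>{..<r}. c \<otimes>\<^sub>S a i)"
 by (simp_all add: free_module_def)

lemma free_eqI:
 assumes "a \<in> {..<r} \<rightarrow>\<^sub>E carrier S" "b \<in> {..<r} \<rightarrow>\<^sub>E carrier S" "\<And>i. i < r \<Longrightarrow> a i = b i"
 shows "a = b"
 using assms by (intro PiE_ext) auto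

lemma free_in: "a \<in> {..<r} \<rightarrow>\<^sub>E carrier S \<Longrightarrow> i < r \<Longrightarrow> a i \<in> carrier S"
 by auto

lemma module_free: "module S (Fr r)"
proof -
 let ?F = "Fr r"
 have c: "x i \<in> carrier S" if "x \<in> carrier ?F" "i \<in> {..<r}" for x i using that by auto
 have "abelian_group ?F"
 proof (rule abelian_groupI)
  show "x \<oplus>\<^sub>?F y \<in> carrier ?F" if "x \<in> carrier ?F" "y \<in> carrier ?F" for x y
   using c[OF that(1)] c[OF that(2)] by auto
  show "x \<oplus>\<^sub>?F y \<oplus>\<^sub>?F z = x \<oplus>\<^sub>?F (y \<oplus>\<^sub>?F z)"
   if "x \<in> carrier ?F" "y \<in> carrier ?F" "z \<in> carrier ?F" for x y z
   unfolding free_simps by (rule restrict_ext) (simp add: c[OF that(1)] c[OF that(2)] c[OF that(3)] S.R.a_assoc)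
  show "x \<oplus>\<^sub>?F y = y \<oplus>\<^sub>?F x" if "x \<in> carrier ?F" "y \<in> carrier ?F" for x y
   unfolding free_simps by (rule restrict_ext) (simp add: c[OF that(1)] c[OF that(2)] S.R.a_comm)
  show "\<zero>\<^sub>?F \<oplus>\<^sub>?F x = x" if "x \<in> carrier ?F" for x
   unfolding free_simps by (rule free_eqI) (use c[OF that] that in auto)
  show "\<exists>y\<in>carrier ?F. y \<oplus>\<^sub>?F x = \<zero>\<^sub>?F" if "x \<in> carrier ?F" for x
  proof
   show "(\<lambda>i\<in>{..<r}. \<ominus>\<^sub>S x i) \<oplus>\<^sub>?F x = \<zero>\<^sub>?F"
    unfolding free_simps by (rule restrict_ext) (simp add: c[OF that] S.R.l_neg)
   show "(\<lambda>i\<in>{..<r}. \<ominus>\<^sub>S x i) \<in> carrier ?F" using c[OF that] by auto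
  qed
 qed auto
 thus ?thesis
 proof (rule moduleI[OF S.R.cring_axioms])
  show "a \<odot>\<^sub>?F x \<in> carrier ?F" if "a \<in> carrier S" "x \<in> carrier ?F" for a x
   using that(1) c[OF that(2)] by auto
  show "(a \<oplus>\<^sub>S b) \<odot>\<^sub>?F x = a \<odot>\<^sub>?F x \<oplus>\<^sub>?F b \<odot>\<^sub>?F x"
   if "a \<in> carrier S" "b \<in> carrier S" "x \<in> carrier ?F" for a b x
   unfolding free_simps by (rule restrict_ext) (simp add: that(1,2) c[OF that(3)] S.R.l_distr)
  show "a \<odot>\<^sub>?F (x \<oplus>\<^sub>?F y) = a \<odot>\<^sub>?F x \<oplus>\<^sub>?F a \<odot>\<^sub>?F y"
   if "a \<in> carrier S" "x \<in> carrier ?F" "y \<in> carrier ?F" for a x y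
   unfolding free_simps by (rule restrict_ext) (simp add: that(1) c[OF that(2)] c[OF that(3)] S.R.r_distr)
  show "(a \<otimes>\<^sub>S b) \<odot>\<^sub>?F x = a \<odot>\<^sub>?F (b \<odot>\<^sub>?F x)"
   if "a \<in> carrier S" "b \<in> carrier S" "x \<in> carrier ?F" for a b x
   unfolding free_simps by (rule restrict_ext) (simp add: that(1,2) c[OF that(3)] S.R.m_assoc)
  show "\<one>\<^sub>S \<odot>\<^sub>?F x = x" if "x \<in> carrier ?F" for x
   unfolding free_simps by (rule free_eqI) (use that c[OF that] in auto)
 qed
qed

definition unit_vec :: "nat \<Rightarrow> nat \<Rightarrow> nat \<Rightarrow> 'a" where
 "unit_vec r j = (\<lambda>i\<in>{..<r}. if i = j then \<one>\<^sub>S else \<zero>\<^sub>S)"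

lemma unit_vec_carrier: "unit_vec r j \<in> {..<r} \<rightarrow>\<^sub>E carrier S"
 by (auto simp: unit_vec_def)

lemma free_induct:
 assumes "a \<in> carrier (Fr r)" "Q \<zero>\<^bsub>Fr r\<^esub>"
  "\<And>s j. s \<in> carrier S \<Longrightarrow> j < r \<Longrightarrow> Q (s \<odot>\<^bsub>Fr r\<^esub> unit_vec r j)"
  "\<And>a b. a \<in> carrier (Fr r) \<Longrightarrow> b \<in> carrier (Fr r) \<Longrightarrow> Q a \<Longrightarrow> Q b \<Longrightarrow>
   Q (a \<oplus>\<^bsub>Fr r\<^esub> b)"
 shows "Q a"
proof -
 \<comment> \<open>Induction on the length \<open>k\<close> of the initial segment outside of which
   \<open>a\<close> vanishes.\<close>
 have "Q a" if "k \<le> r" "a \<in> {..<r} \<rightarrow>\<^sub>E carrier S" "\<And>i. k \<le> i \<Longrightarrow> i < r \<Longrightarrow> a i = \<zero>\<^sub>S" for k a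
  using that
 proof (induction k arbitrary: a)
  case 0
  hence a: "a = \<zero>\<^bsub>Fr r\<^esub>" by (intro free_eqI) auto
  show ?case unfolding a by (rule assms(2))
 next
  case (Suc k)
  let ?b = "\<lambda>i\<in>{..<r}. if i = k then \<zero>\<^sub>S else a i"
  have b: "?b \<in> {..<r} \<rightarrow>\<^sub>E carrier S"
   unfolding restrict_PiE_iff using free_in[OF Suc.prems(2)] by simp
  have Qb: "Q ?b"
  proof (rule Suc.IH[OF _ b])
   show "k \<le> r" using Suc.prems(1) by simp
   show "?b i = \<zero>\<^sub>S" if "k \<le> i" "i < r" for i
    using Suc.prems(3)[of i] that by (cases "i = k") auto
  qed
  have ak: "a k \<in> carrier S" "k < r" using free_in[OF Suc.prems(2), of k] Suc.prems(1) by auto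
  have ac: "a k \<odot>\<^bsub>Fr r\<^esub> unit_vec r k \<in> carrier (Fr r)"
   unfolding free_simps restrict_PiE_iff using ak free_in[OF unit_vec_carrier] by simp
  have a: "a = ?b \<oplus>\<^bsub>Fr r\<^esub> (a k \<odot>\<^bsub>Fr r\<^esub> unit_vec r k)"
  proof (rule free_eqI[OF Suc.prems(2)])
   show "?b \<oplus>\<^bsub>Fr r\<^esub> (a k \<odot>\<^bsub>Fr r\<^esub> unit_vec r k) \<in> {..<r} \<rightarrow>\<^sub>E carrier S"
    unfolding free_simps restrict_PiE_iff using ak free_in[OF unit_vec_carrier] free_in[OF Suc.prems(2)] by simp
   show "a i = (?b \<oplus>\<^bsub>Fr r\<^esub> (a k \<odot>\<^bsub>Fr r\<^esub> unit_vec r k)) i" if "i < r" for i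
    using ak free_in[OF Suc.prems(2) that] that by (simp add: unit_vec_def)
  qed
  have "?b \<in> carrier (Fr r)" unfolding free_simps(1) by (rule b)
  thus ?case by (subst a) (rule assms(4)[OF _ ac Qb assms(3)[OF ak]])
 qed
 from this[of r a] show ?thesis using assms(1) by simp
qed

lemma fin_gen_free: "fin_gen (carrier S) (Fr r) (carrier (Fr r))"
 unfolding fin_gen_def
proof (intro exI conjI allI impI)
 show "finite (unit_vec r ` {..<r})" "unit_vec r ` {..<r} \<subseteq> carrier (Fr r)"
  using unit_vec_carrier by auto
 fix H assume H: "sub (Fr r) H" "unit_vec r ` {..<r} \<subseteq> H"
 note o = opsubD[OF H(1)]
 have "a \<in> H" if "a \<in> carrier (Fr r)" for a
  using that by (rule free_induct) (rule o(2), rule o(5), assumption, use H(2) in blast, rule o(3))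
 thus "carrier (Fr r) \<subseteq> H" by blast
qed

text \<open>Serves twice in a presentation: for the generators of the module, and for generators of
  the kernel, which supply the relations.\<close>

lemma free_cover:
 assumes "module S M" "finite A" "A \<subseteq> carrier M"
 shows "\<exists>r. \<exists>g \<in> lin_hom S (Fr r) M. sub M (g ` carrier (Fr r)) \<and>
  A \<subseteq> g ` carrier (Fr r) \<and> (\<forall>H. sub M H \<longrightarrow> A \<subseteq> H \<longrightarrow> g ` carrier (Fr r) \<subseteq> H)"
proof -
 interpret M: module S M by fact
 interpret F: module S "Fr r" for r by (rule module_free)
 obtain r x where rx: "A = x ` {i::nat. i < r}" using assms(2) unfolding finite_conv_nat_seg_image by blast
 have x: "x i \<in> carrier M" if "i < r" for i using rx assms(3) that by blast
 define g where "g = (\<lambda>a\<in>carrier (Fr r). \<Oplus>\<^sub>M i\<in>{..<r}. a i \<odot>\<^sub>M x i)"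
 have gv: "g a = (\<Oplus>\<^sub>M i\<in>{..<r}. a i \<odot>\<^sub>M x i)" if "a \<in> carrier (Fr r)" for a using that by (simp add: g_def)
 have gc: "g a \<in> carrier M" if "a \<in> carrier (Fr r)" for a
  unfolding gv[OF that] using that x by (intro M.M.finsum_closed) (auto simp: free_in)
 have ga: "g (a \<oplus>\<^bsub>Fr r\<^esub> b) = g a \<oplus>\<^sub>M g b"
  if a: "a \<in> carrier (Fr r)" and b: "b \<in> carrier (Fr r)" for a b
 proof -
  have "g (a \<oplus>\<^bsub>Fr r\<^esub> b) = (\<Oplus>\<^sub>M i\<in>{..<r}. (a \<oplus>\<^bsub>Fr r\<^esub> b) i \<odot>\<^sub>M x i)"
   by (rule gv[OF F.M.a_closed[OF a b]])
  also have "\<dots> = (\<Oplus>\<^sub>M i\<in>{..<r}. a i \<odot>\<^sub>M x i \<oplus>\<^sub>M b i \<odot>\<^sub>M x i)"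
   using a b x by (intro M.M.finsum_cong') (auto simp: M.smult_l_distr free_in)
  also have "\<dots> = g a \<oplus>\<^sub>M g b" unfolding gv[OF a] gv[OF b]
   using a b x by (intro M.M.finsum_addf) (auto simp: free_in)
  finally show ?thesis .
 qed
 have gs: "g (s \<odot>\<^bsub>Fr r\<^esub> a) = s \<odot>\<^sub>M g a"
  if s: "s \<in> carrier S" and a: "a \<in> carrier (Fr r)" for s a
 proof -
  have "g (s \<odot>\<^bsub>Fr r\<^esub> a) = (\<Oplus>\<^sub>M i\<in>{..<r}. (s \<odot>\<^bsub>Fr r\<^esub> a) i \<odot>\<^sub>M x i)"
   by (rule gv[OF F.smult_closed[OF s a]])
  also have "\<dots> = (\<Oplus>\<^sub>M i\<in>{..<r}. s \<odot>\<^sub>M (a i \<odot>\<^sub>M x i))"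
   using a s x by (intro M.M.finsum_cong') (auto simp: M.smult_assoc1 free_in)
  also have "\<dots> = s \<odot>\<^sub>M g a" unfolding gv[OF a]
   using a s x by (intro M.finsum_smult_ldistr[symmetric]) (auto simp: free_in)
  finally show ?thesis .
 qed
 have lin: "g \<in> lin_hom S (Fr r) M"
  unfolding lin_hom_def using gc ga gs by (auto simp: g_def PiE_def simp del: free_simps)
 moreover have "sub M (g ` carrier (Fr r))"
 proof (rule M.opsub_submoduleI)
  show "g ` carrier (Fr r) \<subseteq> carrier M" using gc by blast
  have "g (\<zero>\<^sub>S \<odot>\<^bsub>Fr r\<^esub> \<zero>\<^bsub>Fr r\<^esub>) = \<zero>\<^sub>M"
   unfolding gs[OF S.R.zero_closed F.M.zero_closed] by (rule M.smult_l_null[OF gc[OF F.M.zero_closed]])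
  thus "\<zero>\<^sub>M \<in> g ` carrier (Fr r)"
   by (rule subst) (rule imageI[OF F.smult_closed[OF S.R.zero_closed F.M.zero_closed]])
  show "y \<oplus>\<^sub>M z \<in> g ` carrier (Fr r)"
   if "y \<in> g ` carrier (Fr r)" "z \<in> g ` carrier (Fr r)" for y z
  proof -
   obtain a b where ab: "y = g a" "z = g b" "a \<in> carrier (Fr r)" "b \<in> carrier (Fr r)"
    using \<open>y \<in> g ` carrier (Fr r)\<close> \<open>z \<in> g ` carrier (Fr r)\<close> by (elim imageE)
   show ?thesis unfolding ab(1,2) ga[OF ab(3,4), symmetric] by (rule imageI[OF F.M.a_closed[OF ab(3,4)]])
  qed
  show "s \<odot>\<^sub>M y \<in> g ` carrier (Fr r)"
   if "s \<in> carrier S" "y \<in> g ` carrier (Fr r)" for s y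
  proof -
   obtain a where a: "y = g a" "a \<in> carrier (Fr r)"
    using \<open>y \<in> g ` carrier (Fr r)\<close> by (elim imageE)
   show ?thesis unfolding a(1) gs[OF that(1) a(2), symmetric] by (rule imageI[OF F.smult_closed[OF that(1) a(2)]])
  qed
 qed
 moreover have "A \<subseteq> g ` carrier (Fr r)"
 proof
  fix y assume "y \<in> A"
  then obtain j where j: "j < r" "y = x j" using rx by blast
  have "g (unit_vec r j) = (\<Oplus>\<^sub>M i\<in>{..<r}. if j = i then x i else \<zero>\<^sub>M)"
   using gv[of "unit_vec r j"] unit_vec_carrier[of r j] x
   by (auto simp: unit_vec_def intro!: M.M.finsum_cong')
  also have "\<dots> = x j" using j x by (intro M.M.finsum_singleton) auto
  finally have "g (unit_vec r j) = y" using j by simp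
  moreover have "unit_vec r j \<in> carrier (Fr r)" using unit_vec_carrier by simp
  ultimately show "y \<in> g ` carrier (Fr r)" by (metis imageI)
 qed
 moreover have "g ` carrier (Fr r) \<subseteq> H" if H: "sub M H" "A \<subseteq> H" for H
 proof -
  note o = opsubD[OF H(1)]
  have "(\<Oplus>\<^sub>M i\<in>F. a i \<odot>\<^sub>M x i) \<in> H" if "finite F" "F \<subseteq> {..<r}" "a \<in> carrier (Fr r)" for F a
   using that(1,2)
  proof (induction F)
   case empty
   thus ?case using o(2) by simp
  next
   case (insert i F)
   have c: "a j \<odot>\<^sub>M x j \<in> carrier M" if "j \<in> insert i F" for j
    using that insert \<open>a \<in> carrier (Fr r)\<close> x[of j] by (auto simp: free_in)
   have "a i \<odot>\<^sub>M x i \<in> H" using o(5)[of "a i" "x i"] insert \<open>a \<in> carrier (Fr r)\<close> rx H(2) by (auto simp: free_in)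
   moreover have "(\<Oplus>\<^sub>M i\<in>insert i F. a i \<odot>\<^sub>M x i) = a i \<odot>\<^sub>M x i \<oplus>\<^sub>M (\<Oplus>\<^sub>M i\<in>F. a i \<odot>\<^sub>M x i)"
    using insert c by (intro M.M.finsum_insert) auto
   ultimately show ?case using insert o(3) by simp
  qed
  thus ?thesis using gv by (auto simp del: free_simps)
 qed
 ultimately show ?thesis by blast
qed

text \<open>Over a Noetherian ring the relations between finitely many generators are finitely
  generated, being a submodule of a free module of finite rank.\<close>

lemma finitely_presented_iff:
 assumes "module S M"
 shows "finitely_presented S M \<longleftrightarrow> fin_gen (carrier S) M (carrier M)"
proof
 interpret M: module S M by fact
 interpret F: module S "Fr r" for r by (rule module_free)
 assume "finitely_presented S M"
 then obtain r g where g: "g \<in> lin_hom S (Fr r) M" "g ` carrier (Fr r) = carrier M"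
  unfolding finitely_presented_def by blast
 have ga: "g (a \<oplus>\<^bsub>Fr r\<^esub> b) = g a \<oplus>\<^sub>M g b"
  if "a \<in> carrier (Fr r)" "b \<in> carrier (Fr r)" for a b
  using g(1) that unfolding lin_hom_def by blast
 have gs: "g (s \<odot>\<^bsub>Fr r\<^esub> a) = s \<odot>\<^sub>M g a"
  if "s \<in> carrier S" "a \<in> carrier (Fr r)" for s a
  using g(1) that unfolding lin_hom_def by blast
 have gc: "g a \<in> carrier M" if "a \<in> carrier (Fr r)" for a using g(2) that by blast
 have uc: "unit_vec r j \<in> carrier (Fr r)" for j using unit_vec_carrier by simp
 have z: "\<zero>\<^sub>S \<odot>\<^bsub>Fr r\<^esub> \<zero>\<^bsub>Fr r\<^esub> = \<zero>\<^bsub>Fr r\<^esub>" by (rule F.smult_l_null[OF F.M.zero_closed])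
 have g0: "g \<zero>\<^bsub>Fr r\<^esub> = \<zero>\<^sub>M"
  using gs[OF S.R.zero_closed F.M.zero_closed] unfolding z M.smult_l_null[OF gc[OF F.M.zero_closed]] .
 show "fin_gen (carrier S) M (carrier M)"
  unfolding fin_gen_def
 proof (intro exI conjI allI impI)
  show "finite (g ` unit_vec r ` {..<r})" "g ` unit_vec r ` {..<r} \<subseteq> carrier M" using gc uc by auto
  fix H assume H: "sub M H" "g ` unit_vec r ` {..<r} \<subseteq> H"
  note o = opsubD[OF H(1)]
  have "g a \<in> H" if "a \<in> carrier (Fr r)" for a
   using that
  proof (rule free_induct)
   show "g \<zero>\<^bsub>Fr r\<^esub> \<in> H" unfolding g0 by (rule o(2))
   show "g (s \<odot>\<^bsub>Fr r\<^esub> unit_vec r j) \<in> H" if "s \<in> carrier S" "j < r" for s j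
    unfolding gs[OF that(1) uc] using that H(2) by (intro o(5)) auto
   show "g (a \<oplus>\<^bsub>Fr r\<^esub> b) \<in> H"
    if "a \<in> carrier (Fr r)" "b \<in> carrier (Fr r)" "g a \<in> H" "g b \<in> H" for a b
    unfolding ga[OF that(1,2)] by (rule o(3)[OF that(3,4)])
  qed
  thus "carrier M \<subseteq> H" unfolding g(2)[symmetric] by (rule image_subsetI)
 qed
next
 interpret M: module S M by fact
 assume "fin_gen (carrier S) M (carrier M)"
 then obtain A where A: "finite A" "A \<subseteq> carrier M" "\<And>H'. sub M H' \<Longrightarrow> A \<subseteq> H' \<Longrightarrow> carrier M \<subseteq> H'"
  unfolding fin_gen_def by blast
 obtain r g where g: "g \<in> lin_hom S (Fr r) M" "sub M (g ` carrier (Fr r))"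
  "A \<subseteq> g ` carrier (Fr r)" using free_cover[OF assms A(1,2)] by blast
 interpret F: module S "Fr r" by (rule module_free)
 have im: "g ` carrier (Fr r) = carrier M" using A(3)[OF g(2,3)] opsubD(1)[OF g(2)] by blast
 have ga: "g (a \<oplus>\<^bsub>Fr r\<^esub> b) = g a \<oplus>\<^sub>M g b"
  if "a \<in> carrier (Fr r)" "b \<in> carrier (Fr r)" for a b
  using g(1) that unfolding lin_hom_def by blast
 have gs: "g (s \<odot>\<^bsub>Fr r\<^esub> a) = s \<odot>\<^sub>M g a"
  if "s \<in> carrier S" "a \<in> carrier (Fr r)" for s a
  using g(1) that unfolding lin_hom_def by blast
 have gc: "g a \<in> carrier M" if "a \<in> carrier (Fr r)" for a using im that by blast
 have z: "\<zero>\<^sub>S \<odot>\<^bsub>Fr r\<^esub> \<zero>\<^bsub>Fr r\<^esub> = \<zero>\<^bsub>Fr r\<^esub>" by (rule F.smult_l_null[OF F.M.zero_closed])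
 have g0: "g \<zero>\<^bsub>Fr r\<^esub> = \<zero>\<^sub>M"
  using gs[OF S.R.zero_closed F.M.zero_closed] unfolding z M.smult_l_null[OF gc[OF F.M.zero_closed]] .
 define K where "K = {a \<in> carrier (Fr r). g a = \<zero>\<^sub>M}"
 have K: "sub (Fr r) K"
 proof (rule F.opsub_submoduleI)
  show "K \<subseteq> carrier (Fr r)" unfolding K_def by blast
  show "\<zero>\<^bsub>Fr r\<^esub> \<in> K" unfolding K_def using g0 F.M.zero_closed by blast
  show "a \<oplus>\<^bsub>Fr r\<^esub> b \<in> K" if "a \<in> K" "b \<in> K" for a b
   using that ga F.M.a_closed[of a b] unfolding K_def by (simp del: free_simps)
  show "s \<odot>\<^bsub>Fr r\<^esub> a \<in> K" if "s \<in> carrier S" "a \<in> K" for s a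
   using that gs F.smult_closed[of s a] unfolding K_def by (simp del: free_simps)
 qed
 obtain A' where A': "finite A'" "A' \<subseteq> K" "\<And>H'. sub (Fr r) H' \<Longrightarrow> A' \<subseteq> H' \<Longrightarrow> K \<subseteq> H'"
  using F.fin_gen_submodule[OF noeth_S fin_gen_free K] unfolding fin_gen_def by blast
 have "A' \<subseteq> carrier (Fr r)" using A'(2) opsubD(1)[OF K] by blast
 from free_cover[OF module_free A'(1) this] obtain s h where h: "h \<in> lin_hom S (Fr s) (Fr r)"
  "sub (Fr r) (h ` carrier (Fr s))" "A' \<subseteq> h ` carrier (Fr s)"
  "\<And>H. sub (Fr r) H \<Longrightarrow> A' \<subseteq> H \<Longrightarrow> h ` carrier (Fr s) \<subseteq> H" by blast
 have "h ` carrier (Fr s) = K" using A'(3)[OF h(2,3)] h(4)[OF K A'(2)] by blast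
 thus "finitely_presented S M"
  unfolding finitely_presented_def using g(1) h(1) im unfolding K_def by blast
qed

text \<open>Each generator enlarges a submodule by at most a factor of the size of the ring, and an
  infinite cardinal absorbs this.\<close>

lemma fin_gen_card:
 assumes "module S M" "fin_gen (carrier S) M (carrier M)" "infinite (carrier S)"
 shows "\<exists>f. inj_on f (carrier M) \<and> f ` carrier M \<subseteq> carrier S"
proof -
 interpret M: module S M by fact
 obtain A where A: "finite A" "A \<subseteq> carrier M" "\<And>H'. sub M H' \<Longrightarrow> A \<subseteq> H' \<Longrightarrow> carrier M \<subseteq> H'"
  using assms(2) unfolding fin_gen_def by blast
 have "\<exists>N. sub M N \<and> acc (carrier S) M N \<and> A' \<subseteq> N \<and> (card_of N, card_of (carrier S)) \<in> ordLeq"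
  if "finite A'" "A' \<subseteq> carrier M" for A'
  using that
 proof (induction A')
  case empty
  have "(card_of {\<zero>\<^sub>M}, card_of (carrier S)) \<in> ordLeq"
   using assms(3) by (intro card_of_singl_ordLeq) auto
  thus ?case using M.opsub_zero[OF order_refl] M.acc_zero by blast
 next
  case (insert e A')
  then obtain N where N: "sub M N" "acc (carrier S) M N" "A' \<subseteq> N" "(card_of N, card_of (carrier S)) \<in> ordLeq" by auto
  have e: "e \<in> carrier M" using insert by blast
  let ?N = "{r \<odot>\<^sub>M e \<oplus>\<^sub>M u | r u. r \<in> carrier S \<and> u \<in> N}"
  note G = M.acc_adjoin_generator[OF noeth_S N(1,2) e]
  have "?N \<subseteq> (\<lambda>(r, u). r \<odot>\<^sub>M e \<oplus>\<^sub>M u) ` (carrier S \<times> N)" by auto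
  hence "(card_of ?N, card_of (carrier S \<times> N)) \<in> ordLeq"
   by (rule surj_imp_ordLeq)
  moreover have "(card_of (carrier S \<times> N), card_of (carrier S)) \<in> ordLeq"
   using card_of_Times_infinite_simps(1)[OF assms(3) _ N(4)] opsubD(2)[OF N(1)]
   by (intro ordIso_imp_ordLeq) auto
  ultimately have "(card_of ?N, card_of (carrier S)) \<in> ordLeq" by (rule ordLeq_transitive)
  moreover have "insert e A' \<subseteq> ?N"
   using G(4) order_trans[OF N(3) G(3)] by (rule insert_subset[THEN iffD2, OF conjI])
  ultimately show ?case using G(1,2) by (intro exI conjI)
 qed
 from this[OF A(1,2)] obtain N where "sub M N" "A \<subseteq> N" "(card_of N, card_of (carrier S)) \<in> ordLeq" by blast
 moreover have "carrier M \<subseteq> N" using A(3) calculation by blast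
 ultimately have "(card_of (carrier M), card_of (carrier S)) \<in> ordLeq"
  using card_of_mono1 ordLeq_transitive by blast
 thus ?thesis unfolding card_of_ordLeq[symmetric] .
qed

text \<open>Ensures that the choice made in \<open>to_univ\<close> is an injection. Over the zero
  ring, which \<open>S_infinite\<close> excludes, every module is a single point.\<close>

lemma to_univ_inj:
 assumes "\<exists>\<iota> :: 'a \<Rightarrow> 'u. inj_on \<iota> (carrier S)" "module S M" "fin_gen (carrier S) M (carrier M)"
 shows "inj_on (to_univ M :: 'b \<Rightarrow> 'u) (carrier (M :: ('a, 'b) graded_module))"
proof -
 interpret M: module S M by fact
 obtain \<iota> :: "'a \<Rightarrow> 'u" where \<iota>: "inj_on \<iota> (carrier S)" using assms(1) by blast
 have "\<exists>\<phi> :: 'b \<Rightarrow> 'u. inj_on \<phi> (carrier M)"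
 proof (cases "\<one>\<^sub>S = \<zero>\<^sub>S")
  case True
  have "x = \<zero>\<^sub>M" if "x \<in> carrier M" for x using M.smult_one[OF that] M.smult_l_null[OF that] True by simp
  hence "inj_on (\<lambda>_. undefined) (carrier M)" by (auto simp: inj_on_def)
  thus ?thesis by blast
 next
  case False
  obtain f where f: "inj_on f (carrier M)" "f ` carrier M \<subseteq> carrier S"
   using fin_gen_card[OF assms(2,3) S_infinite[OF False]] by blast
  have "inj_on (\<iota> \<circ> f) (carrier M)" using f \<iota> by (meson comp_inj_on inj_on_subset)
  thus ?thesis by blast
 qed
 thus ?thesis unfolding to_univ_def by (rule someI_ex)
qed

end

section \<open>The category of graded modules\<close>

lemma is_mono_cancel:
 "is_mono C m \<Longrightarrow> m \<bullet>\<^sub>C f = m \<bullet>\<^sub>C g \<Longrightarrow> f \<in> Hom C A (Dom C m) \<Longrightarrow> g \<in> Hom C A (Dom C m) \<Longrightarrow> f = g"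
 by (simp add: is_mono_def)

lemma is_epi_cancel:
 "is_epi C e \<Longrightarrow> f \<bullet>\<^sub>C e = g \<bullet>\<^sub>C e \<Longrightarrow> f \<in> Hom C (Cod C e) A \<Longrightarrow> g \<in> Hom C (Cod C e) A \<Longrightarrow> f = g"
 by (simp add: is_epi_def)

lemma ex1_unique: "\<exists>!x. P x \<Longrightarrow> P a \<Longrightarrow> P b \<Longrightarrow> a = b"
 by blast

context standard_graded begin

abbreviation "Gr \<equiv> grmod_ge S"

lemma Ob_iff: "M \<in> Ob (Gr d) \<longleftrightarrow> gobj d M"
proof -
 have "graded_module S M \<Longrightarrow> module S M" by (simp add: graded_module_def)
 thus ?thesis unfolding grmod_ge_def full_subcat_def grmod_def Let_def gobj_def
  using trunc_eq_iff[of M d] finitely_presented_iff[of M] by auto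
qed

lemma C_simps [simp]:
 "Dom (Gr d) (M, \<phi>, N) = M" "Cod (Gr d) (M, \<phi>, N) = N"
 "Idt (Gr d) M = (M, \<lambda>x\<in>carrier M. x, M)"
 "(N', \<psi>, P) \<bullet>\<^bsub>Gr d\<^esub> (M, \<phi>, N) = (M, compose (carrier M) \<psi> \<phi>, P)"
 by (simp_all add: grmod_ge_def full_subcat_def grmod_def Let_def)

lemma Ar_iff: "(M, \<phi>, N) \<in> Ar (Gr d) \<longleftrightarrow> gobj d M \<and> gobj d N \<and> \<phi> \<in> ghom M N"
proof -
 have "(M, \<phi>, N) \<in> Ar (Gr d) \<longleftrightarrow> M \<in> Ob (Gr d) \<and> N \<in> Ob (Gr d) \<and> \<phi> \<in> ghom M N"
  unfolding grmod_ge_def full_subcat_def grmod_def Let_def by auto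
 thus ?thesis by (simp add: Ob_iff)
qed

lemma Hom_iff: "(M', \<phi>, N') \<in> Hom (Gr d) M N \<longleftrightarrow>
  M' = M \<and> N' = N \<and> gobj d M \<and> gobj d N \<and> \<phi> \<in> ghom M N"
 by (auto simp: Hom_def Ar_iff)

lemma HomE:
 assumes "f \<in> Hom (Gr d) M N"
 obtains \<phi> where "f = (M, \<phi>, N)" "gobj d M" "gobj d N" "\<phi> \<in> ghom M N"
 using assms by (cases f) (auto simp: Hom_iff)

lemma ArE:
 assumes "f \<in> Ar (Gr d)"
 obtains M \<phi> N where "f = (M, \<phi>, N)" "gobj d M" "gobj d N" "\<phi> \<in> ghom M N"
 using assms by (cases f) (auto simp: Ar_iff)

lemma ghom_compose:
 assumes "graded_module S M" "\<phi> \<in> ghom M N" "\<psi> \<in> ghom N P"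
 shows "compose (carrier M) \<psi> \<phi> \<in> ghom M P"
proof -
 note f = ghomD[OF assms(2)] and g = ghomD[OF assms(3)]
 show ?thesis unfolding compose_def
  by (rule ghom_restrictI[OF assms(1)]) (simp_all add: f g)
qed

lemma ghom_id: "graded_module S M \<Longrightarrow> (\<lambda>x\<in>carrier M. x) \<in> ghom M M"
 by (rule ghom_restrictI) auto

lemma ghom_eqI:
 assumes "\<phi> \<in> ghom M N" "\<psi> \<in> ghom M N" "\<And>x. x \<in> carrier M \<Longrightarrow> \<phi> x = \<psi> x"
 shows "\<phi> = \<psi>"
 using ghomD(5)[OF assms(1)] ghomD(5)[OF assms(2)] assms(3) by (rule extensionalityI)

lemma category_C: "category (Gr d)"
proof
 show "Dom (Gr d) f \<in> Ob (Gr d)" "Cod (Gr d) f \<in> Ob (Gr d)"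
  if "f \<in> Ar (Gr d)" for f using that by (auto elim!: ArE simp: Ob_iff)
 show "Idt (Gr d) A \<in> Hom (Gr d) A A" if "A \<in> Ob (Gr d)" for A
  using that ghom_id gobjD(1) by (auto simp: Ob_iff Hom_iff)
 show "g \<bullet>\<^bsub>Gr d\<^esub> f \<in> Hom (Gr d) A Z"
  if "f \<in> Hom (Gr d) A B" "g \<in> Hom (Gr d) B Z" for f g A B Z
  using that by (elim HomE) (simp add: Hom_iff ghom_compose[OF gobjD(1)])
 show "f \<bullet>\<^bsub>Gr d\<^esub> Idt (Gr d) A = f" if "f \<in> Hom (Gr d) A B" for f A B
  using that
 proof (elim HomE)
  fix \<phi> assume f: "f = (A, \<phi>, B)" "\<phi> \<in> ghom A B"
  show ?thesis unfolding f(1)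
   using ghomD(5)[OF f(2)] by (auto simp: compose_def intro: extensionalityI[of _ "carrier A"])
 qed
 show "Idt (Gr d) B \<bullet>\<^bsub>Gr d\<^esub> f = f" if "f \<in> Hom (Gr d) A B" for f A B
  using that
 proof (elim HomE)
  fix \<phi> assume f: "f = (A, \<phi>, B)" "\<phi> \<in> ghom A B"
  show ?thesis unfolding f(1)
   using ghomD(1,5)[OF f(2)] by (auto simp: compose_def intro: extensionalityI[of _ "carrier A"])
 qed
 show "h \<bullet>\<^bsub>Gr d\<^esub> (g \<bullet>\<^bsub>Gr d\<^esub> f) = (h \<bullet>\<^bsub>Gr d\<^esub> g) \<bullet>\<^bsub>Gr d\<^esub> f"
  if "f \<in> Hom (Gr d) A B" "g \<in> Hom (Gr d) B Z" "h \<in> Hom (Gr d) Z V" for f g h A B Z V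
  using that by (elim HomE) (auto simp: compose_def ghomD(1) intro!: restrict_ext)
qed

section \<open>Factoring homomorphisms through injections and surjections\<close>

lemma hom_lift:
 assumes "graded_module S A" "graded_module S K" "graded_module S M"
  and k: "\<kappa> \<in> ghom K M" "inj_on \<kappa> (carrier K)"
  and h: "\<phi> \<in> ghom A M" "\<And>x. x \<in> carrier A \<Longrightarrow> \<phi> x \<in> \<kappa> ` carrier K"
 shows "\<exists>\<psi> \<in> ghom A K. \<forall>x \<in> carrier A. \<kappa> (\<psi> x) = \<phi> x"
proof -
 interpret A: graded_module S A by fact
 interpret K: graded_module S K by fact
 note kD = ghomD[OF k(1)] and hD = ghomD[OF h(1)]
 define \<psi> where "\<psi> = inv_into (carrier K) \<kappa> \<circ> \<phi>"
 have p: "\<psi> x \<in> carrier K" "\<kappa> (\<psi> x) = \<phi> x" if "x \<in> carrier A" for x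
  using h(2)[OF that] by (auto simp: \<psi>_def inv_into_into f_inv_into_f)
 have eq: "\<psi> x = y" if "x \<in> carrier A" "y \<in> carrier K" "\<kappa> y = \<phi> x" for x y
  using p[OF that(1)] that k(2) by (metis inj_onD)
 have "restrict \<psi> (carrier A) \<in> ghom A K"
 proof (rule ghom_restrictI[OF assms(1) p(1)])
  show "\<psi> (x \<oplus>\<^sub>A y) = \<psi> x \<oplus>\<^sub>K \<psi> y" if "x \<in> carrier A" "y \<in> carrier A" for x y
   using that by (intro eq) (simp_all add: p kD hD)
  show "\<psi> (r \<odot>\<^sub>A x) = r \<odot>\<^sub>K \<psi> x" if "r \<in> carrier S" "x \<in> carrier A" for r x
   using that by (intro eq) (simp_all add: p kD hD)
  show "\<psi> x \<in> hcomp K i" if "x \<in> hcomp A i" for i x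
   using A.G.hcompD(1)[OF that] hD(4)[OF that] p
   by (intro ghom_homog_inj[OF assms(2,3) k]) simp_all
 qed
 thus ?thesis using p by (intro bexI[of _ "restrict \<psi> (carrier A)"]) auto
qed

text \<open>Take the component of degree \<open>i\<close> of any preimage.\<close>

lemma surj_homog:
 assumes "graded_module S N" "graded_module S Q" "\<pi> \<in> ghom N Q" "\<pi> ` carrier N = carrier Q" "z \<in> hcomp Q i"
 shows "\<exists>y \<in> hcomp N i. \<pi> y = z"
proof -
 interpret N: graded_module S N by fact
 interpret Q: graded_module S Q by fact
 have "z \<in> \<pi> ` carrier N" using Q.G.hcompD(1)[OF assms(5)] assms(4) by simp
 then obtain y where y: "y \<in> carrier N" "\<pi> y = z" by blast
 have "\<pi> (pr N i y) = z" using ghom_zero(4)[OF assms(1-3) y(1), of i] y(2) Q.pr_homog[OF assms(5), of i] by simp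
 thus ?thesis using N.pr(1)[OF y(1)] by blast
qed

lemma hom_descend:
 assumes "graded_module S N" "graded_module S Q" "graded_module S A"
  and q: "\<pi> \<in> ghom N Q" "\<pi> ` carrier N = carrier Q"
  and h: "\<phi> \<in> ghom N A" "\<And>y. y \<in> carrier N \<Longrightarrow> \<pi> y = \<zero>\<^sub>Q \<Longrightarrow> \<phi> y = \<zero>\<^sub>A"
 shows "\<exists>\<psi> \<in> ghom Q A. \<forall>y \<in> carrier N. \<psi> (\<pi> y) = \<phi> y"
proof -
 interpret N: graded_module S N by fact
 interpret Q: graded_module S Q by fact
 interpret A: graded_module S A by fact
 note qD = ghomD[OF q(1)] and hD = ghomD[OF h(1)]
 note qz = ghom_zero[OF assms(1,2) q(1)] and hz = ghom_zero[OF assms(1,3) h(1)]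
 define \<psi> where "\<psi> = \<phi> \<circ> inv_into (carrier N) \<pi>"
 have inv: "inv_into (carrier N) \<pi> z \<in> carrier N" "\<pi> (inv_into (carrier N) \<pi> z) = z" if "z \<in> carrier Q" for z
  using that q(2) by (auto simp: inv_into_into f_inv_into_f)
 have p: "\<psi> (\<pi> y) = \<phi> y" if y: "y \<in> carrier N" for y
 proof -
  let ?y = "inv_into (carrier N) \<pi> (\<pi> y)"
  note i = inv[OF qD(1)[OF y]]
  have "\<pi> (?y \<ominus>\<^sub>N y) = \<zero>\<^sub>Q" using i y qD(1) by (simp add: qz)
  hence "\<phi> ?y \<ominus>\<^sub>A \<phi> y = \<zero>\<^sub>A" using h(2)[of "?y \<ominus>\<^sub>N y"] i y by (simp add: hz)
  thus ?thesis using i y hD(1) by (simp add: \<psi>_def A.M.minus_eq_zero_iff)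
 qed
 have surj: "\<exists>y. y \<in> carrier N \<and> z = \<pi> y" if "z \<in> carrier Q" for z using inv[OF that] by metis
 have "restrict \<psi> (carrier Q) \<in> ghom Q A"
 proof (rule ghom_restrictI[OF assms(2)])
  fix z assume z: "z \<in> carrier Q"
  obtain y where y: "y \<in> carrier N" "z = \<pi> y" using surj[OF z] by blast
  show "\<psi> z \<in> carrier A" using p y hD(1) by simp
  show "\<psi> (r \<odot>\<^sub>Q z) = r \<odot>\<^sub>A \<psi> z" if "r \<in> carrier S" for r
   using that y p[of "r \<odot>\<^sub>N y"] p[of y] by (simp add: qD hD)
  fix w assume w: "w \<in> carrier Q"
  obtain v where v: "v \<in> carrier N" "w = \<pi> v" using surj[OF w] by blast
  show "\<psi> (z \<oplus>\<^sub>Q w) = \<psi> z \<oplus>\<^sub>A \<psi> w"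
   using y v p[of "y \<oplus>\<^sub>N v"] p[of y] p[of v] by (simp add: qD hD)
 next
  fix i z assume "z \<in> hcomp Q i"
  then obtain y where y: "y \<in> hcomp N i" "\<pi> y = z" using surj_homog[OF assms(1,2) q] by blast
  thus "\<psi> z \<in> hcomp A i" using p[OF N.G.hcompD(1)[OF y(1)]] hD(4)[OF y(1)] by simp
 qed
 thus ?thesis using p qD(1) by (intro bexI[of _ "restrict \<psi> (carrier Q)"]) auto
qed

lemma ghom_zero_map:
 assumes "graded_module S M" "graded_module S N"
 shows "(\<lambda>x\<in>carrier M. \<zero>\<^sub>N) \<in> ghom M N"
proof -
 interpret N: graded_module S N by fact
 show ?thesis by (rule ghom_restrictI[OF assms(1)]) (simp_all add: N.G.hcompD(2))
qed

section \<open>Zero objects, kernels, cokernels, monos and epis on elements\<close>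

lemma zero_obj_iff:
 fixes Z :: "('a, 'u) graded_module"
 shows "is_zero_obj (Gr d) Z \<longleftrightarrow> gobj d Z \<and> carrier Z = {\<zero>\<^sub>Z}"
proof
 assume Z: "is_zero_obj (Gr d) Z"
 hence g: "gobj d Z" by (simp add: is_zero_obj_def Ob_iff)
 note gr = gobjD(1)[OF g]
 interpret Z: graded_module S Z by (rule gr)
 \<comment> \<open>Identity and zero map are both endomorphisms, hence equal.\<close>
 have "\<exists>!f. f \<in> Hom (Gr d) Z Z" using Z by (simp add: is_zero_obj_def)
 moreover have "(Z, \<lambda>x\<in>carrier Z. x, Z) \<in> Hom (Gr d) Z Z"
  "(Z, \<lambda>x\<in>carrier Z. \<zero>\<^sub>Z, Z) \<in> Hom (Gr d) Z Z"
  using g ghom_id[OF gr] ghom_zero_map[OF gr gr] by (auto simp: Hom_iff)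
 ultimately have "(\<lambda>x\<in>carrier Z. x) = (\<lambda>x\<in>carrier Z. \<zero>\<^sub>Z)" by (metis prod.inject)
 hence "x = \<zero>\<^sub>Z" if "x \<in> carrier Z" for x using that by (metis restrict_apply')
 thus "gobj d Z \<and> carrier Z = {\<zero>\<^sub>Z}" using g Z.M.zero_closed by blast
next
 assume Z: "gobj d Z \<and> carrier Z = {\<zero>\<^sub>Z}"
 hence gr: "graded_module S Z" using gobjD(1) by blast
 interpret Z: graded_module S Z by (rule gr)
 have hz: "hcomp Z i = {\<zero>\<^sub>Z}" for i using Z Z.G.hcompD(1,2) by blast
 show "is_zero_obj (Gr d) Z"
  unfolding is_zero_obj_def
 proof (intro conjI ballI)
  show "Z \<in> Ob (Gr d)" using Z by (simp add: Ob_iff)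
  fix A :: "('a, 'u) graded_module" assume "A \<in> Ob (Gr d)"
  hence A: "gobj d A" "graded_module S A" by (auto simp: Ob_iff dest: gobjD)
  show "\<exists>!f. f \<in> Hom (Gr d) A Z"
  proof (rule ex1I[of _ "(A, \<lambda>x\<in>carrier A. \<zero>\<^sub>Z, Z)"])
   show "(A, \<lambda>x\<in>carrier A. \<zero>\<^sub>Z, Z) \<in> Hom (Gr d) A Z"
    using A Z ghom_zero_map[OF A(2) gr] by (simp add: Hom_iff)
   fix f assume "f \<in> Hom (Gr d) A Z"
   then obtain \<phi> where f: "f = (A, \<phi>, Z)" "\<phi> \<in> ghom A Z" by (rule HomE)
   have "\<phi> = (\<lambda>x\<in>carrier A. \<zero>\<^sub>Z)"
    by (rule ghom_eqI[OF f(2) ghom_zero_map[OF A(2) gr]]) (use ghomD(1)[OF f(2)] Z in auto)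
   thus "f = (A, \<lambda>x\<in>carrier A. \<zero>\<^sub>Z, Z)" using f by simp
  qed
  show "\<exists>!f. f \<in> Hom (Gr d) Z A"
  proof (rule ex1I[of _ "(Z, \<lambda>x\<in>carrier Z. \<zero>\<^sub>A, A)"])
   show "(Z, \<lambda>x\<in>carrier Z. \<zero>\<^sub>A, A) \<in> Hom (Gr d) Z A"
    using A Z ghom_zero_map[OF gr A(2)] by (simp add: Hom_iff)
   fix f assume "f \<in> Hom (Gr d) Z A"
   then obtain \<phi> where f: "f = (Z, \<phi>, A)" "\<phi> \<in> ghom Z A" by (rule HomE)
   have "\<phi> = (\<lambda>x\<in>carrier Z. \<zero>\<^sub>A)"
    by (rule ghom_eqI[OF f(2) ghom_zero_map[OF gr A(2)]])
     (use ghom_zero(1)[OF gr A(2) f(2)] Z in auto)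
   thus "f = (Z, \<lambda>x\<in>carrier Z. \<zero>\<^sub>A, A)" using f by simp
  qed
 qed
qed

lemma zero_obj_trivial: "is_zero_obj (Gr d) (trivial_gm z)"
 unfolding zero_obj_iff using gobj_trivial by (simp add: trivial_gm_def)

lemma zero_arr_iff:
 assumes "gobj d M" "gobj d N" "\<phi> \<in> ghom M N"
 shows "is_zero_arr (Gr d) (M, \<phi>, N) \<longleftrightarrow> (\<forall>x\<in>carrier M. \<phi> x = \<zero>\<^sub>N)"
proof
 assume "is_zero_arr (Gr d) (M, \<phi>, N)"
 then obtain Z g h where Z: "is_zero_obj (Gr d) Z" "g \<in> Hom (Gr d) M Z" "h \<in> Hom (Gr d) Z N"
  "(M, \<phi>, N) = h \<bullet>\<^bsub>Gr d\<^esub> g" unfolding is_zero_arr_def by auto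
 obtain \<gamma> where g: "g = (M, \<gamma>, Z)" "\<gamma> \<in> ghom M Z" using Z(2) by (rule HomE)
 obtain \<kappa> where h: "h = (Z, \<kappa>, N)" "\<kappa> \<in> ghom Z N" "gobj d Z" using Z(3) by (rule HomE)
 have "\<phi> = compose (carrier M) \<kappa> \<gamma>" using Z(4) g h by simp
 moreover have "\<gamma> x = \<zero>\<^sub>Z" if "x \<in> carrier M" for x
  using ghomD(1)[OF g(2) that] Z(1) by (simp add: zero_obj_iff)
 ultimately show "\<forall>x\<in>carrier M. \<phi> x = \<zero>\<^sub>N"
  using ghom_zero(1)[OF gobjD(1)[OF h(3)] gobjD(1)[OF assms(2)] h(2)] by (simp add: compose_eq)
next
 assume z: "\<forall>x\<in>carrier M. \<phi> x = \<zero>\<^sub>N"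
 let ?Z = "trivial_gm undefined" and ?a = "\<lambda>M N. (M, \<lambda>x\<in>carrier M. \<zero>\<^sub>N, N)"
 have Z: "gobj d ?Z" by (rule gobj_trivial)
 note m = gobjD(1)[OF assms(1)] gobjD(1)[OF assms(2)] gobjD(1)[OF Z]
 have h: "?a M ?Z \<in> Hom (Gr d) M ?Z" "?a ?Z N \<in> Hom (Gr d) ?Z N"
  using ghom_zero_map m assms Z by (auto simp: Hom_iff)
 have e: "(M, \<phi>, N) = ?a ?Z N \<bullet>\<^bsub>Gr d\<^esub> ?a M ?Z"
  using z ghomD(5)[OF assms(3)]
  by (auto simp: compose_def trivial_gm_def intro: extensionalityI[of _ "carrier M"])
 show "is_zero_arr (Gr d) (M, \<phi>, N)"
  unfolding is_zero_arr_def C_simps(1,2)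
  by (intro conjI exI[of _ ?Z] bexI[OF _ h(1)] bexI[OF _ h(2)] e zero_obj_trivial) (simp add: Ar_iff assms)
qed

text \<open>For the passage from the universal property to elements, the test objects are the
  submodules on which \<open>\<phi>\<close> and \<open>\<kappa>\<close> vanish; they have their
  elements in the same type. The first shows that the image of \<open>\<kappa>\<close> is the whole
  kernel, the second, by comparing inclusion and zero map, that \<open>\<kappa>\<close> is
  injective.\<close>

lemma kernel_iff:
 assumes "gobj d M" "gobj d N" "\<phi> \<in> ghom M N" "gobj d K" "\<kappa> \<in> ghom K M"
 shows "is_kernel (Gr d) (M, \<phi>, N) (K, \<kappa>, M) \<longleftrightarrow>
  inj_on \<kappa> (carrier K) \<and> \<kappa> ` carrier K = {x \<in> carrier M. \<phi> x = \<zero>\<^sub>N}"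
proof
 note m = gobjD(1)[OF assms(1)] gobjD(1)[OF assms(2)] gobjD(1)[OF assms(4)]
 interpret K: graded_module S K by (rule m(3))
 assume k: "is_kernel (Gr d) (M, \<phi>, N) (K, \<kappa>, M)"
 have comp: "(M, \<phi>, N) \<bullet>\<^bsub>Gr d\<^esub> (L, \<alpha>, M) = (L, compose (carrier L) \<phi> \<alpha>, N)" for L \<alpha> by simp
 have "is_zero_arr (Gr d) (K, compose (carrier K) \<phi> \<kappa>, N)" using k by (simp add: is_kernel_def)
 hence z: "\<phi> (\<kappa> x) = \<zero>\<^sub>N" if "x \<in> carrier K" for x
  using zero_arr_iff[OF assms(4,2) ghom_compose[OF m(3) assms(5,3)]] that by (simp add: compose_eq)
 have uni: "\<exists>!u. u \<in> Hom (Gr d) L K \<and> (K, \<kappa>, M) \<bullet>\<^bsub>Gr d\<^esub> u = (L, \<alpha>, M)"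
  if "gobj d L" "\<alpha> \<in> ghom L M" "\<And>x. x \<in> carrier L \<Longrightarrow> \<phi> (\<alpha> x) = \<zero>\<^sub>N" for L \<alpha>
 proof -
  have "(L, \<alpha>, M) \<in> Hom (Gr d) L M" using that assms by (simp add: Hom_iff)
  moreover have "is_zero_arr (Gr d) ((M, \<phi>, N) \<bullet>\<^bsub>Gr d\<^esub> (L, \<alpha>, M))"
   unfolding comp zero_arr_iff[OF that(1) assms(2) ghom_compose[OF gobjD(1)[OF that(1)] that(2) assms(3)]]
   using that by (simp add: compose_eq)
  ultimately show ?thesis using k by (simp add: is_kernel_def)
 qed
 let ?H = "{x \<in> carrier M. \<phi> x = \<zero>\<^sub>N}"
 have H: "hsub M ?H" by (rule hsub_kernel[OF m(1,2) assms(3)])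
 have "{x \<in> carrier M. \<phi> x = \<zero>\<^sub>N} \<subseteq> \<kappa> ` carrier K"
 proof
  fix x assume x: "x \<in> ?H"
  obtain u where "u \<in> Hom (Gr d) (sub_gm M ?H) K"
   "(K, \<kappa>, M) \<bullet>\<^bsub>Gr d\<^esub> u = (sub_gm M ?H, \<lambda>x\<in>?H. x, M)"
   using uni[OF gobj_sub_gm[OF assms(1) H] incl_hom[OF m(1) H]] by auto
  then obtain \<upsilon> where "\<upsilon> \<in> ghom (sub_gm M ?H) K" "compose ?H \<kappa> \<upsilon> = (\<lambda>x\<in>?H. x)"
   by (elim HomE) auto
  hence "\<kappa> (\<upsilon> x) = x" "\<upsilon> x \<in> carrier K" using x ghomD(1)[of \<upsilon> "sub_gm M ?H" K x]
   by (auto simp: compose_def dest!: fun_cong[of _ _ x])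
  thus "x \<in> \<kappa> ` carrier K" by (metis imageI)
 qed
 moreover have "\<kappa> ` carrier K \<subseteq> ?H" using z ghomD(1)[OF assms(5)] by blast
 moreover have "inj_on \<kappa> (carrier K)"
  unfolding ghom_inj_iff[OF m(3,1) assms(5)]
 proof (intro ballI impI)
  let ?L = "{x \<in> carrier K. \<kappa> x = \<zero>\<^sub>M}"
  have L: "hsub K ?L" by (rule hsub_kernel[OF m(3,1) assms(5)])
  fix x assume x: "x \<in> carrier K" "\<kappa> x = \<zero>\<^sub>M"
  note gL = gobj_sub_gm[OF assms(4) L]
  have zz: "\<phi> ((\<lambda>x\<in>?L. \<zero>\<^sub>M) x) = \<zero>\<^sub>N" if "x \<in> carrier (sub_gm K ?L)" for x
   using that ghom_zero(1)[OF m(1,2) assms(3)] by auto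
  have zm: "(\<lambda>x\<in>?L. \<zero>\<^sub>P) \<in> ghom (sub_gm K ?L) P" if "graded_module S P" for P :: "('a, 'b) graded_module"
   using ghom_zero_map[OF gobjD(1)[OF gL] that] by simp
  have "(K, \<kappa>, M) \<bullet>\<^bsub>Gr d\<^esub> (sub_gm K ?L, \<lambda>x\<in>?L. x, K) = (sub_gm K ?L, \<lambda>x\<in>?L. \<zero>\<^sub>M, M)"
   "(K, \<kappa>, M) \<bullet>\<^bsub>Gr d\<^esub> (sub_gm K ?L, \<lambda>x\<in>?L. \<zero>\<^sub>K, K) = (sub_gm K ?L, \<lambda>x\<in>?L. \<zero>\<^sub>M, M)"
   using ghom_zero(1)[OF m(3,1) assms(5)] by (auto simp: compose_def intro!: restrict_ext)
  moreover have "(sub_gm K ?L, \<lambda>x\<in>?L. x, K) \<in> Hom (Gr d) (sub_gm K ?L) K"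
   "(sub_gm K ?L, \<lambda>x\<in>?L. \<zero>\<^sub>K, K) \<in> Hom (Gr d) (sub_gm K ?L) K"
   using gL assms(4) incl_hom[OF m(3) L] zm[OF m(3)] by (auto simp: Hom_iff)
  ultimately have "(sub_gm K ?L, \<lambda>x\<in>?L. x, K) = (sub_gm K ?L, \<lambda>x\<in>?L. \<zero>\<^sub>K, K)"
   using uni[OF gL zm[OF m(1)] zz] by blast
  hence "(\<lambda>x\<in>?L. x) x = (\<lambda>x\<in>?L. \<zero>\<^sub>K) x" by simp
  thus "x = \<zero>\<^sub>K" using x by simp
 qed
 ultimately show "inj_on \<kappa> (carrier K) \<and> \<kappa> ` carrier K = ?H" by blast
next
 note m = gobjD(1)[OF assms(1)] gobjD(1)[OF assms(2)] gobjD(1)[OF assms(4)]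
 assume k: "inj_on \<kappa> (carrier K) \<and> \<kappa> ` carrier K = {x \<in> carrier M. \<phi> x = \<zero>\<^sub>N}"
 show "is_kernel (Gr d) (M, \<phi>, N) (K, \<kappa>, M)"
  unfolding is_kernel_def C_simps
 proof (intro conjI allI ballI impI)
  show "(M, \<phi>, N) \<in> Ar (Gr d)" "(K, \<kappa>, M) \<in> Ar (Gr d)" using assms by (auto simp: Ar_iff)
  show "is_zero_arr (Gr d) (K, compose (carrier K) \<phi> \<kappa>, N)"
   unfolding zero_arr_iff[OF assms(4,2) ghom_compose[OF m(3) assms(5,3)]] using k by (auto simp: compose_eq)
  fix A h assume h: "h \<in> Hom (Gr d) A M" "is_zero_arr (Gr d) ((M, \<phi>, N) \<bullet>\<^bsub>Gr d\<^esub> h)"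
  obtain \<alpha> where a: "h = (A, \<alpha>, M)" "gobj d A" "\<alpha> \<in> ghom A M" using h(1) by (rule HomE)
  note A = gobjD(1)[OF a(2)]
  have "\<phi> (\<alpha> x) = \<zero>\<^sub>N" if "x \<in> carrier A" for x
   using h(2) that zero_arr_iff[OF a(2) assms(2) ghom_compose[OF A a(3) assms(3)]] by (simp add: a compose_eq)
  hence "\<alpha> x \<in> \<kappa> ` carrier K" if "x \<in> carrier A" for x using k that ghomD(1)[OF a(3)] by auto
  with hom_lift[OF A m(3,1) assms(5) _ a(3)] k obtain \<psi> where p: "\<psi> \<in> ghom A K" "\<forall>x\<in>carrier A. \<kappa> (\<psi> x) = \<alpha> x"
   by blast
  show "\<exists>!u. u \<in> Hom (Gr d) A K \<and> (K, \<kappa>, M) \<bullet>\<^bsub>Gr d\<^esub> u = h"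
  proof (rule ex1I[of _ "(A, \<psi>, K)"])
   have "compose (carrier A) \<kappa> \<psi> = \<alpha>"
    by (rule ghom_eqI[OF ghom_compose[OF A p(1) assms(5)] a(3)]) (use p in \<open>simp add: compose_eq\<close>)
   thus "(A, \<psi>, K) \<in> Hom (Gr d) A K \<and> (K, \<kappa>, M) \<bullet>\<^bsub>Gr d\<^esub> (A, \<psi>, K) = h"
    using p(1) a assms(4) by (simp add: Hom_iff)
   fix u assume u: "u \<in> Hom (Gr d) A K \<and> (K, \<kappa>, M) \<bullet>\<^bsub>Gr d\<^esub> u = h"
   then obtain \<upsilon> where v: "u = (A, \<upsilon>, K)" "\<upsilon> \<in> ghom A K" using HomE by metis
   have "\<kappa> (\<upsilon> x) = \<alpha> x" if "x \<in> carrier A" for x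
    using u that v(1) a(1) by (auto simp: compose_def dest!: fun_cong[of _ _ x])
   hence kk: "\<kappa> (\<upsilon> x) = \<kappa> (\<psi> x)" if "x \<in> carrier A" for x using p(2) that by simp
   have "\<upsilon> = \<psi>"
   proof (rule ghom_eqI[OF v(2) p(1)])
    show "\<upsilon> x = \<psi> x" if "x \<in> carrier A" for x
     by (rule inj_onD[OF conjunct1[OF k] kk[OF that] ghomD(1)[OF v(2) that] ghomD(1)[OF p(1) that]])
   qed
   thus "u = (A, \<psi>, K)" using v by simp
  qed
 qed simp
qed

lemma mono_iff:
 assumes "gobj d M" "gobj d N" "\<phi> \<in> ghom M N"
 shows "is_mono (Gr d) (M, \<phi>, N) \<longleftrightarrow> inj_on \<phi> (carrier M)"
proof
 note m = gobjD(1)[OF assms(1)] gobjD(1)[OF assms(2)]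
 assume mono: "is_mono (Gr d) (M, \<phi>, N)"
 show "inj_on \<phi> (carrier M)"
  unfolding ghom_inj_iff[OF m assms(3)]
 proof (intro ballI impI)
  let ?L = "{x \<in> carrier M. \<phi> x = \<zero>\<^sub>N}"
  have L: "hsub M ?L" by (rule hsub_kernel[OF m assms(3)])
  fix x assume x: "x \<in> carrier M" "\<phi> x = \<zero>\<^sub>N"
  note gL = gobj_sub_gm[OF assms(1) L]
  have zm: "(\<lambda>x\<in>?L. \<zero>\<^sub>M) \<in> ghom (sub_gm M ?L) M"
   using ghom_zero_map[OF gobjD(1)[OF gL] m(1)] by simp
  have eq: "(M, \<phi>, N) \<bullet>\<^bsub>Gr d\<^esub> (sub_gm M ?L, \<lambda>x\<in>?L. x, M)
    = (M, \<phi>, N) \<bullet>\<^bsub>Gr d\<^esub> (sub_gm M ?L, \<lambda>x\<in>?L. \<zero>\<^sub>M, M)"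
   using ghom_zero(1)[OF m assms(3)] by (auto simp: compose_def intro!: restrict_ext)
  have "(sub_gm M ?L, \<lambda>x\<in>?L. x, M) \<in> Hom (Gr d) (sub_gm M ?L) M"
   "(sub_gm M ?L, \<lambda>x\<in>?L. \<zero>\<^sub>M, M) \<in> Hom (Gr d) (sub_gm M ?L) M"
   using gL assms(1) incl_hom[OF m(1) L] zm by (auto simp: Hom_iff)
  hence "(sub_gm M ?L, \<lambda>x\<in>?L. x, M) = (sub_gm M ?L, \<lambda>x\<in>?L. \<zero>\<^sub>M, M)"
   by (rule is_mono_cancel[OF mono eq, unfolded C_simps(1)])
  hence "(\<lambda>x\<in>?L. x) x = (\<lambda>x\<in>?L. \<zero>\<^sub>M) x" by simp
  thus "x = \<zero>\<^sub>M" using x by simp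
 qed
next
 assume inj: "inj_on \<phi> (carrier M)"
 show "is_mono (Gr d) (M, \<phi>, N)"
  unfolding is_mono_def C_simps
 proof (intro conjI allI ballI impI)
  show "(M, \<phi>, N) \<in> Ar (Gr d)" using assms by (simp add: Ar_iff)
  fix A f g assume f: "f \<in> Hom (Gr d) A M" and g: "g \<in> Hom (Gr d) A M"
   and eq: "(M, \<phi>, N) \<bullet>\<^bsub>Gr d\<^esub> f = (M, \<phi>, N) \<bullet>\<^bsub>Gr d\<^esub> g"
  obtain \<alpha> where a: "f = (A, \<alpha>, M)" "\<alpha> \<in> ghom A M" using f by (rule HomE)
  obtain \<beta> where b: "g = (A, \<beta>, M)" "\<beta> \<in> ghom A M" using g by (rule HomE)
  have "\<phi> (\<alpha> x) = \<phi> (\<beta> x)" if "x \<in> carrier A" for x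
   using eq that by (auto simp: a b compose_def dest!: fun_cong[of _ _ x])
  hence "\<alpha> = \<beta>" using inj ghomD(1)[OF a(2)] ghomD(1)[OF b(2)]
   by (intro ghom_eqI[OF a(2) b(2)]) (metis inj_onD)
  thus "f = g" using a b by simp
 qed
qed

text \<open>Dual to \<open>kernel_iff\<close>, with the quotients of \<open>N\<close> by the image
  of \<open>\<phi>\<close> and of \<open>Q\<close> by the image of \<open>\<pi>\<close> as test
  objects.\<close>

lemma cokernel_iff:
 assumes "gobj d M" "gobj d N" "\<phi> \<in> ghom M N" "gobj d Q" "\<pi> \<in> ghom N Q"
 shows "is_cokernel (Gr d) (M, \<phi>, N) (N, \<pi>, Q) \<longleftrightarrow>
  \<pi> ` carrier N = carrier Q \<and> {y \<in> carrier N. \<pi> y = \<zero>\<^sub>Q} = \<phi> ` carrier M"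
proof
 note m = gobjD(1)[OF assms(1)] gobjD(1)[OF assms(2)] gobjD(1)[OF assms(4)]
 interpret Q: graded_module S Q by (rule m(3))
 assume k: "is_cokernel (Gr d) (M, \<phi>, N) (N, \<pi>, Q)"
 have "is_zero_arr (Gr d) (M, compose (carrier M) \<pi> \<phi>, Q)" using k by (simp add: is_cokernel_def)
 hence z: "\<pi> (\<phi> x) = \<zero>\<^sub>Q" if "x \<in> carrier M" for x
  using zero_arr_iff[OF assms(1,4) ghom_compose[OF m(1) assms(3,5)]] that by (simp add: compose_eq)
 have uni: "\<exists>!u. u \<in> Hom (Gr d) Q L \<and> u \<bullet>\<^bsub>Gr d\<^esub> (N, \<pi>, Q) = (N, \<alpha>, L)"
  if "gobj d L" "\<alpha> \<in> ghom N L" "\<And>x. x \<in> carrier M \<Longrightarrow> \<alpha> (\<phi> x) = \<zero>\<^sub>L" for L \<alpha>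
 proof -
  have "(N, \<alpha>, L) \<in> Hom (Gr d) N L" using that assms by (simp add: Hom_iff)
  moreover have "is_zero_arr (Gr d) ((N, \<alpha>, L) \<bullet>\<^bsub>Gr d\<^esub> (M, \<phi>, N))"
   unfolding C_simps zero_arr_iff[OF assms(1) that(1) ghom_compose[OF m(1) assms(3) that(2)]]
   using that by (simp add: compose_eq)
  ultimately show ?thesis using k by (simp add: is_cokernel_def)
 qed
 have I: "hsub N (\<phi> ` carrier M)" by (rule hsub_image[OF m(1,2) assms(3) hsub_carrier[OF m(1)]])
 note q = quot[OF assms(2) I]
 have "y \<in> \<phi> ` carrier M" if y: "y \<in> carrier N" "\<pi> y = \<zero>\<^sub>Q" for y
 proof -
  have z': "proj N (\<phi> ` carrier M) (\<phi> x) = \<zero>\<^bsub>quot N (\<phi> ` carrier M)\<^esub>" if "x \<in> carrier M" for x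
   using q(4)[of "\<phi> x"] that ghomD(1)[OF assms(3) that] by blast
  obtain u where "u \<in> Hom (Gr d) Q (quot N (\<phi> ` carrier M))"
   "u \<bullet>\<^bsub>Gr d\<^esub> (N, \<pi>, Q) = (N, proj N (\<phi> ` carrier M), quot N (\<phi> ` carrier M))"
   using uni[OF q(1,2) z'] by auto
  then obtain \<upsilon> where u: "\<upsilon> \<in> ghom Q (quot N (\<phi> ` carrier M))"
   "compose (carrier N) \<upsilon> \<pi> = proj N (\<phi> ` carrier M)" by (elim HomE) auto
  have "proj N (\<phi> ` carrier M) y = \<zero>\<^bsub>quot N (\<phi> ` carrier M)\<^esub>"
   using ghom_zero(1)[OF m(3) gobjD(1)[OF q(1)] u(1)] y by (simp add: u(2)[symmetric] compose_eq)
  thus ?thesis using q(4)[OF y(1)] by blast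
 qed
 moreover have "\<phi> ` carrier M \<subseteq> {y \<in> carrier N. \<pi> y = \<zero>\<^sub>Q}" using z ghomD(1)[OF assms(3)] by blast
 moreover have "\<pi> ` carrier N = carrier Q"
 proof -
  have J: "hsub Q (\<pi> ` carrier N)" by (rule hsub_image[OF m(2,3) assms(5) hsub_carrier[OF m(2)]])
  let ?J = "\<pi> ` carrier N"
  note qj = quot[OF assms(4) J]
  note zm = ghom_zero_map[OF _ gobjD(1)[OF qj(1)]]
  have eq: "(Q, proj Q ?J, quot Q ?J) \<bullet>\<^bsub>Gr d\<^esub> (N, \<pi>, Q) = (N, \<lambda>x\<in>carrier N. \<zero>\<^bsub>quot Q ?J\<^esub>, quot Q ?J)"
   "(Q, \<lambda>x\<in>carrier Q. \<zero>\<^bsub>quot Q ?J\<^esub>, quot Q ?J) \<bullet>\<^bsub>Gr d\<^esub> (N, \<pi>, Q) = (N, \<lambda>x\<in>carrier N. \<zero>\<^bsub>quot Q ?J\<^esub>, quot Q ?J)"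
   using qj(4) ghomD(1)[OF assms(5)] by (auto simp: compose_def intro!: restrict_ext)
  have h: "(Q, proj Q ?J, quot Q ?J) \<in> Hom (Gr d) Q (quot Q ?J)"
   "(Q, \<lambda>x\<in>carrier Q. \<zero>\<^bsub>quot Q ?J\<^esub>, quot Q ?J) \<in> Hom (Gr d) Q (quot Q ?J)"
   using qj(1,2) assms(4) zm[OF m(3)] by (auto simp: Hom_iff)
  have "(Q, proj Q ?J, quot Q ?J) = (Q, \<lambda>x\<in>carrier Q. \<zero>\<^bsub>quot Q ?J\<^esub>, quot Q ?J)"
   by (rule ex1_unique[OF uni[OF qj(1) zm[OF m(2)]]]) (use ghomD(1)[OF assms(3)] eq h in simp_all)
  hence "proj Q ?J = (\<lambda>x\<in>carrier Q. \<zero>\<^bsub>quot Q ?J\<^esub>)" by simp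
  hence "x \<in> ?J" if "x \<in> carrier Q" for x using qj(4)[OF that] that by simp
  thus ?thesis using ghomD(1)[OF assms(5)] by blast
 qed
 ultimately show "\<pi> ` carrier N = carrier Q \<and> {y \<in> carrier N. \<pi> y = \<zero>\<^sub>Q} = \<phi> ` carrier M" by blast
next
 note m = gobjD(1)[OF assms(1)] gobjD(1)[OF assms(2)] gobjD(1)[OF assms(4)]
 assume k: "\<pi> ` carrier N = carrier Q \<and> {y \<in> carrier N. \<pi> y = \<zero>\<^sub>Q} = \<phi> ` carrier M"
 show "is_cokernel (Gr d) (M, \<phi>, N) (N, \<pi>, Q)"
  unfolding is_cokernel_def C_simps
 proof (intro conjI allI ballI impI)
  show "(M, \<phi>, N) \<in> Ar (Gr d)" "(N, \<pi>, Q) \<in> Ar (Gr d)" using assms by (auto simp: Ar_iff)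
  show "is_zero_arr (Gr d) (M, compose (carrier M) \<pi> \<phi>, Q)"
   unfolding zero_arr_iff[OF assms(1,4) ghom_compose[OF m(1) assms(3,5)]] using k by (auto simp: compose_eq)
  fix A h assume h: "h \<in> Hom (Gr d) N A" "is_zero_arr (Gr d) (h \<bullet>\<^bsub>Gr d\<^esub> (M, \<phi>, N))"
  obtain \<alpha> where a: "h = (N, \<alpha>, A)" "gobj d A" "\<alpha> \<in> ghom N A" using h(1) by (rule HomE)
  note A = gobjD(1)[OF a(2)]
  have az: "\<alpha> (\<phi> x) = \<zero>\<^sub>A" if "x \<in> carrier M" for x
   using h(2) that zero_arr_iff[OF assms(1) a(2) ghom_compose[OF m(1) assms(3) a(3)]] by (simp add: a compose_eq)
  have az': "\<alpha> y = \<zero>\<^sub>A" if "y \<in> carrier N" "\<pi> y = \<zero>\<^sub>Q" for y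
  proof -
   have "y \<in> \<phi> ` carrier M" using conjunct2[OF k] that by (auto simp del: image_iff)
   thus ?thesis using az by (elim imageE) simp
  qed
  obtain \<psi> where p: "\<psi> \<in> ghom Q A" "\<forall>x\<in>carrier N. \<psi> (\<pi> x) = \<alpha> x"
   using hom_descend[OF m(2,3) A assms(5) conjunct1[OF k] a(3)] az' by (metis (no_types, lifting))
  show "\<exists>!u. u \<in> Hom (Gr d) Q A \<and> u \<bullet>\<^bsub>Gr d\<^esub> (N, \<pi>, Q) = h"
  proof (rule ex1I[of _ "(Q, \<psi>, A)"])
   have "compose (carrier N) \<psi> \<pi> = \<alpha>"
    by (rule ghom_eqI[OF ghom_compose[OF m(2) assms(5) p(1)] a(3)]) (use p in \<open>simp add: compose_eq\<close>)
   thus "(Q, \<psi>, A) \<in> Hom (Gr d) Q A \<and> (Q, \<psi>, A) \<bullet>\<^bsub>Gr d\<^esub> (N, \<pi>, Q) = h"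
    using p(1) a assms(4) by (simp add: Hom_iff)
   fix u assume u: "u \<in> Hom (Gr d) Q A \<and> u \<bullet>\<^bsub>Gr d\<^esub> (N, \<pi>, Q) = h"
   then obtain \<upsilon> where v: "u = (Q, \<upsilon>, A)" "\<upsilon> \<in> ghom Q A" using HomE by metis
   have "\<upsilon> (\<pi> x) = \<alpha> x" if "x \<in> carrier N" for x
    using u that v(1) a(1) by (auto simp: compose_def dest!: fun_cong[of _ _ x])
   hence vp: "\<upsilon> (\<pi> x) = \<psi> (\<pi> x)" if "x \<in> carrier N" for x using p(2) that by simp
   have "\<upsilon> z = \<psi> z" if "z \<in> carrier Q" for z
   proof -
    have "z \<in> \<pi> ` carrier N" using that conjunct1[OF k] by simp
    thus ?thesis using vp by (elim imageE) simp
   qed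
   hence "\<upsilon> = \<psi>" by (rule ghom_eqI[OF v(2) p(1)])
   thus "u = (Q, \<psi>, A)" using v by simp
  qed
 qed simp
qed

lemma epi_iff:
 assumes "gobj d M" "gobj d N" "\<phi> \<in> ghom M N"
 shows "is_epi (Gr d) (M, \<phi>, N) \<longleftrightarrow> \<phi> ` carrier M = carrier N"
proof
 note m = gobjD(1)[OF assms(1)] gobjD(1)[OF assms(2)]
 assume epi: "is_epi (Gr d) (M, \<phi>, N)"
 let ?J = "\<phi> ` carrier M"
 have J: "hsub N ?J" by (rule hsub_image[OF m assms(3) hsub_carrier[OF m(1)]])
 note qj = quot[OF assms(2) J]
 \<comment> \<open>Projection to the quotient by the image and zero map agree after
   \<open>\<phi>\<close>; an epi cannot tell them apart.\<close>
 have eq: "(N, proj N ?J, quot N ?J) \<bullet>\<^bsub>Gr d\<^esub> (M, \<phi>, N)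
   = (N, \<lambda>x\<in>carrier N. \<zero>\<^bsub>quot N ?J\<^esub>, quot N ?J) \<bullet>\<^bsub>Gr d\<^esub> (M, \<phi>, N)"
  using qj(4) ghomD(1)[OF assms(3)] by (auto simp: compose_def intro!: restrict_ext)
 have "(N, proj N ?J, quot N ?J) \<in> Hom (Gr d) N (quot N ?J)"
  "(N, \<lambda>x\<in>carrier N. \<zero>\<^bsub>quot N ?J\<^esub>, quot N ?J) \<in> Hom (Gr d) N (quot N ?J)"
  using qj(1,2) assms(2) ghom_zero_map[OF m(2) gobjD(1)[OF qj(1)]] by (auto simp: Hom_iff)
 hence "(N, proj N ?J, quot N ?J) = (N, \<lambda>x\<in>carrier N. \<zero>\<^bsub>quot N ?J\<^esub>, quot N ?J)"
  by (rule is_epi_cancel[OF epi eq, unfolded C_simps(2)])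
 hence "proj N ?J = (\<lambda>x\<in>carrier N. \<zero>\<^bsub>quot N ?J\<^esub>)" by simp
 hence "x \<in> ?J" if "x \<in> carrier N" for x using qj(4)[OF that] that by simp
 thus "?J = carrier N" using ghomD(1)[OF assms(3)] by blast
next
 assume surj: "\<phi> ` carrier M = carrier N"
 show "is_epi (Gr d) (M, \<phi>, N)"
  unfolding is_epi_def C_simps
 proof (intro conjI allI ballI impI)
  show "(M, \<phi>, N) \<in> Ar (Gr d)" using assms by (simp add: Ar_iff)
  fix A f g assume f: "f \<in> Hom (Gr d) N A" and g: "g \<in> Hom (Gr d) N A"
   and eq: "f \<bullet>\<^bsub>Gr d\<^esub> (M, \<phi>, N) = g \<bullet>\<^bsub>Gr d\<^esub> (M, \<phi>, N)"
  obtain \<alpha> where a: "f = (N, \<alpha>, A)" "\<alpha> \<in> ghom N A" using f by (rule HomE)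
  obtain \<beta> where b: "g = (N, \<beta>, A)" "\<beta> \<in> ghom N A" using g by (rule HomE)
  have "\<alpha> (\<phi> x) = \<beta> (\<phi> x)" if "x \<in> carrier M" for x
   using eq that by (auto simp: a b compose_def dest!: fun_cong[of _ _ x])
  hence "\<alpha> y = \<beta> y" if "y \<in> \<phi> ` carrier M" for y using that by (elim imageE) simp
  hence "\<alpha> = \<beta>" unfolding surj by (rule ghom_eqI[OF a(2) b(2)])
  thus "f = g" using a b by simp
 qed
qed

lemma compose_fun: "(M, compose (carrier M) \<psi> \<phi>, P) = (M, \<chi>, P) \<Longrightarrow> x \<in> carrier M \<Longrightarrow> \<psi> (\<phi> x) = \<chi> x"
 by (auto simp: compose_def dest!: fun_cong[of _ _ x])

lemma hom_eq_triple:
 assumes "f \<in> Hom (Gr d) M N" "\<phi> \<in> ghom M N"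
  "\<And>\<psi> x. f = (M, \<psi>, N) \<Longrightarrow> \<psi> \<in> ghom M N \<Longrightarrow> x \<in> carrier M \<Longrightarrow> \<psi> x = \<phi> x"
 shows "f = (M, \<phi>, N)"
proof -
 obtain \<psi> where p: "f = (M, \<psi>, N)" "\<psi> \<in> ghom M N" using assms(1) by (rule HomE)
 thus ?thesis using ghom_eqI[OF p(2) assms(2) assms(3)[OF p]] by simp
qed

section \<open>Biproducts, the abelian category and its thick subcategory\<close>

lemma biproduct:
 fixes M N :: "('a, 'u) graded_module"
 assumes univ: "\<exists>\<iota> :: 'a \<Rightarrow> 'u. inj_on \<iota> (carrier S)" and M: "gobj d M" and N: "gobj d N"
 shows "\<exists>P p q i j. gobj d (P :: ('a, 'u) graded_module) \<and> p \<in> ghom P M \<and> q \<in> ghom P N \<and>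
  i \<in> ghom M P \<and> j \<in> ghom N P \<and>
  (\<forall>x\<in>carrier M. p (i x) = x \<and> q (i x) = \<zero>\<^sub>N) \<and> (\<forall>y\<in>carrier N. p (j y) = \<zero>\<^sub>M \<and> q (j y) = y) \<and>
  (\<forall>z\<in>carrier P. z = i (p z) \<oplus>\<^sub>P j (q z))"
proof -
 let ?R = "prod_gm M N"
 have R: "gobj d ?R" by (rule gobj_prod_gm[OF M N])
 note m = gobjD(1)[OF M] gobjD(1)[OF N] gobjD(1)[OF R]
 interpret M: graded_module S M by (rule m(1))
 interpret N: graded_module S N by (rule m(2))
 interpret R: graded_module S ?R by (rule m(3))
 \<comment> \<open>The product has pairs as elements; an injection into \<open>'u\<close> exists
   because it is again finitely generated.\<close>
 let ?t = "to_univ ?R :: _ \<Rightarrow> 'u"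
 have inj: "inj_on ?t (carrier ?R)" by (rule to_univ_inj[OF univ R.module_axioms gobjD(2)[OF R]])
 have K: "hsub ?R {\<zero>\<^sub>?R }" unfolding hsub_def using R.opsub_zero[OF order_refl] R.pr_zero by blast
 have ker: "?t x = ?t y \<longleftrightarrow> x \<ominus>\<^sub>?R y \<in> {\<zero>\<^sub>?R }" if "x \<in> carrier ?R" "y \<in> carrier ?R" for x y
  using inj_on_eq_iff[OF inj that] R.M.minus_eq_zero_iff[OF that] by blast
 define P where "P = image_gm ?t ?R"
 define T where "T = restrict ?t (carrier ?R)"
 have P: "gobj d P" unfolding P_def by (rule gobj_image_gm[OF R K ker])
 have t: "T \<in> ghom ?R P" unfolding P_def T_def by (rule image_gm_hom[OF m(3) K ker])
 have surj: "T ` carrier ?R = carrier P" by (simp add: P_def T_def)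
 interpret P: graded_module S P by (rule gobjD(1)[OF P])
 note tD = ghomD[OF t]
 have z: "y = \<zero>\<^sub>?R" if "y \<in> carrier ?R" "T y = \<zero>\<^sub>P" for y
  using ker[OF that(1) R.M.zero_closed] that R.M.minus_eq_zero_iff[OF that(1) R.M.zero_closed] by (simp add: P_def T_def)
 have f: "restrict fst (carrier ?R) \<in> ghom ?R M" "restrict snd (carrier ?R) \<in> ghom ?R N"
  by (rule ghom_restrictI[OF m(3)]; auto)+
 have fz: "restrict fst (carrier ?R) y = \<zero>\<^sub>M" "restrict snd (carrier ?R) y = \<zero>\<^sub>N"
  if "y \<in> carrier ?R" "T y = \<zero>\<^sub>P" for y using z[OF that] that(1) by simp_all
 obtain p where p: "p \<in> ghom P M" "\<forall>y\<in>carrier ?R. p (T y) = restrict fst (carrier ?R) y"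
  using hom_descend[OF m(3) gobjD(1)[OF P] m(1) t surj f(1)] fz(1) by blast
 obtain q where q: "q \<in> ghom P N" "\<forall>y\<in>carrier ?R. q (T y) = restrict snd (carrier ?R) y"
  using hom_descend[OF m(3) gobjD(1)[OF P] m(2) t surj f(2)] fz(2) by blast
 have e: "(\<lambda>x\<in>carrier M. (x, \<zero>\<^sub>N)) \<in> ghom M ?R"
  by (rule ghom_restrictI[OF m(1)]) (simp_all add: N.G.hcompD(2))
 have e': "(\<lambda>x\<in>carrier N. (\<zero>\<^sub>M, x)) \<in> ghom N ?R"
  by (rule ghom_restrictI[OF m(2)]) (simp_all add: M.G.hcompD(2))
 define i where "i = compose (carrier M) T (\<lambda>x\<in>carrier M. (x, \<zero>\<^sub>N))"
 define j where "j = compose (carrier N) T (\<lambda>x\<in>carrier N. (\<zero>\<^sub>M, x))"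
 have ih: "i \<in> ghom M P" unfolding i_def by (rule ghom_compose[OF m(1) e t])
 have jh: "j \<in> ghom N P" unfolding j_def by (rule ghom_compose[OF m(2) e' t])
 have iv: "i x = T (x, \<zero>\<^sub>N)" if "x \<in> carrier M" for x using that by (simp add: i_def compose_eq)
 have jv: "j x = T (\<zero>\<^sub>M, x)" if "x \<in> carrier N" for x using that by (simp add: j_def compose_eq)
 have sum: "w = i (p w) \<oplus>\<^sub>P j (q w)" if "w \<in> carrier P" for w
 proof -
  have "w \<in> T ` carrier ?R" unfolding surj by (rule that)
  then obtain y where y: "y \<in> carrier ?R" "w = T y" by (elim imageE)
  obtain a b where ab: "y = (a, b)" "a \<in> carrier M" "b \<in> carrier N" using y(1) by auto
  have "p w = a" "q w = b" using p(2) q(2) y ab by auto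
  moreover have "T (a, b) = T (a, \<zero>\<^sub>N) \<oplus>\<^sub>P T (\<zero>\<^sub>M, b)"
   using tD(2)[of "(a, \<zero>\<^sub>N)" "(\<zero>\<^sub>M, b)"] ab by simp
  ultimately show ?thesis using y(2) ab by (simp add: iv jv)
 qed
 show ?thesis
 proof (intro exI conjI ballI)
  show "gobj d P" by (rule P)
  show "p \<in> ghom P M" "q \<in> ghom P N" by (rule p(1), rule q(1))
  show "i \<in> ghom M P" "j \<in> ghom N P" by (rule ih, rule jh)
  show "p (i x) = x" "q (i x) = \<zero>\<^sub>N" if "x \<in> carrier M" for x
   using p(2)[rule_format, of "(x, \<zero>\<^sub>N)"] q(2)[rule_format, of "(x, \<zero>\<^sub>N)"] that by (auto simp: iv)
  show "p (j x) = \<zero>\<^sub>M" "q (j x) = x" if "x \<in> carrier N" for x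
   using p(2)[rule_format, of "(\<zero>\<^sub>M, x)"] q(2)[rule_format, of "(\<zero>\<^sub>M, x)"] that by (auto simp: jv)
  show "w = i (p w) \<oplus>\<^sub>P j (q w)" if "w \<in> carrier P" for w by (rule sum[OF that])
 qed
qed

lemma ghom_plus:
 assumes "graded_module S M" "graded_module S N" "\<phi> \<in> ghom M N" "\<psi> \<in> ghom M N"
 shows "(\<lambda>x\<in>carrier M. \<phi> x \<oplus>\<^sub>N \<psi> x) \<in> ghom M N"
proof -
 interpret M: graded_module S M by fact
 interpret N: graded_module S N by fact
 note f = ghomD[OF assms(3)] and g = ghomD[OF assms(4)]
 show ?thesis
  by (rule ghom_restrictI[OF assms(1)])
   (simp_all add: f g N.M.a_ac N.smult_r_distr N.G.hcompD(3))
qed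

lemma abelian_C:
 assumes univ: "\<exists>\<iota> :: 'a \<Rightarrow> 'u. inj_on \<iota> (carrier S)"
 shows "abelian_category (Gr d :: (('a, 'u) graded_module, ('a, 'u) gmod_arrow) cat)"
  (is "abelian_category ?C")
proof (intro abelian_category.intro abelian_category_axioms.intro category_C)
 show "\<exists>Z. is_zero_obj ?C Z" by (rule exI, rule zero_obj_trivial)
next
 fix M N assume "M \<in> Ob ?C" "N \<in> Ob ?C"
 hence M: "gobj d M" and N: "gobj d N" by (auto simp: Ob_iff)
 \<comment> \<open>An elementwise biproduct; the decomposition \<open>sum\<close> gives uniqueness
   of the induced arrow in both universal properties.\<close>
 obtain P p q i j where P: "gobj d (P :: ('a, 'u) graded_module)" "p \<in> ghom P M" "q \<in> ghom P N"
  "i \<in> ghom M P" "j \<in> ghom N P"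
  and ii: "\<And>x. x \<in> carrier M \<Longrightarrow> p (i x) = x" "\<And>x. x \<in> carrier M \<Longrightarrow> q (i x) = \<zero>\<^sub>N"
  and jj: "\<And>y. y \<in> carrier N \<Longrightarrow> p (j y) = \<zero>\<^sub>M" "\<And>y. y \<in> carrier N \<Longrightarrow> q (j y) = y"
  and sum: "\<And>z. z \<in> carrier P \<Longrightarrow> z = i (p z) \<oplus>\<^sub>P j (q z)"
  using biproduct[OF univ M N] by metis
 note m = gobjD(1)[OF M] gobjD(1)[OF N] gobjD(1)[OF P(1)]
 interpret M: graded_module S M by (rule m(1))
 interpret N: graded_module S N by (rule m(2))
 interpret P: graded_module S P by (rule m(3))
 note pD = ghomD[OF P(2)] and qD = ghomD[OF P(3)] and iD = ghomD[OF P(4)] and jD = ghomD[OF P(5)]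
 show "\<exists>P p q. is_product ?C M N P p q"
 proof (intro exI)
  show "is_product ?C M N P (P, p, M) (P, q, N)"
   unfolding is_product_def
  proof (intro conjI allI ballI)
   show "(P, p, M) \<in> Hom ?C P M" "(P, q, N) \<in> Hom ?C P N" using P M N by (auto simp: Hom_iff)
   fix V f g assume "f \<in> Hom ?C V M" "g \<in> Hom ?C V N"
   then obtain \<phi> \<psi> where f: "f = (V, \<phi>, M)" "\<phi> \<in> ghom V M" "gobj d V" and g: "g = (V, \<psi>, N)" "\<psi> \<in> ghom V N"
    by (elim HomE) auto
   note V = gobjD(1)[OF f(3)]
   note fD = ghomD[OF f(2)] and gD = ghomD[OF g(2)]
   note c = ghom_compose[OF V f(2) P(4)] ghom_compose[OF V g(2) P(5)]
   let ?u = "\<lambda>x\<in>carrier V. compose (carrier V) i \<phi> x \<oplus>\<^sub>P compose (carrier V) j \<psi> x"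
   have u: "?u \<in> ghom V P" by (rule ghom_plus[OF V m(3) c])
   have pu: "p (?u x) = \<phi> x" "q (?u x) = \<psi> x" if "x \<in> carrier V" for x
    using that by (simp_all add: compose_eq pD(2) qD(2) iD(1) jD(1) fD(1) gD(1) ii jj)
   show "\<exists>!u. u \<in> Hom ?C V P \<and> (P, p, M) \<bullet>\<^sub>?C u = f \<and> (P, q, N) \<bullet>\<^sub>?C u = g"
   proof (rule ex1I[of _ "(V, ?u, P)"])
    have "compose (carrier V) p ?u = \<phi>" by (rule ghom_eqI[OF ghom_compose[OF V u P(2)] f(2)]) (simp only: compose_eq pu)
    moreover have "compose (carrier V) q ?u = \<psi>" by (rule ghom_eqI[OF ghom_compose[OF V u P(3)] g(2)]) (simp only: compose_eq pu)
    ultimately show "(V, ?u, P) \<in> Hom ?C V P \<and> (P, p, M) \<bullet>\<^sub>?C (V, ?u, P) = f \<and> (P, q, N) \<bullet>\<^sub>?C (V, ?u, P) = g"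
     using f g u P(1) by (simp add: Hom_iff)
    fix v assume v: "v \<in> Hom ?C V P \<and> (P, p, M) \<bullet>\<^sub>?C v = f \<and> (P, q, N) \<bullet>\<^sub>?C v = g"
    show "v = (V, ?u, P)"
    proof (rule hom_eq_triple[OF conjunct1[OF v] u])
     fix \<upsilon> x assume w: "v = (V, \<upsilon>, P)" "\<upsilon> \<in> ghom V P" "x \<in> carrier V"
     have "p (\<upsilon> x) = \<phi> x" "q (\<upsilon> x) = \<psi> x" using v w f g compose_fun[of V p \<upsilon> M \<phi>] compose_fun[of V q \<upsilon> N \<psi>] by auto
     thus "\<upsilon> x = ?u x" using sum[OF ghomD(1)[OF w(2,3)]] w(3) by (simp add: compose_eq)
    qed
   qed
  qed
 qed
 show "\<exists>P i j. is_coproduct ?C M N P i j"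
 proof (intro exI)
  show "is_coproduct ?C M N P (M, i, P) (N, j, P)"
   unfolding is_coproduct_def
  proof (intro conjI allI ballI)
   show "(M, i, P) \<in> Hom ?C M P" "(N, j, P) \<in> Hom ?C N P" using P M N by (auto simp: Hom_iff)
   fix V f g assume "f \<in> Hom ?C M V" "g \<in> Hom ?C N V"
   then obtain \<phi> \<psi> where f: "f = (M, \<phi>, V)" "\<phi> \<in> ghom M V" "gobj d V" and g: "g = (N, \<psi>, V)" "\<psi> \<in> ghom N V"
    by (elim HomE) auto
   note V = gobjD(1)[OF f(3)]
   interpret V: graded_module S V by (rule V)
   note fD = ghomD[OF f(2)] and gD = ghomD[OF g(2)]
   note c = ghom_compose[OF m(3) P(2) f(2)] ghom_compose[OF m(3) P(3) g(2)]
   let ?u = "\<lambda>x\<in>carrier P. compose (carrier P) \<phi> p x \<oplus>\<^sub>V compose (carrier P) \<psi> q x"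
   have u: "?u \<in> ghom P V" by (rule ghom_plus[OF m(3) V c])
   have pu: "?u (i x) = \<phi> x" if "x \<in> carrier M" for x
    using that ghom_zero(1)[OF m(2) V g(2)] by (simp add: compose_eq iD(1) fD(1) ii)
   have qu: "?u (j x) = \<psi> x" if "x \<in> carrier N" for x
    using that ghom_zero(1)[OF m(1) V f(2)] by (simp add: compose_eq jD(1) gD(1) jj)
   show "\<exists>!u. u \<in> Hom ?C P V \<and> u \<bullet>\<^sub>?C (M, i, P) = f \<and> u \<bullet>\<^sub>?C (N, j, P) = g"
   proof (rule ex1I[of _ "(P, ?u, V)"])
    have "compose (carrier M) ?u i = \<phi>" by (rule ghom_eqI[OF ghom_compose[OF m(1) P(4) u] f(2)]) (simp only: compose_eq pu)
    moreover have "compose (carrier N) ?u j = \<psi>" by (rule ghom_eqI[OF ghom_compose[OF m(2) P(5) u] g(2)]) (simp only: compose_eq qu)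
    ultimately show "(P, ?u, V) \<in> Hom ?C P V \<and> (P, ?u, V) \<bullet>\<^sub>?C (M, i, P) = f \<and> (P, ?u, V) \<bullet>\<^sub>?C (N, j, P) = g"
     using f g u P(1) by (simp add: Hom_iff)
    fix v assume v: "v \<in> Hom ?C P V \<and> v \<bullet>\<^sub>?C (M, i, P) = f \<and> v \<bullet>\<^sub>?C (N, j, P) = g"
    show "v = (P, ?u, V)"
    proof (rule hom_eq_triple[OF conjunct1[OF v] u])
     fix \<upsilon> x assume w: "v = (P, \<upsilon>, V)" "\<upsilon> \<in> ghom P V" "x \<in> carrier P"
     have "\<upsilon> (i y) = \<phi> y" if "y \<in> carrier M" for y using v w f that compose_fun[of M \<upsilon> i V \<phi>] by auto
     moreover have "\<upsilon> (j y) = \<psi> y" if "y \<in> carrier N" for y using v w g that compose_fun[of N \<upsilon> j V \<psi>] by auto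
     moreover have "\<upsilon> x = \<upsilon> (i (p x)) \<oplus>\<^sub>V \<upsilon> (j (q x))"
      using sum[OF w(3)] ghomD(2)[OF w(2), of "i (p x)" "j (q x)"] w(3) pD(1) qD(1) iD(1) jD(1) by simp
     ultimately show "\<upsilon> x = ?u x" using w(3) pD(1) qD(1) by (simp add: compose_eq)
    qed
   qed
  qed
 qed
next
 fix f assume "f \<in> Ar ?C"
 then obtain M \<phi> N where f: "f = (M, \<phi>, N)" "gobj d M" "gobj d N" "\<phi> \<in> ghom M N" by (rule ArE)
 note m = gobjD(1)[OF f(2)] gobjD(1)[OF f(3)]
 let ?H = "{x \<in> carrier M. \<phi> x = \<zero>\<^sub>N}"
 have H: "hsub M ?H" by (rule hsub_kernel[OF m f(4)])
 have "is_kernel ?C f (sub_gm M ?H, \<lambda>x\<in>?H. x, M)"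
  unfolding f(1) kernel_iff[OF f(2-4) gobj_sub_gm[OF f(2) H] incl_hom[OF m(1) H]] by (auto simp: inj_on_def)
 thus "\<exists>k. is_kernel ?C f k" ..
 have I: "hsub N (\<phi> ` carrier M)" by (rule hsub_image[OF m f(4) hsub_carrier[OF m(1)]])
 note q = quot[OF f(3) I]
 have "is_cokernel ?C f (N, proj N (\<phi> ` carrier M), quot N (\<phi> ` carrier M))"
  unfolding f(1) cokernel_iff[OF f(2-4) q(1,2)] using q(3,4) ghomD(1)[OF f(4)] by auto
 thus "\<exists>q. is_cokernel ?C f q" ..
next
 fix f assume mono: "is_mono ?C f"
 hence "f \<in> Ar ?C" by (simp add: is_mono_def)
 then obtain M \<phi> N where f: "f = (M, \<phi>, N)" "gobj d M" "gobj d N" "\<phi> \<in> ghom M N" by (rule ArE)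
 note m = gobjD(1)[OF f(2)] gobjD(1)[OF f(3)]
 have I: "hsub N (\<phi> ` carrier M)" by (rule hsub_image[OF m f(4) hsub_carrier[OF m(1)]])
 note q = quot[OF f(3) I]
 have "inj_on \<phi> (carrier M)" using mono mono_iff[OF f(2-4)] f(1) by simp
 hence "is_kernel ?C (N, proj N (\<phi> ` carrier M), quot N (\<phi> ` carrier M)) f"
  unfolding f(1) kernel_iff[OF f(3) q(1,2) f(2,4)] using q(4) ghomD(1)[OF f(4)] by auto
 thus "\<exists>g. is_kernel ?C g f" ..
next
 fix f assume epi: "is_epi ?C f"
 hence "f \<in> Ar ?C" by (simp add: is_epi_def)
 then obtain M \<phi> N where f: "f = (M, \<phi>, N)" "gobj d M" "gobj d N" "\<phi> \<in> ghom M N" by (rule ArE)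
 note m = gobjD(1)[OF f(2)] gobjD(1)[OF f(3)]
 let ?H = "{x \<in> carrier M. \<phi> x = \<zero>\<^sub>N}"
 have H: "hsub M ?H" by (rule hsub_kernel[OF m f(4)])
 have "\<phi> ` carrier M = carrier N" using epi epi_iff[OF f(2-4)] f(1) by simp
 hence "is_cokernel ?C (sub_gm M ?H, \<lambda>x\<in>?H. x, M) f"
  unfolding f(1) cokernel_iff[OF gobj_sub_gm[OF f(2) H] f(2) incl_hom[OF m(1) H] f(3,4)] by auto
 thus "\<exists>g. is_cokernel ?C g f" ..
qed

lemma grmod0_iff: "M \<in> grmod0_ge S d \<longleftrightarrow> gobj d M \<and> (\<exists>l. \<forall>i\<ge>l. hcomp M i = {\<zero>\<^sub>M})"
 unfolding grmod0_ge_def using quasi_zero_iff[OF gobjD(1)] by (auto simp: Ob_iff)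

lemma thick_C: "thick (Gr d) (grmod0_ge S d :: ('a, 'u) graded_module set)"
 (is "thick ?C ?T")
 unfolding thick_def
proof (intro conjI allI impI)
 have "trivial_gm undefined \<in> ?T" unfolding grmod0_iff using gobj_trivial by (auto simp: trivial_gm_def)
 thus "?T \<noteq> {}" by blast
 show "?T \<subseteq> Ob ?C" by (auto simp: grmod0_ge_def)
next
 fix f assume f: "is_mono ?C f" "Cod ?C f \<in> ?T"
 hence "f \<in> Ar ?C" by (simp add: is_mono_def)
 then obtain M \<phi> N where g: "f = (M, \<phi>, N)" "gobj d M" "gobj d N" "\<phi> \<in> ghom M N" by (rule ArE)
 note m = gobjD(1)[OF g(2)] gobjD(1)[OF g(3)]
 interpret M: graded_module S M by (rule m(1))
 have inj: "inj_on \<phi> (carrier M)" using f(1) mono_iff[OF g(2-4)] g(1) by simp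
 obtain l where l: "\<And>i. i \<ge> l \<Longrightarrow> hcomp N i = {\<zero>\<^sub>N}" using f(2) g(1) by (auto simp: grmod0_iff)
 have "hcomp M i = {\<zero>\<^sub>M}" if "i \<ge> l" for i
  using inj ghom_inj_iff[OF m g(4)] ghomD(4)[OF g(4)] l[OF that] M.G.hcompD(1,2) by fastforce
 thus "Dom ?C f \<in> ?T" using g by (auto simp: grmod0_iff)
next
 fix f assume f: "is_epi ?C f" "Dom ?C f \<in> ?T"
 hence "f \<in> Ar ?C" by (simp add: is_epi_def)
 then obtain M \<phi> N where g: "f = (M, \<phi>, N)" "gobj d M" "gobj d N" "\<phi> \<in> ghom M N" by (rule ArE)
 note m = gobjD(1)[OF g(2)] gobjD(1)[OF g(3)]
 interpret N: graded_module S N by (rule m(2))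
 have surj: "\<phi> ` carrier M = carrier N" using f(1) epi_iff[OF g(2-4)] g(1) by simp
 obtain l where l: "\<And>i. i \<ge> l \<Longrightarrow> hcomp M i = {\<zero>\<^sub>M}" using f(2) g(1) by (auto simp: grmod0_iff)
 have "hcomp N i = {\<zero>\<^sub>N}" if "i \<ge> l" for i
  using surj_homog[OF m g(4) surj] l[OF that] ghom_zero(1)[OF m g(4)] N.G.hcompD(2) by fastforce
 thus "Cod ?C f \<in> ?T" using g by (auto simp: grmod0_iff)
next
 fix k p assume k: "is_kernel ?C p k" "is_cokernel ?C k p" "Dom ?C k \<in> ?T" "Cod ?C p \<in> ?T"
 have "k \<in> Ar ?C" "p \<in> Ar ?C" "Cod ?C k = Dom ?C p" using k by (auto simp: is_kernel_def)
 then obtain K \<kappa> M \<phi> N where g: "k = (K, \<kappa>, M)" "p = (M, \<phi>, N)" "gobj d K" "gobj d M" "gobj d N"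
  "\<kappa> \<in> ghom K M" "\<phi> \<in> ghom M N" by (elim ArE) auto
 note m = gobjD(1)[OF g(3)] gobjD(1)[OF g(4)] gobjD(1)[OF g(5)]
 interpret M: graded_module S M by (rule m(2))
 have ke: "inj_on \<kappa> (carrier K)" "\<kappa> ` carrier K = {x \<in> carrier M. \<phi> x = \<zero>\<^sub>N}"
  using k(1) kernel_iff[OF g(4,5,7,3,6)] g(1,2) by auto
 obtain l where l: "\<And>i. i \<ge> l \<Longrightarrow> hcomp K i = {\<zero>\<^sub>K}" using k(3) g(1) by (auto simp: grmod0_iff)
 obtain l' where l': "\<And>i. i \<ge> l' \<Longrightarrow> hcomp N i = {\<zero>\<^sub>N}" using k(4) g(2) by (auto simp: grmod0_iff)
 \<comment> \<open>Beyond both bounds an element of \<open>M\<close> dies in \<open>N\<close>, so it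
   comes from \<open>K\<close>, by injectivity from the same degree, where \<open>K\<close> is
   zero.\<close>
 have "x = \<zero>\<^sub>M" if i: "i \<ge> max l l'" and x: "x \<in> hcomp M i" for i x
 proof -
  have "\<phi> x = \<zero>\<^sub>N" using ghomD(4)[OF g(7) x] l'[of i] i by simp
  hence "x \<in> \<kappa> ` carrier K" using ke(2) M.G.hcompD(1)[OF x] by simp
  then obtain y where y: "y \<in> carrier K" "x = \<kappa> y" by blast
  hence "y \<in> hcomp K i" using ghom_homog_inj[OF m(1,2) g(6) ke(1)] x by simp
  thus ?thesis using l[of i] i y ghom_zero(1)[OF m(1,2) g(6)] by simp
 qed
 hence "\<forall>i\<ge>max l l'. hcomp M i = {\<zero>\<^sub>M}" using M.G.hcompD(2) by blast
 hence "\<exists>l. \<forall>i\<ge>l. hcomp M i = {\<zero>\<^sub>M}" by (rule exI)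
 thus "Cod ?C k \<in> ?T" using g(1,4) by (simp add: grmod0_iff)
qed

text \<open>The cokernel is quasi-zero exactly when the image exhausts the components of high
  degree. This is shown first for any presentation \<open>\<pi>\<close> of the cokernel, since one
  direction starts from a given cokernel and the other from \<open>quot\<close>.\<close>

lemma cosmall_iff:
 assumes "gobj d M" "gobj d N" "\<phi> \<in> ghom M N"
 shows "cosmall_mono (Gr d) (grmod0_ge S d) (M, \<phi>, N) \<longleftrightarrow>
  inj_on \<phi> (carrier M) \<and> (\<exists>l. \<forall>i\<ge>l. hcomp N i \<subseteq> \<phi> ` carrier M)"
proof -
 note m = gobjD(1)[OF assms(1)] gobjD(1)[OF assms(2)]
 interpret N: graded_module S N by (rule m(2))
 have *: "(\<exists>l. \<forall>i\<ge>l. hcomp Q i = {\<zero>\<^sub>Q}) \<longleftrightarrow> (\<exists>l. \<forall>i\<ge>l. hcomp N i \<subseteq> \<phi> ` carrier M)"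
  if Q: "gobj d Q" "\<pi> \<in> ghom N Q" "\<pi> ` carrier N = carrier Q" "{y \<in> carrier N. \<pi> y = \<zero>\<^sub>Q} = \<phi> ` carrier M" for Q \<pi>
 proof -
  interpret Q: graded_module S Q by (rule gobjD(1)[OF Q(1)])
  have "hcomp Q i = {\<zero>\<^sub>Q} \<longleftrightarrow> hcomp N i \<subseteq> \<phi> ` carrier M" for i
  proof
   assume z: "hcomp Q i = {\<zero>\<^sub>Q}"
   show "hcomp N i \<subseteq> \<phi> ` carrier M"
    unfolding Q(4)[symmetric] using ghomD(4)[OF Q(2), of _ i] N.G.hcompD(1) z by auto
  next
   assume s: "hcomp N i \<subseteq> \<phi> ` carrier M"
   have "z = \<zero>\<^sub>Q" if "z \<in> hcomp Q i" for z
    using surj_homog[OF m(2) gobjD(1)[OF Q(1)] Q(2,3) that] s unfolding Q(4)[symmetric] by auto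
   thus "hcomp Q i = {\<zero>\<^sub>Q}" using Q.G.hcompD(2) by blast
  qed
  thus ?thesis by simp
 qed
 show ?thesis
 proof
  assume c: "cosmall_mono (Gr d) (grmod0_ge S d) (M, \<phi>, N)"
  then obtain q where q: "is_cokernel (Gr d) (M, \<phi>, N) q" "Cod (Gr d) q \<in> grmod0_ge S d"
   unfolding cosmall_mono_def by blast
  have "q \<in> Ar (Gr d)" "Dom (Gr d) q = N" using q(1) by (auto simp: is_cokernel_def)
  then obtain Q \<pi> where Q: "q = (N, \<pi>, Q)" "gobj d Q" "\<pi> \<in> ghom N Q" by (elim ArE) auto
  have "\<exists>l. \<forall>i\<ge>l. hcomp N i \<subseteq> \<phi> ` carrier M"
   using *[OF Q(2,3)] q cokernel_iff[OF assms Q(2,3)] Q(1) by (simp add: grmod0_iff)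
  thus "inj_on \<phi> (carrier M) \<and> (\<exists>l. \<forall>i\<ge>l. hcomp N i \<subseteq> \<phi> ` carrier M)"
   using c mono_iff[OF assms] by (simp add: cosmall_mono_def)
 next
  assume c: "inj_on \<phi> (carrier M) \<and> (\<exists>l. \<forall>i\<ge>l. hcomp N i \<subseteq> \<phi> ` carrier M)"
  have I: "hsub N (\<phi> ` carrier M)" by (rule hsub_image[OF m assms(3) hsub_carrier[OF m(1)]])
  note q = quot[OF assms(2) I]
  have k: "{y \<in> carrier N. proj N (\<phi> ` carrier M) y = \<zero>\<^bsub>quot N (\<phi> ` carrier M)\<^esub>} = \<phi> ` carrier M"
   using q(4) ghomD(1)[OF assms(3)] by auto
  have cok: "is_cokernel (Gr d) (M, \<phi>, N) (N, proj N (\<phi> ` carrier M), quot N (\<phi> ` carrier M))"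
   unfolding cokernel_iff[OF assms q(1,2)] using q(3) k by (rule conjI)
  have T: "quot N (\<phi> ` carrier M) \<in> grmod0_ge S d"
   unfolding grmod0_iff *[OF q(1-3) k] using q(1) conjunct2[OF c] by (rule conjI)
  have "is_mono (Gr d) (M, \<phi>, N)" unfolding mono_iff[OF assms] by (rule conjunct1[OF c])
  thus "cosmall_mono (Gr d) (grmod0_ge S d) (M, \<phi>, N)"
   unfolding cosmall_mono_def by (rule conjI) (rule exI, rule conjI, rule cok, simp only: C_simps T)
 qed
qed

text \<open>The counterpart of \<open>cosmall_iff\<close>: a quasi-zero kernel means that no nonzero
  homogeneous element of high degree is killed.\<close>

lemma small_iff:
 assumes "gobj d M" "gobj d N" "\<phi> \<in> ghom M N"
 shows "small_epi (Gr d) (grmod0_ge S d) (M, \<phi>, N) \<longleftrightarrow>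
  \<phi> ` carrier M = carrier N \<and> (\<exists>l. \<forall>i\<ge>l. \<forall>x\<in>hcomp M i. \<phi> x = \<zero>\<^sub>N \<longrightarrow> x = \<zero>\<^sub>M)"
proof -
 note m = gobjD(1)[OF assms(1)] gobjD(1)[OF assms(2)]
 interpret M: graded_module S M by (rule m(1))
 have *: "(\<exists>l. \<forall>i\<ge>l. hcomp K i = {\<zero>\<^sub>K}) \<longleftrightarrow> (\<exists>l. \<forall>i\<ge>l. \<forall>x\<in>hcomp M i. \<phi> x = \<zero>\<^sub>N \<longrightarrow> x = \<zero>\<^sub>M)"
  if K: "gobj d K" "\<kappa> \<in> ghom K M" "inj_on \<kappa> (carrier K)" "\<kappa> ` carrier K = {x \<in> carrier M. \<phi> x = \<zero>\<^sub>N}" for K \<kappa>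
 proof -
  interpret K: graded_module S K by (rule gobjD(1)[OF K(1)])
  note z = ghom_zero(1)[OF gobjD(1)[OF K(1)] m(1) K(2)]
  have "hcomp K i = {\<zero>\<^sub>K} \<longleftrightarrow> (\<forall>x\<in>hcomp M i. \<phi> x = \<zero>\<^sub>N \<longrightarrow> x = \<zero>\<^sub>M)" for i
  proof
   assume k: "hcomp K i = {\<zero>\<^sub>K}"
   show "\<forall>x\<in>hcomp M i. \<phi> x = \<zero>\<^sub>N \<longrightarrow> x = \<zero>\<^sub>M"
   proof (intro ballI impI)
    fix x assume x: "x \<in> hcomp M i" "\<phi> x = \<zero>\<^sub>N"
    hence "x \<in> \<kappa> ` carrier K" using K(4) M.G.hcompD(1)[OF x(1)] by simp
    then obtain y where y: "y \<in> carrier K" "x = \<kappa> y" by blast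
    hence "y \<in> hcomp K i" using ghom_homog_inj[OF gobjD(1)[OF K(1)] m(1) K(2,3)] x by simp
    thus "x = \<zero>\<^sub>M" using k y z by simp
   qed
  next
   assume k: "\<forall>x\<in>hcomp M i. \<phi> x = \<zero>\<^sub>N \<longrightarrow> x = \<zero>\<^sub>M"
   have "y = \<zero>\<^sub>K" if y: "y \<in> hcomp K i" for y
   proof -
    have yc: "y \<in> carrier K" by (rule K.G.hcompD(1)[OF y])
    hence "\<phi> (\<kappa> y) = \<zero>\<^sub>N" using K(4) by blast
    hence "\<kappa> y = \<zero>\<^sub>M" using k ghomD(4)[OF K(2) y] by blast
    thus ?thesis using K(3) ghom_inj_iff[OF gobjD(1)[OF K(1)] m(1) K(2)] yc by blast
   qed
   thus "hcomp K i = {\<zero>\<^sub>K}" using K.G.hcompD(2) by blast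
  qed
  thus ?thesis by simp
 qed
 show ?thesis
 proof
  assume c: "small_epi (Gr d) (grmod0_ge S d) (M, \<phi>, N)"
  then obtain k where k: "is_kernel (Gr d) (M, \<phi>, N) k" "Dom (Gr d) k \<in> grmod0_ge S d"
   unfolding small_epi_def by blast
  have "k \<in> Ar (Gr d)" "Cod (Gr d) k = M" using k(1) by (auto simp: is_kernel_def)
  then obtain K \<kappa> where K: "k = (K, \<kappa>, M)" "gobj d K" "\<kappa> \<in> ghom K M" by (elim ArE) auto
  have "\<exists>l. \<forall>i\<ge>l. \<forall>x\<in>hcomp M i. \<phi> x = \<zero>\<^sub>N \<longrightarrow> x = \<zero>\<^sub>M"
   using *[OF K(2,3)] k kernel_iff[OF assms K(2,3)] K(1) by (simp add: grmod0_iff)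
  thus "\<phi> ` carrier M = carrier N \<and> (\<exists>l. \<forall>i\<ge>l. \<forall>x\<in>hcomp M i. \<phi> x = \<zero>\<^sub>N \<longrightarrow> x = \<zero>\<^sub>M)"
   using c epi_iff[OF assms] by (simp add: small_epi_def)
 next
  assume c: "\<phi> ` carrier M = carrier N \<and> (\<exists>l. \<forall>i\<ge>l. \<forall>x\<in>hcomp M i. \<phi> x = \<zero>\<^sub>N \<longrightarrow> x = \<zero>\<^sub>M)"
  let ?H = "{x \<in> carrier M. \<phi> x = \<zero>\<^sub>N}"
  have H: "hsub M ?H" by (rule hsub_kernel[OF m assms(3)])
  note g = gobj_sub_gm[OF assms(1) H] incl_hom[OF m(1) H]
  have k: "inj_on (\<lambda>x\<in>?H. x) (carrier (sub_gm M ?H))" "(\<lambda>x\<in>?H. x) ` carrier (sub_gm M ?H) = ?H"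
   by (auto simp: inj_on_def)
  have ker: "is_kernel (Gr d) (M, \<phi>, N) (sub_gm M ?H, \<lambda>x\<in>?H. x, M)"
   unfolding kernel_iff[OF assms g] using k by (rule conjI)
  have T: "sub_gm M ?H \<in> grmod0_ge S d"
   unfolding grmod0_iff *[OF g k] using g(1) conjunct2[OF c] by (rule conjI)
  have "is_epi (Gr d) (M, \<phi>, N)" unfolding epi_iff[OF assms] by (rule conjunct1[OF c])
  thus "small_epi (Gr d) (grmod0_ge S d) (M, \<phi>, N)"
   unfolding small_epi_def by (rule conjI) (rule exI, rule conjI, rule ker, simp only: C_simps T)
 qed
qed

section \<open>Torsion and extension of morphisms\<close>

lemma I_D:
 shows "s \<in> I l \<Longrightarrow> s \<in> carrier S" "\<zero>\<^sub>S \<in> I l" "s \<in> I l \<Longrightarrow> t \<in> I l \<Longrightarrow> s \<oplus>\<^sub>S t \<in> I l"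
  "r \<in> carrier S \<Longrightarrow> s \<in> I l \<Longrightarrow> r \<otimes>\<^sub>S s \<in> I l" "r \<in> carrier S \<Longrightarrow> s \<in> I l \<Longrightarrow> s \<otimes>\<^sub>S r \<in> I l"
proof -
 note o = opsubD[OF I_sub[of l]]
 show c: "s \<in> I l \<Longrightarrow> s \<in> carrier S" by (rule o(7))
 show "\<zero>\<^sub>S \<in> I l" by (rule o(2))
 show "s \<in> I l \<Longrightarrow> t \<in> I l \<Longrightarrow> s \<oplus>\<^sub>S t \<in> I l" by (rule o(3))
 show m: "r \<in> carrier S \<Longrightarrow> s \<in> I l \<Longrightarrow> r \<otimes>\<^sub>S s \<in> I l" using o(5)[of r s] by (simp add: smult_S)
 show "r \<in> carrier S \<Longrightarrow> s \<in> I l \<Longrightarrow> s \<otimes>\<^sub>S r \<in> I l" using m c by (simp add: S.R.m_comm)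
qed

lemma I_induct [consumes 1, case_names zero comp add]:
 assumes "s \<in> I l" "P \<zero>\<^sub>S" "\<And>i s. int l \<le> i \<Longrightarrow> s \<in> hcomp S i \<Longrightarrow> P s"
  "\<And>s t. s \<in> I l \<Longrightarrow> t \<in> I l \<Longrightarrow> P s \<Longrightarrow> P t \<Longrightarrow> P (s \<oplus>\<^sub>S t)"
 shows "P s"
proof -
 have "s \<in> hspan S {int l..}" using assms(1) I_hspan by blast
 hence "s \<in> I l \<and> P s"
 proof (induction rule: S.G.hspan_induct)
  case zero
  thus ?case using I_D(2) assms(2) by simp
 next
  case (comp i y)
  thus ?case using hcomp_I[of l i] assms(3)[of i y] by auto
 next
  case (add y z)
  thus ?case using I_D(3) assms(4) by simp
 qed
 thus ?thesis by simp
qed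

lemma I_mono: "k \<le> l \<Longrightarrow> I l \<subseteq> I k"
proof
 fix s assume "k \<le> l" "s \<in> I l"
 from this(2) show "s \<in> I k"
 proof (induction rule: I_induct)
  case zero
  show ?case by (rule I_D(2))
 next
  case (comp i s)
  thus ?case using hcomp_I[of k i] \<open>k \<le> l\<close> by auto
 next
  case (add s t)
  thus ?case by (intro I_D(3))
 qed
qed

lemma I_monoD: "s \<in> I l \<Longrightarrow> k \<le> l \<Longrightarrow> s \<in> I k"
 using I_mono by blast

lemma pr_smult_homog:
 assumes "graded_module S M" "y \<in> hcomp M i" "s \<in> carrier S"
 shows "pr M k (s \<odot>\<^sub>M y) = pr S (k - i) s \<odot>\<^sub>M y"
proof -
 interpret M: graded_module S M by fact
 note y = M.G.hcompD(1)[OF assms(2)]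
 show ?thesis using assms(3)
 proof (induction rule: S.graded_induct)
  case zero
  thus ?case using y by simp
 next
  case (comp j s)
  thus ?case using y M.pr_homog[OF M.smult_hcomp[OF comp assms(2)], of k]
   by (auto simp: S.pr_homog)
 next
  case (add s t)
  thus ?case using y by (simp add: M.smult_l_distr M.pr_add S.pr_add)
 qed
qed

text \<open>Turns elementwise torsion into a degree bound. The elements all of whose multiples have
  their components of degree at least \<open>L\<close> in \<open>H\<close> form a submodule
  \<open>V L\<close>, and finitely many generators share one \<open>L\<close>.\<close>

lemma bounded_of_torsion:
 assumes "graded_module S K" "fin_gen (carrier S) K (carrier K)" "hsub K H"
  "\<And>x. x \<in> carrier K \<Longrightarrow> \<exists>l. \<forall>s\<in>I l. s \<odot>\<^sub>K x \<in> H"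
 shows "\<exists>L. \<forall>k\<ge>L. hcomp K k \<subseteq> H"
proof -
 interpret K: graded_module S K by fact
 note o = opsubD[OF hsubD(1)[OF assms(3)]]
 define V where "V L = {y \<in> carrier K. \<forall>s\<in>carrier S. \<forall>k\<ge>L. pr K k (s \<odot>\<^sub>K y) \<in> H}" for L
 have V: "sub K (V L)" for L
 proof (rule K.opsub_submoduleI)
  show "V L \<subseteq> carrier K" unfolding V_def by blast
  show "\<zero>\<^sub>K \<in> V L" unfolding V_def using o(2) by simp
  show "x \<oplus>\<^sub>K y \<in> V L" if "x \<in> V L" "y \<in> V L" for x y
   using that o(3) unfolding V_def by (simp add: K.smult_r_distr K.pr_add)
  show "r \<odot>\<^sub>K x \<in> V L" if "r \<in> carrier S" "x \<in> V L" for r x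
   using that unfolding V_def by (simp add: K.smult_assoc1[symmetric])
 qed
 have Vmono: "V L \<subseteq> V L'" if "L \<le> L'" for L L' unfolding V_def using that by auto
 have ex: "\<exists>L. y \<in> V L" if "y \<in> carrier K" for y
  using that
 proof (induction rule: K.graded_induct)
  case zero
  thus ?case using opsubD(2)[OF V] by blast
 next
  case (comp i y)
  have y: "y \<in> carrier K" by (rule K.G.hcompD(1)[OF comp])
  obtain l where l: "\<forall>s\<in>I l. s \<odot>\<^sub>K y \<in> H" using assms(4)[OF y] by blast
  have "pr K k (s \<odot>\<^sub>K y) \<in> H" if "s \<in> carrier S" "k \<ge> i + int l" for s k
  proof -
   \<comment> \<open>For \<open>y\<close> of degree \<open>i\<close>, the component of
     \<open>s y\<close> in degree \<open>k\<close> is \<open>pr S (k - i) s\<close> times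
     \<open>y\<close>, and \<open>k - i \<ge> l\<close> puts this scalar into
     \<open>I l\<close>.\<close>
   have "pr S (k - i) s \<in> I l" using hcomp_I[of l "k - i"] S.pr(1)[OF that(1)] that(2) by auto
   thus ?thesis using l pr_smult_homog[OF assms(1) comp that(1)] by simp
  qed
  thus ?case unfolding V_def using y by blast
 next
  case (add y z)
  then obtain L L' where "y \<in> V L" "z \<in> V L'" by blast
  hence "y \<in> V (max L L')" "z \<in> V (max L L')" using Vmono by (meson max.cobounded1 max.cobounded2 subsetD)+
  thus ?case using opsubD(3)[OF V] by blast
 qed
 obtain A where A: "finite A" "A \<subseteq> carrier K" "\<And>H'. sub K H' \<Longrightarrow> A \<subseteq> H' \<Longrightarrow> carrier K \<subseteq> H'"
  using assms(2) unfolding fin_gen_def by blast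
 have "\<exists>L. A \<subseteq> V L" using A(1,2)
 proof (induction A)
  case (insert a A)
  then obtain L where L: "A \<subseteq> V L" by auto
  obtain L' where "a \<in> V L'" using ex[of a] insert by auto
  note this L
  hence "insert a A \<subseteq> V (max L L')" using Vmono[of L "max L L'"] Vmono[of L' "max L L'"] by auto
  thus ?case by blast
 qed simp
 then obtain L where "A \<subseteq> V L" by blast
 hence VL: "carrier K \<subseteq> V L" using A(3)[OF V] by blast
 have "hcomp K k \<subseteq> H" if "k \<ge> L" for k
 proof
  fix y assume y: "y \<in> hcomp K k"
  hence "y \<in> V L" using VL K.G.hcompD(1) by blast
  hence "pr K k (\<one>\<^sub>S \<odot>\<^sub>K y) \<in> H" using that unfolding V_def by blast
  thus "y \<in> H" using K.G.hcompD(1)[OF y] K.pr_homog[OF y, of k] by simp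
 qed
 thus ?thesis by blast
qed

text \<open>The preimage in \<open>M\<close> of the torsion of \<open>M/H\<close>, described without
  forming the quotient.\<close>

definition torsion_over :: "('a, 'b) graded_module \<Rightarrow> 'b set \<Rightarrow> 'b set" where
 "torsion_over M H = {x \<in> carrier M. \<exists>l. \<forall>s\<in>I l. s \<odot>\<^sub>M x \<in> H}"

abbreviation "torsion M \<equiv> torsion_over M {\<zero>\<^sub>M}"

lemma hsub_zero: "graded_module S M \<Longrightarrow> hsub M {\<zero>\<^sub>M}"
proof -
 assume "graded_module S M"
 then interpret M: graded_module S M .
 show ?thesis unfolding hsub_def using M.opsub_zero[OF order_refl] by simp
qed

lemma hsub_torsion_over:
 assumes "graded_module S M" "hsub M H"
 shows "hsub M (torsion_over M H)" "H \<subseteq> torsion_over M H"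
proof -
 interpret M: graded_module S M by fact
 note H = hsubD[OF assms(2)] and o = opsubD[OF hsubD(1)[OF assms(2)]]
 have "sub M (torsion_over M H)"
 proof (rule M.opsub_submoduleI)
  show "torsion_over M H \<subseteq> carrier M" unfolding torsion_over_def by blast
  show "\<zero>\<^sub>M \<in> torsion_over M H" unfolding torsion_over_def using o(2) I_D(1) by auto
 next
  fix x y assume "x \<in> torsion_over M H" "y \<in> torsion_over M H"
  then obtain k l where *: "x \<in> carrier M" "y \<in> carrier M" "\<forall>s\<in>I k. s \<odot>\<^sub>M x \<in> H" "\<forall>s\<in>I l. s \<odot>\<^sub>M y \<in> H"
   unfolding torsion_over_def by blast
  have "s \<odot>\<^sub>M (x \<oplus>\<^sub>M y) \<in> H" if "s \<in> I (max k l)" for s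
   using * o(3) I_monoD[OF that, of k] I_monoD[OF that, of l] I_D(1)[OF that] by (simp add: M.smult_r_distr)
  thus "x \<oplus>\<^sub>M y \<in> torsion_over M H" unfolding torsion_over_def using * by blast
 next
  fix r x assume r: "r \<in> carrier S" and "x \<in> torsion_over M H"
  then obtain l where *: "x \<in> carrier M" "\<forall>s\<in>I l. s \<odot>\<^sub>M x \<in> H"
   unfolding torsion_over_def by blast
  have "s \<odot>\<^sub>M (r \<odot>\<^sub>M x) \<in> H" if "s \<in> I l" for s
   using * r I_D(5)[OF r that] I_D(1)[OF that] by (simp add: M.smult_assoc1[symmetric])
  thus "r \<odot>\<^sub>M x \<in> torsion_over M H" unfolding torsion_over_def using * r by blast
 qed
 moreover have "pr M i x \<in> torsion_over M H" if "x \<in> torsion_over M H" for x i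
 proof -
  obtain l where l: "x \<in> carrier M" "\<forall>s\<in>I l. s \<odot>\<^sub>M x \<in> H"
   using \<open>x \<in> torsion_over M H\<close> unfolding torsion_over_def by blast
  \<comment> \<open>For homogeneous \<open>s\<close>, the product of \<open>s\<close> with a
    projection of \<open>x\<close> is a projection of \<open>s x\<close>.\<close>
  have "s \<odot>\<^sub>M pr M i x \<in> H" if "s \<in> I l" for s
   using that
  proof (induction rule: I_induct)
   case zero
   thus ?case using l o(2) by simp
  next
   case (comp j s)
   have s: "s \<in> carrier S" by (rule S.G.hcompD(1)[OF comp(2)])
   have "s \<in> I l" using hcomp_I comp by blast
   hence "pr M (i + j) (s \<odot>\<^sub>M x) \<in> H" using l(2) H(2) by blast
   thus ?case using M.pr_smult[OF comp(2) s l(1), of "i + j"] by simp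
  next
   case (add s t)
   thus ?case using o(3) I_D(1) l(1) by (simp add: M.smult_l_distr)
  qed
  thus ?thesis unfolding torsion_over_def using l(1) by blast
 qed
 ultimately show "hsub M (torsion_over M H)" unfolding hsub_def by blast
 show "H \<subseteq> torsion_over M H" unfolding torsion_over_def using o(1,5) I_D(1) by blast
qed

lemma torsion_over_bounded:
 assumes "gobj d M" "hsub M H"
 shows "\<exists>L. \<forall>k\<ge>L. hcomp M k \<inter> torsion_over M H \<subseteq> H"
proof -
 note M = gobjD(1)[OF assms(1)]
 interpret M: graded_module S M by (rule M)
 note T = hsub_torsion_over[OF M assms(2)]
 let ?K = "sub_gm M (torsion_over M H)"
 note K = gobj_sub_gm[OF assms(1) T(1)]
 interpret K: graded_module S ?K by (rule gobjD(1)[OF K])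
 note o = opsubD[OF hsubD(1)[OF assms(2)]]
 have "sub ?K H" by (rule K.opsub_submoduleI) (use T(2) o in auto)
 moreover have "pr ?K i x \<in> H" if "x \<in> H" for x i
  using pr_sub_gm[OF M T(1), of x i] T(2) hsubD(2)[OF assms(2) that] that by auto
 ultimately have H: "hsub ?K H" unfolding hsub_def by blast
 have "\<exists>L. \<forall>k\<ge>L. hcomp ?K k \<subseteq> H"
  by (rule bounded_of_torsion[OF gobjD(1,2)[OF K] H]) (auto simp: torsion_over_def)
 thus ?thesis by simp
qed

text \<open>The submodules annihilated by \<open>I l\<close> ascend with \<open>l\<close> and become
  stationary, which gives one exponent for all torsion elements.\<close>

lemma torsion_uniform:
 assumes "gobj d M"
 shows "\<exists>L. \<forall>x\<in>torsion M. \<forall>s\<in>I L. s \<odot>\<^sub>M x = \<zero>\<^sub>M"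
proof -
 interpret M: graded_module S M by (rule gobjD(1)[OF assms])
 define U where "U l = {x \<in> carrier M. \<forall>s\<in>I l. s \<odot>\<^sub>M x = \<zero>\<^sub>M}" for l
 have U: "sub M (U l)" for l
 proof (rule M.opsub_submoduleI)
  show "U l \<subseteq> carrier M" unfolding U_def by blast
  show "\<zero>\<^sub>M \<in> U l" unfolding U_def using I_D(1) by simp
  show "x \<oplus>\<^sub>M y \<in> U l" if "x \<in> U l" "y \<in> U l" for x y
   using that I_D(1) unfolding U_def by (simp add: M.smult_r_distr)
  show "r \<odot>\<^sub>M x \<in> U l" if "r \<in> carrier S" "x \<in> U l" for r x
   using that I_D(1) I_D(5)[OF that(1)] unfolding U_def by (simp add: M.smult_assoc1[symmetric])
 qed
 have Umono: "U k \<subseteq> U l" if "k \<le> l" for k l unfolding U_def using I_mono[OF that] by blast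
 have "\<exists>k. \<forall>i\<ge>k. U i = U k"
 proof (rule accD[OF M.fin_gen_imp_acc[OF noeth_S gobjD(2)[OF assms]]])
  show "sub M (U i)" for i by (rule U)
  show "U i \<subseteq> carrier M" for i unfolding U_def by blast
  show "U i \<subseteq> U (Suc i)" for i by (rule Umono) simp
 qed
 then obtain L where L: "\<forall>i\<ge>L. U i = U L" ..
 have "x \<in> U L" if "x \<in> torsion M" for x
 proof -
  obtain l where "x \<in> U l" using \<open>x \<in> torsion M\<close> unfolding torsion_over_def U_def by blast
  hence "x \<in> U (max l L)" using Umono[of l "max l L"] by auto
  moreover have "U (max l L) = U L" by (rule L[rule_format]) simp
  ultimately show ?thesis by blast
 qed
 thus ?thesis unfolding U_def by blast
qed

text \<open>Converse to \<open>bounded_of_torsion\<close>: an element of degree \<open>i\<close> is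
  moved past the bound by \<open>I (nat (L - i))\<close>.\<close>

lemma torsion_of_bounded:
 assumes "graded_module S B" "hsub B H" "\<And>i. i \<ge> L \<Longrightarrow> hcomp B i \<subseteq> H" "b \<in> carrier B"
 shows "\<exists>l. \<forall>s\<in>I l. s \<odot>\<^sub>B b \<in> H"
proof -
 interpret B: graded_module S B by fact
 note T = opsubD[OF hsubD(1)[OF hsub_torsion_over(1)[OF assms(1,2)]]]
 note o = opsubD[OF hsubD(1)[OF assms(2)]]
 have "b \<in> torsion_over B H" using assms(4)
 proof (induction rule: B.graded_induct)
  case zero
  thus ?case by (rule T(2))
 next
  case (comp i y)
  have y: "y \<in> carrier B" by (rule B.G.hcompD(1)[OF comp])
  have "s \<odot>\<^sub>B y \<in> H" if "s \<in> I (nat (L - i))" for s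
   using that
  proof (induction rule: I_induct)
   case zero
   thus ?case using y o(2) by simp
  next
   case (comp j s)
   hence "L \<le> j + i" by (simp split: if_splits)
   thus ?case using assms(3)[of "j + i"] B.smult_hcomp[OF comp(2) \<open>y \<in> hcomp B i\<close>] by blast
  next
   case (add s t)
   thus ?case using o(3) I_D(1) y by (simp add: B.smult_l_distr)
  qed
  thus ?case unfolding torsion_over_def using y by blast
 next
  case (add y z)
  thus ?case using T(3) by blast
 qed
 thus ?thesis unfolding torsion_over_def by blast
qed

section \<open>Homomorphisms on powers of the ideal, and envelopes\<close>

definition dhom :: "nat \<Rightarrow> int \<Rightarrow> ('a, 'b) graded_module \<Rightarrow> ('a \<Rightarrow> 'b) set" where
 "dhom k i M = hcomp (internal_hom S (sub_gm S (I k)) M) i"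

lemma lin_homD:
 assumes "f \<in> lin_hom S (sub_gm S (I k)) M"
 shows "s \<in> I k \<Longrightarrow> f s \<in> carrier M" "s \<in> I k \<Longrightarrow> t \<in> I k \<Longrightarrow> f (s \<oplus>\<^sub>S t) = f s \<oplus>\<^sub>M f t"
  "r \<in> carrier S \<Longrightarrow> s \<in> I k \<Longrightarrow> f (r \<otimes>\<^sub>S s) = r \<odot>\<^sub>M f s" "f \<in> extensional (I k)"
 using assms unfolding lin_hom_def by (auto simp: smult_S PiE_def)

lemma lin_homI:
 assumes "f \<in> extensional (I k)" "\<And>s. s \<in> I k \<Longrightarrow> f s \<in> carrier M"
  "\<And>s t. s \<in> I k \<Longrightarrow> t \<in> I k \<Longrightarrow> f (s \<oplus>\<^sub>S t) = f s \<oplus>\<^sub>M f t"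
  "\<And>r s. r \<in> carrier S \<Longrightarrow> s \<in> I k \<Longrightarrow> f (r \<otimes>\<^sub>S s) = r \<odot>\<^sub>M f s"
 shows "f \<in> lin_hom S (sub_gm S (I k)) M"
 using assms unfolding lin_hom_def by (auto simp: smult_S PiE_def)

lemma dhom_iff: "f \<in> dhom k i M \<longleftrightarrow> f \<in> lin_hom S (sub_gm S (I k)) M \<and>
  (\<forall>j. \<forall>s\<in>hcomp S j \<inter> I k. f s \<in> hcomp M (i + j))"
 by (auto simp: dhom_def internal_hom_def image_subset_iff)

text \<open>The properties of a unit \<open>N \<rightarrow> U\<close> on which extension of
  morphisms rests: torsion kernel and cokernel, no torsion in \<open>U\<close>, and every
  homomorphism \<open>I k \<rightarrow> N\<close> of degree at least \<open>d\<close> becomes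
  multiplication by an element of \<open>U\<close>.\<close>

definition envelope :: "int \<Rightarrow> ('a, 'b) graded_module \<Rightarrow> ('a, 'c) graded_module \<Rightarrow> ('b \<Rightarrow> 'c) \<Rightarrow> bool" where
 "envelope d N U \<eta> \<longleftrightarrow> gobj d N \<and> gobj d U \<and> \<eta> \<in> ghom N U \<and> torsion U \<subseteq> {\<zero>\<^sub>U} \<and>
  (\<forall>x\<in>carrier N. \<eta> x = \<zero>\<^sub>U \<longrightarrow> x \<in> torsion N) \<and> carrier U \<subseteq> torsion_over U (\<eta> ` carrier N) \<and>
  (\<forall>k i \<psi>. d \<le> i \<longrightarrow> \<psi> \<in> dhom k i N \<longrightarrow> (\<exists>u\<in>hcomp U i. \<forall>s\<in>I k. s \<odot>\<^sub>U u = \<eta> (\<psi> s)))"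

lemma envelopeD:
 assumes "envelope d N U \<eta>"
 shows "gobj d N" "gobj d U" "\<eta> \<in> ghom N U" "torsion U \<subseteq> {\<zero>\<^sub>U}"
  "x \<in> carrier N \<Longrightarrow> \<eta> x = \<zero>\<^sub>U \<Longrightarrow> x \<in> torsion N" "carrier U \<subseteq> torsion_over U (\<eta> ` carrier N)"
  "d \<le> i \<Longrightarrow> \<psi> \<in> dhom k i N \<Longrightarrow> \<exists>u\<in>hcomp U i. \<forall>s\<in>I k. s \<odot>\<^sub>U u = \<eta> (\<psi> s)"
 using assms unfolding envelope_def by blast+

lemma torsion_free_eq:
 assumes "graded_module S U" "torsion U \<subseteq> {\<zero>\<^sub>U}" "u \<in> carrier U" "v \<in> carrier U"
  "\<And>s. s \<in> I l \<Longrightarrow> s \<odot>\<^sub>U u = s \<odot>\<^sub>U v"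
 shows "u = v"
proof -
 interpret U: graded_module S U by fact
 have "s \<odot>\<^sub>U (u \<ominus>\<^sub>U v) = \<zero>\<^sub>U" if "s \<in> I l" for s
  using assms(3-5) that I_D(1)[OF that] by (simp add: a_minus_def U.smult_r_distr U.smult_r_minus U.M.r_neg)
 hence "u \<ominus>\<^sub>U v \<in> torsion U" unfolding torsion_over_def using assms(3,4) by blast
 thus ?thesis using assms(2-4) U.M.minus_eq_zero_iff by blast
qed

text \<open>Elements of the \<open>\<mm>\<close>-torsion-free module \<open>U\<close> may be compared after multiplication with a
 power of \<open>\<mm>\<close>, which makes \<open>b \<mapsto> u\<close> below a well-defined map.\<close>

lemma envelope_extension:
 assumes E: "envelope d N U \<eta>" and A: "gobj d A" and B: "gobj d B" and \<phi>: "\<phi> \<in> ghom A B"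
  and t1: "\<And>b. b \<in> carrier B \<Longrightarrow> \<exists>l. \<forall>s\<in>I l. s \<odot>\<^sub>B b \<in> \<phi> ` carrier A"
  and t2: "\<And>a. a \<in> carrier A \<Longrightarrow> \<phi> a = \<zero>\<^sub>B \<Longrightarrow> a \<in> torsion A"
  and f: "f \<in> ghom A U"
 shows "\<exists>!g. g \<in> ghom B U \<and> (\<forall>a\<in>carrier A. g (\<phi> a) = f a)"
proof -
 note E = envelopeD[OF E]
 note gA = gobjD(1)[OF A] and gB = gobjD(1)[OF B] and gN = gobjD(1)[OF E(1)] and gU = gobjD(1)[OF E(2)]
 interpret A: graded_module S A by (rule gA)
 interpret B: graded_module S B by (rule gB)
 interpret N: graded_module S N by (rule gN)
 interpret U: graded_module S U by (rule gU)
 note h\<phi> = ghomD[OF \<phi>] and z\<phi> = ghom_zero[OF gA gB \<phi>]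
 note hf = ghomD[OF f] and zf = ghom_zero[OF gA gU f]
 note h\<eta> = ghomD[OF E(3)] and z\<eta> = ghom_zero[OF gN gU E(3)]
 note eqI = torsion_free_eq[OF gU E(4)]
 \<comment> \<open>The difference of the arguments is torsion in \<open>A\<close>, so the difference
   of the values is torsion in \<open>U\<close> and vanishes.\<close>
 have fk: "f a = f a'" if "a \<in> carrier A" "a' \<in> carrier A" "\<phi> a = \<phi> a'" for a a'
 proof -
  have "\<phi> (a \<ominus>\<^sub>A a') = \<zero>\<^sub>B" using that h\<phi> by (simp add: z\<phi>)
  then obtain l where l: "\<forall>s\<in>I l. s \<odot>\<^sub>A (a \<ominus>\<^sub>A a') = \<zero>\<^sub>A"
   using t2[of "a \<ominus>\<^sub>A a'"] A.M.minus_closed[OF \<open>a \<in> carrier A\<close> \<open>a' \<in> carrier A\<close>] unfolding torsion_over_def by auto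
  have "f (a \<ominus>\<^sub>A a') = \<zero>\<^sub>U"
  proof (rule eqI)
   fix s assume s: "s \<in> I l"
   have "s \<odot>\<^sub>U f (a \<ominus>\<^sub>A a') = f (s \<odot>\<^sub>A (a \<ominus>\<^sub>A a'))"
    using hf(3)[OF I_D(1)[OF s] A.M.minus_closed[OF that(1,2)]] by (rule sym)
   also have "\<dots> = s \<odot>\<^sub>U \<zero>\<^sub>U" using l s I_D(1)[OF s] zf(1) by simp
   finally show "s \<odot>\<^sub>U f (a \<ominus>\<^sub>A a') = s \<odot>\<^sub>U \<zero>\<^sub>U" .
  qed (use that hf in auto)
  thus ?thesis using that hf(1) U.M.minus_eq_zero_iff[of "f a" "f a'"] by (simp add: zf)
 qed
 \<comment> \<open>\<open>P b u\<close>: after multiplication by some \<open>I l\<close> the pair is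
   compatible with \<open>\<phi>\<close> and \<open>f\<close>. Uniqueness of \<open>u\<close> is
   freeness from torsion; existence is the point of the proof and reduces to homogeneous
   \<open>b\<close>.\<close>
 define P where "P b u \<longleftrightarrow> (\<exists>l. \<forall>s\<in>I l. \<exists>a\<in>carrier A. \<phi> a = s \<odot>\<^sub>B b \<and> f a = s \<odot>\<^sub>U u)" for b u
 have P_unique: "u = v" if "u \<in> carrier U" "v \<in> carrier U" "P b u" "P b v" for b u v
 proof -
  obtain k l where kl: "\<forall>s\<in>I k. \<exists>a\<in>carrier A. \<phi> a = s \<odot>\<^sub>B b \<and> f a = s \<odot>\<^sub>U u"
   "\<forall>s\<in>I l. \<exists>a\<in>carrier A. \<phi> a = s \<odot>\<^sub>B b \<and> f a = s \<odot>\<^sub>U v"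
   using \<open>P b u\<close> \<open>P b v\<close> unfolding P_def by blast
  show ?thesis
  proof (rule eqI[OF that(1,2)])
   fix s assume "s \<in> I (max k l)"
   hence "s \<in> I k" "s \<in> I l" by (auto elim: I_monoD)
   thus "s \<odot>\<^sub>U u = s \<odot>\<^sub>U v" using kl fk by metis
  qed
 qed
 have P_add: "P (b \<oplus>\<^sub>B c) (u \<oplus>\<^sub>U v)"
  if "b \<in> carrier B" "c \<in> carrier B" "u \<in> carrier U" "v \<in> carrier U" "P b u" "P c v" for b c u v
 proof -
  obtain k l where kl: "\<forall>s\<in>I k. \<exists>a\<in>carrier A. \<phi> a = s \<odot>\<^sub>B b \<and> f a = s \<odot>\<^sub>U u"
   "\<forall>s\<in>I l. \<exists>a\<in>carrier A. \<phi> a = s \<odot>\<^sub>B c \<and> f a = s \<odot>\<^sub>U v"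
   using \<open>P b u\<close> \<open>P c v\<close> unfolding P_def by blast
  have "\<exists>a\<in>carrier A. \<phi> a = s \<odot>\<^sub>B (b \<oplus>\<^sub>B c) \<and> f a = s \<odot>\<^sub>U (u \<oplus>\<^sub>U v)" if s: "s \<in> I (max k l)" for s
  proof -
   have "s \<in> I k" "s \<in> I l" using s by (auto elim: I_monoD)
   then obtain a a' where "a \<in> carrier A" "\<phi> a = s \<odot>\<^sub>B b" "f a = s \<odot>\<^sub>U u"
    "a' \<in> carrier A" "\<phi> a' = s \<odot>\<^sub>B c" "f a' = s \<odot>\<^sub>U v" using kl by blast
   thus ?thesis using that I_D(1)[OF s] \<open>b \<in> carrier B\<close> \<open>c \<in> carrier B\<close> \<open>u \<in> carrier U\<close> \<open>v \<in> carrier U\<close>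
    by (intro bexI[of _ "a \<oplus>\<^sub>A a'"]) (auto simp: h\<phi> hf B.smult_r_distr U.smult_r_distr)
  qed
  thus ?thesis unfolding P_def by blast
 qed
 have P_smult: "P (r \<odot>\<^sub>B b) (r \<odot>\<^sub>U u)"
  if "b \<in> carrier B" "u \<in> carrier U" "P b u" "r \<in> carrier S" for b u r
 proof -
  obtain l where l: "\<forall>s\<in>I l. \<exists>a\<in>carrier A. \<phi> a = s \<odot>\<^sub>B b \<and> f a = s \<odot>\<^sub>U u"
   using \<open>P b u\<close> unfolding P_def by blast
  have "\<exists>a\<in>carrier A. \<phi> a = s \<odot>\<^sub>B (r \<odot>\<^sub>B b) \<and> f a = s \<odot>\<^sub>U (r \<odot>\<^sub>U u)" if "s \<in> I l" for s
   using l[rule_format, OF I_D(5)[OF \<open>r \<in> carrier S\<close> that]] I_D(1)[OF that] \<open>r \<in> carrier S\<close> \<open>b \<in> carrier B\<close> \<open>u \<in> carrier U\<close>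
   by (simp add: B.smult_assoc1 U.smult_assoc1)
  thus ?thesis unfolding P_def by blast
 qed
 have P_base: "P (\<phi> a) (f a)" if "a \<in> carrier A" for a
  unfolding P_def
 proof (intro exI[of _ 0] ballI)
  fix s assume "s \<in> I 0"
  hence "s \<in> carrier S" by (rule I_D(1))
  thus "\<exists>a'\<in>carrier A. \<phi> a' = s \<odot>\<^sub>B \<phi> a \<and> f a' = s \<odot>\<^sub>U f a"
   using that by (intro bexI[of _ "s \<odot>\<^sub>A a"]) (auto simp: h\<phi> hf)
 qed
 \<comment> \<open>Below degree \<open>d\<close> the element \<open>b\<close> is zero. Otherwise,
   sending \<open>s\<close> to the lift to \<open>N\<close> of \<open>f a\<close>, where
   \<open>\<phi> a = s b\<close>, defines a homomorphism of degree \<open>i\<close> on some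
   \<open>I k\<close>, and the last clause of \<open>envelope\<close> realizes it by
   \<open>u\<close>.\<close>
 have P_homog: "\<exists>u\<in>hcomp U i. P b u" if b: "b \<in> hcomp B i" for b i
 proof (cases "d \<le> i")
  case False
  hence "b = \<zero>\<^sub>B" using gobjD(3)[OF B, of i] b by auto
  thus ?thesis using P_base[OF A.zero_closed] U.G.hcompD(2) by (auto simp: z\<phi> zf)
 next
  case True
  note bc = B.G.hcompD(1)[OF b]
  have im: "hsub U (\<eta> ` carrier N)" by (rule hsub_image[OF gN gU E(3) hsub_carrier[OF gN]])
  obtain L where L: "\<And>k. k \<ge> L \<Longrightarrow> hcomp U k \<subseteq> \<eta> ` carrier N"
   using bounded_of_torsion[OF gU gobjD(2)[OF E(2)] im] E(6) unfolding torsion_over_def by blast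
  obtain L' where L': "\<And>k. k \<ge> L' \<Longrightarrow> hcomp N k \<inter> torsion N \<subseteq> {\<zero>\<^sub>N}"
   using torsion_over_bounded[OF E(1) hsub_zero[OF gN]] by blast
  \<comment> \<open>In degrees from \<open>L'\<close> on \<open>\<eta>\<close> is injective. As
    \<open>S\<close> has no negative degrees, the elements without components below
    \<open>L'\<close> form a submodule, and \<open>\<eta>\<close> is injective on it.\<close>
  define Y where "Y = {y \<in> carrier N. \<forall>k<L'. pr N k y = \<zero>\<^sub>N}"
  have Yc: "Y \<subseteq> carrier N" unfolding Y_def by blast
  have Y0: "\<zero>\<^sub>N \<in> Y" unfolding Y_def by simp
  have Yadd: "y \<oplus>\<^sub>N z \<in> Y" if "y \<in> Y" "z \<in> Y" for y z using that unfolding Y_def by (simp add: N.pr_add)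
  have Ysmult: "r \<odot>\<^sub>N y \<in> Y" if "r \<in> carrier S" "y \<in> Y" for r y
   using that(1)
  proof (induction rule: S.graded_induct)
   case zero
   thus ?case using Y0 Yc that by auto
  next
   case (comp p r)
   note rc = S.G.hcompD(1)[OF comp]
   show ?case
   proof (cases "p < 0")
    case True
    thus ?thesis using hcomp_neg[of p] comp Y0 Yc that by auto
   next
    case False
    thus ?thesis using that rc unfolding Y_def by (auto simp: N.pr_smult[OF comp rc])
   qed
  next
   case (add r t)
   thus ?case using Yadd that Yc by (auto simp: N.smult_l_distr)
  qed
  have Yhom: "y \<in> Y" if "y \<in> hcomp N k" "L' \<le> k" for y k
   unfolding Y_def using that N.G.hcompD(1) by (auto simp: N.pr_homog)
  have Ypr: "pr N k y \<in> Y" if "y \<in> Y" for k y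
  proof (cases "k < L'")
   case True
   thus ?thesis using that Y0 unfolding Y_def by simp
  next
   case False
   thus ?thesis using Yhom[OF N.pr(1)] that Yc by auto
  qed
  have Yinj: "y = \<zero>\<^sub>N" if "y \<in> Y" "\<eta> y = \<zero>\<^sub>U" for y
  proof (rule N.pr_eq_zero)
   show y: "y \<in> carrier N" using that Yc by blast
   show "pr N k y = \<zero>\<^sub>N" for k
   proof (cases "k < L'")
    case True
    thus ?thesis using that unfolding Y_def by blast
   next
    case False
    have "\<eta> (pr N k y) = \<zero>\<^sub>U" using z\<eta>(4)[OF y, of k] that(2) by simp
    thus ?thesis using E(5)[OF N.pr_carrier[OF y]] L'[of k] False N.pr(1)[OF y, of k] by auto
   qed
  qed
  have Yinj2: "y = z" if "y \<in> Y" "z \<in> Y" "\<eta> y = \<eta> z" for y z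
  proof -
   have yz: "y \<in> carrier N" "z \<in> carrier N" using that Yc by auto
   have "y \<ominus>\<^sub>N z \<in> Y"
    using Yadd[OF that(1) Ysmult[OF _ that(2), of "\<ominus>\<^sub>S \<one>\<^sub>S"]] yz by (simp add: a_minus_def N.smult_l_minus)
   hence "y \<ominus>\<^sub>N z = \<zero>\<^sub>N" using Yinj that(3) yz h\<eta>(1) by (simp add: z\<eta>)
   thus ?thesis using yz by (simp add: N.M.minus_eq_zero_iff)
  qed
  obtain l where l: "\<forall>s\<in>I l. s \<odot>\<^sub>B b \<in> \<phi> ` carrier A" using t1[OF bc] ..
  \<comment> \<open>Large enough that \<open>I k\<close> carries \<open>b\<close> into the image of
    \<open>\<phi>\<close>, and that degree \<open>i + j\<close> with \<open>j \<ge> k\<close> lies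
    in the ranges where \<open>\<eta>\<close> is surjective (\<open>L\<close>) and injective
    (\<open>L'\<close>).\<close>
  define k where "k = l + nat (L - i) + nat (L' - i)"
  have k: "l \<le> k" "L \<le> i + int k" "L' \<le> i + int k" unfolding k_def by auto
  \<comment> \<open>The graph of the homomorphism to be built; linearity is proved for the relation
    first and transferred by \<open>R_unique\<close>.\<close>
  define R where "R s y \<longleftrightarrow> y \<in> Y \<and> (\<exists>a\<in>carrier A. \<phi> a = s \<odot>\<^sub>B b \<and> \<eta> y = f a)" for s y
  have R_unique: "y = z" if "R s y" "R s z" for s y z
   using that Yinj2 fk unfolding R_def by metis
  have R_add: "R (s \<oplus>\<^sub>S t) (y \<oplus>\<^sub>N z)" if "s \<in> carrier S" "t \<in> carrier S" and yz: "R s y" "R t z" for s t y z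
  proof -
   obtain a a' where a: "a \<in> carrier A" "\<phi> a = s \<odot>\<^sub>B b" "\<eta> y = f a" "a' \<in> carrier A" "\<phi> a' = t \<odot>\<^sub>B b" "\<eta> z = f a'"
    "y \<in> Y" "z \<in> Y" using yz unfolding R_def by blast
   have "y \<in> carrier N" "z \<in> carrier N" using a Yc by auto
   thus ?thesis unfolding R_def using a that bc Yadd
    by (intro conjI bexI[of _ "a \<oplus>\<^sub>A a'"]) (auto simp: h\<phi>(2) hf(2) h\<eta>(2) B.smult_l_distr)
  qed
  have R_smult: "R (r \<otimes>\<^sub>S s) (r \<odot>\<^sub>N y)" if "s \<in> carrier S" "r \<in> carrier S" and y: "R s y" for s r y
  proof -
   obtain a where a: "a \<in> carrier A" "\<phi> a = s \<odot>\<^sub>B b" "\<eta> y = f a" "y \<in> Y" using y unfolding R_def by blast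
   have "y \<in> carrier N" using a Yc by auto
   thus ?thesis unfolding R_def using a that bc Ysmult
    by (intro conjI bexI[of _ "r \<odot>\<^sub>A a"]) (auto simp: h\<phi>(3) hf(3) h\<eta>(3) B.smult_assoc1)
  qed
  \<comment> \<open>The component of \<open>y\<close> in degree \<open>i + j\<close> is related to
    \<open>s\<close> as well, so by uniqueness it is \<open>y\<close>.\<close>
  have R_homog: "y \<in> hcomp N (i + j)" if "s \<in> hcomp S j" "R s y" for s j y
  proof -
   obtain a where a: "a \<in> carrier A" "\<phi> a = s \<odot>\<^sub>B b" "\<eta> y = f a" "y \<in> Y" using \<open>R s y\<close> unfolding R_def by blast
   have y: "y \<in> carrier N" using a Yc by auto
   have "s \<odot>\<^sub>B b \<in> hcomp B (i + j)" using B.smult_hcomp[OF that(1) b] by (simp add: add.commute)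
   hence "\<phi> (pr A (i + j) a) = s \<odot>\<^sub>B b" using z\<phi>(4)[OF a(1), of "i + j"] a(2) by (simp add: B.pr_homog)
   moreover have "\<eta> (pr N (i + j) y) = f (pr A (i + j) a)" using z\<eta>(4)[OF y, of "i + j"] zf(4)[OF a(1), of "i + j"] a(3) by simp
   ultimately have "R s (pr N (i + j) y)" unfolding R_def using Ypr a by blast
   hence "y = pr N (i + j) y" by (rule R_unique[OF that(2)])
   thus ?thesis using N.pr(1)[OF y, of "i + j"] by simp
  qed
  have R_ex: "\<exists>y. R s y" if "s \<in> I k" for s
   using that
  proof (induction rule: I_induct)
   case zero
   have "R \<zero>\<^sub>S \<zero>\<^sub>N" unfolding R_def using Y0 bc by (intro conjI bexI[of _ "\<zero>\<^sub>A"]) (auto simp: z\<phi> z\<eta> zf)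
   thus ?case ..
  next
   case (comp j s)
   have "s \<in> I l" using hcomp_I[of l j] k(1) comp by auto
   then obtain a where a: "a \<in> carrier A" "\<phi> a = s \<odot>\<^sub>B b" using l by auto
   \<comment> \<open>A homogeneous preimage is needed, since surjectivity of \<open>\<eta>\<close>
     is available in single high degrees only.\<close>
   define a' where "a' = pr A (i + j) a"
   have a'c: "a' \<in> hcomp A (i + j)" unfolding a'_def by (rule A.pr(1)[OF a(1)])
   have "s \<odot>\<^sub>B b \<in> hcomp B (i + j)" using B.smult_hcomp[OF comp(2) b] by (simp add: add.commute)
   hence a': "\<phi> a' = s \<odot>\<^sub>B b" unfolding a'_def using z\<phi>(4)[OF a(1), of "i + j"] a(2) by (simp add: B.pr_homog)
   have fa: "f a' \<in> hcomp U (i + j)" by (rule hf(4)[OF a'c])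
   have "L \<le> i + j" using k(2) comp(1) by simp
   then obtain y where y: "y \<in> carrier N" "f a' = \<eta> y" using L[of "i + j"] fa by blast
   have "\<eta> (pr N (i + j) y) = f a'" using z\<eta>(4)[OF y(1), of "i + j"] y(2) fa by (simp add: U.pr_homog)
   moreover have "pr N (i + j) y \<in> Y" by (rule Yhom[OF N.pr(1)[OF y(1)]]) (use k(3) comp(1) in simp)
   ultimately have "R s (pr N (i + j) y)" unfolding R_def using a' A.G.hcompD(1)[OF a'c] by blast
   thus ?case ..
  next
   case (add s t)
   thus ?case using R_add I_D(1) by blast
  qed
  define \<psi> where "\<psi> = (\<lambda>s\<in>I k. THE y. R s y)"
  have R\<psi>: "R s (\<psi> s)" if "s \<in> I k" for s
  proof -
   from R_ex[OF that] obtain y where y: "R s y" ..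
   have "R s (THE y. R s y)" by (rule theI[of "R s", OF y]) (erule R_unique[OF _ y])
   thus ?thesis unfolding \<psi>_def using that by simp
  qed
  have \<psi>c: "\<psi> s \<in> carrier N" if "s \<in> I k" for s using R\<psi>[OF that] Yc unfolding R_def by blast
  have "\<psi> \<in> dhom k i N"
   unfolding dhom_iff
  proof (intro conjI lin_homI allI ballI)
   show "\<psi> \<in> extensional (I k)" unfolding \<psi>_def by simp
   show "\<psi> s \<in> carrier N" if "s \<in> I k" for s by (rule \<psi>c[OF that])
   show "\<psi> (s \<oplus>\<^sub>S t) = \<psi> s \<oplus>\<^sub>N \<psi> t" if "s \<in> I k" "t \<in> I k" for s t
    by (rule R_unique[OF R\<psi>[OF I_D(3)[OF that]] R_add[OF I_D(1)[OF that(1)] I_D(1)[OF that(2)] R\<psi>[OF that(1)] R\<psi>[OF that(2)]]])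
   show "\<psi> (r \<otimes>\<^sub>S s) = r \<odot>\<^sub>N \<psi> s" if "r \<in> carrier S" "s \<in> I k" for r s
    by (rule R_unique[OF R\<psi>[OF I_D(4)[OF that]] R_smult[OF I_D(1)[OF that(2)] that(1) R\<psi>[OF that(2)]]])
   show "\<psi> s \<in> hcomp N (i + j)" if "s \<in> hcomp S j \<inter> I k" for j s
    using R_homog[of s j "\<psi> s"] R\<psi>[of s] that by blast
  qed
  from E(7)[OF True this] obtain u where u: "u \<in> hcomp U i" "\<forall>s\<in>I k. s \<odot>\<^sub>U u = \<eta> (\<psi> s)" ..
  have "P b u" unfolding P_def
  proof (intro exI[of _ k] ballI)
   fix s assume s: "s \<in> I k"
   thus "\<exists>a\<in>carrier A. \<phi> a = s \<odot>\<^sub>B b \<and> f a = s \<odot>\<^sub>U u"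
    using R\<psi>[OF s] u(2) unfolding R_def by metis
  qed
  thus ?thesis using u(1) by blast
 qed
 have P_ex: "\<exists>u\<in>carrier U. P b u" if "b \<in> carrier B" for b
  using that
 proof (induction rule: B.graded_induct)
  case zero
  thus ?case using P_base[OF A.zero_closed] hf(1)[OF A.zero_closed] by (auto simp: z\<phi>)
 next
  case (comp i b)
  thus ?case using P_homog U.G.hcompD(1) by blast
 next
  case (add b c)
  thus ?case using P_add U.add.m_closed by blast
 qed
 define g where "g = (\<lambda>b\<in>carrier B. THE u. u \<in> carrier U \<and> P b u)"
 have g_eq: "g b = u" if "b \<in> carrier B" "u \<in> carrier U" "P b u" for b u
  unfolding g_def using that P_unique by (auto intro!: the_equality)
 have gP: "g b \<in> carrier U \<and> P b (g b)" if b: "b \<in> carrier B" for b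
 proof -
  obtain u where u: "u \<in> carrier U" "P b u" using P_ex[OF b] ..
  thus ?thesis using g_eq[OF b u] by simp
 qed
 have g: "g \<in> ghom B U"
 proof (rule ghomI)
  show "g \<in> extensional (carrier B)" unfolding g_def by simp
  show "g b \<in> carrier U" if "b \<in> carrier B" for b using gP that by blast
  show "g (b \<oplus>\<^sub>B c) = g b \<oplus>\<^sub>U g c" if "b \<in> carrier B" "c \<in> carrier B" for b c
   using gP[OF that(1)] gP[OF that(2)] that P_add by (intro g_eq) auto
  show "g (r \<odot>\<^sub>B b) = r \<odot>\<^sub>U g b" if "r \<in> carrier S" "b \<in> carrier B" for r b
   using gP[OF that(2)] that P_smult by (intro g_eq) auto
  show "g b \<in> hcomp U i" if "b \<in> hcomp B i" for i b
  proof -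
   obtain u where u: "u \<in> hcomp U i" "P b u" using P_homog[OF \<open>b \<in> hcomp B i\<close>] ..
   thus ?thesis using g_eq[OF B.G.hcompD(1)[OF \<open>b \<in> hcomp B i\<close>] U.G.hcompD(1)[OF u(1)] u(2)] by simp
  qed
 qed
 have g\<phi>: "g (\<phi> a) = f a" if "a \<in> carrier A" for a using g_eq[OF h\<phi>(1) hf(1) P_base] that by blast
 have uniq: "g' = g" if g': "g' \<in> ghom B U" "\<forall>a\<in>carrier A. g' (\<phi> a) = f a" for g'
 proof (rule ghom_eqI[OF g'(1) g])
  fix b assume b: "b \<in> carrier B"
  obtain l where l: "\<forall>s\<in>I l. s \<odot>\<^sub>B b \<in> \<phi> ` carrier A" using t1[OF b] ..
  show "g' b = g b"
  proof (rule eqI)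
   show "g' b \<in> carrier U" "g b \<in> carrier U" using ghomD(1)[OF g'(1) b] ghomD(1)[OF g b] .
   fix s assume s: "s \<in> I l"
   then obtain a where a: "s \<odot>\<^sub>B b = \<phi> a" "a \<in> carrier A" using l by (auto elim: imageE)
   thus "s \<odot>\<^sub>U g' b = s \<odot>\<^sub>U g b"
    using ghomD(3)[OF g'(1) I_D(1)[OF s] b] ghomD(3)[OF g I_D(1)[OF s] b] g'(2) g\<phi> by simp
  qed
 qed
 show ?thesis
 proof (rule ex1I[of _ g])
  show "g \<in> ghom B U \<and> (\<forall>a\<in>carrier A. g (\<phi> a) = f a)" using g g\<phi> by blast
  show "g' = g" if "g' \<in> ghom B U \<and> (\<forall>a\<in>carrier A. g' (\<phi> a) = f a)" for g'
   using that by (elim conjE) (rule uniq)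
 qed
qed

section \<open>The limit of the modules of homomorphisms\<close>

text \<open>This definition and the following ones are the counterparts of
  \<open>transform_seq\<close>, \<open>transform_trans\<close> and \<open>transform_lim\<close> over
  the abstract ring; the final theorem identifies them.\<close>

definition hom_seq :: "int \<Rightarrow> ('a, 'b) graded_module \<Rightarrow> nat \<Rightarrow> ('a, 'a \<Rightarrow> 'b) graded_module" where
 "hom_seq d M k = trunc d (internal_hom S (sub_gm S (I k)) M)"

definition hom_trans :: "nat \<Rightarrow> ('a \<Rightarrow> 'b) \<Rightarrow> 'a \<Rightarrow> 'b" where
 "hom_trans k f = restrict f (I (Suc k))"

definition hom_lim :: "int \<Rightarrow> ('a, 'b) graded_module \<Rightarrow> ('a, (nat \<times> ('a \<Rightarrow> 'b)) set) graded_module" where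
 "hom_lim d M = direct_limit (hom_seq d M) hom_trans"

definition germ :: "int \<Rightarrow> ('a, 'b) graded_module \<Rightarrow> nat \<Rightarrow> ('a \<Rightarrow> 'b) \<Rightarrow> (nat \<times> ('a \<Rightarrow> 'b)) set" where
 "germ d M = lim_class (hom_seq d M) hom_trans"

end

locale hom_limit = standard_graded S n var I
 for S :: "('a, 'a) graded_module" and n var I +
 fixes d :: int and M :: "('a, 'b) graded_module"
 assumes gobj_M: "gobj d M"

sublocale hom_limit \<subseteq> M: graded_module S M
 by (rule gobjD(1)[OF gobj_M])

context hom_limit begin

section \<open>The modules of homomorphisms and their truncations\<close>

abbreviation "lin k \<equiv> lin_hom S (sub_gm S (I k)) M"
abbreviation "IH k \<equiv> internal_hom S (sub_gm S (I k)) M"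
abbreviation "HH k \<equiv> hom_seq d M k"
abbreviation "DD \<equiv> hom_lim d M"
abbreviation "cls \<equiv> germ d M"

lemma IH_simps [simp]:
 "carrier (IH k) = lin k" "\<zero>\<^bsub>IH k\<^esub> = (\<lambda>s\<in>I k. \<zero>\<^sub>M)" "f \<oplus>\<^bsub>IH k\<^esub> g = (\<lambda>s\<in>I k. f s \<oplus>\<^sub>M g s)"
 "r \<odot>\<^bsub>IH k\<^esub> f = (\<lambda>s\<in>I k. r \<odot>\<^sub>M f s)" "hcomp (IH k) i = dhom k i M"
 by (simp_all add: internal_hom_def dhom_def)

lemma lin_eqI: "f \<in> lin k \<Longrightarrow> g \<in> lin k \<Longrightarrow> (\<And>s. s \<in> I k \<Longrightarrow> f s = g s) \<Longrightarrow> f = g"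
 using lin_homD(4) by (blast intro: extensionalityI)

lemma lin_zero: "(\<lambda>s\<in>I k. \<zero>\<^sub>M) \<in> lin k"
 by (rule lin_homI) (auto simp: I_D)

lemma lin_add: "f \<in> lin k \<Longrightarrow> g \<in> lin k \<Longrightarrow> (\<lambda>s\<in>I k. f s \<oplus>\<^sub>M g s) \<in> lin k"
 by (rule lin_homI) (auto simp: I_D lin_homD M.M.a_ac M.smult_r_distr)

lemma lin_smult: "r \<in> carrier S \<Longrightarrow> f \<in> lin k \<Longrightarrow> (\<lambda>s\<in>I k. r \<odot>\<^sub>M f s) \<in> lin k"
 by (rule lin_homI) (auto simp: I_D lin_homD M.smult_r_distr M.smult_assoc1[symmetric] S.R.m_comm)

lemma lin_restrict: "f \<in> lin k \<Longrightarrow> k \<le> l \<Longrightarrow> restrict f (I l) \<in> lin l"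
 by (rule lin_homI) (auto simp: I_D lin_homD I_monoD)

lemma dhom_lin: "f \<in> dhom k i M \<Longrightarrow> f \<in> lin k"
 and dhom_hcomp: "f \<in> dhom k i M \<Longrightarrow> s \<in> hcomp S j \<Longrightarrow> s \<in> I k \<Longrightarrow> f s \<in> hcomp M (i + j)"
 by (auto simp: dhom_iff)

lemma dhom_zero: "(\<lambda>s\<in>I k. \<zero>\<^sub>M) \<in> dhom k i M"
 using M.G.hcompD(2) by (simp add: dhom_iff lin_zero)

lemma dhom_add: "f \<in> dhom k i M \<Longrightarrow> g \<in> dhom k i M \<Longrightarrow> (\<lambda>s\<in>I k. f s \<oplus>\<^sub>M g s) \<in> dhom k i M"
 using M.G.hcompD(3) by (simp add: dhom_iff lin_add)

lemma dhom_smult: "r \<in> hcomp S p \<Longrightarrow> f \<in> dhom k i M \<Longrightarrow> (\<lambda>s\<in>I k. r \<odot>\<^sub>M f s) \<in> dhom k (p + i) M"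
 using M.smult_hcomp by (auto simp: dhom_iff lin_smult S.G.hcompD(1) add.assoc)

lemma dhom_restrict: "f \<in> dhom k i M \<Longrightarrow> k \<le> l \<Longrightarrow> restrict f (I l) \<in> dhom l i M"
 by (auto simp: dhom_iff lin_restrict I_monoD)

lemma module_IH: "module S (IH k)"
proof (rule moduleI)
 show "cring S" by (rule S.R.is_cring)
 show "abelian_group (IH k)"
 proof (rule abelian_groupI)
  show "\<zero>\<^bsub>IH k\<^esub> \<oplus>\<^bsub>IH k\<^esub> f = f" if "f \<in> carrier (IH k)" for f
  proof -
   have f: "f \<in> lin k" using that by simp
   show ?thesis by (rule extensionalityI[where A = "I k"]) (use lin_homD[OF f] in auto)
  qed
  show "\<exists>g\<in>carrier (IH k). g \<oplus>\<^bsub>IH k\<^esub> f = \<zero>\<^bsub>IH k\<^esub>" if "f \<in> carrier (IH k)" for f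
   using that lin_smult[of "\<ominus>\<^sub>S \<one>\<^sub>S" f k]
   by (intro bexI[of _ "\<lambda>s\<in>I k. (\<ominus>\<^sub>S \<one>\<^sub>S) \<odot>\<^sub>M f s"])
    (auto simp: lin_homD M.smult_l_minus M.M.l_neg intro!: restrict_ext)
 qed (auto simp: lin_zero lin_add lin_homD M.M.a_ac intro!: restrict_ext lin_eqI[where k = k])
qed (auto simp: lin_smult lin_add lin_zero lin_homD M.smult_r_distr M.smult_l_distr M.smult_assoc1
  intro!: restrict_ext lin_eqI[where k = k])

text \<open>Directness is established in the limit only; there the truncation is spanned by
  homogeneous homomorphisms by its very definition.\<close>

lemma pregraded_IH: "pregraded (IH k)"
proof (rule pregraded.intro)
 interpret IH: module S "IH k" by (rule module_IH)
 show "abelian_group (IH k)" by (rule IH.M.abelian_group_axioms)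
 have neg: "\<ominus>\<^bsub>IH k\<^esub> f \<in> dhom k i M" if "f \<in> dhom k i M" for f i
 proof -
  have f: "f \<in> lin k" using that by (rule dhom_lin)
  have e: "\<ominus>\<^bsub>IH k\<^esub> f = (\<ominus>\<^sub>S \<one>\<^sub>S) \<odot>\<^bsub>IH k\<^esub> f"
   using f IH.smult_l_minus[of "\<one>\<^sub>S" f] IH.smult_one[of f] by (simp del: IH_simps(4))
  have "(\<ominus>\<^sub>S \<one>\<^sub>S) \<odot>\<^sub>M f s \<in> hcomp M (i + j)" if "s \<in> hcomp S j \<inter> I k" for s j
   using that dhom_hcomp[OF \<open>f \<in> dhom k i M\<close>, of s j] M.G.hcompD(1,4)[of "f s" "i + j"] by (simp add: M.smult_l_minus)
  thus ?thesis unfolding e using lin_smult[OF _ f, of "\<ominus>\<^sub>S \<one>\<^sub>S"] by (simp add: dhom_iff)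
 qed
 have "subgroup (hcomp (IH k) i) (add_monoid (IH k))" for i
 proof (rule IH.M.add.subgroupI)
  show "hcomp (IH k) i \<noteq> {}" using dhom_zero by auto
 qed (use dhom_lin dhom_add neg in \<open>auto simp: a_inv_def[symmetric]\<close>)
 thus "pregraded_axioms (IH k)" by (intro pregraded_axioms.intro)
qed

lemma HH_simps [simp]:
 "\<zero>\<^bsub>HH k\<^esub> = (\<lambda>s\<in>I k. \<zero>\<^sub>M)" "f \<oplus>\<^bsub>HH k\<^esub> g = (\<lambda>s\<in>I k. f s \<oplus>\<^sub>M g s)"
 "r \<odot>\<^bsub>HH k\<^esub> f = (\<lambda>s\<in>I k. r \<odot>\<^sub>M f s)"
 "hcomp (HH k) i = (if d \<le> i then dhom k i M else {\<lambda>s\<in>I k. \<zero>\<^sub>M})"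
 using IH_simps[of k] by (simp_all add: hom_seq_def trunc_def del: IH_simps) 

lemma carrier_HH: "carrier (HH k) = hspan (IH k) {d..}"
 by (simp add: hom_seq_def carrier_trunc)

lemma HH_lin: "f \<in> carrier (HH k) \<Longrightarrow> f \<in> lin k"
 using pregraded.hspan_carrier[OF pregraded_IH] unfolding carrier_HH by auto

lemma HH_zero: "(\<lambda>s\<in>I k. \<zero>\<^sub>M) \<in> carrier (HH k)"
 using pregraded.zero_hspan[OF pregraded_IH] unfolding carrier_HH by simp

lemma HH_dhom: "d \<le> i \<Longrightarrow> f \<in> dhom k i M \<Longrightarrow> f \<in> carrier (HH k)"
 unfolding carrier_HH by (rule pregraded.hcomp_hspan[OF pregraded_IH, of i]) auto

lemma HH_add: "f \<in> carrier (HH k) \<Longrightarrow> g \<in> carrier (HH k) \<Longrightarrow> (\<lambda>s\<in>I k. f s \<oplus>\<^sub>M g s) \<in> carrier (HH k)"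
 using pregraded.hspan_add[OF pregraded_IH] unfolding carrier_HH by fastforce

lemma HH_induct [consumes 1, case_names zero comp add]:
 assumes "f \<in> carrier (HH k)" "P (\<lambda>s\<in>I k. \<zero>\<^sub>M)" "\<And>i f. d \<le> i \<Longrightarrow> f \<in> dhom k i M \<Longrightarrow> P f"
  "\<And>f g. f \<in> carrier (HH k) \<Longrightarrow> g \<in> carrier (HH k) \<Longrightarrow> P f \<Longrightarrow> P g \<Longrightarrow> P (\<lambda>s\<in>I k. f s \<oplus>\<^sub>M g s)"
 shows "P f"
 using assms(1) unfolding carrier_HH
proof (induction rule: pregraded.hspan_induct[OF pregraded_IH, consumes 1, case_names zero comp add])
 case zero
 thus ?case using assms(2) by (simp del: restrict_apply)
next
 case (comp i f)
 thus ?case using assms(3) by simp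
next
 case (add f g)
 thus ?case using assms(4) by (simp add: carrier_HH del: restrict_apply)
qed

text \<open>Truncation is stable under scalars because \<open>S\<close> has no negative degrees:
  multiplication cannot push a homogeneous homomorphism below degree \<open>d\<close>.\<close>

lemma HH_smult:
 assumes "r \<in> carrier S" "f \<in> carrier (HH k)"
 shows "(\<lambda>s\<in>I k. r \<odot>\<^sub>M f s) \<in> carrier (HH k)"
 using assms(2)
proof (induction rule: HH_induct)
 case zero
 have "(\<lambda>s\<in>I k. r \<odot>\<^sub>M (\<lambda>s\<in>I k. \<zero>\<^sub>M) s) = (\<lambda>s\<in>I k. \<zero>\<^sub>M)" using assms(1) by (auto intro!: restrict_ext)
 thus ?case using HH_zero by (simp del: restrict_apply)
next
 case (comp i f)
 note f = lin_homD[OF dhom_lin[OF comp(2)]]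
 show ?case using assms(1)
 proof (induction rule: S.graded_induct)
  case zero
  have "(\<lambda>s\<in>I k. \<zero>\<^sub>S \<odot>\<^sub>M f s) = (\<lambda>s\<in>I k. \<zero>\<^sub>M)" using f by (auto intro!: restrict_ext)
  thus ?case using HH_zero by (simp del: restrict_apply)
 next
  case (comp p r)
  show ?case
  proof (cases "p < 0")
   case True
   hence "(\<lambda>s\<in>I k. r \<odot>\<^sub>M f s) = (\<lambda>s\<in>I k. \<zero>\<^sub>M)"
    using f hcomp_neg[of p] comp by (auto intro!: restrict_ext)
   thus ?thesis using HH_zero by (simp del: restrict_apply)
  next
   case False
   thus ?thesis using dhom_smult[OF comp \<open>f \<in> dhom k i M\<close>] \<open>d \<le> i\<close> by (intro HH_dhom[of "p + i"]) (auto simp del: restrict_apply)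
  qed
 next
  case (add r t)
  have "(\<lambda>s\<in>I k. (r \<oplus>\<^sub>S t) \<odot>\<^sub>M f s) = (\<lambda>s\<in>I k. (\<lambda>s\<in>I k. r \<odot>\<^sub>M f s) s \<oplus>\<^sub>M (\<lambda>s\<in>I k. t \<odot>\<^sub>M f s) s)"
   using f add by (auto simp: M.smult_l_distr intro!: restrict_ext)
  thus ?case using HH_add[OF add(3,4)] by (simp del: restrict_apply)
 qed
next
 case (add f g)
 have "(\<lambda>s\<in>I k. r \<odot>\<^sub>M (\<lambda>s\<in>I k. f s \<oplus>\<^sub>M g s) s) = (\<lambda>s\<in>I k. (\<lambda>s\<in>I k. r \<odot>\<^sub>M f s) s \<oplus>\<^sub>M (\<lambda>s\<in>I k. r \<odot>\<^sub>M g s) s)"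
  using lin_homD(1)[OF HH_lin[OF add(1)]] lin_homD(1)[OF HH_lin[OF add(2)]] assms(1)
  by (auto simp: M.smult_r_distr intro!: restrict_ext)
 thus ?case using HH_add[OF add(3,4)] by (simp del: restrict_apply)
qed

lemma HH_restrict:
 assumes "f \<in> carrier (HH k)" "k \<le> l"
 shows "restrict f (I l) \<in> carrier (HH l)"
 using assms(1)
proof (induction rule: HH_induct)
 case zero
 have "restrict (\<lambda>s\<in>I k. \<zero>\<^sub>M) (I l) = (\<lambda>s\<in>I l. \<zero>\<^sub>M)" using I_monoD assms(2) by (auto intro!: restrict_ext)
 thus ?case using HH_zero by (simp del: restrict_apply)
next
 case (comp i f)
 thus ?case using HH_dhom[OF comp(1) dhom_restrict[OF comp(2) assms(2)]] by (simp del: restrict_apply)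
next
 case (add f g)
 have "restrict (\<lambda>s\<in>I k. f s \<oplus>\<^sub>M g s) (I l) = (\<lambda>s\<in>I l. restrict f (I l) s \<oplus>\<^sub>M restrict g (I l) s)"
  using I_monoD assms(2) by (auto intro!: restrict_ext)
 thus ?case using HH_add[OF add(3,4)] by (simp del: restrict_apply)
qed

lemma module_HH: "module S (HH k)"
proof (rule moduleI)
 show "cring S" by (rule S.R.is_cring)
 show "abelian_group (HH k)"
 proof (rule abelian_groupI)
  show "\<zero>\<^bsub>HH k\<^esub> \<oplus>\<^bsub>HH k\<^esub> f = f" if "f \<in> carrier (HH k)" for f
  proof -
   have f: "f \<in> lin k" using that by (rule HH_lin)
   show ?thesis by (rule extensionalityI[where A = "I k"]) (use lin_homD[OF f] in auto)
  qed
  show "\<exists>g\<in>carrier (HH k). g \<oplus>\<^bsub>HH k\<^esub> f = \<zero>\<^bsub>HH k\<^esub>" if "f \<in> carrier (HH k)" for f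
   using that HH_smult[of "\<ominus>\<^sub>S \<one>\<^sub>S" f k] lin_homD(1)[OF HH_lin[OF that]]
   by (intro bexI[of _ "\<lambda>s\<in>I k. (\<ominus>\<^sub>S \<one>\<^sub>S) \<odot>\<^sub>M f s"])
    (auto simp: M.smult_l_minus M.M.l_neg intro!: restrict_ext)
 qed (auto simp: HH_zero HH_add lin_homD[OF HH_lin] M.M.a_ac intro!: restrict_ext lin_eqI[where k = k] HH_lin)
qed (auto simp: HH_smult HH_add HH_zero lin_homD[OF HH_lin] M.smult_r_distr M.smult_l_distr M.smult_assoc1
  intro!: restrict_ext lin_eqI[where k = k] HH_lin)

section \<open>Germs and the module structure of the limit\<close>

lemma trans_iter_hom: "f \<in> extensional (I k) \<Longrightarrow> trans_iter hom_trans k j f = restrict f (I (k + j))"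
proof (induction j)
 case 0
 thus ?case by (simp add: extensional_restrict)
next
 case (Suc j)
 thus ?case using I_monoD[of _ "Suc (k + j)" "k + j"] by (auto simp: hom_trans_def intro!: restrict_ext)
qed

text \<open>Equality under iterated transition maps is agreement on a common \<open>I j\<close>; the
  requirement that \<open>j\<close> exceed both levels is met by enlarging \<open>j\<close>.\<close>

lemma mem_cls_iff:
 assumes "f \<in> carrier (HH k)"
 shows "(l, g) \<in> cls k f \<longleftrightarrow> g \<in> carrier (HH l) \<and> (\<exists>j. \<forall>s\<in>I j. f s = g s)"
proof (cases "g \<in> carrier (HH l)")
 case g: True
 note ext = lin_homD(4)[OF HH_lin[OF assms]] lin_homD(4)[OF HH_lin[OF g]]
 have "(l, g) \<in> cls k f \<longleftrightarrow> (\<exists>j. k \<le> j \<and> l \<le> j \<and> restrict f (I j) = restrict g (I j))"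
  using g by (auto simp: germ_def lim_class_def trans_iter_hom[OF ext(1)] trans_iter_hom[OF ext(2)])
 also have "\<dots> \<longleftrightarrow> (\<exists>j. \<forall>s\<in>I j. f s = g s)"
 proof
  assume "\<exists>j. k \<le> j \<and> l \<le> j \<and> restrict f (I j) = restrict g (I j)"
  then obtain j where "restrict f (I j) = restrict g (I j)" by blast
  hence "\<forall>s\<in>I j. f s = g s" by (metis restrict_apply')
  thus "\<exists>j. \<forall>s\<in>I j. f s = g s" ..
 next
  assume "\<exists>j. \<forall>s\<in>I j. f s = g s"
  then obtain j where j: "\<forall>s\<in>I j. f s = g s" ..
  have "restrict f (I (j + k + l)) = restrict g (I (j + k + l))"
   using j I_monoD[of _ "j + k + l" j] by (intro restrict_ext) simp
  thus "\<exists>j. k \<le> j \<and> l \<le> j \<and> restrict f (I j) = restrict g (I j)" by (intro exI[of _ "j + k + l"]) simp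
 qed
 finally show ?thesis using g by simp
qed (simp add: germ_def lim_class_def)

lemma common_power:
 assumes "\<exists>j. \<forall>s\<in>I j. P s" "\<exists>j. \<forall>s\<in>I j. Q s"
 shows "\<exists>j. \<forall>s\<in>I j. P s \<and> Q s"
proof -
 obtain i j where "\<forall>s\<in>I i. P s" "\<forall>s\<in>I j. Q s" using assms by blast
 hence "\<forall>s\<in>I (i + j). P s \<and> Q s" using I_monoD[of _ "i + j"] by simp
 thus ?thesis ..
qed

lemma cls_eq_iff:
 assumes "f \<in> carrier (HH k)" "g \<in> carrier (HH l)"
 shows "cls k f = cls l g \<longleftrightarrow> (\<exists>j. \<forall>s\<in>I j. f s = g s)"
proof
 assume "cls k f = cls l g"
 hence "(k, f) \<in> cls l g" using mem_cls_iff[OF assms(1), of k f] assms(1) by simp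
 thus "\<exists>j. \<forall>s\<in>I j. f s = g s" using mem_cls_iff[OF assms(2), of k f] by (metis (no_types, lifting))
next
 assume fg: "\<exists>j. \<forall>s\<in>I j. f s = g s"
 have "(m, h) \<in> cls k f \<longleftrightarrow> (m, h) \<in> cls l g" for m h
 proof
  assume "(m, h) \<in> cls k f"
  hence "h \<in> carrier (HH m)" "\<exists>j. \<forall>s\<in>I j. f s = h s" using mem_cls_iff[OF assms(1)] by simp_all
  moreover from common_power[OF fg this(2)] have "\<exists>j. \<forall>s\<in>I j. g s = h s" by metis
  ultimately show "(m, h) \<in> cls l g" using mem_cls_iff[OF assms(2)] by simp
 next
  assume "(m, h) \<in> cls l g"
  hence "h \<in> carrier (HH m)" "\<exists>j. \<forall>s\<in>I j. g s = h s" using mem_cls_iff[OF assms(2)] by simp_all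
  moreover from common_power[OF fg this(2)] have "\<exists>j. \<forall>s\<in>I j. f s = h s" by metis
  ultimately show "(m, h) \<in> cls k f" using mem_cls_iff[OF assms(1)] by simp
 qed
 thus "cls k f = cls l g" by auto
qed

lemma cls_self: "f \<in> carrier (HH k) \<Longrightarrow> (k, f) \<in> cls k f"
 by (simp add: mem_cls_iff)

lemma cls_restrict: "f \<in> carrier (HH k) \<Longrightarrow> k \<le> l \<Longrightarrow> cls k f = cls l (restrict f (I l))"
 using HH_restrict by (subst cls_eq_iff) (auto intro: exI[of _ l])

lemma carrier_DD: "carrier DD = {cls k f | k f. f \<in> carrier (HH k)}"
 by (simp add: hom_lim_def direct_limit_def germ_def)

lemma cls_DD: "f \<in> carrier (HH k) \<Longrightarrow> cls k f \<in> carrier DD"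
 unfolding carrier_DD by blast

lemma DD_cases:
 assumes "U \<in> carrier DD"
 obtains k f where "f \<in> carrier (HH k)" "U = cls k f"
 using assms unfolding carrier_DD by blast

text \<open>Filteredness of the system: identities between finitely many germs can be checked in one
  module of homomorphisms.\<close>

lemma DD_level:
 assumes "finite A" "A \<subseteq> carrier DD"
 shows "\<exists>k. \<forall>U\<in>A. \<exists>f\<in>carrier (HH k). U = cls k f"
 using assms
proof (induction A)
 case (insert U A)
 then obtain k where k: "\<And>V. V \<in> A \<Longrightarrow> \<exists>f\<in>carrier (HH k). V = cls k f" by auto
 obtain l f where lf: "f \<in> carrier (HH l)" "U = cls l f" using insert(4) by (auto elim: DD_cases)
 have "\<exists>g\<in>carrier (HH (max k l)). V = cls (max k l) g" if "V \<in> insert U A" for V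
 proof (cases "V = U")
  case True
  thus ?thesis using lf HH_restrict[OF lf(1), of "max k l"] cls_restrict[OF lf(1), of "max k l"] by auto
 next
  case False
  hence "V \<in> A" using that by simp
  from k[OF this] obtain h where "h \<in> carrier (HH k)" "V = cls k h" by blast
  thus ?thesis using HH_restrict[of h k "max k l"] cls_restrict[of h k "max k l"] by auto
 qed
 thus ?case by blast
qed simp

text \<open>The operations of \<open>direct_limit\<close> are unions over all representatives; each
  is computed by showing that every member of the union is the same class.\<close>

lemma Union_constant: "\<exists>x. P x \<Longrightarrow> (\<And>x. P x \<Longrightarrow> F x = c) \<Longrightarrow> \<Union>{F x | x. P x} = c"
 by auto

lemma DD_add:
 assumes "f \<in> carrier (HH k)" "g \<in> carrier (HH k)"
 shows "cls k f \<oplus>\<^sub>DD cls k g = cls k (\<lambda>s\<in>I k. f s \<oplus>\<^sub>M g s)"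
proof -
 have "cls k f \<oplus>\<^sub>DD cls k g = \<Union>{cls (fst t) (\<lambda>s\<in>I (fst t). fst (snd t) s \<oplus>\<^sub>M snd (snd t) s) |t.
   (fst t, fst (snd t)) \<in> cls k f \<and> (fst t, snd (snd t)) \<in> cls k g}"
  by (simp add: hom_lim_def direct_limit_def germ_def)
 also have "\<dots> = cls k (\<lambda>s\<in>I k. f s \<oplus>\<^sub>M g s)"
 proof (rule Union_constant)
  show "\<exists>t. (fst t, fst (snd t)) \<in> cls k f \<and> (fst t, snd (snd t)) \<in> cls k g"
   using cls_self[OF assms(1)] cls_self[OF assms(2)] by (intro exI[of _ "(k, f, g)"]) simp
 next
  fix t assume t: "(fst t, fst (snd t)) \<in> cls k f \<and> (fst t, snd (snd t)) \<in> cls k g"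
  obtain l f' g' where [simp]: "t = (l, f', g')" by (metis prod_cases3)
  have *: "f' \<in> carrier (HH l)" "g' \<in> carrier (HH l)" "\<exists>j. \<forall>s\<in>I j. f s = f' s" "\<exists>j. \<forall>s\<in>I j. g s = g' s"
   using t mem_cls_iff[OF assms(1)] mem_cls_iff[OF assms(2)] by simp_all
  obtain j where "\<forall>s\<in>I j. f s = f' s \<and> g s = g' s" using common_power[OF *(3,4)] ..
  hence "\<forall>s\<in>I (j + k + l). (\<lambda>s\<in>I l. f' s \<oplus>\<^sub>M g' s) s = (\<lambda>s\<in>I k. f s \<oplus>\<^sub>M g s) s"
   using I_monoD[of _ "j + k + l"] by simp
  hence "\<exists>j. \<forall>s\<in>I j. (\<lambda>s\<in>I l. f' s \<oplus>\<^sub>M g' s) s = (\<lambda>s\<in>I k. f s \<oplus>\<^sub>M g s) s" ..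
  thus "cls (fst t) (\<lambda>s\<in>I (fst t). fst (snd t) s \<oplus>\<^sub>M snd (snd t) s) = cls k (\<lambda>s\<in>I k. f s \<oplus>\<^sub>M g s)"
   using cls_eq_iff[OF HH_add[OF *(1,2)] HH_add[OF assms]] by (simp del: restrict_apply)
 qed
 finally show ?thesis .
qed

lemma DD_smult:
 assumes "f \<in> carrier (HH k)" "r \<in> carrier S"
 shows "r \<odot>\<^sub>DD cls k f = cls k (\<lambda>s\<in>I k. r \<odot>\<^sub>M f s)"
proof -
 have "r \<odot>\<^sub>DD cls k f = \<Union>{cls (fst t) (\<lambda>s\<in>I (fst t). r \<odot>\<^sub>M snd t s) |t. t \<in> cls k f}"
  by (simp add: hom_lim_def direct_limit_def germ_def)
 also have "\<dots> = cls k (\<lambda>s\<in>I k. r \<odot>\<^sub>M f s)"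
 proof (rule Union_constant)
  show "\<exists>t. t \<in> cls k f" using cls_self[OF assms(1)] ..
 next
  fix t assume t: "t \<in> cls k f"
  obtain l f' where [simp]: "t = (l, f')" by (metis surj_pair)
  have *: "f' \<in> carrier (HH l)" "\<exists>j. \<forall>s\<in>I j. f s = f' s"
   using t mem_cls_iff[OF assms(1)] by simp_all
  obtain j where "\<forall>s\<in>I j. f s = f' s" using *(2) ..
  hence "\<forall>s\<in>I (j + k + l). (\<lambda>s\<in>I l. r \<odot>\<^sub>M f' s) s = (\<lambda>s\<in>I k. r \<odot>\<^sub>M f s) s"
   using I_monoD[of _ "j + k + l"] by simp
  hence "\<exists>j. \<forall>s\<in>I j. (\<lambda>s\<in>I l. r \<odot>\<^sub>M f' s) s = (\<lambda>s\<in>I k. r \<odot>\<^sub>M f s) s" ..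
  thus "cls (fst t) (\<lambda>s\<in>I (fst t). r \<odot>\<^sub>M snd t s) = cls k (\<lambda>s\<in>I k. r \<odot>\<^sub>M f s)"
   using cls_eq_iff[OF HH_smult[OF assms(2) *(1)] HH_smult[OF assms(2,1)]] by (simp del: restrict_apply)
 qed
 finally show ?thesis .
qed

lemma DD_zero: "\<zero>\<^sub>DD = cls k (\<lambda>s\<in>I k. \<zero>\<^sub>M)"
proof -
 have "\<zero>\<^sub>DD = cls 0 (\<lambda>s\<in>I 0. \<zero>\<^sub>M)" by (simp add: hom_lim_def direct_limit_def germ_def)
 also have "\<dots> = cls k (\<lambda>s\<in>I k. \<zero>\<^sub>M)"
  using I_monoD[of _ k 0] by (subst cls_eq_iff[OF HH_zero HH_zero]) (intro exI[of _ k], simp)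
 finally show ?thesis .
qed

lemma cls_zero_iff: "f \<in> carrier (HH k) \<Longrightarrow> cls k f = \<zero>\<^sub>DD \<longleftrightarrow> (\<exists>j. \<forall>s\<in>I j. f s = \<zero>\<^sub>M)"
proof -
 assume f: "f \<in> carrier (HH k)"
 have "(\<exists>j. \<forall>s\<in>I j. f s = (\<lambda>s\<in>I 0. \<zero>\<^sub>M) s) \<longleftrightarrow> (\<exists>j. \<forall>s\<in>I j. f s = \<zero>\<^sub>M)"
  using I_monoD[of _ _ 0] by simp
 thus ?thesis unfolding DD_zero[of 0] using cls_eq_iff[OF f HH_zero[of 0]] by simp
qed

lemma hcomp_DD: "hcomp DD i = {cls k f | k f. f \<in> hcomp (HH k) i}"
 by (simp add: hom_lim_def direct_limit_def germ_def)

lemma module_DD: "module S DD"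
proof -
 interpret HH: module S "HH k" for k by (rule module_HH)
 have two: "\<exists>k. \<exists>f\<in>carrier (HH k). \<exists>g\<in>carrier (HH k). U = cls k f \<and> V = cls k g"
  if "U \<in> carrier DD" "V \<in> carrier DD" for U V
  using DD_level[of "{U, V}"] that by auto
 have three: "\<exists>k. \<exists>f\<in>carrier (HH k). \<exists>g\<in>carrier (HH k). \<exists>h\<in>carrier (HH k). U = cls k f \<and> V = cls k g \<and> W = cls k h"
  if "U \<in> carrier DD" "V \<in> carrier DD" "W \<in> carrier DD" for U V W
  using DD_level[of "{U, V, W}"] that by auto
 have add: "cls k f \<oplus>\<^sub>DD cls k g = cls k (f \<oplus>\<^bsub>HH k\<^esub> g)" if "f \<in> carrier (HH k)" "g \<in> carrier (HH k)" for k f g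
  using DD_add[OF that] by simp
 have smult: "r \<odot>\<^sub>DD cls k f = cls k (r \<odot>\<^bsub>HH k\<^esub> f)" if "f \<in> carrier (HH k)" "r \<in> carrier S" for k f r
  using DD_smult[OF that] by simp
 have zero: "\<zero>\<^sub>DD = cls k \<zero>\<^bsub>HH k\<^esub>" for k using DD_zero by simp
 note [simp del] = HH_simps and [simp] = add smult cls_DD
 show ?thesis
 proof (rule moduleI)
  show "cring S" by (rule S.R.is_cring)
  show "abelian_group DD"
  proof (rule abelian_groupI)
   show "U \<oplus>\<^sub>DD V \<in> carrier DD" if "U \<in> carrier DD" "V \<in> carrier DD" for U V
    using two[OF that] by auto
   show "\<zero>\<^sub>DD \<in> carrier DD" using zero[of 0] by simp
   show "U \<oplus>\<^sub>DD V \<oplus>\<^sub>DD W = U \<oplus>\<^sub>DD (V \<oplus>\<^sub>DD W)"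
    if "U \<in> carrier DD" "V \<in> carrier DD" "W \<in> carrier DD" for U V W
    using three[OF that] by (auto simp: HH.M.a_assoc)
   show "U \<oplus>\<^sub>DD V = V \<oplus>\<^sub>DD U" if "U \<in> carrier DD" "V \<in> carrier DD" for U V
    using two[OF that] by (auto simp: HH.M.a_comm)
   show "\<zero>\<^sub>DD \<oplus>\<^sub>DD U = U" if U: "U \<in> carrier DD" for U
   proof -
    obtain k f where f: "f \<in> carrier (HH k)" "U = cls k f" using U by (rule DD_cases)
    thus ?thesis unfolding zero[of k] f(2) by simp
   qed
   show "\<exists>V\<in>carrier DD. V \<oplus>\<^sub>DD U = \<zero>\<^sub>DD" if U: "U \<in> carrier DD" for U
   proof -
    obtain k f where f: "f \<in> carrier (HH k)" "U = cls k f" using U by (rule DD_cases)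
    thus ?thesis unfolding zero[of k] f(2) by (intro bexI[of _ "cls k (\<ominus>\<^bsub>HH k\<^esub> f)"]) (simp_all add: HH.M.l_neg)
   qed
  qed
  show "r \<odot>\<^sub>DD U \<in> carrier DD" if "r \<in> carrier S" "U \<in> carrier DD" for r U
   using that(1) by (auto intro: DD_cases[OF that(2)])
  show "(r \<oplus>\<^sub>S t) \<odot>\<^sub>DD U = r \<odot>\<^sub>DD U \<oplus>\<^sub>DD t \<odot>\<^sub>DD U"
   if "r \<in> carrier S" "t \<in> carrier S" "U \<in> carrier DD" for r t U
   using that(1,2) by (auto intro: DD_cases[OF that(3)] simp: HH.smult_l_distr)
  show "r \<odot>\<^sub>DD (U \<oplus>\<^sub>DD V) = r \<odot>\<^sub>DD U \<oplus>\<^sub>DD r \<odot>\<^sub>DD V"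
   if "r \<in> carrier S" "U \<in> carrier DD" "V \<in> carrier DD" for r U V
   using two[OF that(2,3)] that(1) by (auto simp: HH.smult_r_distr)
  show "r \<otimes>\<^sub>S t \<odot>\<^sub>DD U = r \<odot>\<^sub>DD (t \<odot>\<^sub>DD U)"
   if "r \<in> carrier S" "t \<in> carrier S" "U \<in> carrier DD" for r t U
   using that(1,2) by (auto intro: DD_cases[OF that(3)] simp: HH.smult_assoc1)
  show "\<one>\<^sub>S \<odot>\<^sub>DD U = U" if "U \<in> carrier DD" for U
   by (auto intro: DD_cases[OF that])
 qed
qed

end

lemma common_level:
 assumes "finite F" "\<And>i. i \<in> F \<Longrightarrow> \<exists>k :: nat. P i k" "\<And>i k l. P i k \<Longrightarrow> k \<le> l \<Longrightarrow> P i l"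
 shows "\<exists>k. \<forall>i\<in>F. P i k"
 using assms(1,2)
proof (induction F)
 case (insert i F)
 then obtain k l where "\<forall>i\<in>F. P i k" "P i l" by (metis insertCI)
 hence "\<forall>i\<in>insert i F. P i (max k l)" using assms(3) by (metis insertE max.cobounded1 max.cobounded2)
 thus ?case ..
qed simp

context hom_limit begin

lemma hcomp_DD_iff:
 "U \<in> hcomp DD i \<longleftrightarrow> (if d \<le> i then \<exists>k f. f \<in> dhom k i M \<and> U = cls k f else U = \<zero>\<^sub>DD)"
 unfolding hcomp_DD using DD_zero by (auto simp del: restrict_apply)

lemma pregraded_DD: "pregraded DD"
proof (rule pregraded.intro)
 interpret DD: module S DD by (rule module_DD)
 show "abelian_group DD" by (rule DD.M.abelian_group_axioms)
 have sub: "U \<in> hcomp DD i \<Longrightarrow> U \<in> carrier DD" for U i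
  using cls_DD HH_dhom by (auto simp: hcomp_DD_iff split: if_splits)
 have zero: "\<zero>\<^sub>DD \<in> hcomp DD i" for i
 proof -
  have "\<exists>k f. f \<in> dhom k i M \<and> \<zero>\<^sub>DD = cls k f" using dhom_zero[of 0 i] DD_zero[of 0] by blast
  thus ?thesis unfolding hcomp_DD_iff by simp
 qed
 have neg: "\<ominus>\<^sub>DD U \<in> hcomp DD i" if "U \<in> hcomp DD i" for U i
 proof (cases "d \<le> i")
  case True
  then obtain k f where f: "f \<in> dhom k i M" "U = cls k f" using \<open>U \<in> hcomp DD i\<close> unfolding hcomp_DD_iff by auto
  interpret IH: pregraded "IH k" by (rule pregraded_IH)
  have g: "\<ominus>\<^bsub>IH k\<^esub> f \<in> dhom k i M" using IH.hcompD(4)[of f i] f(1) by simp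
  have "(\<ominus>\<^bsub>IH k\<^esub> f) \<oplus>\<^bsub>IH k\<^esub> f = \<zero>\<^bsub>IH k\<^esub>" using IH.l_neg dhom_lin[OF f(1)] by (simp del: IH_simps add: IH_simps(1))
  hence "cls k (\<ominus>\<^bsub>IH k\<^esub> f) \<oplus>\<^sub>DD U = \<zero>\<^sub>DD"
   unfolding f(2) using DD_add[OF HH_dhom[OF True g] HH_dhom[OF True f(1)]] DD_zero[of k] by (simp del: restrict_apply)
  hence "\<ominus>\<^sub>DD U = cls k (\<ominus>\<^bsub>IH k\<^esub> f)"
   using DD.M.minus_equality sub[OF that] cls_DD[OF HH_dhom[OF True g]] by blast
  thus ?thesis unfolding hcomp_DD_iff using True g by auto
 next
  case False
  hence "U = \<zero>\<^sub>DD" using that unfolding hcomp_DD_iff by auto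
  thus ?thesis using zero by simp
 qed
 have add: "U \<oplus>\<^sub>DD V \<in> hcomp DD i" if "U \<in> hcomp DD i" "V \<in> hcomp DD i" for U V i
 proof (cases "d \<le> i")
  case True
  then obtain k f l g where fg: "f \<in> dhom k i M" "U = cls k f" "g \<in> dhom l i M" "V = cls l g"
   using \<open>U \<in> hcomp DD i\<close> \<open>V \<in> hcomp DD i\<close> unfolding hcomp_DD_iff by auto
  define m where "m = k + l"
  have *: "restrict f (I m) \<in> dhom m i M" "restrict g (I m) \<in> dhom m i M"
   using dhom_restrict fg unfolding m_def by auto
  have "U = cls m (restrict f (I m))" "V = cls m (restrict g (I m))"
   using cls_restrict HH_dhom[OF True] fg unfolding m_def by auto
  hence "U \<oplus>\<^sub>DD V = cls m (\<lambda>s\<in>I m. restrict f (I m) s \<oplus>\<^sub>M restrict g (I m) s)"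
   using DD_add[OF HH_dhom[OF True *(1)] HH_dhom[OF True *(2)]] by (simp del: restrict_apply)
  thus ?thesis unfolding hcomp_DD_iff using True dhom_add[OF *] by auto
 next
  case False
  hence "U = \<zero>\<^sub>DD" "V = \<zero>\<^sub>DD" using that unfolding hcomp_DD_iff by auto
  thus ?thesis using zero by simp
 qed
 have "subgroup (hcomp DD i) (add_monoid DD)" for i
 proof (rule DD.M.add.subgroupI)
  show "hcomp DD i \<noteq> {}" using zero by blast
 qed (use sub neg add in \<open>auto simp: a_inv_def[symmetric]\<close>)
 thus "pregraded_axioms DD" by (intro pregraded_axioms.intro)
qed

text \<open>For directness, finitely many homogeneous germs are brought to one level and evaluated
  at a homogeneous \<open>s\<close> of degree \<open>p\<close>. The i-th value has degree
  \<open>i + p\<close>, so the values of a vanishing sum vanish separately.\<close>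

lemma graded_DD: "graded_module S DD"
proof (rule graded_moduleI)
 interpret DD: module S DD by (rule module_DD)
 interpret DD: pregraded DD by (rule pregraded_DD)
 show "module S DD" by (rule module_DD)
 show "subgroup (hcomp DD i) (add_monoid DD)" for i by (rule DD.hcomp_sub)
 show "carrier DD \<subseteq> hspan DD UNIV"
 proof
  fix U assume "U \<in> carrier DD"
  then obtain k f where f: "f \<in> carrier (HH k)" "U = cls k f" by (rule DD_cases)
  have "cls k f \<in> hspan DD UNIV" using f(1)
  proof (induction rule: HH_induct)
   case zero
   thus ?case using DD.zero_hspan DD_zero[of k] by (simp del: restrict_apply)
  next
   case (comp i f)
   have "cls k f \<in> hcomp DD i" unfolding hcomp_DD_iff using comp by auto
   thus ?case by (rule DD.hcomp_hspan[OF UNIV_I])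
  next
   case (add f g)
   thus ?case using DD.hspan_add[OF add(3,4)] DD_add[OF add(1,2)] by (simp del: restrict_apply)
  qed
  thus "U \<in> hspan DD UNIV" using f(2) by simp
 qed
 show "r \<odot>\<^sub>DD U \<in> hcomp DD (p + i)" if r: "r \<in> hcomp S p" and U: "U \<in> hcomp DD i" for p i r U
 proof -
  have rc: "r \<in> carrier S" by (rule S.G.hcompD(1)[OF r])
  consider "d \<le> i" "0 \<le> p" | "\<not> d \<le> i" | "p < 0" by linarith
  thus ?thesis
  proof cases
   case 1
   then obtain k f where f: "f \<in> dhom k i M" "U = cls k f" using U unfolding hcomp_DD_iff by auto
   have "r \<odot>\<^sub>DD U = cls k (\<lambda>s\<in>I k. r \<odot>\<^sub>M f s)" unfolding f(2) by (rule DD_smult[OF HH_dhom[OF 1(1) f(1)] rc])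
   thus ?thesis unfolding hcomp_DD_iff using dhom_smult[OF r f(1)] 1 by auto
  next
   case 2
   hence "U = \<zero>\<^sub>DD" using U unfolding hcomp_DD_iff by auto
   thus ?thesis using DD.hcompD(2) rc by simp
  next
   case 3
   hence "r = \<zero>\<^sub>S" using hcomp_neg r by blast
   thus ?thesis using DD.hcompD(1)[OF U] DD.hcompD(2) by simp
  qed
 qed
 fix F U
 assume F: "finite F" and U: "\<And>i. i \<in> F \<Longrightarrow> U i \<in> hcomp DD i" and sum: "(\<Oplus>\<^sub>DD i\<in>F. U i) = \<zero>\<^sub>DD"
 have "\<exists>k. \<forall>i\<in>F. \<exists>f\<in>dhom k i M. f \<in> carrier (HH k) \<and> U i = cls k f"
 proof (rule common_level[OF F])
  fix i assume "i \<in> F"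
  show "\<exists>k. \<exists>f\<in>dhom k i M. f \<in> carrier (HH k) \<and> U i = cls k f"
  proof (cases "d \<le> i")
   case True
   thus ?thesis using U[OF \<open>i \<in> F\<close>] HH_dhom[OF True] unfolding hcomp_DD_iff by auto
  next
   case False
   hence "U i = \<zero>\<^sub>DD" using U[OF \<open>i \<in> F\<close>] unfolding hcomp_DD_iff by simp
   thus ?thesis using dhom_zero HH_zero DD_zero by metis
  qed
 next
  fix i k l assume "\<exists>f\<in>dhom k i M. f \<in> carrier (HH k) \<and> U i = cls k f" "k \<le> l"
  thus "\<exists>f\<in>dhom l i M. f \<in> carrier (HH l) \<and> U i = cls l f"
   using dhom_restrict HH_restrict cls_restrict by metis
 qed
 then obtain k where "\<forall>i\<in>F. \<exists>f\<in>dhom k i M. f \<in> carrier (HH k) \<and> U i = cls k f" ..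
 then obtain f where f: "\<And>i. i \<in> F \<Longrightarrow> f i \<in> dhom k i M" "\<And>i. i \<in> F \<Longrightarrow> f i \<in> carrier (HH k)"
   "\<And>i. i \<in> F \<Longrightarrow> U i = cls k (f i)" by metis
 interpret HH: module S "HH k" by (rule module_HH)
 define g where "g = (\<Oplus>\<^bsub>HH k\<^esub>i\<in>F. f i)"
 have g: "g \<in> carrier (HH k)" unfolding g_def using f(2) by (intro HH.M.finsum_closed) auto
 have "cls k g = (\<Oplus>\<^sub>DD i\<in>F. cls k (f i))" unfolding g_def
  using cls_DD DD_add f(2) by (intro hom_finsum[OF HH.M.abelian_group_axioms DD.M.abelian_group_axioms]) (auto simp del: restrict_apply)
 also have "\<dots> = \<zero>\<^sub>DD" unfolding sum[symmetric]
  using f(3) cls_DD[OF f(2)] by (intro DD.M.finsum_cong') auto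
 finally obtain j where j: "\<forall>s\<in>I j. g s = \<zero>\<^sub>M" using cls_zero_iff[OF g] by auto
 have ev: "g s = (\<Oplus>\<^sub>M i\<in>F. f i s)" if "s \<in> I k" for s unfolding g_def
  using that lin_homD(1)[OF HH_lin] f(2)
  by (intro hom_finsum[OF HH.M.abelian_group_axioms M.M.abelian_group_axioms, where \<phi> = "\<lambda>h. h s"]) auto
 have "U i = \<zero>\<^sub>DD" if i: "i \<in> F" for i
 proof -
  have "f i s = \<zero>\<^sub>M" if "s \<in> I (j + k)" for s
   using that
  proof (induction rule: I_induct)
   case zero
   have "f i (\<zero>\<^sub>S \<otimes>\<^sub>S \<zero>\<^sub>S) = \<zero>\<^sub>S \<odot>\<^sub>M f i \<zero>\<^sub>S" by (rule lin_homD(3)[OF dhom_lin[OF f(1)[OF i]]]) (auto simp: I_D)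
   thus ?case using lin_homD(1)[OF dhom_lin[OF f(1)[OF i]], of "\<zero>\<^sub>S"] by (simp add: I_D)
  next
   case (comp p s)
   have s: "s \<in> I j" "s \<in> I k" using hcomp_I[of j p] hcomp_I[of k p] comp by auto
   have h: "f i' s \<in> hcomp M (i' + p)" if "i' \<in> F" for i' by (rule dhom_hcomp[OF f(1)[OF that] comp(2) s(2)])
   have hp: "pr M (i + p) (f i' s) = (if i = i' then f i' s else \<zero>\<^sub>M)" and hc: "f i' s \<in> carrier M" if "i' \<in> F" for i'
    using M.pr_homog[OF h[OF that], of "i + p"] M.G.hcompD(1)[OF h[OF that]] by simp_all
   have "(\<Oplus>\<^sub>M i'\<in>F. f i' s) = \<zero>\<^sub>M" using ev[OF s(2)] j s(1) by metis
   \<comment> \<open>Projecting the vanishing sum to degree \<open>i + p\<close> isolates the i-th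
     summand.\<close>
   hence "\<zero>\<^sub>M = pr M (i + p) (\<Oplus>\<^sub>M i'\<in>F. f i' s)" by (metis M.pr_zero)
   also have "\<dots> = (\<Oplus>\<^sub>M i'\<in>F. pr M (i + p) (f i' s))"
    using hc M.pr_add
    by (intro hom_finsum[OF M.M.abelian_group_axioms M.M.abelian_group_axioms]) auto
   also have "\<dots> = (\<Oplus>\<^sub>M i'\<in>F. if i = i' then f i' s else \<zero>\<^sub>M)"
    using hp hc by (intro M.M.finsum_cong') auto
   also have "\<dots> = f i s" using i F hc by (intro M.M.add.finprod_singleton) auto
   finally show ?case by simp
  next
   case (add s t)
   have "s \<in> I k" "t \<in> I k" using add by (auto elim: I_monoD)
   thus ?case using add lin_homD(2)[OF dhom_lin[OF f(1)[OF i]], of s t] by simp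
  qed
  thus ?thesis using f(3)[OF i] cls_zero_iff[OF f(2)[OF i]] by auto
 qed
 thus "\<forall>i\<in>F. U i = \<zero>\<^sub>DD" by blast
qed

section \<open>The unit and its torsion properties\<close>

definition unit_hom :: "nat \<Rightarrow> 'b \<Rightarrow> 'a \<Rightarrow> 'b" where
 "unit_hom k x = (\<lambda>s\<in>I k. s \<odot>\<^sub>M x)"

text \<open>Level \<open>0\<close> suffices, since multiplication by \<open>x\<close> has the same
  germ at all levels by \<open>cls_unit_hom\<close>.\<close>

definition eta :: "'b \<Rightarrow> (nat \<times> ('a \<Rightarrow> 'b)) set" where
 "eta = (\<lambda>x\<in>carrier M. cls 0 (unit_hom 0 x))"

lemma unit_hom_dhom:
 assumes "x \<in> hcomp M i"
 shows "unit_hom k x \<in> dhom k i M"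
proof -
 have "s \<odot>\<^sub>M x \<in> hcomp M (i + j)" if "s \<in> hcomp S j" for s j
  using M.smult_hcomp[OF that assms] by (simp add: add.commute)
 thus ?thesis unfolding dhom_iff unit_hom_def using M.G.hcompD(1)[OF assms]
  by (auto simp: I_D M.smult_l_distr M.smult_assoc1 intro!: lin_homI)
qed

lemma unit_hom_add:
 "x \<in> carrier M \<Longrightarrow> y \<in> carrier M \<Longrightarrow> unit_hom k (x \<oplus>\<^sub>M y) = (\<lambda>s\<in>I k. unit_hom k x s \<oplus>\<^sub>M unit_hom k y s)"
 by (auto simp: unit_hom_def I_D M.smult_r_distr intro!: restrict_ext)

lemma unit_hom_HH: "x \<in> carrier M \<Longrightarrow> unit_hom k x \<in> carrier (HH k)"
proof (induction rule: M.graded_induct)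
 case zero
 have "unit_hom k \<zero>\<^sub>M = (\<lambda>s\<in>I k. \<zero>\<^sub>M)" by (auto simp: unit_hom_def I_D intro!: restrict_ext)
 thus ?case using HH_zero by (simp del: restrict_apply)
next
 case (comp i x)
 show ?case
 proof (cases "d \<le> i")
  case True
  thus ?thesis using unit_hom_dhom[OF comp] by (rule HH_dhom)
 next
  case False
  hence "x = \<zero>\<^sub>M" using gobjD(3)[OF gobj_M, of i] comp by auto
  hence "unit_hom k x = (\<lambda>s\<in>I k. \<zero>\<^sub>M)" by (auto simp: unit_hom_def I_D intro!: restrict_ext)
  thus ?thesis using HH_zero by (simp del: restrict_apply)
 qed
next
 case (add x y)
 thus ?case using HH_add unit_hom_add by (simp del: restrict_apply)
qed

lemma cls_unit_hom: "x \<in> carrier M \<Longrightarrow> cls k (unit_hom k x) = cls 0 (unit_hom 0 x)"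
 using I_monoD[of _ k 0] by (subst cls_eq_iff[OF unit_hom_HH unit_hom_HH]) (auto simp: unit_hom_def intro!: exI[of _ k])

lemma eta_hom: "eta \<in> ghom M DD"
 unfolding eta_def
proof (rule ghom_restrictI)
 show "graded_module S M" by (rule M.graded_module_axioms)
 show "cls 0 (unit_hom 0 x) \<in> carrier DD" if "x \<in> carrier M" for x using that by (intro cls_DD unit_hom_HH)
 show "cls 0 (unit_hom 0 (x \<oplus>\<^sub>M y)) = cls 0 (unit_hom 0 x) \<oplus>\<^sub>DD cls 0 (unit_hom 0 y)"
  if "x \<in> carrier M" "y \<in> carrier M" for x y
  using that by (simp add: DD_add unit_hom_HH unit_hom_add)
 show "cls 0 (unit_hom 0 (r \<odot>\<^sub>M x)) = r \<odot>\<^sub>DD cls 0 (unit_hom 0 x)"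
  if "r \<in> carrier S" "x \<in> carrier M" for r x
 proof -
  have "unit_hom 0 (r \<odot>\<^sub>M x) = (\<lambda>s\<in>I 0. r \<odot>\<^sub>M unit_hom 0 x s)"
   using that by (auto simp: unit_hom_def I_D M.smult_assoc1[symmetric] S.R.m_comm intro!: restrict_ext)
  thus ?thesis using that by (simp add: DD_smult unit_hom_HH)
 qed
 show "cls 0 (unit_hom 0 x) \<in> hcomp DD i" if "x \<in> hcomp M i" for i x
 proof (cases "d \<le> i")
  case True
  thus ?thesis unfolding hcomp_DD_iff using unit_hom_dhom[OF \<open>x \<in> hcomp M i\<close>] by auto
 next
  case False
  hence x: "x = \<zero>\<^sub>M" using gobjD(3)[OF gobj_M, of i] that by auto
  have "cls 0 (unit_hom 0 x) = \<zero>\<^sub>DD"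
   unfolding x using cls_zero_iff[OF unit_hom_HH[OF M.zero_closed], of 0] by (auto simp: unit_hom_def I_D intro!: exI[of _ 0])
  thus ?thesis unfolding hcomp_DD_iff using False by simp
 qed
qed

text \<open>For \<open>t\<close> in \<open>I k\<close>, both \<open>s\<close> times
  \<open>h t\<close> and \<open>t\<close> times \<open>h s\<close> equal \<open>h\<close> at the
  product of \<open>s\<close> and \<open>t\<close>; so the homomorphism \<open>s h\<close> is
  multiplication by \<open>h s\<close>. The realization clause and the torsion properties of the
  limit rest on this identity.\<close>

lemma smult_cls:
 assumes h: "h \<in> carrier (HH k)" and s: "s \<in> I k"
 shows "s \<odot>\<^sub>DD cls k h = eta (h s)"
proof -
 note l = lin_homD[OF HH_lin[OF h]]
 have "s \<odot>\<^sub>M h t = t \<odot>\<^sub>M h s" if "t \<in> I k" for t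
  using l(3)[OF I_D(1)[OF s] that] l(3)[OF I_D(1)[OF that] s] S.R.m_comm[OF I_D(1)[OF s] I_D(1)[OF that]] by simp
 hence "\<forall>t\<in>I k. (\<lambda>t\<in>I k. s \<odot>\<^sub>M h t) t = unit_hom 0 (h s) t"
  using I_monoD[of _ k 0] by (simp add: unit_hom_def)
 hence "\<exists>j. \<forall>t\<in>I j. (\<lambda>t\<in>I k. s \<odot>\<^sub>M h t) t = unit_hom 0 (h s) t" ..
 hence "cls k (\<lambda>t\<in>I k. s \<odot>\<^sub>M h t) = cls 0 (unit_hom 0 (h s))"
  unfolding cls_eq_iff[OF HH_smult[OF I_D(1)[OF s] h] unit_hom_HH[OF l(1)[OF s]]] .
 thus ?thesis using DD_smult[OF h I_D(1)[OF s]] l(1)[OF s] by (simp add: eta_def)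
qed

lemma eta_zero_iff: "x \<in> carrier M \<Longrightarrow> eta x = \<zero>\<^sub>DD \<longleftrightarrow> x \<in> torsion M"
 using cls_zero_iff[OF unit_hom_HH, of x 0] I_monoD[of _ _ 0]
 by (simp add: eta_def torsion_over_def unit_hom_def)

text \<open>One power \<open>I L\<close> kills all torsion of \<open>M\<close>, so \<open>h\<close>
  vanishes on the products of elements of \<open>I L\<close> and \<open>I m\<close>, and these
  generate \<open>I (L + m)\<close>.\<close>

lemma vanishing_of_torsion:
 assumes h: "h \<in> lin k" and "k \<le> m" and t: "\<And>u. u \<in> I m \<Longrightarrow> h u \<in> torsion M"
 shows "\<exists>j. \<forall>s\<in>I j. h s = \<zero>\<^sub>M"
proof -
 note l = lin_homD[OF h]
 obtain L where L: "\<forall>x\<in>torsion M. \<forall>s\<in>I L. s \<odot>\<^sub>M x = \<zero>\<^sub>M" using torsion_uniform[OF gobj_M] ..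
 let ?H = "{s \<in> I k. h s = \<zero>\<^sub>M}"
 have h0: "h \<zero>\<^sub>S = \<zero>\<^sub>M" using l(3)[of "\<zero>\<^sub>S" "\<zero>\<^sub>S"] l(1)[of "\<zero>\<^sub>S"] by (simp add: I_D)
 have "sub S ?H"
  by (rule S.opsub_submoduleI) (auto simp: I_D h0 l smult_S)
 hence "I (L + m) \<subseteq> ?H"
 proof (rule I_prod)
  fix s t assume st: "s \<in> I L" "t \<in> I m"
  have tk: "t \<in> I k" by (rule I_monoD[OF st(2) \<open>k \<le> m\<close>])
  have "h (s \<otimes>\<^sub>S t) = s \<odot>\<^sub>M h t" by (rule l(3)[OF I_D(1)[OF st(1)] tk])
  thus "s \<otimes>\<^sub>S t \<in> ?H" using L t[OF st(2)] st(1) I_D(4)[OF I_D(1)[OF st(1)] tk] by simp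
 qed
 thus ?thesis by blast
qed

text \<open>If \<open>I l\<close> kills the germ of \<open>h\<close>, the values of \<open>h\<close>
  on a smaller power are torsion by \<open>smult_cls\<close>, and then \<open>h\<close> is zero on a
  still smaller one.\<close>

lemma torsion_DD: "torsion DD \<subseteq> {\<zero>\<^sub>DD}"
proof
 fix U assume U: "U \<in> torsion DD"
 then obtain l where l: "U \<in> carrier DD" "\<forall>s\<in>I l. s \<odot>\<^sub>DD U = \<zero>\<^sub>DD" unfolding torsion_over_def by blast
 obtain k h where h: "h \<in> carrier (HH k)" "U = cls k h" using l(1) by (rule DD_cases)
 have "\<exists>j. \<forall>s\<in>I j. h s = \<zero>\<^sub>M"
 proof (rule vanishing_of_torsion[OF HH_lin[OF h(1)]])
  show "k \<le> k + l" by simp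
  fix u assume "u \<in> I (k + l)"
  hence u: "u \<in> I k" "u \<in> I l" by (auto elim: I_monoD)
  have "eta (h u) = \<zero>\<^sub>DD" using smult_cls[OF h(1) u(1)] l(2) u(2) h(2) by simp
  thus "h u \<in> torsion M" using eta_zero_iff lin_homD(1)[OF HH_lin[OF h(1)] u(1)] by blast
 qed
 thus "U \<in> {\<zero>\<^sub>DD}" using cls_zero_iff[OF h(1)] h(2) by simp
qed

lemma coker_eta: "carrier DD \<subseteq> torsion_over DD (eta ` carrier M)"
proof
 fix U assume U: "U \<in> carrier DD"
 then obtain k h where h: "h \<in> carrier (HH k)" "U = cls k h" by (rule DD_cases)
 have "\<forall>s\<in>I k. s \<odot>\<^sub>DD U \<in> eta ` carrier M"
  using smult_cls[OF h(1)] lin_homD(1)[OF HH_lin[OF h(1)]] h(2) by simp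
 thus "U \<in> torsion_over DD (eta ` carrier M)" unfolding torsion_over_def using U by blast
qed

lemma envelope_DD:
 assumes "fin_gen (carrier S) DD (carrier DD)"
 shows "envelope d M DD eta"
 unfolding envelope_def
proof (intro conjI allI impI ballI)
 show "gobj d DD" unfolding gobj_def using graded_DD assms hcomp_DD_iff by auto
 show "\<exists>u\<in>hcomp DD i. \<forall>s\<in>I k. s \<odot>\<^sub>DD u = eta (\<psi> s)" if "d \<le> i" "\<psi> \<in> dhom k i M" for k i \<psi>
  using smult_cls[OF HH_dhom[OF that]] that hcomp_DD_iff by (intro bexI[of _ "cls k \<psi>"]) auto
 show "x \<in> torsion M" if "x \<in> carrier M" "eta x = \<zero>\<^sub>DD" for x using that eta_zero_iff by blast
qed (rule gobj_M eta_hom torsion_DD coker_eta)+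

end

section \<open>Finite generation of the limit\<close>

text \<open>The extension argument for chains, along a linear relation instead of a homomorphism: a
  chain is controlled by its image in \<open>H\<close> and its trace on the elements related to
  zero. In the application the partner \<open>y\<close> of \<open>u\<close> is not determined by
  \<open>u\<close>.\<close>

lemma acc_linear_relation:
 assumes G: "abelian_group G" and H: "abelian_group H"
  and "acc K H (carrier H)" and "acc K G {u \<in> N. \<rho> u \<zero>\<^sub>H}" and N: "opsub K G N"
  and zero: "\<rho> \<zero>\<^sub>G \<zero>\<^sub>H"
  and add: "\<And>u u' y y'. \<rho> u y \<Longrightarrow> \<rho> u' y' \<Longrightarrow> \<rho> (u \<oplus>\<^sub>G u') (y \<oplus>\<^sub>H y')"
  and neg: "\<And>u y. \<rho> u y \<Longrightarrow> \<rho> (\<ominus>\<^sub>G u) (\<ominus>\<^sub>H y)"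
  and smult: "\<And>r u y. r \<in> K \<Longrightarrow> \<rho> u y \<Longrightarrow> \<rho> (r \<odot>\<^sub>G u) (r \<odot>\<^sub>H y)"
  and \<rho>_closed: "\<And>u y. \<rho> u y \<Longrightarrow> y \<in> carrier H"
  and total: "\<And>u. u \<in> N \<Longrightarrow> \<exists>y. \<rho> u y"
  and smult_zero: "\<And>r. r \<in> K \<Longrightarrow> r \<odot>\<^sub>H \<zero>\<^sub>H = \<zero>\<^sub>H"
 shows "acc K G N"
 unfolding acc_def
proof (intro allI impI)
 fix U :: "nat \<Rightarrow> _"
 assume *: "\<forall>i. opsub K G (U i) \<and> U i \<subseteq> N \<and> U i \<subseteq> U (Suc i)"
 hence U: "opsub K G (U i)" "U i \<subseteq> N" "U i \<subseteq> U (Suc i)" for i by auto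
 interpret G: abelian_group G by fact
 interpret H: abelian_group H by fact
 let ?Z = "{u \<in> N. \<rho> u \<zero>\<^sub>H}"
 have Z: "opsub K G ?Z"
  unfolding opsub_def
 proof (intro conjI ballI)
  show "?Z \<subseteq> carrier G" using opsubD(1)[OF N] by blast
  show "\<zero>\<^sub>G \<in> ?Z" using opsubD(2)[OF N] zero by blast
  show "u \<oplus>\<^sub>G v \<in> ?Z" if "u \<in> ?Z" "v \<in> ?Z" for u v
   using that add[of u "\<zero>\<^sub>H" v "\<zero>\<^sub>H"] opsubD(3)[OF N] by simp
  show "\<ominus>\<^sub>G u \<in> ?Z" if "u \<in> ?Z" for u
   using that neg[of u "\<zero>\<^sub>H"] opsubD(4)[OF N] by simp
  show "r \<odot>\<^sub>G u \<in> ?Z" if "r \<in> K" "u \<in> ?Z" for r u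
   using that smult[of r u "\<zero>\<^sub>H"] smult_zero opsubD(5)[OF N] by simp
 qed
 define W where "W i = {y. \<exists>u\<in>U i. \<rho> u y}" for i
 have "opsub K H (W i)" for i
  unfolding opsub_def
 proof (intro conjI ballI)
  show "W i \<subseteq> carrier H" unfolding W_def using \<rho>_closed by blast
  show "\<zero>\<^sub>H \<in> W i" unfolding W_def using zero opsubD(2)[OF U(1)] by blast
  show "x \<oplus>\<^sub>H y \<in> W i" if "x \<in> W i" "y \<in> W i" for x y
   using that add opsubD(3)[OF U(1)] unfolding W_def by blast
  show "\<ominus>\<^sub>H x \<in> W i" if "x \<in> W i" for x using that neg opsubD(4)[OF U(1)] unfolding W_def by blast
  show "r \<odot>\<^sub>H x \<in> W i" if "r \<in> K" "x \<in> W i" for r x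
   using that smult opsubD(5)[OF U(1)] unfolding W_def by blast
 qed
 moreover have "W i \<subseteq> carrier H" "W i \<subseteq> W (Suc i)" for i unfolding W_def using \<rho>_closed U(3) by blast+
 ultimately have "\<exists>k. \<forall>i\<ge>k. W i = W k" by (rule accD[OF assms(3)])
 then obtain k where k: "\<forall>i\<ge>k. W i = W k" ..
 have "\<exists>l. \<forall>i\<ge>l. U i \<inter> ?Z = U l \<inter> ?Z"
 proof (rule accD[OF assms(4)])
  show "opsub K G (U i \<inter> ?Z)" for i by (rule opsub_Int[OF U(1) Z])
  show "U i \<inter> ?Z \<subseteq> ?Z" for i by (rule Int_lower2)
  show "U i \<inter> ?Z \<subseteq> U (Suc i) \<inter> ?Z" for i by (rule Int_mono[OF U(3) order_refl])
 qed
 then obtain l where l: "\<forall>i\<ge>l. U i \<inter> ?Z = U l \<inter> ?Z" ..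
 have "U i = U (k + l)" if i: "i \<ge> k + l" for i
 proof
  show "U (k + l) \<subseteq> U i" by (rule chain_le[of U, OF U(3) i])
  show "U i \<subseteq> U (k + l)"
  proof
   fix u assume u: "u \<in> U i"
   obtain y where y: "\<rho> u y" using total u U(2) by blast
   have "W i = W (k + l)" using k[rule_format, of i] k[rule_format, of "k + l"] i by simp
   moreover have "y \<in> W i" unfolding W_def using u y by blast
   ultimately obtain v where v: "v \<in> U (k + l)" "\<rho> v y" unfolding W_def by blast
   have vi: "v \<in> U i" using chain_le[of U, OF U(3) i] v(1) by blast
   have uv: "u \<in> carrier G" "v \<in> carrier G" using opsubD(7)[OF U(1)] u vi by auto
   \<comment> \<open>Two elements with a common partner differ by an element related to
     zero.\<close>
   have "\<rho> (u \<ominus>\<^sub>G v) \<zero>\<^sub>H" using add[OF y neg[OF v(2)]] \<rho>_closed[OF y] by (simp add: a_minus_def H.r_neg)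
   moreover have "u \<ominus>\<^sub>G v \<in> U i" by (rule opsubD(6)[OF U(1) u vi])
   ultimately have "u \<ominus>\<^sub>G v \<in> U i \<inter> ?Z" using U(2) by blast
   moreover have "U i \<inter> ?Z = U (k + l) \<inter> ?Z" using l[rule_format, of i] l[rule_format, of "k + l"] i by simp
   ultimately have "u \<ominus>\<^sub>G v \<in> U (k + l)" by blast
   from opsubD(3)[OF U(1) v(1) this] show "u \<in> U (k + l)"
    using G.add_minus_cancel[OF uv] by simp
  qed
 qed
 thus "\<exists>k. \<forall>i\<ge>k. U i = U k" by blast
qed

lemma (in abelian_group) neg_diff: "a \<in> carrier G \<Longrightarrow> b \<in> carrier G \<Longrightarrow> \<ominus> (a \<ominus> b) = b \<ominus> a"
 by (simp add: a_minus_def minus_add a_comm)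

lemma (in abelian_group) diff_add_diff:
 "a \<in> carrier G \<Longrightarrow> b \<in> carrier G \<Longrightarrow> c \<in> carrier G \<Longrightarrow> (a \<ominus> (b \<oplus> c)) \<oplus> c = a \<ominus> b"
 by (simp add: a_minus_def minus_add a_assoc l_neg)

lemma (in abelian_group) diff_diff_add:
 "a \<in> carrier G \<Longrightarrow> b \<in> carrier G \<Longrightarrow> c \<in> carrier G \<Longrightarrow> e \<in> carrier G \<Longrightarrow>
  (a \<oplus> b) \<ominus> (c \<oplus> e) = (a \<ominus> c) \<oplus> (b \<ominus> e)"
 by (simp add: a_minus_def minus_add a_ac)

lemma (in module) smult_diff:
 "r \<in> carrier R \<Longrightarrow> x \<in> carrier M \<Longrightarrow> y \<in> carrier M \<Longrightarrow> r \<odot>\<^sub>M (x \<ominus>\<^sub>M y) = (r \<odot>\<^sub>M x) \<ominus>\<^sub>M (r \<odot>\<^sub>M y)"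
 by (simp add: a_minus_def smult_r_distr smult_r_minus)

section \<open>Torsion with respect to single variables\<close>

context standard_graded begin

text \<open>That the ring unit has degree zero is no axiom of \<open>graded_module\<close>. It
  follows because its component of degree zero acts as identity on all homogeneous elements.\<close>

lemma one_hcomp: "\<one>\<^sub>S \<in> hcomp S 0"
proof -
 have "s \<otimes>\<^sub>S pr S 0 \<one>\<^sub>S = s" if "s \<in> carrier S" for s
  using that
 proof (induction rule: S.graded_induct)
  case (comp i s)
  have s: "s \<in> carrier S" by (rule S.G.hcompD(1)[OF comp])
  show ?case using S.pr_smult[OF comp s S.R.one_closed, of i] s by (simp add: smult_S S.pr_homog[OF comp])
 qed (simp_all add: S.R.l_distr)
 from this[of "\<one>\<^sub>S"] show ?thesis using S.pr(1)[OF S.R.one_closed, of 0] by simp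
qed

lemma pow_hcomp: "v \<in> hcomp S 1 \<Longrightarrow> v [^]\<^sub>S (r :: nat) \<in> hcomp S (int r)"
proof (induction r)
 case 0
 thus ?case using one_hcomp by simp
next
 case (Suc r)
 thus ?case using S.smult_hcomp[of "v [^]\<^sub>S r" "int r" v 1] by (simp add: smult_S add.commute)
qed

definition pow_torsion :: "'a \<Rightarrow> ('a, 'b) graded_module \<Rightarrow> 'b set" where
 "pow_torsion v M = {x \<in> carrier M. \<exists>r :: nat. v [^]\<^sub>S r \<odot>\<^sub>M x = \<zero>\<^sub>M}"

lemma pow_torsion_smult:
 assumes "module S M" "v \<in> carrier S" "x \<in> carrier M" "v [^]\<^sub>S (r :: nat) \<odot>\<^sub>M x \<in> pow_torsion v M"
 shows "x \<in> pow_torsion v M"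
proof -
 interpret M: module S M by fact
 obtain r' :: nat where "v [^]\<^sub>S r' \<odot>\<^sub>M (v [^]\<^sub>S r \<odot>\<^sub>M x) = \<zero>\<^sub>M" using assms(4) unfolding pow_torsion_def by blast
 hence "v [^]\<^sub>S (r' + r) \<odot>\<^sub>M x = \<zero>\<^sub>M" using assms(2,3) by (simp add: M.smult_assoc1 S.R.nat_pow_mult[symmetric])
 thus ?thesis unfolding pow_torsion_def using assms(3) by blast
qed

lemma hsub_pow_torsion:
 assumes "graded_module S M" "v \<in> hcomp S 1"
 shows "hsub M (pow_torsion v M)"
proof -
 interpret M: graded_module S M by fact
 have v: "v \<in> carrier S" by (rule S.G.hcompD(1)[OF assms(2)])
 have "sub M (pow_torsion v M)"
 proof (rule M.opsub_submoduleI)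
  show "pow_torsion v M \<subseteq> carrier M" "\<zero>\<^sub>M \<in> pow_torsion v M" unfolding pow_torsion_def using v by auto
 next
  fix x y assume "x \<in> pow_torsion v M" "y \<in> pow_torsion v M"
  then obtain k l :: nat where *: "x \<in> carrier M" "y \<in> carrier M" "v [^]\<^sub>S k \<odot>\<^sub>M x = \<zero>\<^sub>M" "v [^]\<^sub>S l \<odot>\<^sub>M y = \<zero>\<^sub>M"
   unfolding pow_torsion_def by blast
  have "v [^]\<^sub>S (l + k) \<odot>\<^sub>M x = v [^]\<^sub>S l \<odot>\<^sub>M (v [^]\<^sub>S k \<odot>\<^sub>M x)"
   "v [^]\<^sub>S (l + k) \<odot>\<^sub>M y = v [^]\<^sub>S k \<odot>\<^sub>M (v [^]\<^sub>S l \<odot>\<^sub>M y)"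
   using *(1,2) v by (simp_all add: M.smult_assoc1[symmetric] S.R.nat_pow_mult add.commute)
  hence "v [^]\<^sub>S (l + k) \<odot>\<^sub>M (x \<oplus>\<^sub>M y) = \<zero>\<^sub>M" using * v by (simp add: M.smult_r_distr)
  thus "x \<oplus>\<^sub>M y \<in> pow_torsion v M" unfolding pow_torsion_def using * by blast
 next
  fix r x assume r: "r \<in> carrier S" and "x \<in> pow_torsion v M"
  then obtain k :: nat where *: "x \<in> carrier M" "v [^]\<^sub>S k \<odot>\<^sub>M x = \<zero>\<^sub>M" unfolding pow_torsion_def by blast
  have "v [^]\<^sub>S k \<odot>\<^sub>M (r \<odot>\<^sub>M x) = r \<odot>\<^sub>M (v [^]\<^sub>S k \<odot>\<^sub>M x)"
   using *(1) r v by (simp add: M.smult_assoc1[symmetric] S.R.m_comm)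
  thus "r \<odot>\<^sub>M x \<in> pow_torsion v M" unfolding pow_torsion_def using * r by auto
 qed
 moreover have "pr M i x \<in> pow_torsion v M" if x: "x \<in> pow_torsion v M" for i x
 proof -
  obtain k :: nat where *: "x \<in> carrier M" "v [^]\<^sub>S k \<odot>\<^sub>M x = \<zero>\<^sub>M" using x unfolding pow_torsion_def by blast
  have "v [^]\<^sub>S k \<odot>\<^sub>M pr M i x = \<zero>\<^sub>M"
   using M.pr_smult[OF pow_hcomp[OF assms(2), of k] _ *(1), of "i + int k"] v *(2) by simp
  thus ?thesis unfolding pow_torsion_def using *(1) by blast
 qed
 ultimately show ?thesis unfolding hsub_def by blast
qed

lemma hsub_preimage:
 assumes "graded_module S M" "graded_module S N" "\<phi> \<in> ghom M N" "hsub N H"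
 shows "hsub M {x \<in> carrier M. \<phi> x \<in> H}"
proof -
 interpret M: graded_module S M by fact
 interpret N: graded_module S N by fact
 note h = ghomD[OF assms(3)] and z = ghom_zero[OF assms(1-3)]
 note o = opsubD[OF hsubD(1)[OF assms(4)]]
 have "sub M {x \<in> carrier M. \<phi> x \<in> H}"
  by (rule M.opsub_submoduleI) (auto simp: h z intro: o)
 thus ?thesis unfolding hsub_def using hsubD(2)[OF assms(4)] by (auto simp: z(4)[symmetric])
qed

text \<open>The exponent is uniform because an element of high degree which is \<open>\<mm>\<close>-torsion modulo
 \<open>v M\<close> and \<open>v\<close>-torsion lies in that submodule already.\<close>

lemma uniform_power:
 assumes M: "gobj d M" and E: "graded_module S E" "\<And>i. i < d \<Longrightarrow> hcomp E i = {\<zero>\<^sub>E}"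
  and \<eta>: "\<eta> \<in> ghom M E" and coker: "carrier E \<subseteq> torsion_over E (\<eta> ` carrier M)"
  and v: "v \<in> hcomp S 1"
 shows "\<exists>N :: nat. \<forall>u\<in>carrier E. \<exists>y\<in>carrier M. (v [^]\<^sub>S N \<odot>\<^sub>E u) \<ominus>\<^sub>E \<eta> y \<in> pow_torsion v E"
proof -
 note gM = gobjD(1)[OF M]
 interpret M: graded_module S M by (rule gM)
 interpret E: graded_module S E by fact
 note h = ghomD[OF \<eta>] and z = ghom_zero[OF gM E(1) \<eta>]
 have vc: "v \<in> carrier S" by (rule S.G.hcompD(1)[OF v])
 define \<Gamma> where "\<Gamma> = pow_torsion v E"
 have h\<Gamma>: "hsub E \<Gamma>" unfolding \<Gamma>_def by (rule hsub_pow_torsion[OF E(1) v])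
 note o = opsubD[OF hsubD(1)[OF h\<Gamma>]]
 define G where "G = {x \<in> carrier M. \<eta> x \<in> \<Gamma>}"
 have hG: "hsub M G" unfolding G_def by (rule hsub_preimage[OF gM E(1) \<eta> h\<Gamma>])
 note oG = opsubD[OF hsubD(1)[OF hG]]
 \<comment> \<open>\<open>v M\<close> enlarged by the elements whose images in \<open>E\<close> are
   \<open>v\<close>-torsion; an element of \<open>H\<close> has, up to such torsion, a factor
   \<open>v\<close> that can be split off.\<close>
 define H where "H = {v \<odot>\<^sub>M y \<oplus>\<^sub>M x | y x. y \<in> carrier M \<and> x \<in> G}"
 have HI: "v \<odot>\<^sub>M y \<oplus>\<^sub>M x \<in> H" if "y \<in> carrier M" "x \<in> G" for x y unfolding H_def using that by blast
 have subH: "sub M H"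
 proof (rule M.opsub_submoduleI)
  show "H \<subseteq> carrier M" unfolding H_def using vc oG(7) by auto
  show "\<zero>\<^sub>M \<in> H" using HI[of "\<zero>\<^sub>M" "\<zero>\<^sub>M"] vc oG(2) by simp
 next
  fix a b assume "a \<in> H" "b \<in> H"
  then obtain y x y' x' where *: "a = v \<odot>\<^sub>M y \<oplus>\<^sub>M x" "b = v \<odot>\<^sub>M y' \<oplus>\<^sub>M x'"
   "y \<in> carrier M" "x \<in> G" "y' \<in> carrier M" "x' \<in> G" unfolding H_def by blast
  hence "a \<oplus>\<^sub>M b = v \<odot>\<^sub>M (y \<oplus>\<^sub>M y') \<oplus>\<^sub>M (x \<oplus>\<^sub>M x')"
   using vc oG(7) by (simp add: M.smult_r_distr M.M.a_ac)
  thus "a \<oplus>\<^sub>M b \<in> H" using HI[of "y \<oplus>\<^sub>M y'" "x \<oplus>\<^sub>M x'"] * oG(3) by simp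
 next
  fix r a assume r: "r \<in> carrier S" and "a \<in> H"
  then obtain y x where *: "a = v \<odot>\<^sub>M y \<oplus>\<^sub>M x" "y \<in> carrier M" "x \<in> G" unfolding H_def by blast
  hence "r \<odot>\<^sub>M a = v \<odot>\<^sub>M (r \<odot>\<^sub>M y) \<oplus>\<^sub>M (r \<odot>\<^sub>M x)"
   using r vc oG(7) by (simp add: M.smult_r_distr M.smult_assoc1[symmetric] S.R.m_comm)
  thus "r \<odot>\<^sub>M a \<in> H" using HI[of "r \<odot>\<^sub>M y" "r \<odot>\<^sub>M x"] * r oG(5) by simp
 qed
 have prH: "pr M i (v \<odot>\<^sub>M y \<oplus>\<^sub>M x) = v \<odot>\<^sub>M pr M (i - 1) y \<oplus>\<^sub>M pr M i x"
  if "y \<in> carrier M" "x \<in> carrier M" for i x y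
  using that vc M.pr_smult[OF v vc that(1)] by (simp add: M.pr_add)
 have "pr M i a \<in> H" if "a \<in> H" for i a
 proof -
  obtain y x where *: "a = v \<odot>\<^sub>M y \<oplus>\<^sub>M x" "y \<in> carrier M" "x \<in> G" using \<open>a \<in> H\<close> unfolding H_def by blast
  thus ?thesis using prH[OF *(2) oG(7)[OF *(3)], of i] HI[of "pr M (i - 1) y" "pr M i x"] hsubD(2)[OF hG *(3)] by simp
 qed
 hence hH: "hsub M H" unfolding hsub_def using subH by blast
 obtain K where K: "\<forall>k\<ge>K. hcomp M k \<inter> torsion_over M H \<subseteq> H" using torsion_over_bounded[OF M hH] ..
 \<comment> \<open>Every \<open>y\<close> met in the induction step has degree at least
   \<open>d + N\<close>, hence at least \<open>K\<close>, whatever the degree of \<open>u\<close>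
   is; the lower bound \<open>d\<close> is what makes the exponent uniform.\<close>
 define N where "N = nat (K - d)"
 \<comment> \<open>Induction on the excess exponent \<open>e\<close>. Modulo
   \<open>v\<close>-torsion, \<open>\<eta> y\<close> is a multiple of \<open>u\<close> by a power of
   \<open>v\<close>, and \<open>s u\<close> lies in the image of \<open>\<eta>\<close> for
   \<open>s\<close> in some \<open>I l\<close>; so \<open>s y\<close> lies in \<open>H\<close>. In
   degrees from \<open>K\<close> on, \<open>y\<close> itself is then in \<open>H\<close>, and one
   factor \<open>v\<close> is removed on both sides.\<close>
 have descend: "\<exists>y\<in>carrier M. (v [^]\<^sub>S N \<odot>\<^sub>E u) \<ominus>\<^sub>E \<eta> y \<in> \<Gamma>"
  if "d \<le> i" "u \<in> hcomp E i" "y \<in> hcomp M (i + int (N + e))" "(v [^]\<^sub>S (N + e) \<odot>\<^sub>E u) \<ominus>\<^sub>E \<eta> y \<in> \<Gamma>" for i u y e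
  using that
 proof (induction e arbitrary: y)
  case 0
  thus ?case using M.G.hcompD(1) by auto
 next
  case (Suc e)
  define t where "t = N + e"
  have t: "N + Suc e = Suc t" unfolding t_def by simp
  have u: "u \<in> carrier E" by (rule E.G.hcompD(1)[OF Suc(3)])
  have y: "y \<in> carrier M" by (rule M.G.hcompD(1)[OF Suc(4)])
  have g: "(v [^]\<^sub>S (Suc t) \<odot>\<^sub>E u) \<ominus>\<^sub>E \<eta> y \<in> \<Gamma>" using Suc(5) unfolding t .
  have uc: "v [^]\<^sub>S k \<odot>\<^sub>E u \<in> carrier E" for k :: nat using vc u by simp
  obtain l where l: "\<forall>s\<in>I l. s \<odot>\<^sub>E u \<in> \<eta> ` carrier M" using coker u unfolding torsion_over_def by blast
  have "s \<odot>\<^sub>M y \<in> H" if s: "s \<in> I l" for s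
  proof -
   have sc: "s \<in> carrier S" by (rule I_D(1)[OF s])
   obtain m where m: "s \<odot>\<^sub>E u = \<eta> m" "m \<in> carrier M" using l s by (auto elim: imageE)
   let ?m = "v [^]\<^sub>S t \<odot>\<^sub>M m"
   have mc: "?m \<in> carrier M" using vc m by simp
   have vm: "v \<odot>\<^sub>M ?m = v [^]\<^sub>S (Suc t) \<odot>\<^sub>M m"
    using vc m(2) by (simp add: M.smult_assoc1[symmetric] S.R.m_comm)
   have "\<eta> y \<ominus>\<^sub>E (v [^]\<^sub>S (Suc t) \<odot>\<^sub>E u) \<in> \<Gamma>"
    using o(4)[OF g] E.M.neg_diff[OF uc h(1)[OF y], of "Suc t"] by (simp del: S.R.nat_pow_Suc)
   hence "s \<odot>\<^sub>E (\<eta> y \<ominus>\<^sub>E (v [^]\<^sub>S (Suc t) \<odot>\<^sub>E u)) \<in> \<Gamma>" by (rule o(5)[OF sc])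
   moreover have "s \<odot>\<^sub>E (v [^]\<^sub>S (Suc t) \<odot>\<^sub>E u) = v [^]\<^sub>S (Suc t) \<odot>\<^sub>E (s \<odot>\<^sub>E u)"
    using sc vc u by (simp add: E.smult_assoc1[symmetric] S.R.m_comm del: S.R.nat_pow_Suc)
   ultimately have "\<eta> ((s \<odot>\<^sub>M y) \<ominus>\<^sub>M (v \<odot>\<^sub>M ?m)) \<in> \<Gamma>"
    unfolding vm using sc vc y m uc[of "Suc t"] h(1)
    by (simp add: z h(3) E.smult_diff del: S.R.nat_pow_Suc)
   hence "(s \<odot>\<^sub>M y) \<ominus>\<^sub>M (v \<odot>\<^sub>M ?m) \<in> G" unfolding G_def using sc y vc mc by (simp add: a_minus_def)
   from HI[OF mc this] show ?thesis
    using M.M.add_minus_cancel[of "s \<odot>\<^sub>M y" "v \<odot>\<^sub>M ?m"] sc y vc mc by simp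
  qed
  hence "y \<in> torsion_over M H" unfolding torsion_over_def using y by blast
  moreover have "K \<le> i + int (N + Suc e)" using Suc(2) unfolding N_def by simp
  ultimately have "y \<in> H" using K Suc(4) by blast
  then obtain y1 x where yx: "y = v \<odot>\<^sub>M y1 \<oplus>\<^sub>M x" "y1 \<in> carrier M" "x \<in> G" unfolding H_def by blast
  \<comment> \<open>The decomposition in \<open>H\<close> need not be homogeneous; its components in
    the right degrees give a \<open>y\<close> to which the induction hypothesis applies.\<close>
  let ?y = "pr M (i + int t) y1" and ?x = "pr M (i + int (Suc t)) x"
  have xG: "?x \<in> G" by (rule hsubD(2)[OF hG yx(3)])
  have y1: "?y \<in> carrier M" "?x \<in> carrier M" "?y \<in> hcomp M (i + int (N + e))"
   using yx M.pr(1)[OF yx(2), of "i + int t"] oG(7)[OF xG] unfolding t_def by auto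
  have "y = pr M (i + int (Suc t)) y" using M.pr_homog[OF Suc(4)] unfolding t by simp
  also have "\<dots> = v \<odot>\<^sub>M ?y \<oplus>\<^sub>M ?x" using prH[OF yx(2) oG(7)[OF yx(3)], of "i + int (Suc t)"] yx(1) by simp
  finally have ye: "\<eta> y = v \<odot>\<^sub>E \<eta> ?y \<oplus>\<^sub>E \<eta> ?x" using vc y1 by (simp add: h)
  have "((v [^]\<^sub>S (Suc t) \<odot>\<^sub>E u) \<ominus>\<^sub>E \<eta> y) \<oplus>\<^sub>E \<eta> ?x \<in> \<Gamma>"
   using o(3)[OF g] xG unfolding G_def by blast
  hence "(v [^]\<^sub>S (Suc t) \<odot>\<^sub>E u) \<ominus>\<^sub>E (v \<odot>\<^sub>E \<eta> ?y) \<in> \<Gamma>"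
   unfolding ye using E.M.diff_add_diff[OF uc[of "Suc t"], of "v \<odot>\<^sub>E \<eta> ?y" "\<eta> ?x"] vc h(1) y1 by (simp del: S.R.nat_pow_Suc)
  moreover have "v [^]\<^sub>S (Suc t) \<odot>\<^sub>E u = v \<odot>\<^sub>E (v [^]\<^sub>S t \<odot>\<^sub>E u)"
   using vc u by (simp add: E.smult_assoc1[symmetric] S.R.m_comm)
  ultimately have "v [^]\<^sub>S (1::nat) \<odot>\<^sub>E ((v [^]\<^sub>S t \<odot>\<^sub>E u) \<ominus>\<^sub>E \<eta> ?y) \<in> \<Gamma>"
   using vc uc[of t] h(1)[OF y1(1)] by (simp add: E.smult_diff)
  hence "(v [^]\<^sub>S t \<odot>\<^sub>E u) \<ominus>\<^sub>E \<eta> ?y \<in> \<Gamma>" unfolding \<Gamma>_def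
   by (rule pow_torsion_smult[OF E.module_axioms vc E.M.minus_closed[OF uc h(1)[OF y1(1)]]])
  thus ?case using Suc(1)[OF Suc(2,3) y1(3)] unfolding t_def by blast
 qed
 have "\<exists>y\<in>carrier M. (v [^]\<^sub>S N \<odot>\<^sub>E u) \<ominus>\<^sub>E \<eta> y \<in> \<Gamma>" if "u \<in> carrier E" for u
  using that
 proof (induction rule: E.graded_induct)
  case zero
  show ?case using vc o(2) by (intro bexI[of _ "\<zero>\<^sub>M"]) (simp_all add: z)
 next
  case (comp i u)
  have u: "u \<in> carrier E" by (rule E.G.hcompD(1)[OF comp])
  show ?case
  proof (cases "d \<le> i")
   case True
   obtain l where l: "\<forall>s\<in>I l. s \<odot>\<^sub>E u \<in> \<eta> ` carrier M" using coker u unfolding torsion_over_def by blast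
   \<comment> \<open>The induction can start: this power of \<open>v\<close> lies in
     \<open>I l\<close> and carries \<open>u\<close> into the image of
     \<open>\<eta>\<close>.\<close>
   have vl: "v [^]\<^sub>S (N + l) \<in> hcomp S (int (N + l))" by (rule pow_hcomp[OF v])
   hence "v [^]\<^sub>S (N + l) \<in> I l" using hcomp_I[of l "int (N + l)"] by auto
   then obtain y where y: "v [^]\<^sub>S (N + l) \<odot>\<^sub>E u = \<eta> y" "y \<in> carrier M" using l by (auto elim: imageE)
   let ?y = "pr M (i + int (N + l)) y"
   have "\<eta> ?y = v [^]\<^sub>S (N + l) \<odot>\<^sub>E u"
    using z(4)[OF y(2), of "i + int (N + l)"] E.smult_hcomp[OF vl comp] y(1) by (simp add: E.pr_homog add.commute)
   hence "(v [^]\<^sub>S (N + l) \<odot>\<^sub>E u) \<ominus>\<^sub>E \<eta> ?y \<in> \<Gamma>" using vc u o(2) by simp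
   thus ?thesis by (rule descend[OF True comp M.pr(1)[OF y(2)]])
  next
   case False
   hence "u = \<zero>\<^sub>E" using E(2)[of i] comp by auto
   thus ?thesis using vc o(2) by (intro bexI[of _ "\<zero>\<^sub>M"]) (simp_all add: z)
  qed
 next
  case (add u w)
  then obtain x y where xy: "x \<in> carrier M" "y \<in> carrier M" "(v [^]\<^sub>S N \<odot>\<^sub>E u) \<ominus>\<^sub>E \<eta> x \<in> \<Gamma>"
   "(v [^]\<^sub>S N \<odot>\<^sub>E w) \<ominus>\<^sub>E \<eta> y \<in> \<Gamma>" by blast
  have "(v [^]\<^sub>S N \<odot>\<^sub>E (u \<oplus>\<^sub>E w)) \<ominus>\<^sub>E \<eta> (x \<oplus>\<^sub>M y) \<in> \<Gamma>"
   using o(3)[OF xy(3,4)] add(1,2) xy(1,2) vc h(1) by (simp add: E.smult_r_distr h(2) E.M.diff_diff_add)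
  thus ?case using xy by (intro bexI[of _ "x \<oplus>\<^sub>M y"]) auto
 qed
 thus ?thesis unfolding \<Gamma>_def by blast
qed

text \<open>Chains in \<open>E\<close> are compared with chains in \<open>M\<close>, one variable at
  a time: by \<open>uniform_power\<close> a fixed power of \<open>var j\<close> gives a linear
  relation from \<open>J j\<close> to \<open>M\<close> whose kernel lies in
  \<open>J (Suc j)\<close>. Elements of \<open>J (Suc n)\<close> are killed by a power of every
  variable, hence by some \<open>I l\<close>, hence are zero.\<close>

lemma fin_gen_of_torsion_cokernel:
 assumes M: "gobj d M" and E: "graded_module S E" "\<And>i. i < d \<Longrightarrow> hcomp E i = {\<zero>\<^sub>E}"
  and \<eta>: "\<eta> \<in> ghom M E" and coker: "carrier E \<subseteq> torsion_over E (\<eta> ` carrier M)"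
  and free: "torsion E \<subseteq> {\<zero>\<^sub>E}"
 shows "fin_gen (carrier S) E (carrier E)"
proof -
 note gM = gobjD(1)[OF M]
 interpret M: graded_module S M by (rule gM)
 interpret E: graded_module S E by fact
 note h = ghomD[OF \<eta>] and z = ghom_zero[OF gM E(1) \<eta>]
 define J where "J m = {u \<in> carrier E. \<forall>j<m. u \<in> pow_torsion (var j) E}" for m
 have vh: "var j \<in> hcomp S 1" "var j \<in> carrier S" if "j \<le> n" for j
  using var_hcomp[OF that] S.G.hcompD(1) by blast+
 have subJ: "sub E (J m)" if "m \<le> Suc n" for m
 proof -
  have "u \<in> J m \<longleftrightarrow> u \<in> carrier E \<and> (\<forall>j<m. u \<in> pow_torsion (var j) E)" for u unfolding J_def by blast
  note J = this
  have o: "sub E (pow_torsion (var j) E)" if "j < m" for j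
   using hsubD(1)[OF hsub_pow_torsion[OF E(1) vh(1)]] that \<open>m \<le> Suc n\<close> by simp
  show ?thesis
  proof (rule E.opsub_submoduleI)
   show "J m \<subseteq> carrier E" unfolding J_def by blast
   show "\<zero>\<^sub>E \<in> J m" unfolding J using opsubD(2)[OF o] by simp
   show "x \<oplus>\<^sub>E y \<in> J m" if "x \<in> J m" "y \<in> J m" for x y using that opsubD(3)[OF o] unfolding J by simp
   show "r \<odot>\<^sub>E x \<in> J m" if "r \<in> carrier S" "x \<in> J m" for r x using that opsubD(5)[OF o] unfolding J by simp
  qed
 qed
 \<comment> \<open>From \<open>J (Suc n)\<close>, which is zero, down to \<open>J 0\<close>, which
   is all of \<open>E\<close>.\<close>
 have "acc (carrier S) E (J (Suc n - m))" if "m \<le> Suc n" for m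
  using that
 proof (induction m)
  case 0
  have "J (Suc n) \<subseteq> {\<zero>\<^sub>E}"
  proof
   fix u assume u: "u \<in> J (Suc n)"
   hence uc: "u \<in> carrier E" unfolding J_def by blast
   have "\<exists>l. I l \<subseteq> {s \<in> carrier S. s \<odot>\<^sub>E u = \<zero>\<^sub>E}"
   proof (rule I_var)
    show "sub S {s \<in> carrier S. s \<odot>\<^sub>E u = \<zero>\<^sub>E}"
     by (rule S.opsub_submoduleI) (auto simp: uc E.smult_l_distr E.smult_assoc1 smult_S)
    show "\<exists>r :: nat. var j [^]\<^sub>S r \<in> {s \<in> carrier S. s \<odot>\<^sub>E u = \<zero>\<^sub>E}" if "j \<le> n" for j
     using u that vh(2)[OF that] unfolding J_def pow_torsion_def by auto
   qed
   hence "u \<in> torsion E" unfolding torsion_over_def using uc by blast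
   thus "u \<in> {\<zero>\<^sub>E}" using free by blast
  qed
  thus ?case using acc_subset[OF E.acc_zero] by simp
 next
  case (Suc m)
  define j where "j = Suc n - Suc m"
  have j: "j \<le> n" "Suc n - m = Suc j" "j \<le> Suc n" unfolding j_def using Suc(2) by auto
  let ?v = "var j"
  note v = vh[OF j(1)]
  obtain N :: nat where N: "\<forall>u\<in>carrier E. \<exists>y\<in>carrier M. (?v [^]\<^sub>S N \<odot>\<^sub>E u) \<ominus>\<^sub>E \<eta> y \<in> pow_torsion ?v E"
   using uniform_power[OF M E \<eta> coker v(1)] ..
  define P where "P = pow_torsion ?v E"
  define w where "w = ?v [^]\<^sub>S N"
  have w: "w \<in> carrier S" unfolding w_def using v(2) by simp
  have "hsub E P" unfolding P_def by (rule hsub_pow_torsion[OF E(1) v(1)])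
  note o = opsubD[OF hsubD(1)[OF this]]
  \<comment> \<open>A relation and not a map: \<open>y\<close> is determined only up to elements
    that \<open>\<eta>\<close> sends to \<open>P\<close>.\<close>
  define \<rho> where "\<rho> u y \<longleftrightarrow> u \<in> carrier E \<and> y \<in> carrier M \<and> (w \<odot>\<^sub>E u) \<ominus>\<^sub>E \<eta> y \<in> P" for u y
  have "acc (carrier S) E (J j)"
  proof (rule acc_linear_relation[where H = M and \<rho> = \<rho>])
   show "abelian_group E" "abelian_group M" by (rule E.M.abelian_group_axioms M.M.abelian_group_axioms)+
   show "acc (carrier S) M (carrier M)" by (rule M.fin_gen_imp_acc[OF noeth_S gobjD(2)[OF M]])
   have "{u \<in> J j. \<rho> u \<zero>\<^sub>M} \<subseteq> J (Suc j)"
   proof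
    fix u assume u: "u \<in> {u \<in> J j. \<rho> u \<zero>\<^sub>M}"
    hence "u \<in> carrier E" "w \<odot>\<^sub>E u \<in> P" unfolding \<rho>_def using w by (auto simp: z)
    hence "u \<in> P" unfolding P_def w_def using pow_torsion_smult[OF E.module_axioms v(2)] by blast
    thus "u \<in> J (Suc j)" using u unfolding J_def P_def by (auto simp: less_Suc_eq)
   qed
   moreover have "acc (carrier S) E (J (Suc j))" using Suc j(2) by simp
   ultimately show "acc (carrier S) E {u \<in> J j. \<rho> u \<zero>\<^sub>M}" by (rule acc_subset[rotated])
   show "sub E (J j)" by (rule subJ[OF j(3)])
   show "\<rho> \<zero>\<^sub>E \<zero>\<^sub>M" unfolding \<rho>_def using w o(2) by (simp add: z)
   show "\<rho> (u \<oplus>\<^sub>E u') (y \<oplus>\<^sub>M y')" if "\<rho> u y" "\<rho> u' y'" for u u' y y'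
    using that o(3)[of "(w \<odot>\<^sub>E u) \<ominus>\<^sub>E \<eta> y" "(w \<odot>\<^sub>E u') \<ominus>\<^sub>E \<eta> y'"] w h(1) unfolding \<rho>_def
    by (simp add: E.smult_r_distr h(2) E.M.diff_diff_add)
   show s: "\<rho> (r \<odot>\<^sub>E u) (r \<odot>\<^sub>M y)" if "r \<in> carrier S" "\<rho> u y" for r u y
   proof -
    have uy: "u \<in> carrier E" "y \<in> carrier M" "(w \<odot>\<^sub>E u) \<ominus>\<^sub>E \<eta> y \<in> P" using that(2) unfolding \<rho>_def by auto
    have "w \<odot>\<^sub>E (r \<odot>\<^sub>E u) = r \<odot>\<^sub>E (w \<odot>\<^sub>E u)"
     using w that(1) uy(1) by (simp add: E.smult_assoc1[symmetric] S.R.m_comm)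
    thus ?thesis using o(5)[OF that(1) uy(3)] that(1) uy w h(1) unfolding \<rho>_def
     by (simp add: E.smult_diff h(3))
   qed
   show "\<rho> (\<ominus>\<^sub>E u) (\<ominus>\<^sub>M y)" if "\<rho> u y" for u y
   proof -
    have uy: "u \<in> carrier E" "y \<in> carrier M" using that unfolding \<rho>_def by auto
    have "(\<ominus>\<^sub>S \<one>\<^sub>S) \<odot>\<^sub>E u = \<ominus>\<^sub>E u" "(\<ominus>\<^sub>S \<one>\<^sub>S) \<odot>\<^sub>M y = \<ominus>\<^sub>M y"
     using uy by (simp_all add: E.smult_l_minus M.smult_l_minus)
    thus ?thesis using s[OF _ that, of "\<ominus>\<^sub>S \<one>\<^sub>S"] by simp
   qed
   show "y \<in> carrier M" if "\<rho> u y" for u y using that unfolding \<rho>_def by blast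
   show "\<exists>y. \<rho> u y" if "u \<in> J j" for u
   proof -
    have u: "u \<in> carrier E" using that unfolding J_def by blast
    from N[rule_format, OF u] obtain y where "y \<in> carrier M" "(w \<odot>\<^sub>E u) \<ominus>\<^sub>E \<eta> y \<in> P"
     unfolding w_def P_def by (elim bexE)
    thus ?thesis unfolding \<rho>_def using u by (intro exI[of _ y] conjI)
   qed
   show "r \<odot>\<^sub>M \<zero>\<^sub>M = \<zero>\<^sub>M" if "r \<in> carrier S" for r using that by simp
  qed
  thus ?case unfolding j_def .
 qed
 from this[of "Suc n"] have "acc (carrier S) E (J 0)" by simp
 moreover have "J 0 = carrier E" unfolding J_def by simp
 ultimately show ?thesis using acc_fin_gen[OF _ E.opsub_carrier[OF order_refl] order_refl] by simp
qed

end

context hom_limit begin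

lemma fin_gen_DD: "fin_gen (carrier S) DD (carrier DD)"
 by (rule fin_gen_of_torsion_cokernel[OF gobj_M graded_DD _ eta_hom coker_eta torsion_DD])
  (auto simp: hcomp_DD_iff)

lemmas envelope = envelope_DD[OF fin_gen_DD]

end

section \<open>The transform is a Gabriel monad\<close>

context standard_graded begin

lemma hom_limitI: "gobj d M \<Longrightarrow> hom_limit S n var I d M"
 by (intro hom_limit.intro hom_limit_axioms.intro standard_graded_axioms)

section \<open>Functoriality of the limit\<close>

definition push :: "('b \<Rightarrow> 'c) \<Rightarrow> nat \<Rightarrow> ('a \<Rightarrow> 'b) \<Rightarrow> 'a \<Rightarrow> 'c" where
 "push \<phi> l f = (\<lambda>s\<in>I l. \<phi> (f s))"

definition hom_lim_map :: "int \<Rightarrow> ('a, 'c) graded_module \<Rightarrow> ('b \<Rightarrow> 'c) \<Rightarrow> (nat \<times> ('a \<Rightarrow> 'b)) set \<Rightarrow> (nat \<times> ('a \<Rightarrow> 'c)) set"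
 where "hom_lim_map d N \<phi> U = lim_map (hom_seq d N) hom_trans (push \<phi>) U"

lemma push_closed:
 assumes M: "gobj d M" and N: "gobj d N" and \<phi>: "\<phi> \<in> ghom M N" and f: "f \<in> carrier (hom_seq d M k)"
 shows "push \<phi> k f \<in> carrier (hom_seq d N k)"
  and "f \<in> dhom k i M \<Longrightarrow> push \<phi> k f \<in> dhom k i N"
proof -
 interpret A: hom_limit S n var I d M by (rule hom_limitI[OF M])
 interpret B: hom_limit S n var I d N by (rule hom_limitI[OF N])
 note h = ghomD[OF \<phi>] and z = ghom_zero[OF gobjD(1)[OF M] gobjD(1)[OF N] \<phi>]
 show dh: "push \<phi> k f \<in> dhom k i N" if "f \<in> dhom k i M" for i f
 proof -
  note l = lin_homD[OF A.dhom_lin[OF that]]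
  have "push \<phi> k f \<in> lin_hom S (sub_gm S (I k)) N"
   by (rule lin_homI) (auto simp: push_def I_D l h)
  thus ?thesis using A.dhom_hcomp[OF that] h(4) by (auto simp: dhom_iff push_def)
 qed
 show "push \<phi> k f \<in> carrier (hom_seq d N k)" using f
 proof (induction rule: A.HH_induct)
  case zero
  have "push \<phi> k (\<lambda>s\<in>I k. \<zero>\<^sub>M) = (\<lambda>s\<in>I k. \<zero>\<^sub>N)" by (auto simp: push_def z intro!: restrict_ext)
  thus ?case using B.HH_zero by (simp del: restrict_apply)
 next
  case (comp i f)
  thus ?case using B.HH_dhom dh by blast
 next
  case (add f g)
  have "push \<phi> k (\<lambda>s\<in>I k. f s \<oplus>\<^sub>M g s) = (\<lambda>s\<in>I k. push \<phi> k f s \<oplus>\<^sub>N push \<phi> k g s)"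
   using lin_homD(1)[OF A.HH_lin[OF add(1)]] lin_homD(1)[OF A.HH_lin[OF add(2)]]
   by (auto simp: push_def h intro!: restrict_ext)
  thus ?case using B.HH_add[OF add(3,4)] by (simp del: restrict_apply)
 qed
qed

lemma hom_lim_map_germ:
 assumes M: "gobj d M" and N: "gobj d N" and \<phi>: "\<phi> \<in> ghom M N" and f: "f \<in> carrier (hom_seq d M k)"
 shows "hom_lim_map d N \<phi> (germ d M k f) = germ d N k (push \<phi> k f)"
proof -
 interpret A: hom_limit S n var I d M by (rule hom_limitI[OF M])
 interpret B: hom_limit S n var I d N by (rule hom_limitI[OF N])
 note c = push_closed(1)[OF M N \<phi>]
 have "hom_lim_map d N \<phi> (germ d M k f) = \<Union>{germ d N (fst t) (push \<phi> (fst t) (snd t)) |t. t \<in> germ d M k f}"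
  by (simp add: hom_lim_map_def lim_map_def germ_def)
 also have "\<dots> = germ d N k (push \<phi> k f)"
 proof (rule A.Union_constant)
  show "\<exists>t. t \<in> germ d M k f" using A.cls_self[OF f] ..
 next
  fix t assume t: "t \<in> germ d M k f"
  obtain l f' where [simp]: "t = (l, f')" by (metis surj_pair)
  have *: "f' \<in> carrier (hom_seq d M l)" "\<exists>j. \<forall>s\<in>I j. f s = f' s"
   using t A.mem_cls_iff[OF f] by simp_all
  obtain j where "\<forall>s\<in>I j. f s = f' s" using *(2) ..
  hence "\<forall>s\<in>I (j + k + l). push \<phi> l f' s = push \<phi> k f s"
   using I_monoD[of _ "j + k + l"] by (simp add: push_def)
  hence "\<exists>j. \<forall>s\<in>I j. push \<phi> l f' s = push \<phi> k f s" ..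
  thus "germ d N (fst t) (push \<phi> (fst t) (snd t)) = germ d N k (push \<phi> k f)"
   using B.cls_eq_iff[OF c[OF *(1)] c[OF f]] by simp
 qed
 finally show ?thesis .
qed

lemma hom_lim_map_hom:
 assumes M: "gobj d M" and N: "gobj d N" and \<phi>: "\<phi> \<in> ghom M N"
 shows "restrict (hom_lim_map d N \<phi>) (carrier (hom_lim d M)) \<in> ghom (hom_lim d M) (hom_lim d N)"
  and "x \<in> carrier M \<Longrightarrow> hom_lim_map d N \<phi> (hom_limit.eta S I d M x) = hom_limit.eta S I d N (\<phi> x)"
proof -
 interpret A: hom_limit S n var I d M by (rule hom_limitI[OF M])
 interpret B: hom_limit S n var I d N by (rule hom_limitI[OF N])
 note h = ghomD[OF \<phi>] and z = ghom_zero[OF gobjD(1)[OF M] gobjD(1)[OF N] \<phi>]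
 note c = push_closed[OF M N \<phi>] and e = hom_lim_map_germ[OF M N \<phi>]
 show "hom_lim_map d N \<phi> (A.eta x) = B.eta (\<phi> x)" if x: "x \<in> carrier M"
 proof -
  have "push \<phi> 0 (A.unit_hom 0 x) = B.unit_hom 0 (\<phi> x)"
   using x by (auto simp: push_def A.unit_hom_def B.unit_hom_def I_D h intro!: restrict_ext)
  thus ?thesis using x h(1)[OF x] e[OF A.unit_hom_HH[OF x, of 0]] by (simp add: A.eta_def B.eta_def)
 qed
 show "restrict (hom_lim_map d N \<phi>) (carrier (hom_lim d M)) \<in> ghom (hom_lim d M) (hom_lim d N)"
 proof (rule ghom_restrictI[OF A.graded_DD])
  show "hom_lim_map d N \<phi> U \<in> carrier (hom_lim d N)" if "U \<in> carrier (hom_lim d M)" for U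
   using that e B.cls_DD[OF c(1)] by (auto elim!: A.DD_cases)
  show "hom_lim_map d N \<phi> (U \<oplus>\<^bsub>hom_lim d M\<^esub> V) = hom_lim_map d N \<phi> U \<oplus>\<^bsub>hom_lim d N\<^esub> hom_lim_map d N \<phi> V"
   if "U \<in> carrier (hom_lim d M)" "V \<in> carrier (hom_lim d M)" for U V
  proof -
   obtain k f g where *: "f \<in> carrier (hom_seq d M k)" "U = germ d M k f" "g \<in> carrier (hom_seq d M k)" "V = germ d M k g"
    using A.DD_level[of "{U, V}"] \<open>U \<in> carrier (hom_lim d M)\<close> \<open>V \<in> carrier (hom_lim d M)\<close> by auto
   have "push \<phi> k (\<lambda>s\<in>I k. f s \<oplus>\<^sub>M g s) = (\<lambda>s\<in>I k. push \<phi> k f s \<oplus>\<^sub>N push \<phi> k g s)"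
    using lin_homD(1)[OF A.HH_lin[OF *(1)]] lin_homD(1)[OF A.HH_lin[OF *(3)]]
    by (auto simp: push_def h intro!: restrict_ext)
   thus ?thesis unfolding *(2,4) A.DD_add[OF *(1,3)] e[OF A.HH_add[OF *(1,3)]] e[OF *(1)] e[OF *(3)]
    B.DD_add[OF c(1)[OF *(1)] c(1)[OF *(3)]] by simp
  qed
  show "hom_lim_map d N \<phi> (r \<odot>\<^bsub>hom_lim d M\<^esub> U) = r \<odot>\<^bsub>hom_lim d N\<^esub> hom_lim_map d N \<phi> U"
   if r: "r \<in> carrier S" and U: "U \<in> carrier (hom_lim d M)" for r U
  proof -
   obtain k f where *: "f \<in> carrier (hom_seq d M k)" "U = germ d M k f" using U by (rule A.DD_cases)
   have "push \<phi> k (\<lambda>s\<in>I k. r \<odot>\<^sub>M f s) = (\<lambda>s\<in>I k. r \<odot>\<^sub>N push \<phi> k f s)"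
    using lin_homD(1)[OF A.HH_lin[OF *(1)]] r by (auto simp: push_def h intro!: restrict_ext)
   thus ?thesis unfolding *(2) A.DD_smult[OF *(1) r] e[OF A.HH_smult[OF r *(1)]] e[OF *(1)]
    B.DD_smult[OF c(1)[OF *(1)] r] by simp
  qed
  show "hom_lim_map d N \<phi> U \<in> hcomp (hom_lim d N) i" if U: "U \<in> hcomp (hom_lim d M) i" for i U
  proof (cases "d \<le> i")
   case True
   then obtain k f where *: "f \<in> dhom k i M" "U = germ d M k f" using U unfolding A.hcomp_DD_iff by auto
   have f: "f \<in> carrier (hom_seq d M k)" by (rule A.HH_dhom[OF True *(1)])
   show ?thesis unfolding B.hcomp_DD_iff *(2) e[OF f] using True c(2)[OF f *(1)] by auto
  next
   case False
   hence "U = \<zero>\<^bsub>hom_lim d M\<^esub>" using U unfolding A.hcomp_DD_iff by simp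
   hence "U = germ d M 0 (\<lambda>s\<in>I 0. \<zero>\<^sub>M)" using A.DD_zero by simp
   moreover have "push \<phi> 0 (\<lambda>s\<in>I 0. \<zero>\<^sub>M) = (\<lambda>s\<in>I 0. \<zero>\<^sub>N)" by (auto simp: push_def z intro!: restrict_ext)
   ultimately have "hom_lim_map d N \<phi> U = \<zero>\<^bsub>hom_lim d N\<^esub>" using e[OF A.HH_zero[of 0]] B.DD_zero[of 0] by simp
   thus ?thesis unfolding B.hcomp_DD_iff using False by simp
  qed
 qed
qed

lemma injective_image_gm:
 fixes \<theta> :: "'b \<Rightarrow> 'c"
 assumes "graded_module S E" "inj_on \<theta> (carrier E)"
 shows "graded_module S (image_gm \<theta> E)" "restrict \<theta> (carrier E) \<in> ghom E (image_gm \<theta> E)"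
  "x \<in> carrier E \<Longrightarrow> y \<in> carrier E \<Longrightarrow> \<theta> x \<oplus>\<^bsub>image_gm \<theta> E\<^esub> \<theta> y = \<theta> (x \<oplus>\<^sub>E y)"
  "r \<in> carrier S \<Longrightarrow> x \<in> carrier E \<Longrightarrow> r \<odot>\<^bsub>image_gm \<theta> E\<^esub> \<theta> x = \<theta> (r \<odot>\<^sub>E x)"
  "gobj d E \<Longrightarrow> gobj d (image_gm \<theta> E)"
proof -
 interpret E: graded_module S E by fact
 have k: "\<theta> x = \<theta> y \<longleftrightarrow> x \<ominus>\<^sub>E y \<in> {\<zero>\<^sub>E}" if "x \<in> carrier E" "y \<in> carrier E" for x y
  using that assms(2) by (simp add: inj_on_eq_iff E.M.minus_eq_zero_iff)
 note z = hsub_zero[OF assms(1)]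
 show "graded_module S (image_gm \<theta> E)" "restrict \<theta> (carrier E) \<in> ghom E (image_gm \<theta> E)"
  "x \<in> carrier E \<Longrightarrow> y \<in> carrier E \<Longrightarrow> \<theta> x \<oplus>\<^bsub>image_gm \<theta> E\<^esub> \<theta> y = \<theta> (x \<oplus>\<^sub>E y)"
  "r \<in> carrier S \<Longrightarrow> x \<in> carrier E \<Longrightarrow> r \<odot>\<^bsub>image_gm \<theta> E\<^esub> \<theta> x = \<theta> (r \<odot>\<^sub>E x)"
  by (rule graded_image_gm[OF assms(1) z k] image_gm_hom[OF assms(1) z k]
   image_gm_add[OF assms(1) z k] image_gm_smult[OF assms(1) z k]; assumption)+
 show "gobj d (image_gm \<theta> E)" if "gobj d E" by (rule gobj_image_gm[OF that z k])
qed

text \<open>\<open>\<theta>\<close> is an isomorphism onto its image, and each clause of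
  \<open>envelope\<close> is invariant under isomorphisms of the target.\<close>

lemma envelope_image_gm:
 fixes \<theta> :: "'c \<Rightarrow> 'e"
 assumes "envelope d M E \<eta>" "inj_on \<theta> (carrier E)"
 shows "envelope d M (image_gm \<theta> E) (\<lambda>x\<in>carrier M. \<theta> (\<eta> x))"
proof -
 note e = envelopeD[OF assms(1)]
 note gE = gobjD(1)[OF e(2)] and gM = gobjD(1)[OF e(1)]
 interpret E: graded_module S E by (rule gE)
 interpret M: graded_module S M by (rule gM)
 note i = injective_image_gm[OF gE assms(2)]
 note h = ghomD[OF e(3)]
 have eq: "\<theta> x = \<theta> y \<longleftrightarrow> x = y" if "x \<in> carrier E" "y \<in> carrier E" for x y
  using that assms(2) by (simp add: inj_on_eq_iff)
 have sm: "s \<odot>\<^bsub>image_gm \<theta> E\<^esub> \<theta> x = \<theta> (s \<odot>\<^sub>E x)" if "s \<in> I l" "x \<in> carrier E" for s x l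
  using i(4) I_D(1) that by blast
 have hE: "x \<in> hcomp E j \<Longrightarrow> x \<in> carrier E" for x j by (rule E.G.hcompD(1))
 show ?thesis
  unfolding envelope_def
 proof (intro conjI allI impI ballI)
  show "gobj d M" by (rule e(1))
  show "gobj d (image_gm \<theta> E)" by (rule i(5)[OF e(2)])
  have "compose (carrier M) (restrict \<theta> (carrier E)) \<eta> = (\<lambda>x\<in>carrier M. \<theta> (\<eta> x))"
   by (auto simp: compose_def h(1) intro!: restrict_ext)
  thus "(\<lambda>x\<in>carrier M. \<theta> (\<eta> x)) \<in> ghom M (image_gm \<theta> E)"
   using ghom_compose[OF gM e(3) i(2)] by simp
  show "torsion (image_gm \<theta> E) \<subseteq> {\<zero>\<^bsub>image_gm \<theta> E\<^esub>}"
  proof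
   fix y assume "y \<in> torsion (image_gm \<theta> E)"
   then obtain x l where *: "y = \<theta> x" "x \<in> carrier E" "\<forall>s\<in>I l. s \<odot>\<^bsub>image_gm \<theta> E\<^esub> \<theta> x = \<theta> \<zero>\<^sub>E"
    unfolding torsion_over_def by auto
   have "s \<odot>\<^sub>E x = \<zero>\<^sub>E" if "s \<in> I l" for s
    using *(2,3) that sm[OF that *(2)] eq I_D(1)[OF that] by simp
   hence "x \<in> torsion E" unfolding torsion_over_def using *(2) by blast
   thus "y \<in> {\<zero>\<^bsub>image_gm \<theta> E\<^esub>}" using e(4) *(1) by auto
  qed
  show "x \<in> torsion M" if "x \<in> carrier M" "(\<lambda>x\<in>carrier M. \<theta> (\<eta> x)) x = \<zero>\<^bsub>image_gm \<theta> E\<^esub>" for x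
   using e(5) that eq h(1) by simp
  show "carrier (image_gm \<theta> E) \<subseteq> torsion_over (image_gm \<theta> E) ((\<lambda>x\<in>carrier M. \<theta> (\<eta> x)) ` carrier M)"
  proof
   fix y assume "y \<in> carrier (image_gm \<theta> E)"
   then obtain x where x: "y = \<theta> x" "x \<in> carrier E" by auto
   obtain l where l: "\<forall>s\<in>I l. s \<odot>\<^sub>E x \<in> \<eta> ` carrier M" using e(6) x(2) unfolding torsion_over_def by blast
   have "s \<odot>\<^bsub>image_gm \<theta> E\<^esub> y \<in> (\<lambda>x\<in>carrier M. \<theta> (\<eta> x)) ` carrier M" if "s \<in> I l" for s
    using l[rule_format, OF that] sm[OF that x(2)] x(1) by auto
   thus "y \<in> torsion_over (image_gm \<theta> E) ((\<lambda>x\<in>carrier M. \<theta> (\<eta> x)) ` carrier M)"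
    unfolding torsion_over_def using x by auto
  qed
  show "\<exists>u\<in>hcomp (image_gm \<theta> E) i. \<forall>s\<in>I k. s \<odot>\<^bsub>image_gm \<theta> E\<^esub> u = (\<lambda>x\<in>carrier M. \<theta> (\<eta> x)) (\<psi> s)"
   if "d \<le> i" "\<psi> \<in> dhom k i M" for k i \<psi>
  proof -
   from e(7)[OF that] obtain u where u: "u \<in> hcomp E i" "\<forall>s\<in>I k. s \<odot>\<^sub>E u = \<eta> (\<psi> s)" ..
   have "\<psi> \<in> lin_hom S (sub_gm S (I k)) M" using that(2) unfolding dhom_iff by blast
   note lin_homD(1)[OF this]
   thus ?thesis using u sm[OF _ hE[OF u(1)]] by (intro bexI[of _ "\<theta> u"]) auto
  qed
 qed
qed

section \<open>The copy of the limit in the universe\<close>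

definition limit_ob :: "int \<Rightarrow> ('a, 'u) graded_module \<Rightarrow> ('a, 'u) graded_module" where
 "limit_ob d M = univ_copy (hom_lim d M)"

definition limit_ar :: "int \<Rightarrow> ('a, 'u) gmod_arrow \<Rightarrow> ('a, 'u) gmod_arrow" where
 "limit_ar d = (\<lambda>(M, \<phi>, N). (limit_ob d M,
  \<lambda>y\<in>carrier (limit_ob d M). to_univ (hom_lim d N) (hom_lim_map d N \<phi> (from_univ (hom_lim d M) y)),
  limit_ob d N))"

definition limit_unit_map :: "int \<Rightarrow> ('a, 'u) graded_module \<Rightarrow> 'u \<Rightarrow> 'u" where
 "limit_unit_map d M = (\<lambda>x\<in>carrier M. to_univ (hom_lim d M) (\<Union>l. germ d M l (\<lambda>s\<in>I l. s \<odot>\<^sub>M x)))"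

definition limit_unit :: "int \<Rightarrow> ('a, 'u) graded_module \<Rightarrow> ('a, 'u) gmod_arrow" where
 "limit_unit d M = (M, limit_unit_map d M, limit_ob d M)"

lemma hom_lim_to_univ_inj:
 assumes "\<exists>\<iota> :: 'a \<Rightarrow> 'u. inj_on \<iota> (carrier S)" "gobj d (M :: ('a, 'u) graded_module)"
 shows "inj_on (to_univ (hom_lim d M) :: _ \<Rightarrow> 'u) (carrier (hom_lim d M))"
proof -
 interpret A: hom_limit S n var I d M by (rule hom_limitI[OF assms(2)])
 show ?thesis by (rule to_univ_inj[OF assms(1) A.module_DD A.fin_gen_DD])
qed

text \<open>The union over all levels is a union of equal germs.\<close>

lemma limit_unit_map_eq:
 assumes "gobj d (M :: ('a, 'u) graded_module)"
 shows "limit_unit_map d M = (\<lambda>x\<in>carrier M. to_univ (hom_lim d M) (hom_limit.eta S I d M x))"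
proof -
 interpret A: hom_limit S n var I d M by (rule hom_limitI[OF assms])
 have "(\<Union>l. germ d M l (\<lambda>s\<in>I l. s \<odot>\<^sub>M x)) = A.eta x" if x: "x \<in> carrier M" for x
 proof -
  have "germ d M l (\<lambda>s\<in>I l. s \<odot>\<^sub>M x) = A.eta x" for l
   using A.cls_unit_hom[OF x, of l] x by (simp add: A.eta_def A.unit_hom_def)
  thus ?thesis by simp
 qed
 thus ?thesis unfolding limit_unit_map_def by (intro restrict_ext) simp
qed

lemma envelope_limit:
 assumes "\<exists>\<iota> :: 'a \<Rightarrow> 'u. inj_on \<iota> (carrier S)" "gobj d (M :: ('a, 'u) graded_module)"
 shows "envelope d M (limit_ob d M) (limit_unit_map d M)"
proof -
 interpret A: hom_limit S n var I d M by (rule hom_limitI[OF assms(2)])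
 show ?thesis unfolding limit_unit_map_eq[OF assms(2)] limit_ob_def univ_copy_eq
  by (rule envelope_image_gm[OF A.envelope hom_lim_to_univ_inj[OF assms]])
qed

lemma limit_ar:
 fixes M N :: "('a, 'u) graded_module"
 assumes univ: "\<exists>\<iota> :: 'a \<Rightarrow> 'u. inj_on \<iota> (carrier S)" and M: "gobj d M" and N: "gobj d N" and \<phi>: "\<phi> \<in> ghom M N"
 shows "\<exists>\<psi> \<in> ghom (limit_ob d M) (limit_ob d N). limit_ar d (M, \<phi>, N) = (limit_ob d M, \<psi>, limit_ob d N) \<and>
  (\<forall>x\<in>carrier M. \<psi> (limit_unit_map d M x) = limit_unit_map d N (\<phi> x))"
proof -
 interpret A: hom_limit S n var I d M by (rule hom_limitI[OF M])
 interpret B: hom_limit S n var I d N by (rule hom_limitI[OF N])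
 let ?E = "hom_lim d M" and ?F = "hom_lim d N"
 let ?\<alpha> = "to_univ ?E :: _ \<Rightarrow> 'u" and ?\<beta> = "to_univ ?F :: _ \<Rightarrow> 'u"
 note iE = hom_lim_to_univ_inj[OF univ M] and iF = hom_lim_to_univ_inj[OF univ N]
 note E = injective_image_gm[OF A.graded_DD iE] and F = injective_image_gm[OF B.graded_DD iF]
 note g = ghomD[OF hom_lim_map_hom(1)[OF M N \<phi>]]
 interpret E: graded_module S ?E by (rule A.graded_DD)
 let ?h = "hom_lim_map d N \<phi>"
 have h: "x \<in> carrier ?E \<Longrightarrow> ?h x \<in> carrier ?F"
  "x \<in> carrier ?E \<Longrightarrow> y \<in> carrier ?E \<Longrightarrow> ?h (x \<oplus>\<^sub>?E y) = ?h x \<oplus>\<^sub>?F ?h y"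
  "r \<in> carrier S \<Longrightarrow> x \<in> carrier ?E \<Longrightarrow> ?h (r \<odot>\<^sub>?E x) = r \<odot>\<^sub>?F ?h x"
  "x \<in> hcomp ?E i \<Longrightarrow> ?h x \<in> hcomp ?F i" for x y r i
  using g(1)[of x] g(2)[of x y] g(3)[of r x] g(4)[of x i] E.G.hcompD(1)[of x i] by auto
 have inv: "from_univ ?E (?\<alpha> U) = U" if "U \<in> carrier ?E" for U
  unfolding from_univ_def using iE that by (rule inv_into_f_f)
 define \<psi> where "\<psi> = (\<lambda>y\<in>carrier (limit_ob d M). ?\<beta> (?h (from_univ ?E y)))"
 have ob: "limit_ob d M = image_gm ?\<alpha> ?E" "limit_ob d N = image_gm ?\<beta> ?F"
  unfolding limit_ob_def univ_copy_eq by simp_all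
 have "\<psi> \<in> ghom (limit_ob d M) (limit_ob d N)"
  unfolding \<psi>_def
 proof (rule ghom_restrictI)
  show "graded_module S (limit_ob d M)" unfolding ob by (rule E(1))
  show "?\<beta> (?h (from_univ ?E y)) \<in> carrier (limit_ob d N)" if "y \<in> carrier (limit_ob d M)" for y
   using that h(1) inv unfolding ob by auto
  show "?\<beta> (?h (from_univ ?E (x \<oplus>\<^bsub>limit_ob d M\<^esub> y))) = ?\<beta> (?h (from_univ ?E x)) \<oplus>\<^bsub>limit_ob d N\<^esub> ?\<beta> (?h (from_univ ?E y))"
   if xy: "x \<in> carrier (limit_ob d M)" "y \<in> carrier (limit_ob d M)" for x y
  proof -
   obtain U V where *: "x = ?\<alpha> U" "U \<in> carrier ?E" "y = ?\<alpha> V" "V \<in> carrier ?E" using xy unfolding ob by auto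
   show ?thesis unfolding *(1,3) ob using *(2,4) E(3) F(3) h(1,2) inv E.M.add.m_closed by simp
  qed
  show "?\<beta> (?h (from_univ ?E (r \<odot>\<^bsub>limit_ob d M\<^esub> y))) = r \<odot>\<^bsub>limit_ob d N\<^esub> ?\<beta> (?h (from_univ ?E y))"
   if r: "r \<in> carrier S" and y: "y \<in> carrier (limit_ob d M)" for r y
  proof -
   obtain V where *: "y = ?\<alpha> V" "V \<in> carrier ?E" using y unfolding ob by auto
   show ?thesis unfolding *(1) ob using *(2) E(4) F(4) h(1,3) inv E.smult_closed r by simp
  qed
  show "?\<beta> (?h (from_univ ?E y)) \<in> hcomp (limit_ob d N) i" if "y \<in> hcomp (limit_ob d M) i" for i y
   using that h(4) inv E.G.hcompD(1) unfolding ob by auto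
 qed
 moreover have "limit_ar d (M, \<phi>, N) = (limit_ob d M, \<psi>, limit_ob d N)" by (simp add: limit_ar_def \<psi>_def)
 moreover have "\<psi> (limit_unit_map d M x) = limit_unit_map d N (\<phi> x)" if x: "x \<in> carrier M" for x
 proof -
  have "A.eta x \<in> carrier ?E" by (rule ghomD(1)[OF A.eta_hom x])
  thus ?thesis unfolding \<psi>_def limit_unit_map_eq[OF M] limit_unit_map_eq[OF N] ob
   using x ghomD(1)[OF \<phi> x] hom_lim_map_hom(2)[OF M N \<phi> x] inv by simp
 qed
 ultimately show ?thesis by blast
qed

section \<open>Verification of the axioms of a closed reflection\<close>

lemma compose_eqI:
 assumes "\<chi> \<in> ghom M N" "\<And>x. x \<in> carrier M \<Longrightarrow> \<psi> (\<phi> x) = \<chi> x"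
 shows "compose (carrier M) \<psi> \<phi> = \<chi>"
 by (rule extensionalityI[where A = "carrier M"]) (use assms ghomD(5) in \<open>auto simp: compose_def\<close>)

text \<open>Brings both kinds of negligible morphisms to the common hypotheses of
  \<open>envelope_extension\<close>: torsion kernel and torsion cokernel.\<close>

lemma torsion_of_cosmall_or_small:
 assumes M: "gobj d M" and N: "gobj d N" and \<phi>: "\<phi> \<in> ghom M N"
  and "cosmall_mono (Gr d) (grmod0_ge S d) (M, \<phi>, N) \<or> small_epi (Gr d) (grmod0_ge S d) (M, \<phi>, N)"
 shows "b \<in> carrier N \<Longrightarrow> \<exists>l. \<forall>s\<in>I l. s \<odot>\<^sub>N b \<in> \<phi> ` carrier M"
  and "a \<in> carrier M \<Longrightarrow> \<phi> a = \<zero>\<^sub>N \<Longrightarrow> a \<in> torsion M"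
proof -
 note gM = gobjD(1)[OF M] and gN = gobjD(1)[OF N]
 interpret M: graded_module S M by (rule gM)
 interpret N: graded_module S N by (rule gN)
 note h = ghomD[OF \<phi>] and z = ghom_zero[OF gM gN \<phi>]
 \<comment> \<open>For a cosmall mono the second property is injectivity and the bound comes from
   the first; for a small epi the roles are exchanged.\<close>
 obtain l where l: "\<And>i. i \<ge> l \<Longrightarrow> hcomp N i \<subseteq> \<phi> ` carrier M" "\<And>i x. i \<ge> l \<Longrightarrow> x \<in> hcomp M i \<Longrightarrow> \<phi> x = \<zero>\<^sub>N \<Longrightarrow> x = \<zero>\<^sub>M"
  using assms(4)
 proof
  assume "cosmall_mono (Gr d) (grmod0_ge S d) (M, \<phi>, N)"
  then obtain l where l: "inj_on \<phi> (carrier M)" "\<forall>i\<ge>l. hcomp N i \<subseteq> \<phi> ` carrier M"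
   unfolding cosmall_iff[OF M N \<phi>] by blast
  have "x = \<zero>\<^sub>M" if "x \<in> hcomp M i" "\<phi> x = \<zero>\<^sub>N" for i x
   using inj_onD[OF l(1), of x "\<zero>\<^sub>M"] that M.G.hcompD(1) z(1) by auto
  thus thesis using l(2) by (intro that[of l]) auto
 next
  assume "small_epi (Gr d) (grmod0_ge S d) (M, \<phi>, N)"
  then obtain l where l: "\<phi> ` carrier M = carrier N" "\<forall>i\<ge>l. \<forall>x\<in>hcomp M i. \<phi> x = \<zero>\<^sub>N \<longrightarrow> x = \<zero>\<^sub>M"
   unfolding small_iff[OF M N \<phi>] by blast
  show thesis by (rule that[of l]) (use l N.G.hcompD(1) in auto)
 qed
 have im: "hsub N (\<phi> ` carrier M)" by (rule hsub_image[OF gM gN \<phi> hsub_carrier[OF gM]])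
 show "\<exists>l. \<forall>s\<in>I l. s \<odot>\<^sub>N b \<in> \<phi> ` carrier M" if "b \<in> carrier N"
  by (rule torsion_of_bounded[OF gN im l(1) that])
 let ?K = "{x \<in> carrier M. \<phi> x = \<zero>\<^sub>N}"
 have K: "hsub M ?K" by (rule hsub_kernel[OF gM gN \<phi>])
 have gK: "graded_module S (sub_gm M ?K)" by (rule graded_sub_gm[OF gM K])
 show "a \<in> torsion M" if a: "a \<in> carrier M" "\<phi> a = \<zero>\<^sub>N"
 proof -
  have "\<exists>j. \<forall>s\<in>I j. s \<odot>\<^bsub>sub_gm M ?K\<^esub> a \<in> {\<zero>\<^bsub>sub_gm M ?K\<^esub>}"
   by (rule torsion_of_bounded[OF gK hsub_zero[OF gK], of l]) (use l(2) a in auto)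
  thus ?thesis unfolding torsion_over_def using a(1) by simp
 qed
qed

lemma closed_reflection_limit:
 assumes univ: "\<exists>\<iota> :: 'a \<Rightarrow> 'u. inj_on \<iota> (carrier S)"
 shows "closed_reflection (Gr d :: (('a, 'u) graded_module, ('a, 'u) gmod_arrow) cat) (grmod0_ge S d)
  \<lparr>Fo = limit_ob d, Fa = limit_ar d\<rparr> (limit_unit d)"
  (is "closed_reflection ?C ?T ?W ?\<eta>")
proof (intro closed_reflection.intro category_C closed_reflection_axioms.intro)
 note env = envelope_limit[OF univ]
 fix A B Y Z U V N N' :: "('a, 'u) graded_module" and f g i j e m w :: "('a, 'u) gmod_arrow"
 show "Fo ?W A \<in> Ob ?C" if "A \<in> Ob ?C" for A
  using envelopeD(2)[OF env] that by (simp add: Ob_iff)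
 show "Fa ?W f \<in> Hom ?C (Fo ?W A) (Fo ?W B)" if "f \<in> Hom ?C A B" for f A B
  using that
 proof (rule HomE)
  fix \<phi> assume f: "f = (A, \<phi>, B)" "gobj d A" "gobj d B" "\<phi> \<in> ghom A B"
  from limit_ar[OF univ f(2-4)] show ?thesis unfolding f(1)
   using envelopeD(2)[OF env[OF f(2)]] envelopeD(2)[OF env[OF f(3)]] by (auto simp: Hom_iff)
 qed
 show "?\<eta> A \<in> Hom ?C A (Fo ?W A)" if "A \<in> Ob ?C" for A
  using envelopeD(2,3)[OF env] that by (simp add: Ob_iff Hom_iff limit_unit_def)
 show "?\<eta> B \<bullet>\<^sub>?C f = Fa ?W f \<bullet>\<^sub>?C ?\<eta> A" if "f \<in> Hom ?C A B" for f A B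
  using that
 proof (rule HomE)
  fix \<phi> assume f: "f = (A, \<phi>, B)" "gobj d A" "gobj d B" "\<phi> \<in> ghom A B"
  obtain \<psi> where \<psi>: "limit_ar d (A, \<phi>, B) = (limit_ob d A, \<psi>, limit_ob d B)"
   "\<forall>x\<in>carrier A. \<psi> (limit_unit_map d A x) = limit_unit_map d B (\<phi> x)" using limit_ar[OF univ f(2-4)] by blast
  show ?thesis unfolding f(1) using \<psi> by (auto simp: limit_unit_def compose_def intro!: restrict_ext)
 qed
 show "\<exists>!g. g \<in> Hom ?C B (Fo ?W U) \<and> g \<bullet>\<^sub>?C i = f"
  if s: "cosmall_mono ?C ?T i \<or> small_epi ?C ?T i" and i: "i \<in> Hom ?C A B" and U: "U \<in> Ob ?C"
   and f: "f \<in> Hom ?C A (Fo ?W U)" for i f A B U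
 proof -
  obtain \<phi> where \<phi>: "i = (A, \<phi>, B)" "gobj d A" "gobj d B" "\<phi> \<in> ghom A B" using i by (rule HomE)
  obtain \<psi> where \<psi>: "f = (A, \<psi>, limit_ob d U)" "\<psi> \<in> ghom A (limit_ob d U)"
   using f unfolding select_convs(1) by (auto elim: HomE)
  have U': "gobj d U" using U by (simp add: Ob_iff)
  note t = torsion_of_cosmall_or_small[OF \<phi>(2-4) s[unfolded \<phi>(1)]]
  have "\<exists>!g. g \<in> ghom B (limit_ob d U) \<and> (\<forall>a\<in>carrier A. g (\<phi> a) = \<psi> a)"
   by (rule envelope_extension[OF env[OF U'] \<phi>(2-4) t \<psi>(2)])
  then obtain g where g: "g \<in> ghom B (limit_ob d U)" "\<forall>a\<in>carrier A. g (\<phi> a) = \<psi> a"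
   and un: "\<And>g'. g' \<in> ghom B (limit_ob d U) \<Longrightarrow> \<forall>a\<in>carrier A. g' (\<phi> a) = \<psi> a \<Longrightarrow> g' = g" by (elim ex1E) blast
  have "compose (carrier A) g \<phi> = \<psi>" by (rule compose_eqI[OF \<psi>(2)]) (use g(2) in blast)
  note g = g(1) this
  show ?thesis
  proof (rule ex1I[of _ "(B, g, limit_ob d U)"])
   show "(B, g, limit_ob d U) \<in> Hom ?C B (Fo ?W U) \<and> (B, g, limit_ob d U) \<bullet>\<^sub>?C i = f"
    using g \<phi> \<psi> envelopeD(2)[OF env[OF U']] by (simp add: Hom_iff)
   fix g' assume g': "g' \<in> Hom ?C B (Fo ?W U) \<and> g' \<bullet>\<^sub>?C i = f"
   hence "g' \<in> Hom ?C B (limit_ob d U)" by simp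
   then obtain \<gamma> where \<gamma>: "g' = (B, \<gamma>, limit_ob d U)" "\<gamma> \<in> ghom B (limit_ob d U)" by (rule HomE)
   have eq: "(A, compose (carrier A) \<gamma> \<phi>, limit_ob d U) = (A, \<psi>, limit_ob d U)" using g' \<gamma>(1) \<phi>(1) \<psi>(1) by simp
   have "\<forall>a\<in>carrier A. \<gamma> (\<phi> a) = \<psi> a" by (rule ballI) (rule compose_fun[OF eq])
   thus "g' = (B, g, limit_ob d U)" using un[OF \<gamma>(2)] \<gamma>(1) by simp
  qed
 qed
 show "\<exists>Y. \<exists>q\<in>Hom ?C U Y. \<exists>m\<in>Hom ?C Y (Fo ?W U). small_epi ?C ?T q \<and> cosmall_mono ?C ?T m \<and> m \<bullet>\<^sub>?C q = ?\<eta> U"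
  if "U \<in> Ob ?C" for U
 proof -
  have U: "gobj d U" using that by (simp add: Ob_iff)
  let ?h = "limit_unit_map d U" and ?E = "limit_ob d U"
  note e = envelopeD[OF env[OF U]]
  note gU = gobjD(1)[OF U] and gE = gobjD(1)[OF e(2)]
  interpret U: graded_module S U by (rule gU)
  interpret E: graded_module S ?E by (rule gE)
  note h = ghomD[OF e(3)]
  \<comment> \<open>The image of the unit. The corestriction is small because torsion vanishes in
    high degrees, the inclusion is cosmall because the cokernel is torsion.\<close>
  let ?Y = "sub_gm ?E (?h ` carrier U)"
  have im: "hsub ?E (?h ` carrier U)" by (rule hsub_image[OF gU gE e(3) hsub_carrier[OF gU]])
  have Y: "gobj d ?Y" by (rule gobj_sub_gm[OF e(2) im])
  have q: "?h \<in> ghom U ?Y" using h U.G.hcompD(1) by (intro ghomI) auto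
  have m: "(\<lambda>x\<in>?h ` carrier U. x) \<in> ghom ?Y ?E" by (rule incl_hom[OF gE im])
  obtain L where "\<forall>k\<ge>L. hcomp U k \<inter> torsion U \<subseteq> {\<zero>\<^sub>U}" using torsion_over_bounded[OF U hsub_zero[OF gU]] ..
  hence L: "x = \<zero>\<^sub>U" if "k \<ge> L" "x \<in> hcomp U k" "?h x = \<zero>\<^sub>?E" for k x
   using that e(5)[OF U.G.hcompD(1)[OF that(2)]] by blast
  have "small_epi ?C ?T (U, ?h, ?Y)" unfolding small_iff[OF U Y q] using L by auto
  moreover have "\<exists>l. \<forall>i\<ge>l. hcomp ?E i \<subseteq> ?h ` carrier U"
   by (rule bounded_of_torsion[OF gE gobjD(2)[OF e(2)] im]) (use e(6) in \<open>auto simp: torsion_over_def\<close>)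
  hence "cosmall_mono ?C ?T (?Y, \<lambda>x\<in>?h ` carrier U. x, ?E)"
   unfolding cosmall_iff[OF Y e(2) m] by (simp add: inj_on_def)
  moreover have "(?Y, \<lambda>x\<in>?h ` carrier U. x, ?E) \<bullet>\<^sub>?C (U, ?h, ?Y) = ?\<eta> U"
   using compose_eqI[OF e(3), of "\<lambda>x\<in>?h ` carrier U. x" ?h] by (simp add: limit_unit_def)
  moreover have "(U, ?h, ?Y) \<in> Hom ?C U ?Y" "(?Y, \<lambda>x\<in>?h ` carrier U. x, ?E) \<in> Hom ?C ?Y (Fo ?W U)"
   using U Y e(2) q m by (simp_all add: Hom_iff)
  ultimately show ?thesis by blast
 qed
 show "cosmall_mono ?C ?T (j \<bullet>\<^sub>?C i)"
  if c: "cosmall_mono ?C ?T i" "cosmall_mono ?C ?T j" and ij: "i \<in> Hom ?C A B" "j \<in> Hom ?C B Z" for i j A B Z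
 proof -
  obtain \<phi> where \<phi>: "i = (A, \<phi>, B)" "gobj d A" "gobj d B" "\<phi> \<in> ghom A B" using ij(1) by (rule HomE)
  obtain \<psi> where \<psi>: "j = (B, \<psi>, Z)" "gobj d Z" "\<psi> \<in> ghom B Z" using ij(2) by (rule HomE)
  obtain k where k: "inj_on \<phi> (carrier A)" "\<And>p. p \<ge> k \<Longrightarrow> hcomp B p \<subseteq> \<phi> ` carrier A"
   using c(1) unfolding \<phi>(1) cosmall_iff[OF \<phi>(2-4)] by blast
  obtain l where l: "inj_on \<psi> (carrier B)" "\<And>p. p \<ge> l \<Longrightarrow> hcomp Z p \<subseteq> \<psi> ` carrier B"
   using c(2) unfolding \<psi>(1) cosmall_iff[OF \<phi>(3) \<psi>(2,3)] by blast
  have co: "compose (carrier A) \<psi> \<phi> \<in> ghom A Z" by (rule ghom_compose[OF gobjD(1)[OF \<phi>(2)] \<phi>(4) \<psi>(3)])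
  have "inj_on (compose (carrier A) \<psi> \<phi>) (carrier A)"
   using k(1) l(1) ghomD(1)[OF \<phi>(4)] by (auto simp: inj_on_def compose_def)
  moreover have "hcomp Z p \<subseteq> compose (carrier A) \<psi> \<phi> ` carrier A" if p: "p \<ge> max k l" for p
  proof
   fix z assume z: "z \<in> hcomp Z p"
   then obtain y where y: "z = \<psi> y" "y \<in> carrier B" using l(2)[of p] p by auto
   \<comment> \<open>Injectivity of \<open>\<psi>\<close> makes the preimage homogeneous of the same
     degree, so that the bound for \<open>\<phi>\<close> applies to it.\<close>
   have "y \<in> hcomp B p"
    by (rule ghom_homog_inj[OF gobjD(1)[OF \<phi>(3)] gobjD(1)[OF \<psi>(2)] \<psi>(3) l(1) y(2)]) (use z y in simp)
   then obtain x where "y = \<phi> x" "x \<in> carrier A" using k(2)[of p] p by auto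
   thus "z \<in> compose (carrier A) \<psi> \<phi> ` carrier A" using y by (auto simp: compose_def)
  qed
  ultimately show ?thesis unfolding \<phi>(1) \<psi>(1) C_simps cosmall_iff[OF \<phi>(2) \<psi>(2) co] by blast
 qed
 show "\<exists>M'. \<exists>i\<in>Hom ?C M' M. \<exists>f\<in>Hom ?C M' J. cosmall_mono ?C ?T i \<and> g \<bullet>\<^sub>?C i = m \<bullet>\<^sub>?C f"
  if c: "cosmall_mono ?C ?T m" and mg: "m \<in> Hom ?C J Y" "g \<in> Hom ?C M Y" for m g J Y M
 proof -
  obtain \<mu> where \<mu>: "m = (J, \<mu>, Y)" "gobj d J" "gobj d Y" "\<mu> \<in> ghom J Y" using mg(1) by (rule HomE)
  obtain \<gamma> where \<gamma>: "g = (M, \<gamma>, Y)" "gobj d M" "\<gamma> \<in> ghom M Y" using mg(2) by (rule HomE)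
  note gr = gobjD(1)[OF \<mu>(2)] gobjD(1)[OF \<mu>(3)] gobjD(1)[OF \<gamma>(2)]
  interpret M: graded_module S M by (rule gr(3))
  obtain l where l: "inj_on \<mu> (carrier J)" "\<And>p. p \<ge> l \<Longrightarrow> hcomp Y p \<subseteq> \<mu> ` carrier J"
   using c unfolding \<mu>(1) cosmall_iff[OF \<mu>(2-4)] by blast
  \<comment> \<open>The pullback of a mono is realized as a preimage inside \<open>M\<close>, so it
    stays in the universe.\<close>
  let ?H = "{x \<in> carrier M. \<gamma> x \<in> \<mu> ` carrier J}"
  have H: "hsub M ?H"
   by (rule hsub_preimage[OF gr(3,2) \<gamma>(3) hsub_image[OF gr(1,2) \<mu>(4) hsub_carrier[OF gr(1)]]])
  let ?M = "sub_gm M ?H"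
  have gM: "gobj d ?M" by (rule gobj_sub_gm[OF \<gamma>(2) H])
  have i: "(\<lambda>x\<in>?H. x) \<in> ghom ?M M" by (rule incl_hom[OF gr(3) H])
  have r: "compose (carrier ?M) \<gamma> (\<lambda>x\<in>?H. x) \<in> ghom ?M Y"
   by (rule ghom_compose[OF gobjD(1)[OF gM] i \<gamma>(3)])
  have "\<exists>f\<in>ghom ?M J. \<forall>x\<in>carrier ?M. \<mu> (f x) = compose (carrier ?M) \<gamma> (\<lambda>x\<in>?H. x) x"
   by (rule hom_lift[OF gobjD(1)[OF gM] gr(1,2) \<mu>(4) l(1) r]) (auto simp: compose_def)
  then obtain f where f: "f \<in> ghom ?M J"
   "\<And>x. x \<in> carrier ?M \<Longrightarrow> \<mu> (f x) = compose (carrier ?M) \<gamma> (\<lambda>x\<in>?H. x) x" by blast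
  have "hcomp M p \<subseteq> (\<lambda>x\<in>?H. x) ` carrier ?M" if p: "p \<ge> l" for p
  proof
   fix x assume x: "x \<in> hcomp M p"
   have "x \<in> ?H" using l(2)[OF p] ghomD(4)[OF \<gamma>(3) x] M.G.hcompD(1)[OF x] by blast
   thus "x \<in> (\<lambda>x\<in>?H. x) ` carrier ?M" by (intro rev_image_eqI[of x]) simp_all
  qed
  hence "cosmall_mono ?C ?T (?M, \<lambda>x\<in>?H. x, M)"
   unfolding cosmall_iff[OF gM \<gamma>(2) i] by (intro conjI exI[of _ l]) (auto simp: inj_on_def)
  moreover have "g \<bullet>\<^sub>?C (?M, \<lambda>x\<in>?H. x, M) = m \<bullet>\<^sub>?C (?M, f, J)"
   unfolding \<mu>(1) \<gamma>(1) C_simps using compose_eqI[OF r, of \<mu> f, OF f(2)] by simp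
  moreover have "(?M, \<lambda>x\<in>?H. x, M) \<in> Hom ?C ?M M" "(?M, f, J) \<in> Hom ?C ?M J"
   using gM \<gamma>(2) \<mu>(2) i f(1) by (simp_all add: Hom_iff)
  ultimately show ?thesis by blast
 qed
 show "\<exists>J. \<exists>e0\<in>Hom ?C N' J. \<exists>m0\<in>Hom ?C J Y. is_epi ?C e0 \<and> cosmall_mono ?C ?T m0 \<and> m0 \<bullet>\<^sub>?C e0 = e \<bullet>\<^sub>?C j"
  if ep: "is_epi ?C e" and e: "e \<in> Hom ?C N Y" and c: "cosmall_mono ?C ?T j" and j: "j \<in> Hom ?C N' N" for e j N N' Y
 proof -
  obtain \<epsilon> where \<epsilon>: "e = (N, \<epsilon>, Y)" "gobj d N" "gobj d Y" "\<epsilon> \<in> ghom N Y" using e by (rule HomE)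
  obtain \<phi> where \<phi>: "j = (N', \<phi>, N)" "gobj d N'" "\<phi> \<in> ghom N' N" using j by (rule HomE)
  note gr = gobjD(1)[OF \<epsilon>(2)] gobjD(1)[OF \<epsilon>(3)] gobjD(1)[OF \<phi>(2)]
  interpret N': graded_module S N' by (rule gr(3))
  have su: "\<epsilon> ` carrier N = carrier Y" using ep unfolding \<epsilon>(1) epi_iff[OF \<epsilon>(2-4)] .
  obtain l where l: "\<And>p. p \<ge> l \<Longrightarrow> hcomp N p \<subseteq> \<phi> ` carrier N'"
   using c unfolding \<phi>(1) cosmall_iff[OF \<phi>(2) \<epsilon>(2) \<phi>(3)] by blast
  let ?c = "compose (carrier N') \<epsilon> \<phi>"
  have co: "?c \<in> ghom N' Y" by (rule ghom_compose[OF gr(3) \<phi>(3) \<epsilon>(4)])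
  let ?J = "sub_gm Y (?c ` carrier N')"
  have im: "hsub Y (?c ` carrier N')" by (rule hsub_image[OF gr(3,2) co hsub_carrier[OF gr(3)]])
  have J: "gobj d ?J" by (rule gobj_sub_gm[OF \<epsilon>(3) im])
  have e0: "?c \<in> ghom N' ?J" using ghomD[OF co] N'.G.hcompD(1) by (intro ghomI) auto
  have m0: "(\<lambda>x\<in>?c ` carrier N'. x) \<in> ghom ?J Y" by (rule incl_hom[OF gr(2) im])
  have "hcomp Y p \<subseteq> ?c ` carrier N'" if p: "p \<ge> l" for p
  proof
   fix y assume "y \<in> hcomp Y p"
   \<comment> \<open>A homogeneous lift to \<open>N\<close>, so that the bound for
     \<open>\<phi>\<close> applies in degree \<open>p\<close>.\<close>
   then obtain x where x: "x \<in> hcomp N p" "\<epsilon> x = y" using surj_homog[OF gr(1,2) \<epsilon>(4) su] by blast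
   then obtain u where "x = \<phi> u" "u \<in> carrier N'" using l[OF p] by blast
   thus "y \<in> ?c ` carrier N'" using x(2) by (auto simp: compose_def)
  qed
  hence "cosmall_mono ?C ?T (?J, \<lambda>x\<in>?c ` carrier N'. x, Y)"
   unfolding cosmall_iff[OF J \<epsilon>(3) m0] by (intro conjI exI[of _ l]) (auto simp: inj_on_def)
  moreover have "is_epi ?C (N', ?c, ?J)" unfolding epi_iff[OF \<phi>(2) J e0] by simp
  moreover have "(?J, \<lambda>x\<in>?c ` carrier N'. x, Y) \<bullet>\<^sub>?C (N', ?c, ?J) = e \<bullet>\<^sub>?C j"
   unfolding \<epsilon>(1) \<phi>(1) C_simps using compose_eqI[OF co, of "\<lambda>x\<in>?c ` carrier N'. x" ?c] by simp
  moreover have "(N', ?c, ?J) \<in> Hom ?C N' ?J" "(?J, \<lambda>x\<in>?c ` carrier N'. x, Y) \<in> Hom ?C ?J Y"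
   using J \<phi>(2) \<epsilon>(3) e0 m0 by (simp_all add: Hom_iff)
  ultimately show ?thesis by blast
 qed
 show "\<exists>v\<in>Hom ?C Y Z. v \<bullet>\<^sub>?C e = g"
  if ep: "is_epi ?C e" and e: "e \<in> Hom ?C A Y" and mo: "is_mono ?C m" and m: "m \<in> Hom ?C Z V"
   and g: "g \<in> Hom ?C A Z" and w: "w \<in> Hom ?C Y V" and eq: "m \<bullet>\<^sub>?C g = w \<bullet>\<^sub>?C e" for e m g w A Y Z V
 proof -
  obtain \<epsilon> where \<epsilon>: "e = (A, \<epsilon>, Y)" "gobj d A" "gobj d Y" "\<epsilon> \<in> ghom A Y" using e by (rule HomE)
  obtain \<mu> where \<mu>: "m = (Z, \<mu>, V)" "gobj d Z" "gobj d V" "\<mu> \<in> ghom Z V" using m by (rule HomE)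
  obtain \<gamma> where \<gamma>: "g = (A, \<gamma>, Z)" "\<gamma> \<in> ghom A Z" using g by (rule HomE)
  obtain \<omega> where \<omega>: "w = (Y, \<omega>, V)" "\<omega> \<in> ghom Y V" using w by (rule HomE)
  note gr = gobjD(1)[OF \<epsilon>(2)] gobjD(1)[OF \<epsilon>(3)] gobjD(1)[OF \<mu>(2)] gobjD(1)[OF \<mu>(3)]
  have su: "\<epsilon> ` carrier A = carrier Y" using ep unfolding \<epsilon>(1) epi_iff[OF \<epsilon>(2-4)] .
  have inj: "inj_on \<mu> (carrier Z)" using mo unfolding \<mu>(1) mono_iff[OF \<mu>(2-4)] .
  have "(A, compose (carrier A) \<mu> \<gamma>, V) = (A, compose (carrier A) \<omega> \<epsilon>, V)"
   using eq unfolding \<epsilon>(1) \<mu>(1) \<gamma>(1) \<omega>(1) C_simps .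
  hence sq: "\<mu> (\<gamma> x) = \<omega> (\<epsilon> x)" if "x \<in> carrier A" for x
   using compose_fun[of A \<mu> \<gamma> V "compose (carrier A) \<omega> \<epsilon>" x] that by (simp add: compose_def)
  \<comment> \<open>The square sends \<open>\<gamma> x\<close> to zero under the injective
    \<open>\<mu>\<close>, so \<open>\<gamma>\<close> descends along
    \<open>\<epsilon>\<close>.\<close>
  have ker: "\<gamma> x = \<zero>\<^sub>Z" if "x \<in> carrier A" "\<epsilon> x = \<zero>\<^sub>Y" for x
  proof (rule inj_onD[OF inj])
   show "\<mu> (\<gamma> x) = \<mu> \<zero>\<^sub>Z"
    using sq[OF that(1)] that(2) ghom_zero(1)[OF gr(2,4) \<omega>(2)] ghom_zero(1)[OF gr(3,4) \<mu>(4)] by simp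
   show "\<gamma> x \<in> carrier Z" by (rule ghomD(1)[OF \<gamma>(2) that(1)])
   interpret Z: graded_module S Z by (rule gr(3))
   show "\<zero>\<^sub>Z \<in> carrier Z" by simp
  qed
  obtain v where v: "v \<in> ghom Y Z" "\<And>x. x \<in> carrier A \<Longrightarrow> v (\<epsilon> x) = \<gamma> x"
   using hom_descend[OF gr(1,2,3) \<epsilon>(4) su \<gamma>(2) ker] by blast
  have "(Y, v, Z) \<bullet>\<^sub>?C e = g" unfolding \<epsilon>(1) \<gamma>(1) C_simps using compose_eqI[OF \<gamma>(2), of v \<epsilon>, OF v(2)] by simp
  moreover have "(Y, v, Z) \<in> Hom ?C Y Z" using v(1) \<epsilon>(3) \<mu>(2) by (simp add: Hom_iff)
  ultimately show ?thesis by blast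
 qed
 show "cosmall_mono ?C ?T (Idt ?C A)" if "A \<in> Ob ?C" for A
 proof -
  have A: "gobj d A" using that by (simp add: Ob_iff)
  interpret A: graded_module S A by (rule gobjD(1)[OF A])
  show ?thesis unfolding C_simps cosmall_iff[OF A A ghom_id[OF gobjD(1)[OF A]]]
   using A.G.hcompD(1) by (auto simp: inj_on_def)
 qed
 show "small_epi ?C ?T (Idt ?C A)" if "A \<in> Ob ?C" for A
 proof -
  have A: "gobj d A" using that by (simp add: Ob_iff)
  interpret A: graded_module S A by (rule gobjD(1)[OF A])
  show ?thesis unfolding C_simps small_iff[OF A A ghom_id[OF gobjD(1)[OF A]]]
   using A.G.hcompD(1) by auto
 qed
qed

theorem gabriel_monad_limit:
 assumes "\<exists>\<iota> :: 'a \<Rightarrow> 'u. inj_on \<iota> (carrier S)"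
 shows "gabriel_monad (Gr d :: (('a, 'u) graded_module, ('a, 'u) gmod_arrow) cat) (grmod0_ge S d)
  \<lparr>Fo = limit_ob d, Fa = limit_ar d\<rparr> (limit_unit d)"
 by (rule closed_reflection.gabriel_monadI[OF closed_reflection_limit[OF assms] abelian_C[OF assms] thick_C])

end

theorem theorem4p6:
 fixes B :: "('b, 'm) ring_scheme" and n :: nat and d :: int
 assumes "cring B" and "noetherian_ring B" and "d \<le> 0"
  and universe: "\<exists>\<iota> :: (nat multiset \<Rightarrow> 'b) \<Rightarrow> 'u. inj_on \<iota> (carrier (graded_poly_ring B n))"
 shows "gabriel_monad
  (grmod_ge (graded_poly_ring B n) d
    :: ((nat multiset \<Rightarrow> 'b, 'u) graded_module, (nat multiset \<Rightarrow> 'b, 'u) gmod_arrow) cat)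
  (grmod0_ge (graded_poly_ring B n) d)
  (transform B n d)
  (transform_unit B n d)"
proof -
 interpret B: cring B by fact
 interpret S: standard_graded "graded_poly_ring B n" n B.indexed_var "irrelevant_power B n"
  by (rule B.standard_graded_PR) fact
 \<comment> \<open>With the ideal powers of the polynomial ring put for \<open>I\<close>, the
   abstract constructions unfold to those of the statement; they are matched one by one.\<close>
 have seq: "S.hom_seq e M = transform_seq B n e M" for e and M :: "(nat multiset \<Rightarrow> 'b, 'u) graded_module"
  by (rule ext) (simp add: S.hom_seq_def transform_seq_def power_module_def sub_gm_def)
 have trans: "S.hom_trans = transform_trans B n"
  by (intro ext) (simp add: S.hom_trans_def transform_trans_def)
 have lim: "S.hom_lim e M = transform_lim B n e M" for e and M :: "(nat multiset \<Rightarrow> 'b, 'u) graded_module"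
  unfolding S.hom_lim_def transform_lim_def seq trans ..
 have ob: "S.limit_ob e M = transform_ob B n e M" for e and M :: "(nat multiset \<Rightarrow> 'b, 'u) graded_module"
  by (simp add: S.limit_ob_def transform_ob_def lim)
 have push: "S.push \<phi> = (\<lambda>l f. \<lambda>s\<in>irrelevant_power B n l. \<phi> (f s))" for \<phi> :: "'u \<Rightarrow> 'u"
  by (intro ext) (simp add: S.push_def)
 have ar: "S.limit_ar e f = transform_ar B n e f" for e and f :: "(nat multiset \<Rightarrow> 'b, 'u) gmod_arrow"
  unfolding S.limit_ar_def transform_ar_def S.hom_lim_map_def lim ob seq trans push ..
 have unit: "S.limit_unit e M = transform_unit B n e M" for e and M :: "(nat multiset \<Rightarrow> 'b, 'u) graded_module"
  unfolding S.limit_unit_def transform_unit_def S.limit_unit_map_def S.germ_def transform_unit_level_def lim ob seq trans ..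
 show ?thesis
  using S.gabriel_monad_limit[OF universe, of d]
  unfolding transform_def ext[of "S.limit_ob d" "transform_ob B n d", OF ob]
   ext[of "S.limit_ar d" "transform_ar B n d", OF ar] ext[of "S.limit_unit d" "transform_unit B n d", OF unit] .
qed

end
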